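(* Let $d\ge1$, $q\in(0,1]$, $n=[dq^{-1}]+1$, let $m\ge n$ be an integer, and fix $\ell_0>0$. Let $\alpha,\ell,\rho>0$ with $\alpha\ell\rho\ge\ell_0$, let $R\ge\ell$, and let $h_1,h_2\in L^\infty(\mathbb R^d)$ be two functions such that the distance between their supports is at least $R$. Let $a\in\mathbf S^{(n,m)}$ be a symbol whose support is contained in $B(\mathbf u,\ell)\times B(\boldsymbol\mu,\rho)$ for some $\mathbf u,\boldsymbol\mu\in\mathbb R^d$. Then for any $t\in[0,1]$ $$\|h_1\,\mathrm{Op}_{\alpha,t}(a)\,h_2\|_{\mathfrak S_q}\le C_{q,m}\,\|h_1\|_{L^\infty}\|h_2\|_{L^\infty}\,(\alpha R\rho)^{\frac dq-m}\,\mathsf N^{(n,m)}(a;\ell,\rho),$$ with a constant $C_{q,m}$ independent of $t$ (it depends only on $d,q,m,\ell_0$, and not on $a,h_1,h_2,\mathbf u,\boldsymbol\mu,\alpha,\ell,\rho,R$).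
   Context: $[\,\cdot\,]$ is the integer part; $B(\mathbf u,r)$ is the open ball in $\mathbb R^d$ of radius $r$ centred at $\mathbf u$. For $0<q<\infty$, $\mathfrak S_q$ is the set of compact operators $A$ on a Hilbert space (here $L^2(\mathbb R^d)$) with singular values $s_k(A)$ such that $\|A\|_{\mathfrak S_q}=(\sum_k s_k(A)^q)^{1/q}<\infty$. For a symbol $a(\mathbf x,\boldsymbol\xi)$, $\alpha>0$ and $t\in[0,1]$, $(\mathrm{Op}_{\alpha,t}(a)u)(\mathbf x)=\big(\frac{\alpha}{2\pi}\big)^d\iint e^{i\alpha(\mathbf x-\mathbf y)\cdot\boldsymbol\xi}a((1-t)\mathbf x+t\mathbf y,\boldsymbol\xi)u(\mathbf y)\,d\mathbf y\,d\boldsymbol\xi$ for Schwartz $u$ (and extended to $L^2$). Functions $h_1,h_2$ act by multiplication. For $\ell,\rho>0$, $\mathsf N^{(n,m)}(a;\ell,\rho)=\max_{0\le k\le n,\,0\le r\le m}\sup_{\mathbf w,\boldsymbol\xi}\ell^k\rho^r|\nabla_{\mathbf w}^k\nabla_{\boldsymbol\xi}^r a(\mathbf w,\boldsymbol\xi)|$, where $\nabla^k$ is the tensor of all partial derivatives of order $k$. $\mathbf S^{(n,m)}$ is the class of complex-valued functions $a$, with the derivatives involved existing and continuous, for which this norm is finite for some (equivalently all) $\ell,\rho>0$. *)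

theory Defs
  imports "HOL-Analysis.Analysis" "HOL-Probability.Essential_Supremum"
begin

definition square_integrable :: "('a::euclidean_space \<Rightarrow> complex) \<Rightarrow> bool" where
  "square_integrable f \<longleftrightarrow>
     f \<in> borel_measurable lebesgue \<and> integrable lebesgue (\<lambda>x. (cmod (f x))\<^sup>2)"

lemma square_integrable_zero: "square_integrable (\<lambda>x. 0)"
  by (simp add: square_integrable_def)

lemma square_integrable_cmult:
  assumes "square_integrable f"
  shows "square_integrable (\<lambda>x. c * f x)"
proof -
  have [measurable]: "f \<in> borel_measurable lebesgue"
    using assms by (simp add: square_integrable_def)
  have "(\<lambda>x. c * f x) \<in> borel_measurable lebesgue" by measurable
  then show ?thesis
    using assms by (simp add: square_integrable_def norm_mult power_mult_distrib)
qed

lemma square_integrable_cmult_right: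
  assumes "square_integrable f"
  shows "square_integrable (\<lambda>x. f x * c)"
  using square_integrable_cmult[OF assms, of c] by (simp add: mult.commute)

lemma square_integrable_add:
  assumes f: "square_integrable f" and g: "square_integrable g"
  shows "square_integrable (\<lambda>x. f x + g x)"
proof -
  have [measurable]: "f \<in> borel_measurable lebesgue" "g \<in> borel_measurable lebesgue"
    using f g by (auto simp: square_integrable_def)
  have "integrable lebesgue (\<lambda>x. 2 * (cmod (f x))\<^sup>2 + 2 * (cmod (g x))\<^sup>2)"
    using f g by (auto simp: square_integrable_def)
  then have "integrable lebesgue (\<lambda>x. (cmod (f x + g x))\<^sup>2)"
  proof (rule Bochner_Integration.integrable_bound)
    have "(cmod (f x + g x))\<^sup>2 \<le> 2 * (cmod (f x))\<^sup>2 + 2 * (cmod (g x))\<^sup>2" for x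
    proof -
      have "(cmod (f x + g x))\<^sup>2 \<le> (cmod (f x) + cmod (g x))\<^sup>2"
        by (simp add: norm_triangle_ineq power_mono)
      also have "\<dots> \<le> 2 * (cmod (f x))\<^sup>2 + 2 * (cmod (g x))\<^sup>2"
        using sum_squares_bound[of "cmod (f x)" "cmod (g x)"]
        by (simp add: power2_eq_square algebra_simps)
      finally show ?thesis .
    qed
    then show "AE x in lebesgue. norm ((cmod (f x + g x))\<^sup>2)
        \<le> norm (2 * (cmod (f x))\<^sup>2 + 2 * (cmod (g x))\<^sup>2)"
      by (intro AE_I2) (metis abs_ge_self order_trans real_norm_def abs_of_nonneg zero_le_power2)
  qed measurable
  then show ?thesis by (simp add: square_integrable_def)
qed

lemma square_integrable_prod:
  assumes f: "square_integrable f" and g: "square_integrable g"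
  shows "integrable lebesgue (\<lambda>x. f x * cnj (g x))"
proof -
  have [measurable]: "f \<in> borel_measurable lebesgue" "g \<in> borel_measurable lebesgue"
    using f g by (auto simp: square_integrable_def)
  have [measurable]: "(\<lambda>x. cnj (g x)) \<in> borel_measurable lebesgue"
    by (rule borel_measurable_continuous_on[where g = g and f = cnj])
       (auto intro!: continuous_intros)
  have "integrable lebesgue (\<lambda>x. (cmod (f x))\<^sup>2 + (cmod (g x))\<^sup>2)"
    using f g by (auto simp: square_integrable_def)
  then show ?thesis
  proof (rule Bochner_Integration.integrable_bound)
    have "cmod (f x * cnj (g x)) \<le> (cmod (f x))\<^sup>2 + (cmod (g x))\<^sup>2" for x
      using sum_squares_bound[of "cmod (f x)" "cmod (g x)"]
        mult_nonneg_nonneg[of "cmod (f x)" "cmod (g x)"]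
      by (simp add: norm_mult del: mult_nonneg_nonneg)
    then show "AE x in lebesgue. norm (f x * cnj (g x))
        \<le> norm ((cmod (f x))\<^sup>2 + (cmod (g x))\<^sup>2)"
      by (intro AE_I2) simp
  qed measurable
qed

quotient_type (overloaded) 'a L2 =
  "'a::euclidean_space \<Rightarrow> complex" / partial:
  "\<lambda>f g. square_integrable f \<and> square_integrable g \<and> (AE x in lebesgue. f x = g x)"
proof (rule part_equivpI)
  show "\<exists>f::'a \<Rightarrow> complex. square_integrable f \<and> square_integrable f
      \<and> (AE x in lebesgue. f x = f x)"
    using square_integrable_zero by auto
  show "symp (\<lambda>f g::'a \<Rightarrow> complex. square_integrable f \<and> square_integrable g
      \<and> (AE x in lebesgue. f x = g x))"
    by (auto simp: symp_def elim: AE_mp)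
  show "transp (\<lambda>f g::'a \<Rightarrow> complex. square_integrable f \<and> square_integrable g
      \<and> (AE x in lebesgue. f x = g x))"
    by (auto simp: transp_def elim: AE_mp)
qed

lift_definition scaleC_L2 :: "complex \<Rightarrow> 'a::euclidean_space L2 \<Rightarrow> 'a L2"
  is "\<lambda>c f x. c * f x"
  by (auto intro: square_integrable_cmult)

lift_definition cinner_L2 :: "'a::euclidean_space L2 \<Rightarrow> 'a L2 \<Rightarrow> complex"
  is "\<lambda>f g. integral\<^sup>L lebesgue (\<lambda>x. f x * cnj (g x))"
proof -
  fix f f' g g' :: "'a \<Rightarrow> complex"
  assume f: "square_integrable f \<and> square_integrable f' \<and> (AE x in lebesgue. f x = f' x)"
    and g: "square_integrable g \<and> square_integrable g' \<and> (AE x in lebesgue. g x = g' x)"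
  have "AE x in lebesgue. f x * cnj (g x) = f' x * cnj (g' x)"
    using f g by auto
  then show "integral\<^sup>L lebesgue (\<lambda>x. f x * cnj (g x))
      = integral\<^sup>L lebesgue (\<lambda>x. f' x * cnj (g' x))"
    using square_integrable_prod f g
    by (intro integral_cong_AE) (auto dest: borel_measurable_integrable)
qed

instantiation L2 :: (euclidean_space) real_vector
begin

lift_definition zero_L2 :: "'a L2" is "\<lambda>x. 0"
  by (simp add: square_integrable_zero)

lift_definition plus_L2 :: "'a L2 \<Rightarrow> 'a L2 \<Rightarrow> 'a L2" is "\<lambda>f g x. f x + g x"
  by (auto intro: square_integrable_add)

definition uminus_L2 :: "'a L2 \<Rightarrow> 'a L2" where
  "uminus_L2 f = scaleC_L2 (-1) f"

definition minus_L2 :: "'a L2 \<Rightarrow> 'a L2 \<Rightarrow> 'a L2" where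
  "minus_L2 f g = f + (- g)"

definition scaleR_L2 :: "real \<Rightarrow> 'a L2 \<Rightarrow> 'a L2" where
  "scaleR_L2 r = scaleC_L2 (complex_of_real r)"

instance
proof
  fix f g h :: "'a L2" and r s :: real
  show "f + g + h = f + (g + h)"
    by transfer (auto simp: add.assoc intro!: square_integrable_add)
  show "f + g = g + f"
    by transfer (auto simp: add.commute intro!: square_integrable_add)
  show "0 + f = f"
    by transfer auto
  show "- f + f = 0"
    unfolding uminus_L2_def
    by transfer (auto intro: square_integrable_zero)
  show "f - g = f + - g"
    by (rule minus_L2_def)
  show "r *\<^sub>R (f + g) = r *\<^sub>R f + r *\<^sub>R g"
    unfolding scaleR_L2_def
    by transfer (auto simp: algebra_simps intro!: square_integrable_cmult square_integrable_cmult_right square_integrable_add)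
  show "(r + s) *\<^sub>R f = r *\<^sub>R f + s *\<^sub>R f"
    unfolding scaleR_L2_def
    by transfer (auto simp: algebra_simps intro!: square_integrable_cmult square_integrable_cmult_right square_integrable_add)
  show "r *\<^sub>R s *\<^sub>R f = (r * s) *\<^sub>R f"
    unfolding scaleR_L2_def
    by transfer (auto simp: algebra_simps intro!: square_integrable_cmult square_integrable_cmult_right square_integrable_add)
  show "1 *\<^sub>R f = f"
    unfolding scaleR_L2_def by transfer auto
qed

end

lemma square_integrable_Re_prod_self:
  assumes "square_integrable f"
  shows "Re (integral\<^sup>L lebesgue (\<lambda>x. f x * cnj (f x)))
    = integral\<^sup>L lebesgue (\<lambda>x. (cmod (f x))\<^sup>2)"
  using square_integrable_prod[OF assms assms]
  by (simp add: complex_norm_square[symmetric] flip: integral_Re of_real_power)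

text \<open>The real inner product \<open>Re \<langle>f, g\<rangle>\<close> induces the usual norm of the complex Hilbert space.\<close>

instantiation L2 :: (euclidean_space) real_inner
begin

definition inner_L2 :: "'a L2 \<Rightarrow> 'a L2 \<Rightarrow> real" where
  "inner_L2 f g = Re (cinner_L2 f g)"

definition norm_L2 :: "'a L2 \<Rightarrow> real" where
  "norm_L2 f = sqrt (inner f f)"

definition sgn_L2 :: "'a L2 \<Rightarrow> 'a L2" where
  "sgn_L2 f = f /\<^sub>R norm f"

definition dist_L2 :: "'a L2 \<Rightarrow> 'a L2 \<Rightarrow> real" where
  "dist_L2 f g = norm (f - g)"

definition uniformity_L2 :: "('a L2 \<times> 'a L2) filter" where
  "uniformity_L2 = (INF e\<in>{0 <..}. principal {(f, g). dist f g < e})"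

definition open_L2 :: "'a L2 set \<Rightarrow> bool" where
  "open_L2 U \<longleftrightarrow> (\<forall>f\<in>U. eventually (\<lambda>(f', g). f' = f \<longrightarrow> g \<in> U) uniformity)"

instance
proof
  fix f g h :: "'a L2" and r :: real and U :: "'a L2 set"
  show "dist f g = norm (f - g)" by (rule dist_L2_def)
  show "sgn f = f /\<^sub>R norm f" by (rule sgn_L2_def)
  show "(uniformity :: ('a L2 \<times> 'a L2) filter) = (INF e\<in>{0 <..}. principal {(f, g). dist f g < e})"
    by (rule uniformity_L2_def)
  show "open U \<longleftrightarrow> (\<forall>f\<in>U. eventually (\<lambda>(f', g). f' = f \<longrightarrow> g \<in> U) uniformity)"
    by (rule open_L2_def)
  show "norm f = sqrt (inner f f)" by (rule norm_L2_def)
  show "inner f g = inner g f"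
    unfolding inner_L2_def
  proof transfer
    fix f g :: "'a \<Rightarrow> complex"
    assume f: "square_integrable f \<and> square_integrable f \<and> (AE x in lebesgue. f x = f x)"
      and g: "square_integrable g \<and> square_integrable g \<and> (AE x in lebesgue. g x = g x)"
    have "integral\<^sup>L lebesgue (\<lambda>x. cnj (f x * cnj (g x)))
        = cnj (integral\<^sup>L lebesgue (\<lambda>x. f x * cnj (g x)))"
      using integral_bounded_linear[OF bounded_linear_cnj square_integrable_prod, of f g] f g
      by simp
    then have "integral\<^sup>L lebesgue (\<lambda>x. g x * cnj (f x))
        = cnj (integral\<^sup>L lebesgue (\<lambda>x. f x * cnj (g x)))"
      by (simp add: mult.commute)
    then show "Re (integral\<^sup>L lebesgue (\<lambda>x. f x * cnj (g x)))
        = Re (integral\<^sup>L lebesgue (\<lambda>x. g x * cnj (f x)))" by simp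
  qed
  show "inner (f + g) h = inner f h + inner g h"
    unfolding inner_L2_def
    by transfer (auto simp: ring_distribs square_integrable_prod)
  show "inner (r *\<^sub>R f) g = r * inner f g"
    unfolding inner_L2_def scaleR_L2_def
    by transfer (auto simp: mult.assoc)
  show "0 \<le> inner f f"
    unfolding inner_L2_def
    by transfer (auto simp: square_integrable_Re_prod_self)
  show "inner f f = 0 \<longleftrightarrow> f = 0"
    unfolding inner_L2_def
  proof transfer
    fix f :: "'a \<Rightarrow> complex"
    assume f: "square_integrable f \<and> square_integrable f \<and> (AE x in lebesgue. f x = f x)"
    then have "integral\<^sup>L lebesgue (\<lambda>x. (cmod (f x))\<^sup>2) = 0 \<longleftrightarrow> (AE x in lebesgue. (cmod (f x))\<^sup>2 = 0)"
      by (intro integral_nonneg_eq_0_iff_AE) (auto simp: square_integrable_def)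
    then show "Re (integral\<^sup>L lebesgue (\<lambda>x. f x * cnj (f x))) = 0 \<longleftrightarrow>
        square_integrable f \<and> square_integrable (\<lambda>x::'a. 0) \<and> (AE x in lebesgue. f x = 0)"
      using f by (simp add: square_integrable_Re_prod_self square_integrable_zero)
  qed
qed

end

interpretation L2: vector_space "scaleC_L2 :: complex \<Rightarrow> 'a::euclidean_space L2 \<Rightarrow> 'a L2"
proof
  fix f g :: "'a L2" and b c :: complex
  show "scaleC_L2 b (f + g) = scaleC_L2 b f + scaleC_L2 b g"
    by transfer (auto simp: algebra_simps intro!: square_integrable_cmult square_integrable_cmult_right square_integrable_add)
  show "scaleC_L2 (b + c) f = scaleC_L2 b f + scaleC_L2 c f"
    by transfer (auto simp: algebra_simps intro!: square_integrable_cmult square_integrable_cmult_right square_integrable_add)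
  show "scaleC_L2 b (scaleC_L2 c f) = scaleC_L2 (b * c) f"
    by transfer (auto simp: algebra_simps intro!: square_integrable_cmult square_integrable_cmult_right square_integrable_add)
  show "scaleC_L2 1 f = f"
    by transfer auto
qed

definition bounded_clinear_L2 :: "('a::euclidean_space L2 \<Rightarrow> 'a L2) \<Rightarrow> bool" where
  "bounded_clinear_L2 A \<longleftrightarrow>
     bounded_linear A \<and> (\<forall>c f. A (scaleC_L2 c f) = scaleC_L2 c (A f))"

definition compact_operator_L2 :: "('a::euclidean_space L2 \<Rightarrow> 'a L2) \<Rightarrow> bool" where
  "compact_operator_L2 A \<longleftrightarrow> bounded_clinear_L2 A \<and> compact (closure (A ` cball 0 1))"

definition adjoint_L2 :: "('a::euclidean_space L2 \<Rightarrow> 'a L2) \<Rightarrow> 'a L2 \<Rightarrow> 'a L2" where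
  "adjoint_L2 A = (SOME B. \<forall>f g. cinner_L2 (A f) g = cinner_L2 f (B g))"

text \<open>Multiplicity of \<open>\<mu> > 0\<close> as an eigenvalue of \<open>\<bar>A\<bar> = (A\<^sup>* A)\<^bsup>1/2\<^esup>\<close>, that is,
  of \<open>\<mu>\<^sup>2\<close> as an eigenvalue of \<open>A\<^sup>* A\<close>.\<close>

definition singular_mult :: "('a::euclidean_space L2 \<Rightarrow> 'a L2) \<Rightarrow> real \<Rightarrow> nat" where
  "singular_mult A \<mu> = L2.dim {f. adjoint_L2 A (A f) = \<mu>\<^sup>2 *\<^sub>R f}"

definition singular_count :: "('a::euclidean_space L2 \<Rightarrow> 'a L2) \<Rightarrow> real \<Rightarrow> nat" where
  "singular_count A s = (\<Sum>\<mu> | s < \<mu> \<and> singular_mult A \<mu> \<noteq> 0. singular_mult A \<mu>)"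

text \<open>The eigenvalues of \<open>\<bar>A\<bar>\<close> in nonincreasing order, repeated according to multiplicity and
  padded with zeros; the indices start at \<open>0\<close>. It is meant for compact \<open>A\<close>, for which the
  eigenspaces and the sum in \<open>singular_count A s\<close> are finite whenever \<open>s > 0\<close> (for other
  operators \<open>dim\<close> and \<open>\<Sum>\<close> default to zero on infinite objects).\<close>

definition singular_value :: "('a::euclidean_space L2 \<Rightarrow> 'a L2) \<Rightarrow> nat \<Rightarrow> real" where
  "singular_value A k = Inf {s. 0 < s \<and> singular_count A s \<le> k}"

definition schatten_class :: "real \<Rightarrow> ('a::euclidean_space L2 \<Rightarrow> 'a L2) set" where
  "schatten_class q =
     {A. compact_operator_L2 A \<and> summable (\<lambda>k. singular_value A k powr q)}"

definition schatten_norm :: "real \<Rightarrow> ('a::euclidean_space L2 \<Rightarrow> 'a L2) \<Rightarrow> real" where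
  "schatten_norm q A = (\<Sum>k. singular_value A k powr q) powr (1 / q)"

definition Linf_norm :: "('a::euclidean_space \<Rightarrow> complex) \<Rightarrow> ereal" where
  "Linf_norm h = esssup lebesgue (\<lambda>x. ereal (cmod (h x)))"

definition Linf :: "('a::euclidean_space \<Rightarrow> complex) set" where
  "Linf = {h. h \<in> borel_measurable lebesgue \<and> Linf_norm h < \<infinity>}"

text \<open>The complement of the largest open set on which \<open>h\<close> vanishes almost everywhere; it depends
  only on the class of \<open>h\<close> modulo null sets.\<close>

definition ess_support :: "('a::euclidean_space \<Rightarrow> complex) \<Rightarrow> 'a set" where
  "ess_support h = {x. \<forall>e>0. \<not> (AE y in lebesgue. y \<in> ball x e \<longrightarrow> h y = 0)}"

definition mult_L2 :: "('a::euclidean_space \<Rightarrow> complex) \<Rightarrow> 'a L2 \<Rightarrow> 'a L2" where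
  "mult_L2 h f = abs_L2 (\<lambda>x. h x * rep_L2 f x)"

fun iter_deriv :: "'b list \<Rightarrow> ('b::real_normed_vector \<Rightarrow> complex) \<Rightarrow> 'b \<Rightarrow> complex" where
  "iter_deriv [] f = f"
| "iter_deriv (b # bs) f = (\<lambda>x. vector_derivative (\<lambda>s. iter_deriv bs f (x + s *\<^sub>R b)) (at 0))"

fun iter_differentiable :: "'b list \<Rightarrow> ('b::real_normed_vector \<Rightarrow> complex) \<Rightarrow> bool" where
  "iter_differentiable [] f \<longleftrightarrow> True"
| "iter_differentiable (b # bs) f \<longleftrightarrow> iter_differentiable bs f \<and>
     (\<forall>x. (\<lambda>s. iter_deriv bs f (x + s *\<^sub>R b)) differentiable (at (0::real)))"

definition schwartz :: "('a::euclidean_space \<Rightarrow> complex) set" where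
  "schwartz = {u. \<forall>bs. set bs \<subseteq> Basis \<longrightarrow>
     iter_differentiable bs u \<and> continuous_on UNIV (iter_deriv bs u) \<and>
     (\<forall>k::nat. bounded (range (\<lambda>x. (1 + norm x) ^ k *\<^sub>R iter_deriv bs u x)))}"

text \<open>Symbols are functions of the pair \<open>(w, \<xi>)\<close>. The list below selects a partial derivative
  first in the directions \<open>cs\<close> with respect to \<open>\<xi>\<close> and then in the directions \<open>bs\<close> with respect
  to \<open>w\<close>.\<close>

definition phase_dirs :: "'a::euclidean_space list \<Rightarrow> 'a list \<Rightarrow> ('a \<times> 'a) list" where
  "phase_dirs bs cs = map (\<lambda>b. (b, 0)) bs @ map (\<lambda>c. (0, c)) cs"

text \<open>The Euclidean norm of the tensor \<open>\<nabla>\<^sub>w\<^sup>k \<nabla>\<^sub>\<xi>\<^sup>r a\<close> of all partial derivatives, whose entries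
  are indexed by sequences of coordinate directions.\<close>

definition grad_norm ::
    "nat \<Rightarrow> nat \<Rightarrow> ('a::euclidean_space \<times> 'a \<Rightarrow> complex) \<Rightarrow> 'a \<times> 'a \<Rightarrow> real" where
  "grad_norm k r a z =
     sqrt (\<Sum>bs | set bs \<subseteq> Basis \<and> length bs = k. \<Sum>cs | set cs \<subseteq> Basis \<and> length cs = r.
       (cmod (iter_deriv (phase_dirs bs cs) a z))\<^sup>2)"

definition symbol_norm ::
    "nat \<Rightarrow> nat \<Rightarrow> ('a::euclidean_space \<times> 'a \<Rightarrow> complex) \<Rightarrow> real \<Rightarrow> real \<Rightarrow> ennreal" where
  "symbol_norm n m a l \<rho> =
     (MAX k\<in>{0..n}. MAX r\<in>{0..m}. SUP z. ennreal (l ^ k * \<rho> ^ r * grad_norm k r a z))"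

definition symbol_class :: "nat \<Rightarrow> nat \<Rightarrow> ('a::euclidean_space \<times> 'a \<Rightarrow> complex) set" where
  "symbol_class n m = {a.
     (\<forall>bs cs. set bs \<subseteq> Basis \<and> length bs \<le> n \<and> set cs \<subseteq> Basis \<and> length cs \<le> m \<longrightarrow>
        iter_differentiable (phase_dirs bs cs) a \<and>
        continuous_on UNIV (iter_deriv (phase_dirs bs cs) a)) \<and>
     (\<exists>l>0. \<exists>\<rho>>0. symbol_norm n m a l \<rho> < \<infinity>)}"

definition Op_schwartz ::
    "real \<Rightarrow> real \<Rightarrow> ('a::euclidean_space \<times> 'a \<Rightarrow> complex) \<Rightarrow> ('a \<Rightarrow> complex) \<Rightarrow> 'a \<Rightarrow> complex" where
  "Op_schwartz \<alpha> t a u x =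
     complex_of_real ((\<alpha> / (2 * pi)) ^ DIM('a)) *
     (LINT \<xi>|lebesgue. LINT y|lebesgue.
        exp (\<i> * complex_of_real (\<alpha> * ((x - y) \<bullet> \<xi>))) * a ((1 - t) *\<^sub>R x + t *\<^sub>R y, \<xi>) * u y)"

text \<open>The extension by continuity; it is unique when it exists, since the Schwartz functions
  are dense.\<close>

definition Op :: "real \<Rightarrow> real \<Rightarrow> ('a::euclidean_space \<times> 'a \<Rightarrow> complex) \<Rightarrow> 'a L2 \<Rightarrow> 'a L2" where
  "Op \<alpha> t a = (THE A. bounded_clinear_L2 A \<and>
     (\<forall>u\<in>schwartz. square_integrable (Op_schwartz \<alpha> t a u) \<and>
        A (abs_L2 u) = abs_L2 (Op_schwartz \<alpha> t a u)))"

end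

theory Submission
  imports Defs "HOL-Probability.Characteristic_Functions" "HOL-Probability.Sinc_Integral"
begin

text \<open>
The operator \<open>h\<^sub>1 Op h\<^sub>2\<close> is an integral operator (\<open>Op_eq_kernel_op\<close>; the Schwartz functions are dense, so it is
enough to compare on them): its kernel at \<open>(x, y)\<close> is, up to
unimodular factors, the Fourier transform of the symbol in \<open>\<xi>\<close> at frequency \<open>\<alpha> (x - y)\<close>, taken at
the point \<open>w = (1 - t) x + t y\<close>. By Plancherel its Hilbert-Schmidt norm is controlled by the symbol,
and \<open>m\<close> integrations by parts gain a factor \<open>(\<alpha> \<rho> \<bar>x - y\<bar>)\<^bsup>-m\<^esup>\<close> (\<open>pker_hs_far\<close>). As \<open>\<bar>x - y\<bar> \<ge> R\<close> where
both cut-offs are nonzero, the squared Hilbert-Schmidt norm is at most a constant times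
\<open>N\<^sup>2 B\<^bsup>d - 2m\<^esup>\<close> with \<open>B = \<alpha> R \<rho>\<close>. This alone gives \<open>s\<^sub>k \<le> \<Gamma> (k + 1)\<^bsup>-1/2\<^esup>\<close> for the singular values,
which is not summable to the power \<open>q\<close>.

More decay comes from smoothness in \<open>x\<close>. If the sum of the squared norms
of the images is at most \<open>E\<close> for every finite orthonormal family in the common kernel of \<open>K\<close> linear
functionals, then \<open>s\<^sub>k\<^sup>2 \<le> E / (k + 1 - K)\<close> (\<open>singular_value_bounds\<close>). A derivative
in \<open>x\<close> of the operator is an operator of the same kind, with a symbol larger by a factor of order
\<open>\<alpha> \<rho>\<close> (\<open>w_class_step\<close>). Cut space into cells of size \<open>\<delta> / (\<alpha> \<rho>)\<close> and let the functionals be the means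
over the cells of the derivatives of order less than \<open>n\<close>: where they vanish, the Poincare inequality
applied \<open>n\<close> times reduces this energy by the factor \<open>\<delta>\<^bsup>2n\<^esup>\<close> (\<open>Uop_poincare_iterated\<close>).

The support of \<open>h\<^sub>1\<close> may be unbounded. At distance about \<open>2\<^sup>j R\<close> from the centre \<open>u\<close> of the symbol,
\<open>\<bar>x - y\<bar>\<close> is at least of order \<open>2\<^sup>j R\<close>, whatever \<open>t\<close>, and the kernel is smaller by the factor \<open>2\<^bsup>-j m\<^esup>\<close>.
Hence \<open>\<delta>\<close> may be of order \<open>2\<^bsup>\<theta> (j - J)\<^esup>\<close> on that shell, for \<open>j \<le> J\<close> and a fixed \<open>\<theta> > 1\<close>, and no cells are
needed beyond the shell \<open>J\<close>: the number of functionals is of order \<open>B\<^sup>d 2\<^bsup>d \<theta> J\<^esup>\<close> and the energy drops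
by \<open>2\<^bsup>-2 n J\<^esup>\<close> (\<open>card_level_functionals\<close>, \<open>energy_level\<close>). Eliminating \<open>J\<close> gives
\<open>s\<^sub>k \<le> C \<Gamma> (k + 1)\<^bsup>-1/2\<^esup> ((k + 1) / Y)\<^bsup>-p\<^esup>\<close> for \<open>k + 1 \<ge> Y\<close>, with \<open>Y\<close> of order \<open>B\<^sup>d\<close> and \<open>p = n / (d \<theta>)\<close>. Since
\<open>q n > d\<close>, the choice \<open>\<theta> = 1 + q / 2\<close> makes \<open>(1/2 + p) q > 1\<close>, and the sum of the \<open>q\<close>-th powers is of
order \<open>\<Gamma>\<^sup>q Y\<^bsup>1 - q/2\<^esup>\<close>, whose \<open>1/q\<close>-th power is of order \<open>N B\<^bsup>d/q - m\<^esup>\<close>.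
\<close>

section \<open>The Hilbert space of square integrable functions\<close>

lemma square_integrable_rep_L2: "square_integrable (rep_L2 f)"
  using Quotient_rep_reflp[OF Quotient_L2, of f] by auto

lemma abs_rep_L2: "abs_L2 (rep_L2 f) = f"
  using Quotient_abs_rep[OF Quotient_L2] .

lemma abs_L2_eq_iff:
  assumes "square_integrable f" "square_integrable g"
  shows "abs_L2 f = abs_L2 g \<longleftrightarrow> (AE x in lebesgue. f x = g x)"
  using Quotient_rel[OF Quotient_L2, of f g] assms by auto

lemma rep_abs_L2:
  assumes "square_integrable f"
  shows "AE x in lebesgue. rep_L2 (abs_L2 f) x = f x"
  using abs_L2_eq_iff[OF square_integrable_rep_L2[of "abs_L2 f"] assms] by (simp add: abs_rep_L2)

abbreviation cmod_sq :: "complex \<Rightarrow> ennreal" where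
  "cmod_sq z \<equiv> ennreal ((cmod z)\<^sup>2)"

abbreviation sq_norm :: "('a::euclidean_space \<Rightarrow> complex) \<Rightarrow> ennreal" where
  "sq_norm f \<equiv> \<integral>\<^sup>+x. cmod_sq (f x) \<partial>lborel"

abbreviation sq_mass :: "('a::euclidean_space \<Rightarrow> complex) \<Rightarrow> 'a set \<Rightarrow> ennreal" where
  "sq_mass f S \<equiv> \<integral>\<^sup>+x. cmod_sq (f x) * indicator S x \<partial>lborel"

abbreviation hs_norm_sq :: "('a::euclidean_space \<Rightarrow> 'b::euclidean_space \<Rightarrow> complex) \<Rightarrow> ennreal" where
  "hs_norm_sq k \<equiv> \<integral>\<^sup>+x. \<integral>\<^sup>+y. cmod_sq (k x y) \<partial>lborel \<partial>lborel"

abbreviation jointly_measurable :: "('a::euclidean_space \<Rightarrow> 'b::euclidean_space \<Rightarrow> 'c::topological_space) \<Rightarrow> bool" where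
  "jointly_measurable k \<equiv> (\<lambda>p. k (fst p) (snd p)) \<in> borel_measurable (borel \<Otimes>\<^sub>M borel)"

text \<open>Borel representatives allow all integrals below to be taken with respect to \<open>lborel\<close>, for
  which the product measure and the affine changes of variables are available.\<close>

definition bsq :: "('a::euclidean_space \<Rightarrow> complex) \<Rightarrow> bool" where
  "bsq f \<longleftrightarrow> f \<in> borel_measurable borel \<and> (sq_norm f) < \<infinity>"

lemma bsq_measurable[measurable_dest]: "bsq f \<Longrightarrow> f \<in> borel_measurable borel"
  by (simp add: bsq_def)

lemma bsq_integrable: "bsq f \<Longrightarrow> integrable lborel (\<lambda>x. (cmod (f x))\<^sup>2)"
  unfolding bsq_def by (intro integrableI_bounded) auto

lemma bsq_square_integrable: 
  assumes "bsq f" shows "square_integrable f"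
proof -
  have [measurable]: "f \<in> borel_measurable borel" using assms by (simp add: bsq_def)
  have "integrable lebesgue (\<lambda>x. (cmod (f x))\<^sup>2)"
    using bsq_integrable[OF assms] by (subst integrable_completion) auto
  then show ?thesis unfolding square_integrable_def
    by (auto intro!: measurable_completion)
qed

lemma lebesgue_borel_version:
  fixes f :: "'a::euclidean_space \<Rightarrow> complex"
  assumes "f \<in> borel_measurable lebesgue"
  shows "\<exists>g\<in>borel_measurable borel. AE x in lebesgue. f x = g x"
proof -
  have m: "(\<lambda>x. Re (f x)) \<in> borel_measurable lebesgue" "(\<lambda>x. Im (f x)) \<in> borel_measurable lebesgue"
    using assms by measurable
  obtain g1 where g1: "g1 \<in> borel_measurable lborel" "AE x in lborel. Re (f x) = g1 x"
    using completion_ex_borel_measurable_real[OF m(1)] by auto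
  obtain g2 where g2: "g2 \<in> borel_measurable lborel" "AE x in lborel. Im (f x) = g2 x"
    using completion_ex_borel_measurable_real[OF m(2)] by auto
  have [measurable]: "g1 \<in> borel_measurable borel" "g2 \<in> borel_measurable borel"
    using g1 g2 by auto
  have "AE x in lborel. f x = Complex (g1 x) (g2 x)"
    using g1(2) g2(2) by eventually_elim (simp add: complex_eq_iff)
  then have "AE x in lebesgue. f x = Complex (g1 x) (g2 x)"
    by (rule AE_completion)
  moreover have "(\<lambda>x. Complex (g1 x) (g2 x)) \<in> borel_measurable borel"
    by (simp add: borel_measurable_complex_iff)
  ultimately show ?thesis by (rule bexI)
qed

lemma L2_borel_rep:
  obtains g where "bsq g" "f = abs_L2 g" "AE x in lebesgue. rep_L2 f x = g x"
proof -
  have sq: "square_integrable (rep_L2 f)" by (rule square_integrable_rep_L2)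
  then obtain g where g: "g \<in> borel_measurable borel" "AE x in lebesgue. rep_L2 f x = g x"
    using lebesgue_borel_version[of "rep_L2 f"] by (auto simp: square_integrable_def)
  have [measurable]: "g \<in> borel_measurable borel" by fact
  have "integrable lebesgue (\<lambda>x. (cmod (g x))\<^sup>2)"
  proof (rule integrable_cong_AE_imp)
    show "integrable lebesgue (\<lambda>x. (cmod (rep_L2 f x))\<^sup>2)" using sq by (simp add: square_integrable_def)
    show "AE x in lebesgue. (cmod (rep_L2 f x))\<^sup>2 = (cmod (g x))\<^sup>2" using g(2) by eventually_elim simp
    show "(\<lambda>x. (cmod (g x))\<^sup>2) \<in> borel_measurable lebesgue"
      by (intro measurable_completion) (simp, measurable)
  qed
  then have "integrable lborel (\<lambda>x. (cmod (g x))\<^sup>2)"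
    by (subst (asm) integrable_completion) auto
  then have "bsq g" unfolding bsq_def using g(1)
    by (auto simp: integrable_iff_bounded)
  moreover have "f = abs_L2 g"
    using abs_L2_eq_iff[OF sq bsq_square_integrable[OF \<open>bsq g\<close>]] g(2) abs_rep_L2 by metis
  ultimately show ?thesis using g(2) that by blast
qed

lemma norm_abs_L2_sq:
  assumes "bsq f"
  shows "ennreal ((norm (abs_L2 f))\<^sup>2) = sq_norm f"
proof -
  have sq: "square_integrable f" using assms by (rule bsq_square_integrable)
  have [measurable]: "f \<in> borel_measurable borel" using assms by (simp add: bsq_def)
  have "inner (abs_L2 f) (abs_L2 f) = (LINT x|lebesgue. (cmod (f x))\<^sup>2)"
    unfolding inner_L2_def using cinner_L2.abs_eq[of f f] sq square_integrable_Re_prod_self[OF sq] by simp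
  also have "\<dots> = (LINT x|lborel. (cmod (f x))\<^sup>2)"
    by (subst integral_completion) auto
  finally have "(norm (abs_L2 f))\<^sup>2 = (LINT x|lborel. (cmod (f x))\<^sup>2)"
    by (simp add: power2_norm_eq_inner)
  moreover have "sq_norm f = ennreal (LINT x|lborel. (cmod (f x))\<^sup>2)"
    by (rule nn_integral_eq_integral[OF bsq_integrable[OF assms]]) simp
  ultimately show ?thesis by (simp only:)
qed

lemma abs_L2_plus: "square_integrable f \<Longrightarrow> square_integrable g \<Longrightarrow>
  abs_L2 (\<lambda>x. f x + g x) = abs_L2 f + abs_L2 g"
  using plus_L2.abs_eq[of f g] by simp

lemma abs_L2_scale: "square_integrable f \<Longrightarrow> abs_L2 (\<lambda>x. c * f x) = scaleC_L2 c (abs_L2 f)"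
  using scaleC_L2.abs_eq[of f c] by simp

lemma square_integrable_diff:
  assumes "square_integrable f" "square_integrable g"
  shows "square_integrable (\<lambda>x. f x - g x)"
  using square_integrable_add[OF assms(1) square_integrable_cmult[OF assms(2), of "-1"]] by simp

lemma abs_L2_diff:
  assumes "square_integrable f" "square_integrable g"
  shows "abs_L2 (\<lambda>x. f x - g x) = abs_L2 f - abs_L2 g"
proof -
  have "abs_L2 (\<lambda>x. f x + (-1) * g x) = abs_L2 f + scaleC_L2 (-1) (abs_L2 g)"
    by (simp only: abs_L2_plus[OF assms(1) square_integrable_cmult[OF assms(2)]] abs_L2_scale[OF assms(2)])
  then show ?thesis by (simp add: uminus_L2_def[symmetric])
qed

lemma bsq_bound:
  assumes [measurable]: "f \<in> borel_measurable borel" and "bsq g"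
    and "\<And>x. cmod (f x) \<le> C * cmod (g x)"
  shows "bsq f"
proof -
  have [measurable]: "g \<in> borel_measurable borel" using assms by (simp add: bsq_def)
  have "sq_norm f \<le> (\<integral>\<^sup>+x. ennreal (C\<^sup>2) * cmod_sq (g x) \<partial>lborel)"
    using power_mono[OF assms(3), of _ 2]
    by (intro nn_integral_mono) (simp add: power_mult_distrib ennreal_mult''[symmetric] ennreal_leI)
  also have "\<dots> = ennreal (C\<^sup>2) * sq_norm g"
    by (rule nn_integral_cmult) simp
  also have "\<dots> < \<infinity>" using \<open>bsq g\<close> by (simp add: bsq_def ennreal_mult_less_top)
  finally show ?thesis by (simp add: bsq_def)
qed

lemma square_integrable_borel_bsq:
  assumes "square_integrable f" "f \<in> borel_measurable borel" shows "bsq f"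
proof -
  have [measurable]: "f \<in> borel_measurable borel" by fact
  have "integrable lborel (\<lambda>x. (cmod (f x))\<^sup>2)"
    using assms(1) by (simp add: square_integrable_def integrable_completion)
  then show ?thesis unfolding bsq_def using assms(2) by (auto simp: integrable_iff_bounded)
qed

lemma bsq_add: "bsq f \<Longrightarrow> bsq g \<Longrightarrow> bsq (\<lambda>x. f x + g x)"
  by (rule square_integrable_borel_bsq[OF square_integrable_add[OF bsq_square_integrable bsq_square_integrable]])
    (auto simp: bsq_def)

lemma bsq_diff: "bsq f \<Longrightarrow> bsq g \<Longrightarrow> bsq (\<lambda>x. f x - g x)"
  by (rule square_integrable_borel_bsq[OF square_integrable_diff[OF bsq_square_integrable bsq_square_integrable]])
    (auto simp: bsq_def)

lemma cinner_L2_add_left: "cinner_L2 (f + g) h = cinner_L2 f h + cinner_L2 g h"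
  by transfer (auto simp: ring_distribs square_integrable_prod)

lemma cinner_L2_scale_left: "cinner_L2 (scaleC_L2 c f) h = c * cinner_L2 f h"
  by transfer (auto simp: mult.assoc)

lemma cinner_L2_cnj: "cinner_L2 g f = cnj (cinner_L2 f g)"
proof -
  have "integral\<^sup>L lebesgue (\<lambda>x. cnj (rep_L2 f x * cnj (rep_L2 g x)))
      = cnj (integral\<^sup>L lebesgue (\<lambda>x. rep_L2 f x * cnj (rep_L2 g x)))"
    by (rule integral_bounded_linear[OF bounded_linear_cnj square_integrable_prod])
      (rule square_integrable_rep_L2)+
  then show ?thesis by (simp add: cinner_L2.rep_eq mult.commute)
qed

lemma cinner_L2_add_right: "cinner_L2 h (f + g) = cinner_L2 h f + cinner_L2 h g"
  by (simp only: cinner_L2_cnj[of h] cinner_L2_add_left complex_cnj_add)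

lemma cinner_L2_scale_right: "cinner_L2 h (scaleC_L2 c f) = cnj c * cinner_L2 h f"
  by (simp only: cinner_L2_cnj[of h] cinner_L2_scale_left complex_cnj_mult)

lemma cinner_L2_self: "cinner_L2 f f = complex_of_real ((norm f)\<^sup>2)"
proof -
  have "Im (cinner_L2 f f) = 0" using arg_cong[OF cinner_L2_cnj[of f f], of Im] by simp
  moreover have "Re (cinner_L2 f f) = (norm f)\<^sup>2"
    by (simp only: power2_norm_eq_inner[of f] inner_L2_def)
  ultimately show ?thesis
    by (intro complex_eqI) (simp_all only: Re_complex_of_real Im_complex_of_real)
qed

lemma scaleR_scaleC: "r *\<^sub>R (f::'a::euclidean_space L2) = scaleC_L2 (complex_of_real r) f"
  by (rule scaleR_L2_def[THEN fun_cong])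

lemma cinner_L2_zero[simp]: "cinner_L2 0 h = 0" "cinner_L2 h 0 = 0"
  using cinner_L2_add_left[of 0 0 h] cinner_L2_add_right[of h 0 0] by simp_all

lemma cinner_L2_sum_left: "cinner_L2 (sum f S) h = (\<Sum>i\<in>S. cinner_L2 (f i) h)"
  by (induction S rule: infinite_finite_induct) (auto simp: cinner_L2_add_left)

lemma cinner_L2_sum_right: "cinner_L2 h (sum f S) = (\<Sum>i\<in>S. cinner_L2 h (f i))"
  by (induction S rule: infinite_finite_induct) (auto simp: cinner_L2_add_right)

lemma norm_scaleC: "norm (scaleC_L2 c f) = cmod c * norm f"
proof -
  have "cinner_L2 (scaleC_L2 c f) (scaleC_L2 c f) = (c * cnj c) * cinner_L2 f f"
    by (simp add: cinner_L2_scale_left cinner_L2_scale_right mult_ac)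
  also have "\<dots> = complex_of_real ((cmod c)\<^sup>2) * complex_of_real ((norm f)\<^sup>2)"
    by (simp only: cinner_L2_self complex_norm_square)
  finally have "complex_of_real ((norm (scaleC_L2 c f))\<^sup>2) = complex_of_real ((cmod c * norm f)\<^sup>2)"
    by (simp only: cinner_L2_self of_real_mult power_mult_distrib)
  then have "(norm (scaleC_L2 c f))\<^sup>2 = (cmod c * norm f)\<^sup>2" by (simp only: of_real_eq_iff)
  then show ?thesis by (rule power2_eq_imp_eq) auto
qed

text \<open>Completeness is what turns total boundedness into relative compactness below.\<close>

lemma complete_L2: "complete (UNIV :: 'a::euclidean_space L2 set)"
  unfolding complete_def
proof (intro allI impI)
  fix X :: "nat \<Rightarrow> 'a L2"
  assume "(\<forall>n. X n \<in> UNIV) \<and> Cauchy X"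
  then have C: "Cauchy X" by simp
  have "\<forall>k. \<exists>N. \<forall>m\<ge>N. \<forall>n\<ge>N. norm (X m - X n) < (1/2)^k"
    using C unfolding Cauchy_def dist_norm by (auto simp: zero_less_power)
  then obtain N where N: "\<And>k m n. m \<ge> N k \<Longrightarrow> n \<ge> N k \<Longrightarrow> norm (X m - X n) < (1/2)^k" by metis
  define r where "r k = (\<Sum>j\<le>k. N j) + k" for k
  have rN: "r k \<ge> N k" for k
  proof -
    have "N k \<le> (\<Sum>j\<le>k. N j)" by (rule member_le_sum) auto
    then show ?thesis by (simp add: r_def)
  qed
  have rS: "r (Suc k) > r k" for k by (simp add: r_def)
  have sm: "strict_mono r" using rS by (simp add: strict_mono_Suc_iff)
  define g where "g k = (SOME g. bsq g \<and> X (r k) = abs_L2 g)" for k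
  have g: "bsq (g k)" "X (r k) = abs_L2 (g k)" for k
  proof -
    have "\<exists>g. bsq g \<and> X (r k) = abs_L2 g" by (rule L2_borel_rep[of "X (r k)"]) blast
    from someI_ex[OF this] show "bsq (g k)" "X (r k) = abs_L2 (g k)" by (auto simp: g_def)
  qed
  have gm[measurable]: "g k \<in> borel_measurable borel" for k using g(1)[of k] by (simp add: bsq_def)
  have dg: "(\<integral>\<^sup>+x. cmod_sq (g (Suc k) x - g k x) \<partial>lborel) \<le> ennreal ((1/4)^k)" for k
  proof -
    have "(norm (X (r (Suc k)) - X (r k)))\<^sup>2 \<le> ((1/2)^k)\<^sup>2"
      using N[of k "r (Suc k)" "r k"] rN[of k] rS[of k] by (intro power_mono) auto
    also have "((1/2::real)^k)\<^sup>2 = (1/4)^k" by (simp add: power_even_eq[symmetric] power_mult power2_eq_square flip: power_mult_distrib)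
    finally have "(norm (X (r (Suc k)) - X (r k)))\<^sup>2 \<le> (1/4)^k" .
    then show ?thesis
      using norm_abs_L2_sq[OF bsq_diff[OF g(1)[of "Suc k"] g(1)[of k]]] g(2)
        abs_L2_diff[OF bsq_square_integrable[OF g(1)] bsq_square_integrable[OF g(1)], of "Suc k" k]
      by (metis ennreal_leI)
  qed
  \<comment> \<open>The weights \<open>2\<^sup>k\<close> turn the summable squares into geometric decay of the increments.\<close>
  have "(\<integral>\<^sup>+x. (\<Sum>k. ennreal (2^k * (cmod (g (Suc k) x - g k x))\<^sup>2)) \<partial>lborel)
      = (\<Sum>k. \<integral>\<^sup>+x. ennreal (2^k * (cmod (g (Suc k) x - g k x))\<^sup>2) \<partial>lborel)"
    by (rule nn_integral_suminf) measurable
  also have "\<dots> \<le> (\<Sum>k. ennreal ((1/2)^k))"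
  proof (rule suminf_le)
    fix k
    have "(\<integral>\<^sup>+x. ennreal (2^k * (cmod (g (Suc k) x - g k x))\<^sup>2) \<partial>lborel)
       = ennreal (2^k) * (\<integral>\<^sup>+x. cmod_sq (g (Suc k) x - g k x) \<partial>lborel)"
      by (subst nn_integral_cmult[symmetric]) (auto simp: ennreal_mult)
    also have "\<dots> \<le> ennreal (2^k) * ennreal ((1/4)^k)" by (rule mult_left_mono[OF dg]) simp
    also have "\<dots> = ennreal ((1/2)^k)" by (simp add: ennreal_mult[symmetric] power_mult_distrib[symmetric])
    finally show "(\<integral>\<^sup>+x. ennreal (2^k * (cmod (g (Suc k) x - g k x))\<^sup>2) \<partial>lborel) \<le> ennreal ((1/2)^k)" .
  qed auto
  also have "\<dots> < \<infinity>"
    by (subst suminf_ennreal2) (auto simp: summable_geometric)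
  finally have "AE x in lborel. (\<Sum>k. ennreal (2^k * (cmod (g (Suc k) x - g k x))\<^sup>2)) \<noteq> \<infinity>"
    by (intro nn_integral_PInf_AE) auto
  then have conv: "AE x in lborel. convergent (\<lambda>k. g k x)"
  proof eventually_elim
    fix x assume "(\<Sum>k. ennreal (2^k * (cmod (g (Suc k) x - g k x))\<^sup>2)) \<noteq> \<infinity>"
    then have "summable (\<lambda>k. 2^k * (cmod (g (Suc k) x - g k x))\<^sup>2)"
      by (intro summable_suminf_not_top) (auto simp: infinity_ennreal_def)
    then have "(\<lambda>k. 2^k * (cmod (g (Suc k) x - g k x))\<^sup>2) \<longlonglongrightarrow> 0" by (rule summable_LIMSEQ_zero)
    then have "eventually (\<lambda>k. 2^k * (cmod (g (Suc k) x - g k x))\<^sup>2 < 1) sequentially"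
      by (rule order_tendstoD) simp
    then have "eventually (\<lambda>k. norm (g (Suc k) x - g k x) \<le> (sqrt (1/2)) ^ k) sequentially"
    proof eventually_elim
      fix k assume "2^k * (cmod (g (Suc k) x - g k x))\<^sup>2 < 1"
      then have "(cmod (g (Suc k) x - g k x))\<^sup>2 \<le> (1/2)^k" by (simp add: field_simps)
      also have "\<dots> = (sqrt (1/2) ^ k)\<^sup>2" by (simp add: power_mult[symmetric] mult.commute[of k] power_mult real_sqrt_pow2)
      finally show "norm (g (Suc k) x - g k x) \<le> (sqrt (1/2)) ^ k"
        by (rule power2_le_imp_le) simp
    qed
    moreover have "summable (\<lambda>k. sqrt (1/2) ^ k)"
      by (rule summable_geometric) (simp add: real_sqrt_divide)
    ultimately have "summable (\<lambda>k. g (Suc k) x - g k x)"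
      by (rule summable_comparison_test_ev)
    then have "convergent (\<lambda>n. \<Sum>k<n. g (Suc k) x - g k x)" by (simp add: summable_iff_convergent)
    then have "convergent (\<lambda>n. g n x - g 0 x)"
      by (simp only: sum_lessThan_telescope[of "\<lambda>n. g n x"])
    from convergent_add[OF this convergent_const[of "g 0 x"]] show "convergent (\<lambda>k. g k x)" by simp
  qed
  define G where "G x = lim (\<lambda>k. g k x)" for x
  have [measurable]: "G \<in> borel_measurable borel" unfolding G_def by measurable
  have lim: "AE x in lborel. (\<lambda>k. g k x) \<longlonglongrightarrow> G x"
    using conv unfolding G_def convergent_LIMSEQ_iff .
  have fatou: "(\<integral>\<^sup>+x. cmod_sq (G x - g k x) \<partial>lborel) \<le> ennreal ((1/4)^i)"
    if k: "r k \<ge> N i" for k i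
  proof -
    have "(\<integral>\<^sup>+x. cmod_sq (G x - g k x) \<partial>lborel) = (\<integral>\<^sup>+x. liminf (\<lambda>j. cmod_sq (g j x - g k x)) \<partial>lborel)"
    proof (rule nn_integral_cong_AE)
      show "AE x in lborel. cmod_sq (G x - g k x) = liminf (\<lambda>j. cmod_sq (g j x - g k x))"
        using lim
      proof eventually_elim
        fix x assume "(\<lambda>k. g k x) \<longlonglongrightarrow> G x"
        then have "(\<lambda>j. cmod_sq (g j x - g k x)) \<longlonglongrightarrow> cmod_sq (G x - g k x)"
          by (intro tendsto_ennrealI tendsto_power tendsto_norm tendsto_diff tendsto_const)
        then show "cmod_sq (G x - g k x) = liminf (\<lambda>j. cmod_sq (g j x - g k x))"
          by (intro lim_imp_Liminf[symmetric]) auto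
      qed
    qed
    also have "\<dots> \<le> liminf (\<lambda>j. \<integral>\<^sup>+x. cmod_sq (g j x - g k x) \<partial>lborel)"
      by (rule nn_integral_liminf) measurable
    also have "\<dots> \<le> ennreal ((1/4)^i)"
    proof (rule order_trans[OF Liminf_le_Limsup Limsup_bounded], simp, rule eventually_sequentiallyI)
      fix j assume "N i \<le> j"
      then have "r j \<ge> N i" using seq_suble[OF sm, of j] by linarith
      have "(norm (X (r j) - X (r k)))\<^sup>2 \<le> ((1/2)^i)\<^sup>2"
        using N[OF \<open>r j \<ge> N i\<close> k] by (intro power_mono) auto
      also have "((1/2::real)^i)\<^sup>2 = (1/4)^i" by (simp add: power_even_eq[symmetric] power_mult power2_eq_square flip: power_mult_distrib)
      finally have "(norm (X (r j) - X (r k)))\<^sup>2 \<le> (1/4)^i" .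
      then show "(\<integral>\<^sup>+x. cmod_sq (g j x - g k x) \<partial>lborel) \<le> ennreal ((1/4)^i)"
        using norm_abs_L2_sq[OF bsq_diff[OF g(1)[of j] g(1)[of k]]] g(2)
          abs_L2_diff[OF bsq_square_integrable[OF g(1)] bsq_square_integrable[OF g(1)], of j k]
        by (metis ennreal_leI)
    qed
    finally show ?thesis .
  qed
  have "bsq (\<lambda>x. G x - g 0 x)" unfolding bsq_def
  proof
    have "(\<integral>\<^sup>+x. cmod_sq (G x - g 0 x) \<partial>lborel) \<le> ennreal ((1/4)^0)"
      by (rule fatou) (rule rN)
    also have "\<dots> < \<infinity>" by simp
    finally show "(\<integral>\<^sup>+x. cmod_sq (G x - g 0 x) \<partial>lborel) < \<infinity>" .
  qed measurable
  from bsq_add[OF this g(1)[of 0]] have bG: "bsq G" by simp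
  have "X \<longlonglongrightarrow> abs_L2 G"
  proof (rule LIMSEQ_I)
    fix e :: real assume "e > 0"
    then obtain i where i: "(1/2)^i < e/2" using real_arch_pow_inv[of "e/2" "1/2"] by auto
    have "norm (X n - abs_L2 G) < e" if n: "n \<ge> N i" for n
    proof -
      define k where "k = N i"
      have rk: "r k \<ge> N i" using seq_suble[OF sm, of k] by (simp add: k_def)
      have "ennreal ((norm (abs_L2 G - X (r k)))\<^sup>2) \<le> ennreal ((1/4)^i)"
        using norm_abs_L2_sq[OF bsq_diff[OF bG g(1)[of k]]] g(2)
          abs_L2_diff[OF bsq_square_integrable[OF bG] bsq_square_integrable[OF g(1)], of k] fatou[OF rk] by simp
      then have "(norm (abs_L2 G - X (r k)))\<^sup>2 \<le> (1/4)^i" by (simp add: ennreal_le_iff)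
      also have "(1/4)^i = ((1/2::real)^i)\<^sup>2" by (simp add: power_even_eq[symmetric] power_mult power2_eq_square flip: power_mult_distrib)
      finally have "norm (abs_L2 G - X (r k)) \<le> (1/2)^i"
        by (rule power2_le_imp_le) simp
      moreover have "norm (X n - X (r k)) < (1/2)^i" using N[OF n rk] .
      ultimately have "norm ((X n - X (r k)) - (abs_L2 G - X (r k))) < e"
        using norm_triangle_ineq4[of "X n - X (r k)" "abs_L2 G - X (r k)"] i by linarith
      then show ?thesis by simp
    qed
    then show "\<exists>no. \<forall>n\<ge>no. norm (X n - abs_L2 G) < e" by blast
  qed
  then show "\<exists>l\<in>UNIV. X \<longlonglongrightarrow> l" by blast
qed

section \<open>Singular values and orthonormal families\<close>

definition clinear_fun :: "('a::euclidean_space L2 \<Rightarrow> complex) \<Rightarrow> bool" where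
  "clinear_fun \<phi> \<longleftrightarrow> (\<forall>f g. \<phi> (f + g) = \<phi> f + \<phi> g) \<and> (\<forall>c f. \<phi> (scaleC_L2 c f) = c * \<phi> f)"

definition clinear_map :: "('a::euclidean_space L2 \<Rightarrow> 'a L2) \<Rightarrow> bool" where
  "clinear_map A \<longleftrightarrow> (\<forall>f g. A (f + g) = A f + A g) \<and> (\<forall>c f. A (scaleC_L2 c f) = scaleC_L2 c (A f))"

definition orthonormal_L2 :: "'a::euclidean_space L2 set \<Rightarrow> bool" where
  "orthonormal_L2 G \<longleftrightarrow> finite G \<and> (\<forall>f\<in>G. \<forall>g\<in>G. cinner_L2 f g = (if f = g then 1 else 0))"

lemma scaleC_L2_zero[simp]: "scaleC_L2 c 0 = 0" "scaleC_L2 0 f = 0"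
  using L2.scale_zero_right[of c] L2.scale_zero_left[of f] by simp_all

lemma clinear_fun_zero: "clinear_fun \<phi> \<Longrightarrow> \<phi> 0 = 0"
proof -
  assume "clinear_fun \<phi>"
  then have "\<phi> (0 + 0) = \<phi> 0 + \<phi> 0" unfolding clinear_fun_def by blast
  then show ?thesis by simp
qed

lemma clinear_fun_sum:
  "clinear_fun \<phi> \<Longrightarrow> \<phi> (\<Sum>i\<in>I. scaleC_L2 (c i) (e i)) = (\<Sum>i\<in>I. c i * \<phi> (e i))"
  by (induction I rule: infinite_finite_induct) (auto simp: clinear_fun_def clinear_fun_zero)

lemma clinear_map_zero: "clinear_map A \<Longrightarrow> A 0 = 0"
proof -
  assume "clinear_map A"
  then have "A (0 + 0) = A 0 + A 0" unfolding clinear_map_def by blast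
  then show ?thesis by simp
qed

lemma clinear_map_sum:
  "clinear_map A \<Longrightarrow> A (\<Sum>i\<in>I. scaleC_L2 (c i) (e i)) = (\<Sum>i\<in>I. scaleC_L2 (c i) (A (e i)))"
  by (induction I rule: infinite_finite_induct) (auto simp: clinear_map_def clinear_map_zero)

lemma clinear_map_diff: "clinear_map A \<Longrightarrow> A (f - g) = A f - A g"
  by (simp only: clinear_map_def minus_L2_def uminus_L2_def)

lemma cinner_L2_diff_left: "cinner_L2 (f - g) h = cinner_L2 f h - cinner_L2 g h"
proof -
  have "f - g = f + scaleC_L2 (-1) g" by (simp only: minus_L2_def uminus_L2_def)
  then have "cinner_L2 (f - g) h = cinner_L2 f h + (-1) * cinner_L2 g h"
    by (simp only: cinner_L2_add_left cinner_L2_scale_left)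
  then show ?thesis by simp
qed

lemma cinner_L2_diff_right: "cinner_L2 h (f - g) = cinner_L2 h f - cinner_L2 h g"
  by (simp only: cinner_L2_cnj[of h] cinner_L2_diff_left complex_cnj_diff)

lemma clinear_fun_cinner: "clinear_fun (\<lambda>f. cinner_L2 f g)"
  by (simp add: clinear_fun_def cinner_L2_add_left cinner_L2_scale_left)

lemma cinner_self_one: "cinner_L2 g g = 1 \<longleftrightarrow> norm g = 1"
  by (simp only: cinner_L2_self of_real_eq_1_iff abs_square_eq_1 abs_norm_cancel)

text \<open>Fewer equations than unknowns, by eliminating one unknown per equation.\<close>

lemma homogeneous_system_solution:
  fixes a :: "'p \<Rightarrow> 'i \<Rightarrow> complex"
  assumes "finite P" "finite I" "card P < card I"
  shows "\<exists>c. (\<exists>i\<in>I. c i \<noteq> 0) \<and> (\<forall>p\<in>P. (\<Sum>i\<in>I. c i * a p i) = 0)"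
  using assms
proof (induction P arbitrary: I a rule: finite_induct)
  case empty
  then have "I \<noteq> {}" by auto
  then show ?case by (intro exI[of _ "\<lambda>_. 1"]) auto
next
  case (insert p P)
  show ?case
  proof (cases "\<forall>i\<in>I. a p i = 0")
    case True
    have "card P < card I" using insert.prems insert.hyps by simp
    from insert.IH[OF \<open>finite I\<close> this, of a]
    obtain c where "\<exists>i\<in>I. c i \<noteq> 0" "\<forall>p\<in>P. (\<Sum>i\<in>I. c i * a p i) = 0" by blast
    then show ?thesis using True by (intro exI[of _ c]) auto
  next
    case False
    then obtain j where j: "j \<in> I" "a p j \<noteq> 0" by auto
    define J where "J = I - {j}"
    have fJ: "finite J" "j \<notin> J" and I: "I = insert j J" using insert.prems j by (auto simp: J_def)
    have "card P < card J" using insert.prems insert.hyps I fJ by simp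
    then obtain c where c: "\<exists>i\<in>J. c i \<noteq> 0"
      "\<forall>r\<in>P. (\<Sum>i\<in>J. c i * (a r i - a p i / a p j * a r j)) = 0"
      using insert.IH[of J "\<lambda>r i. a r i - a p i / a p j * a r j"] fJ by auto
    define d where "d = c(j := - (\<Sum>i\<in>J. c i * a p i) / a p j)"
    have dJ: "(\<Sum>i\<in>J. d i * f i) = (\<Sum>i\<in>J. c i * f i)" for f
      using fJ by (intro sum.cong) (auto simp: d_def)
    have S: "(\<Sum>i\<in>I. d i * a r i) = (\<Sum>i\<in>J. c i * (a r i - a p i / a p j * a r j))" for r
    proof -
      have "(\<Sum>i\<in>I. d i * a r i) = d j * a r j + (\<Sum>i\<in>J. c i * a r i)"
        unfolding I using fJ by (simp add: dJ)
      also have "d j = - (\<Sum>i\<in>J. c i * (a p i / a p j))"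
        by (simp add: d_def sum_divide_distrib)
      finally show ?thesis
        by (simp add: right_diff_distrib sum_subtractf sum_distrib_right sum_distrib_left mult_ac)
    qed
    have "(\<Sum>i\<in>I. d i * a p i) = 0" unfolding S using j by simp
    moreover have "\<exists>i\<in>I. d i \<noteq> 0" using c(1) fJ I by (auto simp: d_def)
    ultimately show ?thesis using c(2) S by (intro exI[of _ d]) auto
  qed
qed

lemma span_meets_kernels:
  assumes "finite B" "L2.independent B" "finite P" "\<And>\<phi>. \<phi> \<in> P \<Longrightarrow> clinear_fun \<phi>" "card P < card B"
  shows "\<exists>v\<in>L2.span B. v \<noteq> 0 \<and> (\<forall>\<phi>\<in>P. \<phi> v = 0)"
proof -
  obtain c where c: "\<exists>b\<in>B. c b \<noteq> 0" "\<forall>\<phi>\<in>P. (\<Sum>b\<in>B. c b * \<phi> b) = 0"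
    using homogeneous_system_solution[of P B "\<lambda>\<phi>. \<phi>"] assms by auto
  define v where "v = (\<Sum>b\<in>B. scaleC_L2 (c b) b)"
  have "v \<noteq> 0" using assms(1,2) c(1) unfolding v_def by (auto simp: L2.dependent_finite)
  moreover have "v \<in> L2.span B" unfolding v_def
    by (intro L2.span_sum L2.span_scale L2.span_base)
  moreover have "\<phi> v = 0" if "\<phi> \<in> P" for \<phi>
    unfolding v_def clinear_fun_sum[OF assms(4)[OF that]] using c(2) that by simp
  ultimately show ?thesis by blast
qed

text \<open>Gram-Schmidt inside the common kernel of finitely many functionals: orthogonality to the
  vectors already found is just one more linear constraint for each of them.\<close>

lemma orthonormal_in_kernels:
  assumes "finite B" "L2.independent B" "finite P" "\<And>\<phi>. \<phi> \<in> P \<Longrightarrow> clinear_fun \<phi>"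
    and "j + card P \<le> card B"
  shows "\<exists>G. orthonormal_L2 G \<and> card G = j \<and> G \<subseteq> L2.span B \<and> (\<forall>g\<in>G. \<forall>\<phi>\<in>P. \<phi> g = 0)"
  using assms(5)
proof (induction j)
  case 0
  then show ?case by (intro exI[of _ "{}"]) (auto simp: orthonormal_L2_def)
next
  case (Suc j)
  then obtain G where G: "orthonormal_L2 G" "card G = j" "G \<subseteq> L2.span B" "\<forall>g\<in>G. \<forall>\<phi>\<in>P. \<phi> g = 0"
    by auto
  have fG: "finite G" using G(1) by (simp add: orthonormal_L2_def)
  let ?P = "P \<union> (\<lambda>g f. cinner_L2 f g) ` G"
  have "card ?P \<le> card P + card ((\<lambda>g f. cinner_L2 f g) ` G)" by (rule card_Un_le)
  also have "\<dots> \<le> card P + j" using card_image_le[OF fG, of "\<lambda>g f. cinner_L2 f g"] G(2) by simp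
  also have "\<dots> < card B" using Suc.prems by simp
  finally have "\<exists>v\<in>L2.span B. v \<noteq> 0 \<and> (\<forall>\<phi>\<in>?P. \<phi> v = 0)"
    using assms(1-4) fG by (intro span_meets_kernels) (auto intro: clinear_fun_cinner)
  then obtain v where v0: "v \<in> L2.span B" "v \<noteq> 0" "\<forall>\<phi>\<in>?P. \<phi> v = 0"
    by (elim bexE conjE)
  then have v: "v \<in> L2.span B" "v \<noteq> 0" "\<And>\<phi>. \<phi> \<in> P \<Longrightarrow> \<phi> v = 0" "\<And>g. g \<in> G \<Longrightarrow> cinner_L2 v g = 0"
    by auto
  define g where "g = scaleC_L2 (complex_of_real (1 / norm v)) v"
  have ng: "norm g = 1" using v(2) by (simp add: g_def norm_scaleC norm_divide)
  have og: "cinner_L2 g h = 0" "cinner_L2 h g = 0" if "h \<in> G" for h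
  proof -
    show "cinner_L2 g h = 0" using v(4)[OF that] by (simp add: g_def cinner_L2_scale_left)
    then show "cinner_L2 h g = 0" by (simp add: cinner_L2_cnj[of h g])
  qed
  have gG: "g \<notin> G" using og(1)[of g] ng cinner_self_one[of g] by auto
  have "orthonormal_L2 (insert g G)"
    using G(1) og ng gG by (auto simp: orthonormal_L2_def cinner_self_one)
  moreover have "card (insert g G) = Suc j" using gG fG G(2) by simp
  moreover have "g \<in> L2.span B" unfolding g_def using v(1) by (rule L2.span_scale)
  moreover have "\<phi> g = 0" if "\<phi> \<in> P" for \<phi>
    using assms(4)[OF that] v(3)[OF that] by (simp add: g_def clinear_fun_def)
  ultimately show ?case using G(3,4) by (intro exI[of _ "insert g G"]) auto
qed

lemma orthonormal_sum_cinner: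
  assumes "orthonormal_L2 G" "h \<in> G"
  shows "cinner_L2 (\<Sum>g\<in>G. scaleC_L2 (c g) g) h = c h"
proof -
  have "cinner_L2 (\<Sum>g\<in>G. scaleC_L2 (c g) g) h = (\<Sum>g\<in>G. c g * (if g = h then 1 else 0))"
    unfolding cinner_L2_sum_left
    by (rule sum.cong) (use assms in \<open>auto simp: cinner_L2_scale_left orthonormal_L2_def\<close>)
  also have "\<dots> = c h" using assms by (simp add: orthonormal_L2_def if_distrib cong: if_cong)
  finally show ?thesis .
qed

lemma orthonormal_independent:
  assumes "orthonormal_L2 G" shows "L2.independent G"
proof -
  have f: "finite G" using assms by (simp add: orthonormal_L2_def)
  have "u h = 0" if "(\<Sum>g\<in>G. scaleC_L2 (u g) g) = 0" "h \<in> G" for u h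
    using orthonormal_sum_cinner[OF assms that(2), of u] that(1) by simp
  then show ?thesis by (auto simp: L2.dependent_finite[OF f])
qed

text \<open>Covers both the Pythagorean theorem (the identity map) and eigenvectors of \<open>A\<^sup>* A\<close>, whose images
  under \<open>A\<close> are orthogonal with \<open>m g\<close> the eigenvalue.\<close>

lemma norm_sq_orthogonal_images:
  assumes A: "clinear_map A" and f: "finite G"
    and o: "\<And>g h. g \<in> G \<Longrightarrow> h \<in> G \<Longrightarrow> cinner_L2 (A g) (A h) = (if g = h then complex_of_real (m g) else 0)"
  shows "(norm (A (\<Sum>g\<in>G. scaleC_L2 (c g) g)))\<^sup>2 = (\<Sum>g\<in>G. (cmod (c g))\<^sup>2 * m g)"
proof -
  have "complex_of_real ((norm (A (\<Sum>g\<in>G. scaleC_L2 (c g) g)))\<^sup>2)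
      = (\<Sum>g\<in>G. \<Sum>h\<in>G. c g * cnj (c h) * cinner_L2 (A g) (A h))"
    unfolding cinner_L2_self[symmetric] clinear_map_sum[OF A] cinner_L2_sum_left
    unfolding cinner_L2_sum_right
    by (intro sum.cong refl) (simp add: cinner_L2_scale_left cinner_L2_scale_right)
  also have "\<dots> = (\<Sum>g\<in>G. \<Sum>h\<in>G. if h = g then c g * cnj (c g) * complex_of_real (m g) else 0)"
    by (intro sum.cong refl) (auto simp: o)
  also have "\<dots> = (\<Sum>g\<in>G. c g * cnj (c g) * complex_of_real (m g))"
    using f by simp
  also have "\<dots> = (\<Sum>g\<in>G. complex_of_real ((cmod (c g))\<^sup>2 * m g))"
    by (simp only: of_real_mult complex_norm_square)
  finally have "complex_of_real ((norm (A (\<Sum>g\<in>G. scaleC_L2 (c g) g)))\<^sup>2) = complex_of_real (\<Sum>g\<in>G. (cmod (c g))\<^sup>2 * m g)"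
    by simp
  then show ?thesis by (simp only: of_real_eq_iff)
qed

lemma clinear_map_id: "clinear_map (\<lambda>f. f)" by (simp add: clinear_map_def)

lemma norm_sq_orthonormal_sum:
  assumes "orthonormal_L2 G"
  shows "(norm (\<Sum>g\<in>G. scaleC_L2 (c g) g))\<^sup>2 = (\<Sum>g\<in>G. (cmod (c g))\<^sup>2)"
  using norm_sq_orthogonal_images[OF clinear_map_id, of G "\<lambda>_. 1" c] assms
  by (simp add: orthonormal_L2_def)

text \<open>If the singular value of index \<open>k\<close> were too large, the eigenvectors of \<open>A\<^sup>* A\<close> would span a
  space of dimension \<open>k + 1\<close> on which \<open>A\<close> is bounded below; this space contains
  \<open>k + 1 - card P\<close> orthonormal vectors in the kernels of the functionals in \<open>P\<close>.\<close>

lemma singular_count_le: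
  assumes A: "clinear_map A" and adj: "\<And>f g. cinner_L2 (A f) g = cinner_L2 f (B g)"
    and P: "finite P" "\<And>\<phi>. \<phi> \<in> P \<Longrightarrow> clinear_fun \<phi>" "card P \<le> k"
    and E: "\<And>G. orthonormal_L2 G \<Longrightarrow> (\<And>g \<phi>. g \<in> G \<Longrightarrow> \<phi> \<in> P \<Longrightarrow> \<phi> g = 0) \<Longrightarrow> (\<Sum>g\<in>G. (norm (A g))\<^sup>2) \<le> E"
    and s: "s > 0" "E \<le> real (k + 1 - card P) * s\<^sup>2"
  shows "singular_count A s \<le> k"
proof (rule ccontr)
  assume neg: "\<not> singular_count A s \<le> k"
  define S where "S = {\<mu>. s < \<mu> \<and> singular_mult A \<mu> \<noteq> 0}"
  have count: "singular_count A s = (\<Sum>\<mu>\<in>S. singular_mult A \<mu>)" by (simp add: singular_count_def S_def)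
  then have fS: "finite S" using neg by (cases "finite S") auto
  let ?B = "adjoint_L2 A"
  have adj': "cinner_L2 (A f) g = cinner_L2 f (?B g)" for f g
    unfolding adjoint_L2_def using someI[of "\<lambda>B. \<forall>f g. cinner_L2 (A f) g = cinner_L2 f (B g)" B] adj by blast
  define V where "V \<mu> = {f. ?B (A f) = \<mu>\<^sup>2 *\<^sub>R f}" for \<mu>
  have VA: "cinner_L2 (A f) (A g) = complex_of_real (\<nu>\<^sup>2) * cinner_L2 f g" if "g \<in> V \<nu>" for f g \<nu>
    using that unfolding adj' V_def by (simp add: scaleR_scaleC cinner_L2_scale_right)
  have Vs: "L2.subspace (V \<mu>)" for \<mu>
  proof -
    have 1: "f \<in> V \<mu> \<longleftrightarrow> (\<forall>h. cinner_L2 (A h) (A f) = complex_of_real (\<mu>\<^sup>2) * cinner_L2 h f)" for f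
    proof
      assume "\<forall>h. cinner_L2 (A h) (A f) = complex_of_real (\<mu>\<^sup>2) * cinner_L2 h f"
      then have "cinner_L2 h (?B (A f) - \<mu>\<^sup>2 *\<^sub>R f) = 0" for h
        unfolding adj' by (simp add: cinner_L2_diff_right cinner_L2_scale_right scaleR_scaleC)
      then have "cinner_L2 (?B (A f) - \<mu>\<^sup>2 *\<^sub>R f) (?B (A f) - \<mu>\<^sup>2 *\<^sub>R f) = 0" .
      then show "f \<in> V \<mu>" unfolding cinner_L2_self V_def by simp
    qed (use VA in blast)
    show ?thesis
      using A unfolding L2.subspace_def 1
      by (auto simp: VA clinear_map_zero clinear_map_def cinner_L2_add_right cinner_L2_scale_right ring_distribs mult_ac)
  qed
  have "\<exists>G. orthonormal_L2 G \<and> card G = singular_mult A \<mu> \<and> G \<subseteq> V \<mu>" if "\<mu> \<in> S" for \<mu>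
  proof -
    obtain C where C: "C \<subseteq> V \<mu>" "L2.independent C" "V \<mu> \<subseteq> L2.span C" "card C = L2.dim (V \<mu>)"
      by (rule L2.basis_exists)
    have d: "L2.dim (V \<mu>) = singular_mult A \<mu>" by (simp add: singular_mult_def V_def)
    then have "card C \<noteq> 0" using that C by (simp add: S_def)
    then have "finite C" by (rule card_ge_0_finite[OF neq0_conv[THEN iffD1]])
    from orthonormal_in_kernels[OF this C(2), of "{}" "card C"]
    have "\<exists>G. orthonormal_L2 G \<and> card G = card C \<and> G \<subseteq> L2.span C" by simp
    then obtain G where "orthonormal_L2 G" "card G = card C" "G \<subseteq> L2.span C" by (elim exE conjE)
    moreover have "L2.span C \<subseteq> V \<mu>" using C(1) Vs by (rule L2.span_minimal)
    ultimately show ?thesis using C(4) d by (intro exI[of _ G]) auto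
  qed
  then obtain O\<mu> where O: "\<And>\<mu>. \<mu> \<in> S \<Longrightarrow> orthonormal_L2 (O\<mu> \<mu>)" "\<And>\<mu>. \<mu> \<in> S \<Longrightarrow> card (O\<mu> \<mu>) = singular_mult A \<mu>"
    "\<And>\<mu>. \<mu> \<in> S \<Longrightarrow> O\<mu> \<mu> \<subseteq> V \<mu>"
    unfolding Bex_def by (metis (no_types, lifting))
  have Spos: "\<mu> > s" "\<mu> > 0" if "\<mu> \<in> S" for \<mu> using that s(1) by (auto simp: S_def)
  have orth: "cinner_L2 f g = 0" if "f \<in> V \<mu>" "g \<in> V \<nu>" "\<mu> \<in> S" "\<nu> \<in> S" "\<mu> \<noteq> \<nu>" for f g \<mu> \<nu>
  proof -
    have "complex_of_real (\<nu>\<^sup>2) * cinner_L2 f g = cnj (cinner_L2 (A g) (A f))"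
      using VA[OF that(2), of f] cinner_L2_cnj[of "A f" "A g"] by simp
    also have "\<dots> = complex_of_real (\<mu>\<^sup>2) * cinner_L2 f g"
      using VA[OF that(1), of g] cinner_L2_cnj[of f g] by simp
    finally have eq: "complex_of_real (\<nu>\<^sup>2) * cinner_L2 f g = complex_of_real (\<mu>\<^sup>2) * cinner_L2 f g" .
    have "\<nu>\<^sup>2 \<noteq> \<mu>\<^sup>2" using Spos[OF that(3)] Spos[OF that(4)] that(5) by (simp add: power2_eq_iff_nonneg)
    then have "complex_of_real (\<nu>\<^sup>2) \<noteq> complex_of_real (\<mu>\<^sup>2)" by (simp only: of_real_eq_iff not_False_eq_True)
    then show ?thesis using eq unfolding mult_cancel_right by argo
  qed
  define G where "G = (\<Union>\<mu>\<in>S. O\<mu> \<mu>)"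
  have disj: "O\<mu> \<mu> \<inter> O\<mu> \<nu> = {}" if "\<mu> \<in> S" "\<nu> \<in> S" "\<mu> \<noteq> \<nu>" for \<mu> \<nu>
  proof -
    have False if h: "h \<in> O\<mu> \<mu>" "h \<in> O\<mu> \<nu>" for h
    proof -
      have "cinner_L2 h h = 0"
        using orth[of h \<mu> h \<nu>] h O(3)[OF \<open>\<mu> \<in> S\<close>] O(3)[OF \<open>\<nu> \<in> S\<close>] \<open>\<mu> \<in> S\<close> \<open>\<nu> \<in> S\<close> \<open>\<mu> \<noteq> \<nu>\<close> by blast
      moreover have "cinner_L2 h h = 1" using O(1)[OF \<open>\<mu> \<in> S\<close>] h(1) by (auto simp: orthonormal_L2_def)
      ultimately show False by simp
    qed
    then show ?thesis by blast
  qed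
  have fO: "finite (O\<mu> \<mu>)" if "\<mu> \<in> S" for \<mu> using O(1)[OF that] by (simp add: orthonormal_L2_def)
  have fG: "finite G" unfolding G_def using fS fO by blast
  have "card G = (\<Sum>\<mu>\<in>S. card (O\<mu> \<mu>))" unfolding G_def
    by (rule card_UN_disjoint) (use fS fO disj in auto)
  then have cG: "card G \<ge> k + 1" using O(2) count neg by simp
  have "\<forall>g\<in>G. \<exists>\<mu>. \<mu> \<in> S \<and> g \<in> O\<mu> \<mu>" by (auto simp: G_def)
  then obtain M where M: "\<And>g. g \<in> G \<Longrightarrow> M g \<in> S \<and> g \<in> O\<mu> (M g)" by metis
  have MV: "g \<in> V (M g)" if "g \<in> G" for g using M[OF that] O(3) by blast
  have oG: "cinner_L2 g h = (if g = h then 1 else 0)" if "g \<in> G" "h \<in> G" for g h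
  proof (cases "M g = M h")
    case True
    then show ?thesis using M[OF that(1)] M[OF that(2)] O(1)[of "M h"] by (auto simp: orthonormal_L2_def)
  next
    case False
    then show ?thesis using orth[OF MV[OF that(1)] MV[OF that(2)]] M that by auto
  qed
  have ortho: "orthonormal_L2 G" using oG fG by (simp add: orthonormal_L2_def)
  have oA: "cinner_L2 (A g) (A h) = (if g = h then complex_of_real ((M g)\<^sup>2) else 0)" if "g \<in> G" "h \<in> G" for g h
    using VA[OF MV[OF that(2)], of g] oG[OF that] by auto
  obtain H where H: "orthonormal_L2 H" "card H = k + 1 - card P" "H \<subseteq> L2.span G" "\<forall>g\<in>H. \<forall>\<phi>\<in>P. \<phi> g = 0"
    using orthonormal_in_kernels[OF fG orthonormal_independent[OF ortho] P(1,2), of "k + 1 - card P"] cG P(3) by auto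
  have big: "(norm (A g))\<^sup>2 > s\<^sup>2" if "g \<in> H" for g
  proof -
    have "g \<in> range (\<lambda>c. \<Sum>h\<in>G. scaleC_L2 (c h) h)"
      using subsetD[OF H(3) that] unfolding L2.span_finite[OF fG] .
    then obtain c where c: "g = (\<Sum>h\<in>G. scaleC_L2 (c h) h)" by (elim rangeE)
    have "norm g = 1" using H(1) that cinner_self_one[of g] by (auto simp: orthonormal_L2_def)
    then have c1: "(\<Sum>h\<in>G. (cmod (c h))\<^sup>2) = 1" using norm_sq_orthonormal_sum[OF ortho, of c] c by simp
    have n: "(norm (A g))\<^sup>2 = (\<Sum>h\<in>G. (cmod (c h))\<^sup>2 * (M h)\<^sup>2)"
      unfolding c by (rule norm_sq_orthogonal_images[OF A fG oA])
    have "\<exists>h\<in>G. c h \<noteq> 0"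
    proof (rule ccontr)
      assume "\<not> ?thesis"
      then have "(\<Sum>h\<in>G. (cmod (c h))\<^sup>2) = 0" by (intro sum.neutral) auto
      then show False using c1 by simp
    qed
    then have "(\<Sum>h\<in>G. (cmod (c h))\<^sup>2 * s\<^sup>2) < (\<Sum>h\<in>G. (cmod (c h))\<^sup>2 * (M h)\<^sup>2)"
    proof (intro sum_strict_mono_ex1[OF fG] ballI, goal_cases)
      case (1 h)
      then show ?case using M[of h] Spos[of "M h"] s(1)
        by (intro mult_left_mono power_mono) auto
    next
      case 2
      then obtain h where "h \<in> G" "c h \<noteq> 0" by blast
      then show ?case using M[of h] Spos[of "M h"] s(1)
        by (intro bexI[of _ h] mult_strict_left_mono power_strict_mono) auto
    qed
    then show ?thesis using n c1 by (simp add: sum_distrib_right[symmetric])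
  qed
  have fH: "finite H" "H \<noteq> {}" using H(1,2) P(3) by (auto simp: orthonormal_L2_def)
  have "real (k + 1 - card P) * s\<^sup>2 = (\<Sum>g\<in>H. s\<^sup>2)" using H(2) by simp
  also have "\<dots> < (\<Sum>g\<in>H. (norm (A g))\<^sup>2)" using fH big by (intro sum_strict_mono) auto
  also have "\<dots> \<le> E" using H by (intro E) auto
  finally show False using s(2) by simp
qed

text \<open>This is the only way in which singular values are estimated: for a Hilbert-Schmidt operator \<open>E\<close>
  comes from its kernel, and the functionals are chosen so as to make \<open>E\<close> small.\<close>

lemma singular_value_bounds:
  assumes A: "clinear_map A" and adj: "\<And>f g. cinner_L2 (A f) g = cinner_L2 f (B g)"
    and P: "finite P" "\<And>\<phi>. \<phi> \<in> P \<Longrightarrow> clinear_fun \<phi>" "card P \<le> k"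
    and E: "\<And>G. orthonormal_L2 G \<Longrightarrow> (\<And>g \<phi>. g \<in> G \<Longrightarrow> \<phi> \<in> P \<Longrightarrow> \<phi> g = 0) \<Longrightarrow> (\<Sum>g\<in>G. (norm (A g))\<^sup>2) \<le> E"
  shows "0 \<le> singular_value A k" "singular_value A k \<le> sqrt (E / real (k + 1 - card P))"
proof -
  let ?S = "{s. 0 < s \<and> singular_count A s \<le> k}"
  let ?r = "sqrt (E / real (k + 1 - card P))"
  have E0: "0 \<le> E" using E[of "{}"] by (simp add: orthonormal_L2_def)
  have pos: "real (k + 1 - card P) > 0" using P(3) by simp
  have mem: "s \<in> ?S" if "s > ?r" for s
  proof -
    have r0: "?r \<ge> 0" using E0 by simp
    have "E / real (k + 1 - card P) = ?r\<^sup>2" using E0 by simp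
    also have "\<dots> \<le> s\<^sup>2" using that r0 by (intro power_mono) auto
    finally have "E \<le> real (k + 1 - card P) * s\<^sup>2" using pos by (simp add: field_simps)
    then show ?thesis using singular_count_le[OF A adj P E, of s] that r0 by (simp del: real_sqrt_ge_0_iff)
  qed
  have "?r + 1 \<in> ?S" by (rule mem) (rule less_add_one)
  then have ne: "?S \<noteq> {}" by (rule ex_in_conv[THEN iffD1, OF exI])
  show "0 \<le> singular_value A k" unfolding singular_value_def using ne by (intro cInf_greatest) auto
  show "singular_value A k \<le> ?r" unfolding singular_value_def
  proof (rule dense_ge)
    fix s assume "?r < s"
    then show "Inf ?S \<le> s" by (intro cInf_lower mem) (auto intro!: bdd_belowI[of _ 0])
  qed
qed

section \<open>Hilbert-Schmidt kernels\<close>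

lemma Cauchy_Schwarz_LINT:
  fixes k g :: "'b \<Rightarrow> complex"
  assumes [measurable]: "k \<in> borel_measurable M" "g \<in> borel_measurable M"
  shows "cmod_sq (LINT y|M. k y * g y)
     \<le> (\<integral>\<^sup>+y. cmod_sq (k y) \<partial>M) * (\<integral>\<^sup>+y. cmod_sq (g y) \<partial>M)"
proof (cases "integrable M (\<lambda>y. k y * g y)")
  case True
  have "ennreal (cmod (LINT y|M. k y * g y)) \<le> (\<integral>\<^sup>+y. ennreal (cmod (k y * g y)) \<partial>M)"
    by (rule integral_norm_bound_ennreal[OF True])
  also have "\<dots> = (\<integral>\<^sup>+y. ennreal (cmod (k y)) * ennreal (cmod (g y)) \<partial>M)"
    by (simp add: norm_mult ennreal_mult)
  finally have "(ennreal (cmod (LINT y|M. k y * g y)))\<^sup>2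
      \<le> (\<integral>\<^sup>+y. ennreal (cmod (k y)) * ennreal (cmod (g y)) \<partial>M)\<^sup>2"
    by (rule power_mono) simp
  also have "\<dots> \<le> (\<integral>\<^sup>+y. (ennreal (cmod (k y)))\<^sup>2 \<partial>M) * (\<integral>\<^sup>+y. (ennreal (cmod (g y)))\<^sup>2 \<partial>M)"
    by (rule Cauchy_Schwarz_nn_integral) measurable
  finally show ?thesis by (simp add: ennreal_power)
qed (simp add: not_integrable_integral_eq)

lemma integrable_mult_L2:
  fixes k g :: "'b \<Rightarrow> complex"
  assumes [measurable]: "k \<in> borel_measurable M" "g \<in> borel_measurable M"
    and "(\<integral>\<^sup>+y. cmod_sq (k y) \<partial>M) < \<infinity>" "(\<integral>\<^sup>+y. cmod_sq (g y) \<partial>M) < \<infinity>"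
  shows "integrable M (\<lambda>y. k y * g y)"
proof (rule integrableI_bounded)
  have "(\<integral>\<^sup>+y. ennreal (cmod (k y * g y)) \<partial>M) \<le> (\<integral>\<^sup>+y. cmod_sq (k y) + cmod_sq (g y) \<partial>M)"
  proof (rule nn_integral_mono)
    fix y
    have "cmod (k y * g y) \<le> (cmod (k y))\<^sup>2 + (cmod (g y))\<^sup>2"
      using sum_squares_bound[of "cmod (k y)" "cmod (g y)"] mult_nonneg_nonneg[of "cmod (k y)" "cmod (g y)"]
      by (simp add: norm_mult del: mult_nonneg_nonneg)
    then show "ennreal (cmod (k y * g y)) \<le> cmod_sq (k y) + cmod_sq (g y)"
      by (simp flip: ennreal_plus)
  qed
  also have "\<dots> = (\<integral>\<^sup>+y. cmod_sq (k y) \<partial>M) + (\<integral>\<^sup>+y. cmod_sq (g y) \<partial>M)"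
    by (rule nn_integral_add) measurable
  also have "\<dots> < \<infinity>" using assms by (simp add: less_top[symmetric])
  finally show "(\<integral>\<^sup>+y. ennreal (cmod (k y * g y)) \<partial>M) < \<infinity>" .
qed measurable

definition hs_kernel :: "('a::euclidean_space \<Rightarrow> 'a \<Rightarrow> complex) \<Rightarrow> bool" where
  "hs_kernel k \<longleftrightarrow> jointly_measurable k \<and>
     (hs_norm_sq k) < \<infinity>"

definition kernel_op :: "('a::euclidean_space \<Rightarrow> 'a \<Rightarrow> complex) \<Rightarrow> 'a L2 \<Rightarrow> 'a L2" where
  "kernel_op k f = abs_L2 (\<lambda>x. LINT y|lebesgue. k x y * rep_L2 f y)"

lemma LINT_rep_L2:
  assumes [measurable]: "k \<in> borel_measurable borel" and g: "bsq g"
    and ae: "AE x in lebesgue. rep_L2 f x = g x"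
  shows "(LINT y|lebesgue. k y * rep_L2 f y) = (LINT y|lborel. k y * g y)"
proof -
  have [measurable]: "g \<in> borel_measurable borel" using g by (simp add: bsq_def)
  have m: "(\<lambda>y. k y * g y) \<in> borel_measurable lborel" by measurable
  have "(LINT y|lebesgue. k y * rep_L2 f y) = (LINT y|lebesgue. k y * g y)"
  proof (rule integral_cong_AE)
    have "k \<in> borel_measurable lebesgue" by (rule measurable_completion) simp
    moreover have "rep_L2 f \<in> borel_measurable lebesgue"
      using square_integrable_rep_L2[of f] by (simp add: square_integrable_def)
    ultimately show "(\<lambda>y. k y * rep_L2 f y) \<in> borel_measurable lebesgue" by measurable
    show "(\<lambda>y. k y * g y) \<in> borel_measurable lebesgue" using m by (rule measurable_completion)
    show "AE y in lebesgue. k y * rep_L2 f y = k y * g y" using ae by eventually_elim simp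
  qed
  also have "\<dots> = (LINT y|lborel. k y * g y)" using m by (rule integral_completion)
  finally show ?thesis .
qed

lemma kernel_section_measurable:
  assumes "jointly_measurable k"
  shows "k x \<in> borel_measurable borel"
  using measurable_compose[OF measurable_Pair1'[of x borel borel] assms] by simp

lemma kernel_op_rep:
  assumes k: "jointly_measurable k"
    and g: "bsq g" "AE x in lebesgue. rep_L2 f x = g x"
  shows "kernel_op k f = abs_L2 (\<lambda>x. LINT y|lborel. k x y * g y)"
  unfolding kernel_op_def using LINT_rep_L2[OF kernel_section_measurable[OF k] g] by simp

lemma borel_measurable_kernel_int:
  fixes k :: "'a::euclidean_space \<Rightarrow> 'b::euclidean_space \<Rightarrow> complex"
  assumes k[measurable]: "jointly_measurable k"
    and g[measurable]: "g \<in> borel_measurable borel"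
  shows "(\<lambda>x. LINT y|lborel. k x y * g y) \<in> borel_measurable borel"
proof -
  have "(\<lambda>(x,y). k x y * g y) \<in> borel_measurable (borel \<Otimes>\<^sub>M lborel)"
    unfolding split_beta by measurable
  from lborel.borel_measurable_lebesgue_integral[OF this] show ?thesis by simp
qed

lemma kernel_int_L2:
  assumes k: "hs_kernel k" and g: "bsq g"
  shows "(\<integral>\<^sup>+x. cmod_sq (LINT y|lborel. k x y * g y) \<partial>lborel)
      \<le> hs_norm_sq k * sq_norm g"
    and "bsq (\<lambda>x. LINT y|lborel. k x y * g y)"
proof -
  have km[measurable]: "jointly_measurable k"
    using k by (simp add: hs_kernel_def)
  have [measurable]: "k x \<in> borel_measurable borel" for x by (rule kernel_section_measurable[OF km])
  have [measurable]: "g \<in> borel_measurable borel" using g by (simp add: bsq_def)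
  have "(\<integral>\<^sup>+x. cmod_sq (LINT y|lborel. k x y * g y) \<partial>lborel)
      \<le> (\<integral>\<^sup>+x. (sq_norm (k x)) * sq_norm g \<partial>lborel)"
    by (intro nn_integral_mono Cauchy_Schwarz_LINT) measurable
  also have "\<dots> = hs_norm_sq k * sq_norm g"
    by (rule nn_integral_multc) measurable
  finally show *: "(\<integral>\<^sup>+x. cmod_sq (LINT y|lborel. k x y * g y) \<partial>lborel)
      \<le> hs_norm_sq k * sq_norm g" .
  also have "\<dots> < \<infinity>" using k g by (simp add: hs_kernel_def bsq_def ennreal_mult_less_top)
  finally show "bsq (\<lambda>x. LINT y|lborel. k x y * g y)"
    unfolding bsq_def using borel_measurable_kernel_int[OF km, of g] by simp
qed

lemma kernel_op_abs:
  assumes k: "hs_kernel k" and g: "bsq g"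
  shows "kernel_op k (abs_L2 g) = abs_L2 (\<lambda>x. LINT y|lborel. k x y * g y)"
  using k by (intro kernel_op_rep g rep_abs_L2 bsq_square_integrable) (simp add: hs_kernel_def)

lemma hs_kernel_AE_section:
  assumes k: "hs_kernel k"
  shows "AE x in lborel. (sq_norm (k x)) < \<infinity>"
proof -
  have km[measurable]: "jointly_measurable k"
    using k by (simp add: hs_kernel_def)
  have "AE x in lborel. (sq_norm (k x)) \<noteq> \<infinity>"
    by (rule nn_integral_PInf_AE) (use k in \<open>simp_all add: hs_kernel_def less_top[symmetric]\<close>)
  then show ?thesis by (simp add: less_top infinity_ennreal_def)
qed

lemma clinear_map_kernel_op:
  assumes k: "hs_kernel k"
  shows "clinear_map (kernel_op k)"
  unfolding clinear_map_def
proof (intro conjI allI)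
  have km: "jointly_measurable k"
    using k by (simp add: hs_kernel_def)
  have ks: "k x \<in> borel_measurable lborel" for x using kernel_section_measurable[OF km] by simp
  fix f f' :: "'a L2"
  obtain g where g: "bsq g" "f = abs_L2 g" by (rule L2_borel_rep[of f])
  obtain g' where g': "bsq g'" "f' = abs_L2 g'" by (rule L2_borel_rep[of f'])
  have gm: "g \<in> borel_measurable lborel" "g' \<in> borel_measurable lborel" using g g' by (auto simp: bsq_def)
  let ?T = "\<lambda>g x. LINT y|lborel. k x y * g y"
  have sq: "square_integrable (?T g)" "square_integrable (?T g')" "square_integrable (?T (\<lambda>x. g x + g' x))"
    by (intro bsq_square_integrable kernel_int_L2(2)[OF k] bsq_add g g')+
  have "AE x in lborel. ?T (\<lambda>x. g x + g' x) x = ?T g x + ?T g' x"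
    using hs_kernel_AE_section[OF k]
  proof eventually_elim
    fix x assume fin: "sq_norm (k x) < \<infinity>"
    have "integrable lborel (\<lambda>y. k x y * g y)" "integrable lborel (\<lambda>y. k x y * g' y)"
      using fin g g' by (intro integrable_mult_L2 ks gm; simp add: bsq_def)+
    then show "?T (\<lambda>x. g x + g' x) x = ?T g x + ?T g' x"
      by (simp add: distrib_left)
  qed
  then have "abs_L2 (?T (\<lambda>x. g x + g' x)) = abs_L2 (\<lambda>x. ?T g x + ?T g' x)"
    using abs_L2_eq_iff[OF sq(3) square_integrable_add[OF sq(1,2)]] AE_completion by blast
  moreover have "f + f' = abs_L2 (\<lambda>x. g x + g' x)"
    using abs_L2_plus[OF bsq_square_integrable[OF g(1)] bsq_square_integrable[OF g'(1)]] g(2) g'(2) by simp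
  ultimately show "kernel_op k (f + f') = kernel_op k f + kernel_op k f'"
    using kernel_op_abs[OF k bsq_add[OF g(1) g'(1)]] kernel_op_abs[OF k g(1)] kernel_op_abs[OF k g'(1)]
      abs_L2_plus[OF sq(1,2)] g(2) g'(2) by simp
next
  fix c :: complex and f :: "'a L2"
  obtain g where g: "bsq g" "f = abs_L2 g" by (rule L2_borel_rep[of f])
  have cg: "bsq (\<lambda>x. c * g x)" using g(1) by (intro bsq_bound[OF _ g(1), of _ "cmod c"]) (auto simp: bsq_def norm_mult)
  have "scaleC_L2 c f = abs_L2 (\<lambda>x. c * g x)"
    using abs_L2_scale[OF bsq_square_integrable[OF g(1)]] g(2) by simp
  then show "kernel_op k (scaleC_L2 c f) = scaleC_L2 c (kernel_op k f)"
    using kernel_op_abs[OF k cg] kernel_op_abs[OF k g(1)]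
      abs_L2_scale[OF bsq_square_integrable[OF kernel_int_L2(2)[OF k g(1)]], of c] g(2)
    by (simp add: mult.left_commute)
qed

lemma norm_kernel_op:
  assumes k: "hs_kernel k"
  shows "ennreal ((norm (kernel_op k f))\<^sup>2)
    \<le> hs_norm_sq k * ennreal ((norm f)\<^sup>2)"
proof -
  obtain g where g: "bsq g" "f = abs_L2 g" by (rule L2_borel_rep[of f])
  show ?thesis
    using kernel_int_L2(1)[OF k g(1)]
    unfolding g(2) kernel_op_abs[OF k g(1)] norm_abs_L2_sq[OF g(1)] norm_abs_L2_sq[OF kernel_int_L2(2)[OF k g(1)]] .
qed

lemma bounded_clinear_L2I:
  assumes A: "clinear_map A" and B: "\<And>f. norm (A f) \<le> K * norm f"
  shows "bounded_clinear_L2 A"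
  unfolding bounded_clinear_L2_def
proof
  show "bounded_linear A"
    by (rule bounded_linear_intro[where K = K])
      (use A B in \<open>simp_all add: clinear_map_def scaleR_scaleC mult.commute\<close>)
  show "\<forall>c f. A (scaleC_L2 c f) = scaleC_L2 c (A f)" using A by (simp add: clinear_map_def)
qed

lemma norm_kernel_op_le:
  assumes k: "hs_kernel k"
  shows "norm (kernel_op k f) \<le> sqrt (enn2real (hs_norm_sq k)) * norm f"
proof -
  let ?H = "hs_norm_sq k"
  have H: "?H = ennreal (enn2real ?H)" using k by (simp add: hs_kernel_def less_top)
  have "ennreal ((norm (kernel_op k f))\<^sup>2) \<le> ennreal (enn2real ?H) * ennreal ((norm f)\<^sup>2)"
    using norm_kernel_op[OF k, of f] H by simp
  then have "(norm (kernel_op k f))\<^sup>2 \<le> enn2real ?H * (norm f)\<^sup>2"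
    by (simp add: ennreal_mult[symmetric] ennreal_le_iff)
  then have "sqrt ((norm (kernel_op k f))\<^sup>2) \<le> sqrt (enn2real ?H * (norm f)\<^sup>2)" by (rule real_sqrt_le_mono)
  then show ?thesis by (simp add: real_sqrt_mult)
qed

lemma bounded_clinear_kernel_op: "hs_kernel k \<Longrightarrow> bounded_clinear_L2 (kernel_op k)"
  by (rule bounded_clinear_L2I[OF clinear_map_kernel_op norm_kernel_op_le])

lemma hs_kernel_adjoint:
  fixes k :: "'a::euclidean_space \<Rightarrow> 'a \<Rightarrow> complex"
  assumes k: "hs_kernel k"
  shows "hs_kernel (\<lambda>x y. cnj (k y x))"
proof -
  have km[measurable]: "jointly_measurable k"
    using k by (simp add: hs_kernel_def)
  have sw[measurable]: "(\<lambda>p. k (snd p) (fst p)) \<in> borel_measurable (borel \<Otimes>\<^sub>M borel)"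
    using measurable_compose[OF measurable_Pair[OF measurable_snd measurable_fst] km] by simp
  have "(\<integral>\<^sup>+x. \<integral>\<^sup>+y. cmod_sq (cnj (k y x)) \<partial>lborel \<partial>lborel)
      = hs_norm_sq k"
    using lborel_pair.Fubini'[of "\<lambda>x y. cmod_sq (k y x)"] by (simp add: split_beta)
  moreover have "(\<lambda>p. cnj (k (snd p) (fst p))) \<in> borel_measurable (borel \<Otimes>\<^sub>M borel)"
    by (rule borel_measurable_continuous_on[OF _ sw]) (intro continuous_intros)
  ultimately show ?thesis using k by (simp add: hs_kernel_def)
qed

lemma cinner_abs_L2:
  assumes "bsq f" "bsq g"
  shows "cinner_L2 (abs_L2 f) (abs_L2 g) = (LINT x|lborel. f x * cnj (g x))"
proof -
  have [measurable]: "f \<in> borel_measurable borel" "g \<in> borel_measurable borel"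
    using assms by (auto simp: bsq_def)
  have [measurable]: "(\<lambda>x. cnj (g x)) \<in> borel_measurable borel"
    by (rule borel_measurable_continuous_on[where g = g and f = cnj])
       (auto intro!: continuous_intros)
  have "cinner_L2 (abs_L2 f) (abs_L2 g) = (LINT x|lebesgue. f x * cnj (g x))"
    using cinner_L2.abs_eq[of f g] bsq_square_integrable[OF assms(1)] bsq_square_integrable[OF assms(2)] by simp
  then show ?thesis by (simp add: integral_completion)
qed

lemma bsq_norm_cong:
  assumes "bsq f" "g \<in> borel_measurable borel" "\<And>x. cmod (g x) = cmod (f x)"
  shows "bsq g"
  using assms by (intro bsq_bound[OF assms(2,1), of 1]) simp

text \<open>The adjoint in the definition of the singular values is given by a choice operator, which has its
  meaning once some adjoint is known to exist.\<close>

lemma kernel_op_adjoint: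
  fixes k :: "'a::euclidean_space \<Rightarrow> 'a \<Rightarrow> complex"
  assumes k: "hs_kernel k"
  shows "cinner_L2 (kernel_op k f) g = cinner_L2 f (kernel_op (\<lambda>x y. cnj (k y x)) g)"
proof -
  obtain u where u: "bsq u" "f = abs_L2 u" by (rule L2_borel_rep[of f])
  obtain v where v: "bsq v" "g = abs_L2 v" by (rule L2_borel_rep[of g])
  have [measurable]: "u \<in> borel_measurable borel" "v \<in> borel_measurable borel" using u v by (auto simp: bsq_def)
  have vm[measurable]: "(\<lambda>x. cnj (v x)) \<in> borel_measurable borel"
    by (rule borel_measurable_continuous_on[where g = v and f = cnj]) (auto intro!: continuous_intros)
  have cv: "bsq (\<lambda>x. cnj (v x))" by (rule bsq_norm_cong[OF v(1) vm]) simp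
  have km[measurable]: "jointly_measurable k"
    using k by (simp add: hs_kernel_def)
  have ks[measurable]: "k x \<in> borel_measurable borel" for x by (rule kernel_section_measurable[OF km])
  let ?k = "\<lambda>x y. cnj (k y x)"
  have k': "hs_kernel ?k" by (rule hs_kernel_adjoint[OF k])
  have int: "integrable (lborel \<Otimes>\<^sub>M lborel) (\<lambda>(x,y). k x y * u y * cnj (v x))"
  proof (rule integrableI_bounded)
    have km2: "(\<lambda>p. complex_of_real (cmod (k (fst p) (snd p)))) \<in> borel_measurable (borel \<Otimes>\<^sub>M borel)" by measurable
    have hsa: "hs_kernel (\<lambda>x y. complex_of_real (cmod (k x y)))"
      using k km2 by (simp add: hs_kernel_def)
    have bu: "bsq (\<lambda>y. complex_of_real (cmod (u y)))" by (rule bsq_norm_cong[OF u(1)]) auto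
    let ?I = "\<lambda>x. LINT y|lborel. complex_of_real (cmod (k x y)) * complex_of_real (cmod (u y))"
    have bI: "bsq ?I" by (rule kernel_int_L2(2)[OF hsa bu])
    have "(\<integral>\<^sup>+p. ennreal (cmod (case p of (x,y) \<Rightarrow> k x y * u y * cnj (v x))) \<partial>(lborel \<Otimes>\<^sub>M lborel))
       = (\<integral>\<^sup>+x. \<integral>\<^sup>+y. ennreal (cmod (k x y * u y * cnj (v x))) \<partial>lborel \<partial>lborel)"
      by (subst lborel.nn_integral_fst[symmetric]) (simp_all add: split_beta)
    also have "\<dots> = (\<integral>\<^sup>+x. ennreal (cmod (?I x * v x)) \<partial>lborel)"
    proof (rule nn_integral_cong_AE)
      show "AE x in lborel. (\<integral>\<^sup>+y. ennreal (cmod (k x y * u y * cnj (v x))) \<partial>lborel) = ennreal (cmod (?I x * v x))"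
        using hs_kernel_AE_section[OF k]
      proof eventually_elim
        fix x assume fin: "sq_norm (k x) < \<infinity>"
        have "integrable lborel (\<lambda>y. k x y * u y)"
          by (rule integrable_mult_L2) (use fin u in \<open>simp_all add: bsq_def\<close>)
        then have i: "integrable lborel (\<lambda>y. cmod (k x y) * cmod (u y))"
          using integrable_norm by (force simp: norm_mult)
        have I: "?I x = complex_of_real (LINT y|lborel. cmod (k x y) * cmod (u y))"
          by (simp flip: of_real_mult)
        have "(\<integral>\<^sup>+y. ennreal (cmod (k x y * u y * cnj (v x))) \<partial>lborel)
            = (\<integral>\<^sup>+y. ennreal (cmod (k x y) * cmod (u y)) * ennreal (cmod (v x)) \<partial>lborel)"
          by (simp add: norm_mult ennreal_mult)
        also have "\<dots> = (\<integral>\<^sup>+y. ennreal (cmod (k x y) * cmod (u y)) \<partial>lborel) * ennreal (cmod (v x))"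
          by (rule nn_integral_multc) measurable
        also have "(\<integral>\<^sup>+y. ennreal (cmod (k x y) * cmod (u y)) \<partial>lborel) = ennreal (LINT y|lborel. cmod (k x y) * cmod (u y))"
          by (rule nn_integral_eq_integral[OF i]) simp
        finally show "(\<integral>\<^sup>+y. ennreal (cmod (k x y * u y * cnj (v x))) \<partial>lborel) = ennreal (cmod (?I x * v x))"
          unfolding I by (simp add: norm_mult ennreal_mult abs_of_nonneg integral_nonneg_AE)
      qed
    qed
    also have "\<dots> < \<infinity>"
    proof -
      have "integrable lborel (\<lambda>x. ?I x * v x)"
        by (rule integrable_mult_L2) (use bI v(1) in \<open>simp_all add: bsq_def\<close>)
      then show ?thesis by (simp add: integrable_iff_bounded)
    qed
    finally show "(\<integral>\<^sup>+p. ennreal (cmod (case p of (x,y) \<Rightarrow> k x y * u y * cnj (v x))) \<partial>(lborel \<Otimes>\<^sub>M lborel)) < \<infinity>" .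
  qed (unfold split_beta, measurable)
  have "cinner_L2 (kernel_op k f) g = (LINT x|lborel. (LINT y|lborel. k x y * u y) * cnj (v x))"
    unfolding u(2) v(2) kernel_op_abs[OF k u(1)] by (rule cinner_abs_L2[OF kernel_int_L2(2)[OF k u(1)] v(1)])
  also have "\<dots> = (LINT x|lborel. LINT y|lborel. k x y * u y * cnj (v x))" by simp
  also have "\<dots> = (LINT y|lborel. LINT x|lborel. k x y * u y * cnj (v x))"
    by (rule lborel_pair.Fubini_integral[OF int, symmetric])
  also have "\<dots> = (LINT y|lborel. u y * cnj (LINT x|lborel. ?k y x * v x))"
  proof (rule Bochner_Integration.integral_cong[OF refl])
    fix y
    have "cnj (LINT x|lborel. ?k y x * v x) = (LINT x|lborel. cnj (?k y x * v x))"
      by (rule integral_bounded_linear'[OF bounded_linear_cnj bounded_linear_cnj, symmetric])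
        (auto intro!: exI[of _ 1])
    also have "u y * \<dots> = (LINT x|lborel. u y * cnj (?k y x * v x))" by simp
    finally show "(LINT x|lborel. k x y * u y * cnj (v x)) = u y * cnj (LINT x|lborel. ?k y x * v x)"
      by (subst (asm) eq_commute) (simp only: complex_cnj_mult complex_cnj_cnj mult_ac)
  qed
  also have "\<dots> = cinner_L2 f (kernel_op ?k g)"
    unfolding u(2) v(2) kernel_op_abs[OF k' v(1)] by (rule cinner_abs_L2[OF u(1) kernel_int_L2(2)[OF k' v(1)], symmetric])
  finally show ?thesis .
qed

lemma Bessel_L2:
  assumes "orthonormal_L2 G"
  shows "(\<Sum>g\<in>G. (cmod (cinner_L2 f g))\<^sup>2) + (norm (f - (\<Sum>g\<in>G. scaleC_L2 (cinner_L2 f g) g)))\<^sup>2 = (norm f)\<^sup>2"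
proof -
  let ?p = "\<Sum>g\<in>G. scaleC_L2 (cinner_L2 f g) g"
  have pp: "cinner_L2 ?p ?p = complex_of_real (\<Sum>g\<in>G. (cmod (cinner_L2 f g))\<^sup>2)"
    unfolding cinner_L2_self norm_sq_orthonormal_sum[OF assms] ..
  have fp: "cinner_L2 f ?p = complex_of_real (\<Sum>g\<in>G. (cmod (cinner_L2 f g))\<^sup>2)"
    unfolding cinner_L2_sum_right cinner_L2_scale_right of_real_sum
    by (intro sum.cong refl) (simp only: complex_norm_square mult.commute)
  have pf: "cinner_L2 ?p f = complex_of_real (\<Sum>g\<in>G. (cmod (cinner_L2 f g))\<^sup>2)"
    unfolding cinner_L2_cnj[of ?p f] fp by (rule complex_cnj_complex_of_real)
  have "complex_of_real ((norm (f - ?p))\<^sup>2) = complex_of_real ((norm f)\<^sup>2 - (\<Sum>g\<in>G. (cmod (cinner_L2 f g))\<^sup>2))"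
    unfolding cinner_L2_self[symmetric] cinner_L2_diff_left cinner_L2_diff_right pp fp pf of_real_diff by simp
  then show ?thesis unfolding of_real_eq_iff by simp
qed

lemma Bessel_LINT:
  assumes G: "orthonormal_L2 G" and k: "k \<in> borel_measurable borel"
  shows "(\<Sum>g\<in>G. cmod_sq (LINT y|lebesgue. k y * rep_L2 g y)) \<le> sq_norm k"
proof (cases "sq_norm k < \<infinity>")
  case True
  have km: "(\<lambda>y. cnj (k y)) \<in> borel_measurable borel"
    by (rule borel_measurable_continuous_on[OF _ k]) (intro continuous_intros)
  have bk: "bsq (\<lambda>y. cnj (k y))" using True km by (simp add: bsq_def)
  let ?f = "abs_L2 (\<lambda>y. cnj (k y))"
  have e: "cmod (LINT y|lebesgue. k y * rep_L2 g y) = cmod (cinner_L2 ?f g)" for g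
  proof -
    obtain u where u: "bsq u" "g = abs_L2 u" "AE x in lebesgue. rep_L2 g x = u x" by (rule L2_borel_rep[of g])
    have "(LINT y|lebesgue. k y * rep_L2 g y) = (LINT y|lborel. k y * u y)" by (rule LINT_rep_L2[OF k u(1,3)])
    also have "\<dots> = cinner_L2 g ?f" unfolding u(2) cinner_abs_L2[OF u(1) bk] by (simp add: mult.commute)
    also have "\<dots> = cnj (cinner_L2 ?f g)" by (rule cinner_L2_cnj)
    finally show ?thesis by simp
  qed
  have "(\<Sum>g\<in>G. (cmod (cinner_L2 ?f g))\<^sup>2) \<le> (norm ?f)\<^sup>2"
    unfolding Bessel_L2[OF G, of ?f, symmetric] by simp
  then have "ennreal (\<Sum>g\<in>G. (cmod (cinner_L2 ?f g))\<^sup>2) \<le> ennreal ((norm ?f)\<^sup>2)" by (rule ennreal_leI)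
  then show ?thesis unfolding norm_abs_L2_sq[OF bk] e by (simp add: sum_ennreal)
qed (simp add: less_top[symmetric])

text \<open>The Bessel inequality in \<open>y\<close> for each \<open>x\<close>, integrated over \<open>x\<close>.\<close>

lemma hs_orthonormal_sum:
  assumes k: "hs_kernel k" and G: "orthonormal_L2 G"
  shows "(\<Sum>g\<in>G. (norm (kernel_op k g))\<^sup>2) \<le> enn2real (hs_norm_sq k)"
proof -
  let ?H = "hs_norm_sq k"
  have H: "?H = ennreal (enn2real ?H)" using k by (simp add: hs_kernel_def less_top)
  have km: "jointly_measurable k"
    using k by (simp add: hs_kernel_def)
  have n: "ennreal ((norm (kernel_op k g))\<^sup>2) = (\<integral>\<^sup>+x. cmod_sq (LINT y|lebesgue. k x y * rep_L2 g y) \<partial>lborel)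
      \<and> (\<lambda>x. LINT y|lebesgue. k x y * rep_L2 g y) \<in> borel_measurable borel" for g
  proof -
    obtain u where u: "bsq u" "g = abs_L2 u" "AE x in lebesgue. rep_L2 g x = u x" by (rule L2_borel_rep[of g])
    have e: "(LINT y|lebesgue. k x y * rep_L2 g y) = (LINT y|lborel. k x y * u y)" for x
      using LINT_rep_L2[OF kernel_section_measurable[OF km] u(1,3)] by simp
    have "bsq (\<lambda>x. LINT y|lborel. k x y * u y)" by (rule kernel_int_L2(2)[OF k u(1)])
    then show ?thesis unfolding e kernel_op_def by (simp add: norm_abs_L2_sq bsq_def)
  qed
  have [measurable]: "(\<lambda>x. LINT y|lebesgue. k x y * rep_L2 g y) \<in> borel_measurable borel" for g using n by blast
  have "ennreal (\<Sum>g\<in>G. (norm (kernel_op k g))\<^sup>2) = (\<Sum>g\<in>G. ennreal ((norm (kernel_op k g))\<^sup>2))"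
    by (simp add: sum_ennreal)
  also have "\<dots> = (\<Sum>g\<in>G. \<integral>\<^sup>+x. cmod_sq (LINT y|lebesgue. k x y * rep_L2 g y) \<partial>lborel)"
    using n by simp
  also have "\<dots> = (\<integral>\<^sup>+x. (\<Sum>g\<in>G. cmod_sq (LINT y|lebesgue. k x y * rep_L2 g y)) \<partial>lborel)"
    by (rule nn_integral_sum[symmetric]) measurable
  also have "\<dots> \<le> ?H"
    by (intro nn_integral_mono Bessel_LINT[OF G] kernel_section_measurable[OF km])
  finally have "ennreal (\<Sum>g\<in>G. (norm (kernel_op k g))\<^sup>2) \<le> ennreal (enn2real ?H)" using H by simp
  then show ?thesis by (simp add: ennreal_le_iff)
qed

lemma compact_coefficient_combinations:
  fixes v :: "'i \<Rightarrow> 'a::euclidean_space L2"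
  assumes "finite G"
  shows "compact {\<Sum>g\<in>G. scaleC_L2 (c g) (v g) | c. \<forall>g\<in>G. cmod (c g) \<le> 1}"
  using assms
proof (induction G rule: finite_induct)
  case empty
  then show ?case by simp
next
  case (insert h G)
  let ?K = "{\<Sum>g\<in>G. scaleC_L2 (c g) (v g) | c. \<forall>g\<in>G. cmod (c g) \<le> 1}"
  have cont: "continuous_on (cball 0 1) (\<lambda>c. scaleC_L2 c (v h))"
  proof -
    have "dist (scaleC_L2 c (v h)) (scaleC_L2 d (v h)) \<le> (norm (v h)) * dist c d" for c d
      by (simp only: dist_norm L2.scale_left_diff_distrib[symmetric] norm_scaleC mult.commute)
    then have "(norm (v h))-lipschitz_on (cball 0 1) (\<lambda>c. scaleC_L2 c (v h))"
      by (intro lipschitz_onI) auto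
    then show ?thesis by (rule lipschitz_on_continuous_on)
  qed
  have "{\<Sum>g\<in>insert h G. scaleC_L2 (c g) (v g) | c. \<forall>g\<in>insert h G. cmod (c g) \<le> 1}
      = {x + y | x y. x \<in> (\<lambda>c. scaleC_L2 c (v h)) ` cball 0 1 \<and> y \<in> ?K}" (is "?L = ?R")
  proof (intro equalityI subsetI)
    fix z assume "z \<in> ?L"
    then obtain c where c: "\<forall>g\<in>insert h G. cmod (c g) \<le> 1" "z = (\<Sum>g\<in>insert h G. scaleC_L2 (c g) (v g))" by auto
    then have "z = scaleC_L2 (c h) (v h) + (\<Sum>g\<in>G. scaleC_L2 (c g) (v g))" using insert.hyps by simp
    moreover have "scaleC_L2 (c h) (v h) \<in> (\<lambda>c. scaleC_L2 c (v h)) ` cball 0 1" using c(1) by (intro imageI) simp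
    moreover have "(\<Sum>g\<in>G. scaleC_L2 (c g) (v g)) \<in> ?K" using c(1) by auto
    ultimately show "z \<in> ?R" by blast
  next
    fix z assume "z \<in> ?R"
    then obtain x y c where xy: "x \<in> (\<lambda>c. scaleC_L2 c (v h)) ` cball 0 1" "z = x + y"
      and c': "y = (\<Sum>g\<in>G. scaleC_L2 (c g) (v g))" "\<forall>g\<in>G. cmod (c g) \<le> 1"
      by (elim CollectE exE conjE) blast
    obtain d where d: "x = scaleC_L2 d (v h)" "d \<in> cball 0 1" using xy(1) by (elim imageE)
    have c: "\<forall>g\<in>G. cmod (c g) \<le> 1" "z = scaleC_L2 d (v h) + (\<Sum>g\<in>G. scaleC_L2 (c g) (v g))" "cmod d \<le> 1"
      using xy(2) d c' by (simp_all add: dist_norm)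
    have "(\<Sum>g\<in>G. scaleC_L2 ((c(h := d)) g) (v g)) = (\<Sum>g\<in>G. scaleC_L2 (c g) (v g))"
      by (intro sum.cong refl) (use insert.hyps in auto)
    then have "z = (\<Sum>g\<in>insert h G. scaleC_L2 ((c(h := d)) g) (v g))"
      using c insert.hyps by simp
    moreover have "\<forall>g\<in>insert h G. cmod ((c(h := d)) g) \<le> 1" using c by simp
    ultimately show "z \<in> ?L" by blast
  qed
  then show ?case
    by (simp only: compact_sums[OF compact_continuous_image[OF cont compact_cball] insert.IH])
qed

text \<open>Choosing an orthonormal family that nearly exhausts the Hilbert-Schmidt norm leaves an
  operator that is small on the orthogonal complement; so the image of the unit ball lies near a
  compact set of finite dimension.\<close>

lemma compact_of_orthonormal_sums:
  assumes A: "clinear_map A" and bA: "bounded_clinear_L2 A"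
    and H: "\<And>G. orthonormal_L2 G \<Longrightarrow> (\<Sum>g\<in>G. (norm (A g))\<^sup>2) \<le> H"
  shows "compact_operator_L2 A"
proof -
  define N where "N G = (\<Sum>g\<in>G. (norm (A g))\<^sup>2)" for G
  define S where "S = N ` Collect orthonormal_L2"
  have ne: "S \<noteq> {}" by (auto simp: S_def orthonormal_L2_def intro!: exI[of _ "{}"])
  have bdd: "bdd_above S" using H by (auto simp: S_def N_def intro!: bdd_aboveI[of _ H])
  have near: "\<exists>k. finite k \<and> A ` cball 0 1 \<subseteq> (\<Union>x\<in>k. cball x (2 * e))" if e: "e > 0" for e
  proof -
    have "Sup S - e\<^sup>2 < Sup S" using e by simp
    then obtain y where "y \<in> S" "Sup S - e\<^sup>2 < y" using less_cSup_iff[OF ne bdd] by auto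
    then obtain G where G: "orthonormal_L2 G" "Sup S - e\<^sup>2 < N G" by (auto simp: S_def)
    have fG: "finite G" using G(1) by (simp add: orthonormal_L2_def)
    \<comment> \<open>Adding a normalised \<open>r\<close> to \<open>G\<close> cannot raise the sum above its supremum.\<close>
    have small: "norm (A r) \<le> e * norm r" if r: "\<And>g. g \<in> G \<Longrightarrow> cinner_L2 r g = 0" for r
    proof (cases "r = 0")
      case True
      then show ?thesis using clinear_map_zero[OF A] by simp
    next
      case False
      define h where "h = scaleC_L2 (complex_of_real (1 / norm r)) r"
      have nh: "norm h = 1" using False by (simp add: h_def norm_scaleC norm_divide)
      have og: "cinner_L2 h g = 0" "cinner_L2 g h = 0" if "g \<in> G" for g
      proof -
        show "cinner_L2 h g = 0" using r[OF that] by (simp add: h_def cinner_L2_scale_left)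
        then show "cinner_L2 g h = 0" by (simp add: cinner_L2_cnj[of g h])
      qed
      have hG: "h \<notin> G" using og(1)[of h] nh cinner_self_one[of h] by auto
      have "orthonormal_L2 (insert h G)"
        using G(1) og nh hG by (auto simp: orthonormal_L2_def cinner_self_one)
      then have "N (insert h G) \<le> Sup S" by (intro cSup_upper bdd) (auto simp: S_def)
      then have "(norm (A h))\<^sup>2 \<le> e\<^sup>2" using G(2) hG fG by (simp add: N_def)
      then have "norm (A h) \<le> e" by (rule power2_le_imp_le) (use e in simp)
      moreover have "norm (A h) = norm (A r) / norm r"
        using A by (simp add: h_def clinear_map_def norm_scaleC norm_divide)
      ultimately show ?thesis using False by (simp add: field_simps)
    qed
    let ?K = "{\<Sum>g\<in>G. scaleC_L2 (c g) (A g) | c. \<forall>g\<in>G. cmod (c g) \<le> 1}"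
    have "compact ?K" by (rule compact_coefficient_combinations[OF fG])
    then obtain k where k: "finite k" "?K \<subseteq> (\<Union>x\<in>k. ball x e)"
      using e unfolding compact_eq_totally_bounded by blast
    have "A f \<in> (\<Union>x\<in>k. cball x (2 * e))" if f: "norm f \<le> 1" for f
    proof -
      let ?p = "\<Sum>g\<in>G. scaleC_L2 (cinner_L2 f g) g"
      have B: "(\<Sum>g\<in>G. (cmod (cinner_L2 f g))\<^sup>2) + (norm (f - ?p))\<^sup>2 = (norm f)\<^sup>2"
        by (rule Bessel_L2[OF G(1)])
      have f1: "(norm f)\<^sup>2 \<le> 1" using f by (simp add: abs_square_le_1)
      have "cmod (cinner_L2 f g) \<le> 1" if "g \<in> G" for g
      proof -
        have "(cmod (cinner_L2 f g))\<^sup>2 \<le> (\<Sum>g\<in>G. (cmod (cinner_L2 f g))\<^sup>2)"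
          by (rule member_le_sum[OF that]) (auto simp: fG)
        also have "\<dots> \<le> 1" using B f1 zero_le_power2[of "norm (f - ?p)"] by linarith
        finally show ?thesis by (simp add: abs_square_le_1)
      qed
      then have "A ?p \<in> ?K" unfolding clinear_map_sum[OF A] by (intro CollectI exI[of _ "\<lambda>g. cinner_L2 f g"]) simp
      then obtain x where x: "x \<in> k" "dist x (A ?p) < e" using k(2) by (auto simp: subset_iff)
      have "norm (A (f - ?p)) \<le> e * norm (f - ?p)"
        by (rule small) (simp add: cinner_L2_diff_left orthonormal_sum_cinner[OF G(1)])
      also have "norm (f - ?p) \<le> 1"
      proof -
        have "(norm (f - ?p))\<^sup>2 \<le> 1" using B f1 sum_nonneg[of G "\<lambda>g. (cmod (cinner_L2 f g))\<^sup>2"] by simp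
        then show ?thesis by (simp add: abs_square_le_1)
      qed
      then have "e * norm (f - ?p) \<le> e" using e by simp
      finally have "dist (A ?p) (A f) \<le> e"
        by (simp add: clinear_map_diff[OF A] dist_norm norm_minus_commute)
      then have "dist x (A f) \<le> 2 * e" using x(2) dist_triangle[of x "A f" "A ?p"] by linarith
      then show ?thesis using x(1) by (intro UN_I[of x]) auto
    qed
    then show ?thesis using k(1) by (intro exI[of _ k]) auto
  qed
  have "compact (closure (A ` cball 0 1))"
    unfolding compact_eq_totally_bounded
  proof (intro conjI allI impI)
    show "complete (closure (A ` cball 0 1))"
      using complete_closed_subset[OF closed_closure subset_UNIV complete_L2] .
    fix e :: real assume e: "e > 0"
    then have e4: "e / 4 > 0" by simp
    obtain k where k: "finite k" "A ` cball 0 1 \<subseteq> (\<Union>x\<in>k. cball x (2 * (e/4)))"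
      using near[OF e4] by (elim exE conjE)
    have "closure (A ` cball 0 1) \<subseteq> (\<Union>x\<in>k. cball x (2 * (e/4)))"
      by (rule closure_minimal[OF k(2)]) (intro closed_UN k(1) ballI closed_cball)
    also have "\<dots> \<subseteq> (\<Union>x\<in>k. ball x e)"
    proof (rule UN_mono[OF order_refl])
      fix x assume "x \<in> k"
      show "cball x (2 * (e/4)) \<subseteq> ball x e" using e by (auto simp: subset_iff)
    qed
    finally show "\<exists>k. finite k \<and> closure (A ` cball 0 1) \<subseteq> (\<Union>x\<in>k. ball x e)" using k(1) by (intro exI[of _ k] conjI)
  qed
  then show ?thesis using bA by (simp add: compact_operator_L2_def)
qed

lemma compact_kernel_op: "hs_kernel k \<Longrightarrow> compact_operator_L2 (kernel_op k)"
  by (rule compact_of_orthonormal_sums[OF clinear_map_kernel_op bounded_clinear_kernel_op hs_orthonormal_sum])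

section \<open>A Plancherel inequality\<close>

lemma integral_prod_Basis:
  fixes f :: "'a::euclidean_space \<Rightarrow> real \<Rightarrow> complex"
  assumes f: "\<And>b. b \<in> Basis \<Longrightarrow> integrable lborel (f b)"
  shows "integrable lborel (\<lambda>x::'a. \<Prod>b\<in>Basis. f b (x \<bullet> b))"
    and "(LINT x|lborel. (\<Prod>b\<in>Basis. f b ((x::'a) \<bullet> b))) = (\<Prod>b\<in>Basis. LINT s|lborel. f b s)"
proof -
  interpret P: product_sigma_finite "\<lambda>_::'a. lborel :: real measure" ..
  have [measurable]: "f b \<in> borel_measurable borel" if "b \<in> Basis" for b
    using borel_measurable_integrable[OF f[OF that]] by simp
  let ?M = "\<Pi>\<^sub>M b\<in>(Basis::'a set). (lborel::real measure)"
  have T[measurable]: "(\<lambda>g. \<Sum>b\<in>Basis. g b *\<^sub>R b) \<in> measurable ?M (borel :: 'a measure)" by measurable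
  have e: "(\<Prod>b\<in>Basis. f b ((\<Sum>c\<in>Basis. g c *\<^sub>R c) \<bullet> b)) = (\<Prod>b\<in>Basis. f b (g b))" for g :: "'a \<Rightarrow> real"
    by (intro prod.cong refl) simp
  have i: "integrable ?M (\<lambda>g. \<Prod>b\<in>Basis. f b (g b))" by (rule P.product_integrable_prod[OF finite_Basis f])
  show "integrable lborel (\<lambda>x::'a. \<Prod>b\<in>Basis. f b (x \<bullet> b))"
    unfolding lborel_eq[where 'a='a] using i by (subst integrable_distr_eq[OF T]) (simp_all add: e)
  show "(LINT x|lborel. (\<Prod>b\<in>Basis. f b ((x::'a) \<bullet> b))) = (\<Prod>b\<in>Basis. LINT s|lborel. f b s)"
    unfolding lborel_eq[where 'a='a] using P.product_integral_prod[OF finite_Basis f]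
    by (subst integral_distr[OF T]) (simp_all add: e)
qed

lemma gaussian_integrable: "integrable lborel (\<lambda>s::real. exp (- (s\<^sup>2) / 2))"
proof -
  have "integrable lborel (\<lambda>s. sqrt (2 * pi) * std_normal_density s)"
    by (intro integrable_mult_right integrable_normal_density) simp
  then show ?thesis by (simp add: std_normal_density_def)
qed

lemma gaussian_fourier_unit:
  "(LINT s|lborel. exp (\<i> * of_real (t * s)) * complex_of_real (exp (- (s\<^sup>2) / 2)))
     = complex_of_real (sqrt (2 * pi) * exp (- (t\<^sup>2) / 2))"
proof -
  have "complex_of_real (exp (- (t\<^sup>2) / 2)) = char std_normal_distribution t"
    by (simp add: char_std_normal_distribution)
  also have "\<dots> = (LINT s|lborel. std_normal_density s *\<^sub>R iexp (t * s))"
    unfolding char_def by (rule integral_density) (auto simp: normal_density_nonneg)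
  also have "\<dots> = (LINT s|lborel. complex_of_real (1 / sqrt (2 * pi)) *
      (exp (\<i> * of_real (t * s)) * complex_of_real (exp (- (s\<^sup>2) / 2))))"
    by (intro Bochner_Integration.integral_cong refl) (simp add: std_normal_density_def scaleR_conv_of_real mult_ac)
  also have "\<dots> = complex_of_real (1 / sqrt (2 * pi)) *
      (LINT s|lborel. exp (\<i> * of_real (t * s)) * complex_of_real (exp (- (s\<^sup>2) / 2)))"
    by (rule integral_mult_right_zero)
  finally show ?thesis by (simp add: field_simps)
qed

lemma gaussian_fourier:
  fixes e a :: real
  assumes e: "e > 0"
  shows "integrable lborel (\<lambda>s. exp (\<i> * of_real (a * s)) * complex_of_real (exp (- ((e * s)\<^sup>2) / 2)))"
    and "(LINT s|lborel. exp (\<i> * of_real (a * s)) * complex_of_real (exp (- ((e * s)\<^sup>2) / 2)))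
     = complex_of_real (sqrt (2 * pi) / e * exp (- ((a / e)\<^sup>2) / 2))"
proof -
  let ?f = "\<lambda>s. exp (\<i> * of_real ((a/e) * s)) * complex_of_real (exp (- (s\<^sup>2) / 2))"
  have f: "integrable lborel ?f"
    by (rule Bochner_Integration.integrable_bound[OF gaussian_integrable]) (auto simp: norm_mult)
  have c: "?f (0 + e * s) = exp (\<i> * of_real (a * s)) * complex_of_real (exp (- ((e * s)\<^sup>2) / 2))" for s
    using e by simp
  show "integrable lborel (\<lambda>s. exp (\<i> * of_real (a * s)) * complex_of_real (exp (- ((e * s)\<^sup>2) / 2)))"
    using lborel_integrable_real_affine[OF f, of e 0] e unfolding c by simp
  have "(LINT s|lborel. ?f s) = \<bar>e\<bar> *\<^sub>R (LINT s|lborel. ?f (0 + e * s))"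
    by (rule lborel_integral_real_affine) (use e in simp)
  then have "complex_of_real (sqrt (2 * pi) * exp (- ((a/e)\<^sup>2) / 2)) = complex_of_real e *
     (LINT s|lborel. exp (\<i> * of_real (a * s)) * complex_of_real (exp (- ((e * s)\<^sup>2) / 2)))"
    unfolding c gaussian_fourier_unit using e by (simp add: scaleR_conv_of_real)
  then show "(LINT s|lborel. exp (\<i> * of_real (a * s)) * complex_of_real (exp (- ((e * s)\<^sup>2) / 2)))
     = complex_of_real (sqrt (2 * pi) / e * exp (- ((a / e)\<^sup>2) / 2))"
    using e by (simp add: field_simps)
qed

text \<open>The Gaussian in product form, so that integrals over the space factor into one-dimensional ones.\<close>

definition gauss :: "real \<Rightarrow> 'a::euclidean_space \<Rightarrow> real" where
  "gauss e z = (\<Prod>b\<in>Basis. exp (- ((e * (z \<bullet> b))\<^sup>2) / 2))"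

lemma gauss_nonneg: "gauss e z \<ge> 0" unfolding gauss_def by (intro prod_nonneg) auto

lemma gauss_measurable[measurable]: "gauss e \<in> borel_measurable borel"
  unfolding gauss_def[abs_def] by measurable

lemma exp_inner_prod:
  fixes z v :: "'a::euclidean_space"
  shows "exp (\<i> * of_real (\<alpha> * (z \<bullet> v))) = (\<Prod>b\<in>Basis. exp (\<i> * of_real ((\<alpha> * (v \<bullet> b)) * (z \<bullet> b))))"
proof -
  have "\<i> * of_real (\<alpha> * (z \<bullet> v)) = (\<Sum>b\<in>Basis. \<i> * of_real ((\<alpha> * (v \<bullet> b)) * (z \<bullet> b)))"
    by (subst euclidean_inner) (simp add: sum_distrib_left mult_ac)
  then show ?thesis by (simp add: exp_sum)
qed

lemma gauss_fourier:
  fixes v :: "'a::euclidean_space"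
  assumes e: "e > 0"
  shows "integrable lborel (\<lambda>z::'a. exp (\<i> * of_real (\<alpha> * (z \<bullet> v))) * complex_of_real (gauss e z))"
    and "(LINT z|lborel. exp (\<i> * of_real (\<alpha> * (z \<bullet> v))) * complex_of_real (gauss e z))
     = complex_of_real ((sqrt (2 * pi) / e) ^ DIM('a) * gauss (\<alpha> / e) v)"
proof -
  let ?f = "\<lambda>b s. exp (\<i> * of_real ((\<alpha> * (v \<bullet> b)) * s)) * complex_of_real (exp (- ((e * s)\<^sup>2) / 2))"
  have eq: "exp (\<i> * of_real (\<alpha> * (z \<bullet> v))) * complex_of_real (gauss e z) = (\<Prod>b\<in>Basis. ?f b (z \<bullet> b))" for z :: 'a
    by (subst exp_inner_prod) (simp only: gauss_def of_real_prod prod.distrib)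
  show "integrable lborel (\<lambda>z::'a. exp (\<i> * of_real (\<alpha> * (z \<bullet> v))) * complex_of_real (gauss e z))"
    unfolding eq by (rule integral_prod_Basis(1)) (rule gaussian_fourier(1)[OF e])
  have "(LINT z|lborel. exp (\<i> * of_real (\<alpha> * (z \<bullet> v))) * complex_of_real (gauss e z)) = (\<Prod>b\<in>Basis. LINT s|lborel. ?f b s)"
    unfolding eq by (rule integral_prod_Basis(2)) (rule gaussian_fourier(1)[OF e])
  also have "\<dots> = (\<Prod>b\<in>Basis. complex_of_real (sqrt (2 * pi) / e * exp (- ((\<alpha> * (v \<bullet> b) / e)\<^sup>2) / 2)))"
    unfolding gaussian_fourier(2)[OF e] ..
  also have "\<dots> = complex_of_real ((sqrt (2 * pi) / e) ^ DIM('a) * gauss (\<alpha> / e) v)"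
    unfolding gauss_def of_real_prod[symmetric] prod.distrib prod_constant by simp
  finally show "(LINT z|lborel. exp (\<i> * of_real (\<alpha> * (z \<bullet> v))) * complex_of_real (gauss e z))
     = complex_of_real ((sqrt (2 * pi) / e) ^ DIM('a) * gauss (\<alpha> / e) v)" .
qed

lemma gauss_integral:
  assumes e: "e > 0"
  shows "integrable lborel (gauss e :: 'a::euclidean_space \<Rightarrow> real)"
    and "(\<integral>\<^sup>+z. ennreal (gauss e (z::'a)) \<partial>lborel) = ennreal ((sqrt (2 * pi) / e) ^ DIM('a))"
proof -
  have g: "integrable lborel (\<lambda>z::'a. complex_of_real (gauss e z))"
    using gauss_fourier(1)[OF e, of 0 "0::'a"] by simp
  then show i: "integrable lborel (gauss e :: 'a \<Rightarrow> real)"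
    by (simp only: complex_of_real_integrable_eq)
  have g0: "gauss (0 / e) (0::'a) = 1" by (simp add: gauss_def)
  have "complex_of_real (LINT z|lborel. gauss e (z::'a)) = complex_of_real ((sqrt (2 * pi) / e) ^ DIM('a))"
    using gauss_fourier(2)[OF e, of 0 "0::'a"] g0 by simp
  then have *: "(LINT z|lborel. gauss e (z::'a)) = (sqrt (2 * pi) / e) ^ DIM('a)" by (simp only: of_real_eq_iff)
  show "(\<integral>\<^sup>+z. ennreal (gauss e (z::'a)) \<partial>lborel) = ennreal ((sqrt (2 * pi) / e) ^ DIM('a))"
    unfolding *[symmetric] by (rule nn_integral_eq_integral[OF i]) (simp add: gauss_nonneg)
qed

lemma integrable_pair_bound:
  fixes F :: "'a::euclidean_space \<Rightarrow> 'b::euclidean_space \<Rightarrow> complex"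
  assumes [measurable]: "jointly_measurable F"
    and a: "integrable lborel a" and b: "integrable lborel b"
    and ab: "\<And>x y. cmod (F x y) \<le> a x * b y" "\<And>x. 0 \<le> a x" "\<And>y. 0 \<le> (b y :: real)"
  shows "integrable (lborel \<Otimes>\<^sub>M lborel) (case_prod F)"
proof (rule integrableI_bounded)
  have [measurable]: "a \<in> borel_measurable borel" "b \<in> borel_measurable borel"
    using borel_measurable_integrable[OF a] borel_measurable_integrable[OF b] by auto
  show "case_prod F \<in> borel_measurable (lborel \<Otimes>\<^sub>M lborel)" unfolding split_beta' by measurable
  have "(\<integral>\<^sup>+p. ennreal (cmod (case_prod F p)) \<partial>(lborel \<Otimes>\<^sub>M lborel)) \<le> (\<integral>\<^sup>+p. ennreal (a (fst p)) * ennreal (b (snd p)) \<partial>(lborel \<Otimes>\<^sub>M lborel))"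
    by (intro nn_integral_mono) (auto simp: ennreal_mult[symmetric] ab intro!: ennreal_leI)
  also have "\<dots> = (\<integral>\<^sup>+x. \<integral>\<^sup>+y. ennreal (a x) * ennreal (b y) \<partial>lborel \<partial>lborel)"
    by (subst lborel.nn_integral_fst[symmetric]) simp_all
  also have "\<dots> = (\<integral>\<^sup>+x. ennreal (a x) \<partial>lborel) * (\<integral>\<^sup>+y. ennreal (b y) \<partial>lborel)"
    by (simp add: nn_integral_cmult nn_integral_multc)
  also have "\<dots> < \<infinity>" using a b ab by (simp add: integrable_iff_bounded ennreal_mult_less_top)
  finally show "(\<integral>\<^sup>+p. ennreal (cmod (case_prod F p)) \<partial>(lborel \<Otimes>\<^sub>M lborel)) < \<infinity>" .
qed

lemma nn_integral_reflect_shift: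
  fixes f :: "'a::euclidean_space \<Rightarrow> ennreal"
  assumes [measurable]: "f \<in> borel_measurable borel"
  shows "(\<integral>\<^sup>+y. f (x - y) \<partial>lborel) = (\<integral>\<^sup>+y. f y \<partial>lborel)" "(\<integral>\<^sup>+y. f (y + x) \<partial>lborel) = (\<integral>\<^sup>+y. f y \<partial>lborel)"
proof -
  show "(\<integral>\<^sup>+y. f (x - y) \<partial>lborel) = (\<integral>\<^sup>+y. f y \<partial>lborel)"
    by (subst (2) lborel_affine[of "-1" x]) (simp_all add: nn_integral_density nn_integral_distr)
  show "(\<integral>\<^sup>+y. f (y + x) \<partial>lborel) = (\<integral>\<^sup>+y. f y \<partial>lborel)"
    by (subst (2) lborel_affine[of "1" x]) (simp_all add: nn_integral_density nn_integral_distr add.commute)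
qed

lemma LINT_norm_bound:
  fixes f :: "'b \<Rightarrow> complex"
  assumes "f \<in> borel_measurable M"
  shows "ennreal (cmod (LINT y|M. f y)) \<le> (\<integral>\<^sup>+y. ennreal (cmod (f y)) \<partial>M)"
  by (cases "integrable M f") (auto simp: integral_norm_bound_ennreal not_integrable_integral_eq)

text \<open>The Gaussian weight makes every integral absolutely convergent; its Fourier transform is a
  positive kernel of total mass \<open>(2 \<pi> / \<alpha>)\<^sup>d\<close>, independent of \<open>e\<close>, and Schur's test applies.\<close>

lemma plancherel_gauss:
  fixes g :: "'a::euclidean_space \<Rightarrow> complex"
  assumes g1: "integrable lborel g" and \<alpha>: "\<alpha> > 0" and e: "e > 0"
  shows "(\<integral>\<^sup>+z. ennreal ((cmod (LINT \<xi>|lborel. exp (\<i> * of_real (\<alpha> * (z \<bullet> \<xi>))) * g \<xi>))\<^sup>2 * gauss e z) \<partial>lborel)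
    \<le> ennreal ((2 * pi / \<alpha>) ^ DIM('a)) * (\<integral>\<^sup>+\<xi>. cmod_sq (g \<xi>) \<partial>lborel)"
proof -
  have gm[measurable]: "g \<in> borel_measurable borel" using borel_measurable_integrable[OF g1] by simp
  have cm[measurable]: "(\<lambda>x. cnj (g x)) \<in> borel_measurable borel"
    by (rule borel_measurable_continuous_on[OF _ gm]) (intro continuous_intros)
  define G where "G z = (LINT \<xi>|lborel. exp (\<i> * of_real (\<alpha> * (z \<bullet> \<xi>))) * g \<xi>)" for z :: 'a
  define C where "C = (LINT \<xi>|lborel. cmod (g \<xi>))"
  have GC: "cmod (G z) \<le> C" for z
    unfolding G_def C_def by (rule order_trans[OF integral_norm_bound]) (simp add: norm_mult)
  have C0: "C \<ge> 0" using GC[of 0] norm_ge_zero[of "G 0"] by linarith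
  have Gm[measurable]: "G \<in> borel_measurable borel"
    unfolding G_def by (rule borel_measurable_kernel_int) measurable
  have cGm[measurable]: "(\<lambda>z. cnj (G z)) \<in> borel_measurable borel"
    by (rule borel_measurable_continuous_on[OF _ Gm]) (intro continuous_intros)
  have cG: "cnj (G z) = (LINT \<eta>|lborel. exp (- \<i> * of_real (\<alpha> * (z \<bullet> \<eta>))) * cnj (g \<eta>))" for z
  proof -
    have "cnj (G z) = (LINT \<eta>|lborel. cnj (exp (\<i> * of_real (\<alpha> * (z \<bullet> \<eta>))) * g \<eta>))"
      unfolding G_def by (rule integral_bounded_linear'[OF bounded_linear_cnj bounded_linear_cnj, symmetric])
        (auto intro!: exI[of _ 1])
    then show ?thesis by (simp add: exp_cnj)
  qed
  have cGw: "w * cnj (G z) = (LINT \<eta>|lborel. w * (exp (- \<i> * of_real (\<alpha> * (z \<bullet> \<eta>))) * cnj (g \<eta>)))" for z w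
    unfolding cG by (rule integral_mult_right_zero[symmetric])
  let ?ge = "\<lambda>z. complex_of_real (gauss e z)"
  let ?I = "LINT z|lborel. G z * (cnj (G z) * ?ge z)"
  have ig: "integrable lborel (\<lambda>z::'a. C * gauss e z)" by (intro integrable_mult_right gauss_integral(1)[OF e])
  have n1: "integrable lborel (\<lambda>x. cmod (g x))" using g1 by simp
  have Gw: "G z * w = (LINT \<xi>|lborel. exp (\<i> * of_real (\<alpha> * (z \<bullet> \<xi>))) * g \<xi> * w)" for z w
    unfolding G_def by (rule integral_mult_left_zero[symmetric])
  have "?I = (LINT z|lborel. LINT \<xi>|lborel. exp (\<i> * of_real (\<alpha> * (z \<bullet> \<xi>))) * g \<xi> * (cnj (G z) * ?ge z))"
    unfolding Gw ..
  also have "\<dots> = (LINT \<xi>|lborel. LINT z|lborel. exp (\<i> * of_real (\<alpha> * (z \<bullet> \<xi>))) * g \<xi> * (cnj (G z) * ?ge z))"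
  proof (rule lborel_pair.Fubini_integral[symmetric], rule integrable_pair_bound[OF _ ig n1])
    fix x y :: 'a
    show "cmod (exp (\<i> * of_real (\<alpha> * (x \<bullet> y))) * g y * (cnj (G x) * ?ge x)) \<le> C * gauss e x * cmod (g y)"
      using mult_right_mono[OF mult_right_mono[OF GC[of x] gauss_nonneg[of e x]] norm_ge_zero[of "g y"]]
      by (simp add: norm_mult abs_of_nonneg gauss_nonneg mult_ac)
  qed (use C0 in \<open>auto simp: gauss_nonneg\<close>)
  also have "\<dots> = (LINT \<xi>|lborel. g \<xi> * (LINT \<eta>|lborel. cnj (g \<eta>) * complex_of_real ((sqrt (2 * pi) / e) ^ DIM('a) * gauss (\<alpha> / e) (\<xi> - \<eta>))))"
  proof (rule Bochner_Integration.integral_cong[OF refl])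
    fix \<xi> :: 'a
    have "(LINT z|lborel. exp (\<i> * of_real (\<alpha> * (z \<bullet> \<xi>))) * g \<xi> * (cnj (G z) * ?ge z))
       = (LINT z|lborel. g \<xi> * (\<integral>\<eta>. exp (\<i> * of_real (\<alpha> * (z \<bullet> \<xi>))) * ?ge z * (exp (- \<i> * of_real (\<alpha> * (z \<bullet> \<eta>))) * cnj (g \<eta>)) \<partial>lborel))"
    proof -
      have "(LINT z|lborel. exp (\<i> * of_real (\<alpha> * (z \<bullet> \<xi>))) * g \<xi> * (cnj (G z) * ?ge z))
        = (LINT z|lborel. g \<xi> * (exp (\<i> * of_real (\<alpha> * (z \<bullet> \<xi>))) * ?ge z * cnj (G z)))"
        by (simp only: mult_ac)
      then show ?thesis unfolding cGw .
    qed
    also have "\<dots> = g \<xi> * (LINT z|lborel. (\<integral>\<eta>. exp (\<i> * of_real (\<alpha> * (z \<bullet> \<xi>))) * ?ge z * (exp (- \<i> * of_real (\<alpha> * (z \<bullet> \<eta>))) * cnj (g \<eta>)) \<partial>lborel))"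
      by (rule integral_mult_right_zero)
    also have "(LINT z|lborel. (\<integral>\<eta>. exp (\<i> * of_real (\<alpha> * (z \<bullet> \<xi>))) * ?ge z * (exp (- \<i> * of_real (\<alpha> * (z \<bullet> \<eta>))) * cnj (g \<eta>)) \<partial>lborel))
      = (LINT \<eta>|lborel. (\<integral>z. exp (\<i> * of_real (\<alpha> * (z \<bullet> \<xi>))) * ?ge z * (exp (- \<i> * of_real (\<alpha> * (z \<bullet> \<eta>))) * cnj (g \<eta>)) \<partial>lborel))"
    proof (rule lborel_pair.Fubini_integral[symmetric], rule integrable_pair_bound[OF _ gauss_integral(1)[OF e] n1])
      fix x y :: 'a
      have "cmod (exp (- \<i> * of_real (\<alpha> * (x \<bullet> y)))) = 1"
        using norm_exp_i_times[of "- (\<alpha> * (x \<bullet> y))"] by simp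
      then show "cmod (exp (\<i> * of_real (\<alpha> * (x \<bullet> \<xi>))) * ?ge x * (exp (- \<i> * of_real (\<alpha> * (x \<bullet> y))) * cnj (g y))) \<le> gauss e x * cmod (g y)"
        by (simp add: norm_mult abs_of_nonneg gauss_nonneg)
    qed (auto simp: gauss_nonneg)
    also have "\<dots> = (LINT \<eta>|lborel. cnj (g \<eta>) * complex_of_real ((sqrt (2 * pi) / e) ^ DIM('a) * gauss (\<alpha> / e) (\<xi> - \<eta>)))"
    proof (rule Bochner_Integration.integral_cong[OF refl])
      fix \<eta> :: 'a
      have x: "exp (\<i> * of_real (\<alpha> * (z \<bullet> \<xi>))) * ?ge z * (exp (- \<i> * of_real (\<alpha> * (z \<bullet> \<eta>))) * cnj (g \<eta>))
         = cnj (g \<eta>) * (exp (\<i> * of_real (\<alpha> * (z \<bullet> (\<xi> - \<eta>)))) * ?ge z)" for z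
      proof -
        have "exp (\<i> * of_real (\<alpha> * (z \<bullet> (\<xi> - \<eta>))))
            = exp (\<i> * of_real (\<alpha> * (z \<bullet> \<xi>))) * exp (- \<i> * of_real (\<alpha> * (z \<bullet> \<eta>)))"
          unfolding mult_exp_exp by (simp add: inner_diff_right algebra_simps)
        then show ?thesis by (simp only: mult_ac)
      qed
      show "(\<integral>z. exp (\<i> * of_real (\<alpha> * (z \<bullet> \<xi>))) * ?ge z * (exp (- \<i> * of_real (\<alpha> * (z \<bullet> \<eta>))) * cnj (g \<eta>)) \<partial>lborel)
        = cnj (g \<eta>) * complex_of_real ((sqrt (2 * pi) / e) ^ DIM('a) * gauss (\<alpha> / e) (\<xi> - \<eta>))"
        unfolding x integral_mult_right_zero gauss_fourier(2)[OF e] ..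
    qed
    finally show "(LINT z|lborel. exp (\<i> * of_real (\<alpha> * (z \<bullet> \<xi>))) * g \<xi> * (cnj (G z) * ?ge z))
      = g \<xi> * (LINT \<eta>|lborel. cnj (g \<eta>) * complex_of_real ((sqrt (2 * pi) / e) ^ DIM('a) * gauss (\<alpha> / e) (\<xi> - \<eta>)))" .
  qed
  finally have I: "?I = (LINT \<xi>|lborel. g \<xi> * (LINT \<eta>|lborel. cnj (g \<eta>) * complex_of_real ((sqrt (2 * pi) / e) ^ DIM('a) * gauss (\<alpha> / e) (\<xi> - \<eta>))))" .
  define K where "K v = (sqrt (2 * pi) / e) ^ DIM('a) * gauss (\<alpha> / e) v" for v :: 'a
  have K0: "K v \<ge> 0" for v unfolding K_def using e by (auto intro!: mult_nonneg_nonneg gauss_nonneg)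
  have [measurable]: "K \<in> borel_measurable borel" unfolding K_def[abs_def] by measurable
  have intK: "(\<integral>\<^sup>+v. ennreal (K v) \<partial>lborel) = ennreal ((2 * pi / \<alpha>) ^ DIM('a))"
  proof -
    let ?c = "(sqrt (2 * pi) / e) ^ DIM('a)" and ?c' = "(sqrt (2 * pi) / (\<alpha> / e)) ^ DIM('a)"
    have "(\<integral>\<^sup>+v. ennreal (K v) \<partial>lborel) = (\<integral>\<^sup>+v. ennreal ?c * ennreal (gauss (\<alpha> / e) (v::'a)) \<partial>lborel)"
      unfolding K_def using e by (intro nn_integral_cong ennreal_mult) (auto simp: gauss_nonneg)
    also have "\<dots> = ennreal ?c * ennreal ?c'"
      using gauss_integral(2)[where 'a='a, of "\<alpha> / e"] \<alpha> e by (subst nn_integral_cmult) auto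
    also have "\<dots> = ennreal (?c * ?c')" using \<alpha> e by (intro ennreal_mult[symmetric]) auto
    also have "?c * ?c' = ((sqrt (2 * pi) / e) * (sqrt (2 * pi) / (\<alpha> / e))) ^ DIM('a)"
      by (rule power_mult_distrib[symmetric])
    also have "(sqrt (2 * pi) / e) * (sqrt (2 * pi) / (\<alpha> / e)) = 2 * pi / \<alpha>"
      using e by simp
    finally show ?thesis .
  qed
  let ?N = "\<integral>\<^sup>+\<xi>. cmod_sq (g \<xi>) \<partial>lborel"
  have s1: "(\<integral>\<^sup>+\<xi>. \<integral>\<^sup>+\<eta>. cmod_sq (g \<xi>) * ennreal (K (\<xi> - \<eta>)) \<partial>lborel \<partial>lborel) = ?N * ennreal ((2 * pi / \<alpha>) ^ DIM('a))"
  proof -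
    have "(\<integral>\<^sup>+\<eta>. cmod_sq (g \<xi>) * ennreal (K (\<xi> - \<eta>)) \<partial>lborel) = cmod_sq (g \<xi>) * ennreal ((2 * pi / \<alpha>) ^ DIM('a))" for \<xi>
      using nn_integral_reflect_shift(1)[of "\<lambda>v. ennreal (K v)" \<xi>] intK by (simp add: nn_integral_cmult)
    then show ?thesis by (simp add: nn_integral_multc)
  qed
  have s2: "(\<integral>\<^sup>+\<xi>. \<integral>\<^sup>+\<eta>. cmod_sq (g \<eta>) * ennreal (K (\<xi> - \<eta>)) \<partial>lborel \<partial>lborel) = ?N * ennreal ((2 * pi / \<alpha>) ^ DIM('a))"
  proof -
    have "(\<integral>\<^sup>+\<xi>. \<integral>\<^sup>+\<eta>. cmod_sq (g \<eta>) * ennreal (K (\<xi> - \<eta>)) \<partial>lborel \<partial>lborel)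
       = (\<integral>\<^sup>+\<eta>. \<integral>\<^sup>+\<xi>. cmod_sq (g \<eta>) * ennreal (K (\<xi> - \<eta>)) \<partial>lborel \<partial>lborel)"
      by (rule lborel_pair.Fubini') measurable
    also have "\<dots> = (\<integral>\<^sup>+\<eta>. cmod_sq (g \<eta>) * ennreal ((2 * pi / \<alpha>) ^ DIM('a)) \<partial>lborel)"
      using nn_integral_reflect_shift(2)[of "\<lambda>v. ennreal (K v)" "- y" for y] intK by (simp add: nn_integral_cmult)
    finally show ?thesis by (simp add: nn_integral_multc)
  qed
  have "ennreal (cmod ?I) \<le> (\<integral>\<^sup>+\<xi>. \<integral>\<^sup>+\<eta>. ennreal (cmod (g \<xi>) * cmod (g \<eta>) * K (\<xi> - \<eta>)) \<partial>lborel \<partial>lborel)"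
  proof -
    have m[measurable]: "(\<lambda>\<xi>. LINT \<eta>|lborel. cnj (g \<eta>) * complex_of_real (K (\<xi> - \<eta>))) \<in> borel_measurable borel"
    proof -
      have "(\<lambda>\<xi>. LINT \<eta>|lborel. complex_of_real (K (\<xi> - \<eta>)) * cnj (g \<eta>)) \<in> borel_measurable borel"
        by (rule borel_measurable_kernel_int) measurable
      then show ?thesis by (simp only: mult.commute)
    qed
    have "ennreal (cmod ?I) \<le> (\<integral>\<^sup>+\<xi>. ennreal (cmod (g \<xi> * (LINT \<eta>|lborel. cnj (g \<eta>) * complex_of_real (K (\<xi> - \<eta>))))) \<partial>lborel)"
      unfolding I K_def[symmetric] by (rule LINT_norm_bound) measurable
    also have "\<dots> \<le> (\<integral>\<^sup>+\<xi>. \<integral>\<^sup>+\<eta>. ennreal (cmod (g \<xi>) * cmod (g \<eta>) * K (\<xi> - \<eta>)) \<partial>lborel \<partial>lborel)"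
    proof (rule nn_integral_mono)
      fix \<xi> :: 'a
      have "ennreal (cmod (g \<xi> * (LINT \<eta>|lborel. cnj (g \<eta>) * complex_of_real (K (\<xi> - \<eta>)))))
         = ennreal (cmod (g \<xi>)) * ennreal (cmod (LINT \<eta>|lborel. cnj (g \<eta>) * complex_of_real (K (\<xi> - \<eta>))))"
        by (simp add: norm_mult ennreal_mult)
      also have "\<dots> \<le> ennreal (cmod (g \<xi>)) * (\<integral>\<^sup>+\<eta>. ennreal (cmod (cnj (g \<eta>) * complex_of_real (K (\<xi> - \<eta>)))) \<partial>lborel)"
        by (intro mult_left_mono LINT_norm_bound) measurable
      also have "\<dots> = (\<integral>\<^sup>+\<eta>. ennreal (cmod (g \<xi>)) * ennreal (cmod (cnj (g \<eta>) * complex_of_real (K (\<xi> - \<eta>)))) \<partial>lborel)"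
        by (rule nn_integral_cmult[symmetric]) measurable
      also have "\<dots> = (\<integral>\<^sup>+\<eta>. ennreal (cmod (g \<xi>) * cmod (g \<eta>) * K (\<xi> - \<eta>)) \<partial>lborel)"
        using K0 by (intro nn_integral_cong) (simp add: norm_mult ennreal_mult[symmetric] mult.assoc)
      finally show "ennreal (cmod (g \<xi> * (LINT \<eta>|lborel. cnj (g \<eta>) * complex_of_real (K (\<xi> - \<eta>)))))
          \<le> (\<integral>\<^sup>+\<eta>. ennreal (cmod (g \<xi>) * cmod (g \<eta>) * K (\<xi> - \<eta>)) \<partial>lborel)" .
    qed
    finally show ?thesis .
  qed
  then have "2 * ennreal (cmod ?I) \<le> 2 * (\<integral>\<^sup>+\<xi>. \<integral>\<^sup>+\<eta>. ennreal (cmod (g \<xi>) * cmod (g \<eta>) * K (\<xi> - \<eta>)) \<partial>lborel \<partial>lborel)"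
    by (rule mult_left_mono) simp
  also have "\<dots> = (\<integral>\<^sup>+\<xi>. \<integral>\<^sup>+\<eta>. 2 * ennreal (cmod (g \<xi>) * cmod (g \<eta>) * K (\<xi> - \<eta>)) \<partial>lborel \<partial>lborel)"
    by (simp add: nn_integral_cmult)
  also have "\<dots> \<le> (\<integral>\<^sup>+\<xi>. \<integral>\<^sup>+\<eta>. cmod_sq (g \<xi>) * ennreal (K (\<xi> - \<eta>)) + cmod_sq (g \<eta>) * ennreal (K (\<xi> - \<eta>)) \<partial>lborel \<partial>lborel)"
  proof (intro nn_integral_mono)
    fix \<xi> \<eta> :: 'a
    have "2 * (cmod (g \<xi>) * cmod (g \<eta>) * K (\<xi> - \<eta>)) \<le> (cmod (g \<xi>))\<^sup>2 * K (\<xi> - \<eta>) + (cmod (g \<eta>))\<^sup>2 * K (\<xi> - \<eta>)"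
      using mult_right_mono[OF sum_squares_bound[of "cmod (g \<xi>)" "cmod (g \<eta>)"] K0[of "\<xi> - \<eta>"]] by (simp add: algebra_simps)
    then have "ennreal (2 * (cmod (g \<xi>) * cmod (g \<eta>) * K (\<xi> - \<eta>))) \<le> ennreal ((cmod (g \<xi>))\<^sup>2 * K (\<xi> - \<eta>) + (cmod (g \<eta>))\<^sup>2 * K (\<xi> - \<eta>))"
      by (rule ennreal_leI)
    then show "2 * ennreal (cmod (g \<xi>) * cmod (g \<eta>) * K (\<xi> - \<eta>)) \<le> cmod_sq (g \<xi>) * ennreal (K (\<xi> - \<eta>)) + cmod_sq (g \<eta>) * ennreal (K (\<xi> - \<eta>))"
      using K0 by (simp add: ennreal_mult ennreal_plus)
  qed
  also have "\<dots> = (\<integral>\<^sup>+\<xi>. \<integral>\<^sup>+\<eta>. cmod_sq (g \<xi>) * ennreal (K (\<xi> - \<eta>)) \<partial>lborel \<partial>lborel)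
      + (\<integral>\<^sup>+\<xi>. \<integral>\<^sup>+\<eta>. cmod_sq (g \<eta>) * ennreal (K (\<xi> - \<eta>)) \<partial>lborel \<partial>lborel)"
  proof -
    have a: "(\<integral>\<^sup>+\<eta>. cmod_sq (g \<xi>) * ennreal (K (\<xi> - \<eta>)) + cmod_sq (g \<eta>) * ennreal (K (\<xi> - \<eta>)) \<partial>lborel)
      = (\<integral>\<^sup>+\<eta>. cmod_sq (g \<xi>) * ennreal (K (\<xi> - \<eta>)) \<partial>lborel) + (\<integral>\<^sup>+\<eta>. cmod_sq (g \<eta>) * ennreal (K (\<xi> - \<eta>)) \<partial>lborel)" for \<xi>
      by (rule nn_integral_add) measurable
    have m: "(\<lambda>\<xi>. \<integral>\<^sup>+\<eta>. cmod_sq (g \<xi>) * ennreal (K (\<xi> - \<eta>)) \<partial>lborel) \<in> borel_measurable lborel"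
      "(\<lambda>\<xi>. \<integral>\<^sup>+\<eta>. cmod_sq (g \<eta>) * ennreal (K (\<xi> - \<eta>)) \<partial>lborel) \<in> borel_measurable lborel"
      by measurable
    show ?thesis unfolding a by (rule nn_integral_add[OF m])
  qed
  also have "\<dots> = 2 * (?N * ennreal ((2 * pi / \<alpha>) ^ DIM('a)))"
    unfolding s1 s2 by (rule mult_2[symmetric])
  finally have I2: "ennreal (cmod ?I) \<le> ?N * ennreal ((2 * pi / \<alpha>) ^ DIM('a))"
    by (rule ennreal_mult_le_mult_iff[THEN iffD1, rotated 2]) simp_all
  have r: "G z * (cnj (G z) * ?ge z) = complex_of_real ((cmod (G z))\<^sup>2 * gauss e z)" for z
    by (simp only: of_real_mult complex_norm_square mult.assoc)
  have int: "integrable lborel (\<lambda>z. (cmod (G z))\<^sup>2 * gauss e z)"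
  proof (rule Bochner_Integration.integrable_bound)
    show "integrable lborel (\<lambda>z::'a. C\<^sup>2 * gauss e z)" by (intro integrable_mult_right gauss_integral(1)[OF e])
    have "norm ((cmod (G z))\<^sup>2 * gauss e z) \<le> norm (C\<^sup>2 * gauss e z)" for z
      using mult_right_mono[OF power_mono[OF GC[of z], of 2] gauss_nonneg[of e z]] gauss_nonneg[of e z] by (simp add: abs_mult abs_of_nonneg)
    then show "AE z in lborel. norm ((cmod (G z))\<^sup>2 * gauss e z) \<le> norm (C\<^sup>2 * gauss e z)" by simp
  qed measurable
  have "(\<integral>\<^sup>+z. ennreal ((cmod (G z))\<^sup>2 * gauss e z) \<partial>lborel) = ennreal (LINT z|lborel. (cmod (G z))\<^sup>2 * gauss e z)"
    by (rule nn_integral_eq_integral[OF int]) (auto intro!: mult_nonneg_nonneg gauss_nonneg)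
  also have "(LINT z|lborel. (cmod (G z))\<^sup>2 * gauss e z) = cmod ?I"
    unfolding r integral_complex_of_real by (simp add: abs_of_nonneg integral_nonneg_AE gauss_nonneg)
  finally show ?thesis using I2 unfolding G_def by (simp add: mult.commute)
qed

text \<open>As \<open>e\<close> tends to \<open>0\<close> the weight tends to \<open>1\<close>, and Fatou applies because the bound does not depend on \<open>e\<close>.\<close>

lemma plancherel_le:
  fixes g :: "'a::euclidean_space \<Rightarrow> complex"
  assumes g1: "integrable lborel g" and \<alpha>: "\<alpha> > 0"
  shows "(\<integral>\<^sup>+z. cmod_sq (LINT \<xi>|lborel. exp (\<i> * of_real (\<alpha> * (z \<bullet> \<xi>))) * g \<xi>) \<partial>lborel)
    \<le> ennreal ((2 * pi / \<alpha>) ^ DIM('a)) * (\<integral>\<^sup>+\<xi>. cmod_sq (g \<xi>) \<partial>lborel)"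
proof -
  have gm[measurable]: "g \<in> borel_measurable borel" using borel_measurable_integrable[OF g1] by simp
  let ?G = "\<lambda>z::'a. LINT \<xi>|lborel. exp (\<i> * of_real (\<alpha> * (z \<bullet> \<xi>))) * g \<xi>"
  have [measurable]: "?G \<in> borel_measurable borel" by (rule borel_measurable_kernel_int) measurable
  have lim: "(\<lambda>n. ennreal ((cmod (?G z))\<^sup>2 * gauss (1 / real (Suc n)) z)) \<longlonglongrightarrow> cmod_sq (?G z)" for z
  proof -
    have "(\<lambda>n. (cmod (?G z))\<^sup>2 * gauss (1 / real (Suc n)) z) \<longlonglongrightarrow> (cmod (?G z))\<^sup>2 * (\<Prod>b\<in>(Basis::'a set). exp (- ((0 * (z \<bullet> b))\<^sup>2) / 2))"
      unfolding gauss_def by (intro tendsto_intros LIMSEQ_Suc[OF lim_inverse_n']) simp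
    then show ?thesis by (intro tendsto_ennrealI) simp
  qed
  have "sq_norm ?G = (\<integral>\<^sup>+z. liminf (\<lambda>n. ennreal ((cmod (?G z))\<^sup>2 * gauss (1 / real (Suc n)) z)) \<partial>lborel)"
    by (intro nn_integral_cong lim_imp_Liminf[symmetric] lim) simp
  also have "\<dots> \<le> liminf (\<lambda>n. \<integral>\<^sup>+z. ennreal ((cmod (?G z))\<^sup>2 * gauss (1 / real (Suc n)) z) \<partial>lborel)"
    by (rule nn_integral_liminf) measurable
  also have "\<dots> \<le> limsup (\<lambda>n. \<integral>\<^sup>+z. ennreal ((cmod (?G z))\<^sup>2 * gauss (1 / real (Suc n)) z) \<partial>lborel)"
    by (rule Liminf_le_Limsup) simp
  also have "\<dots> \<le> ennreal ((2 * pi / \<alpha>) ^ DIM('a)) * (\<integral>\<^sup>+\<xi>. cmod_sq (g \<xi>) \<partial>lborel)"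
    by (intro Limsup_bounded always_eventually allI plancherel_gauss[OF g1 \<alpha>]) simp
  finally show ?thesis .
qed

section \<open>Symbol classes\<close>

lemma directional_derivative_along_line:
  fixes f :: "'b::real_normed_vector \<Rightarrow> complex"
  assumes "\<And>x. ((\<lambda>s. f (x + s *\<^sub>R v)) has_vector_derivative g x) (at 0)"
  shows "((\<lambda>s. f (x + s *\<^sub>R v)) has_vector_derivative g (x + s *\<^sub>R v)) (at s within S)"
proof -
  have 1: "((\<lambda>\<sigma>. f ((x + s *\<^sub>R v) + \<sigma> *\<^sub>R v)) has_vector_derivative g (x + s *\<^sub>R v)) (at (s - s))"
    using assms[of "x + s *\<^sub>R v"] by simp
  have 2: "((\<lambda>\<sigma>. \<sigma> - s) has_vector_derivative 1) (at s)"
    by (auto intro!: derivative_eq_intros)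
  have "((\<lambda>\<sigma>. f ((x + s *\<^sub>R v) + \<sigma> *\<^sub>R v)) \<circ> (\<lambda>\<sigma>. \<sigma> - s) has_vector_derivative 1 *\<^sub>R g (x + s *\<^sub>R v)) (at s)"
    by (rule vector_diff_chain_at[OF 2 1])
  moreover have "(\<lambda>\<sigma>. f ((x + s *\<^sub>R v) + \<sigma> *\<^sub>R v)) \<circ> (\<lambda>\<sigma>. \<sigma> - s) = (\<lambda>\<sigma>. f (x + \<sigma> *\<^sub>R v))"
    by (auto simp: fun_eq_iff algebra_simps)
  ultimately have "((\<lambda>\<sigma>. f (x + \<sigma> *\<^sub>R v)) has_vector_derivative g (x + s *\<^sub>R v)) (at s)" by simp
  then show ?thesis by (rule has_vector_derivative_at_within)
qed

text \<open>The derivative is only assumed in the direction \<open>v\<close>; with \<open>L = g x\<close> and \<open>e\<close> the oscillation of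
  \<open>g\<close> this measures the error of the difference quotient.\<close>

lemma mean_value_line:
  fixes f :: "'b::real_normed_vector \<Rightarrow> complex"
  assumes d: "\<And>x. ((\<lambda>s. f (x + s *\<^sub>R v)) has_vector_derivative g x) (at 0)"
    and b: "\<And>\<sigma>. \<bar>\<sigma>\<bar> \<le> \<bar>s\<bar> \<Longrightarrow> norm (g (x + \<sigma> *\<^sub>R v) - L) \<le> e"
  shows "norm (f (x + s *\<^sub>R v) - f x - s *\<^sub>R L) \<le> e * \<bar>s\<bar>"
proof -
  let ?\<phi> = "\<lambda>\<sigma>. f (x + \<sigma> *\<^sub>R v) - \<sigma> *\<^sub>R L"
  have "norm (?\<phi> s - ?\<phi> 0) \<le> e * norm (s - 0)"
  proof (rule differentiable_bound[where S = "{- \<bar>s\<bar>..\<bar>s\<bar>}" and f' = "\<lambda>\<sigma> h. h *\<^sub>R (g (x + \<sigma> *\<^sub>R v) - L)"])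
    fix \<sigma> assume "\<sigma> \<in> {- \<bar>s\<bar>..\<bar>s\<bar>}"
    then have s: "\<bar>\<sigma>\<bar> \<le> \<bar>s\<bar>" by auto
    have "(?\<phi> has_vector_derivative (g (x + \<sigma> *\<^sub>R v) - L)) (at \<sigma> within {- \<bar>s\<bar>..\<bar>s\<bar>})"
      using has_vector_derivative_diff[OF directional_derivative_along_line[OF d]
          has_vector_derivative_scaleR[OF DERIV_ident has_vector_derivative_const, of L]]
      by simp
    then show "(?\<phi> has_derivative (\<lambda>h. h *\<^sub>R (g (x + \<sigma> *\<^sub>R v) - L))) (at \<sigma> within {- \<bar>s\<bar>..\<bar>s\<bar>})"
      by (simp add: has_vector_derivative_def)
    show "onorm (\<lambda>h. h *\<^sub>R (g (x + \<sigma> *\<^sub>R v) - L)) \<le> e"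
      using mult_left_mono[OF b[OF s] abs_ge_zero] by (intro onorm_le) (simp add: mult.commute)
  qed auto
  then show ?thesis by (simp add: algebra_simps)
qed

text \<open>The iterated derivatives of a symbol are taken in a fixed order; a mixed difference quotient
  shows that a derivative in \<open>\<xi>\<close> may be applied last.\<close>

lemma directional_derivatives_commute:
  fixes f :: "'b::real_normed_vector \<Rightarrow> complex"
  assumes fg: "\<And>x. ((\<lambda>s. f (x + s *\<^sub>R v)) has_vector_derivative g x) (at 0)"
    and fF: "\<And>x. ((\<lambda>s. f (x + s *\<^sub>R e)) has_vector_derivative F x) (at 0)"
    and gG: "\<And>x. ((\<lambda>s. g (x + s *\<^sub>R e)) has_vector_derivative G x) (at 0)"
    and G: "continuous_on UNIV G"
  shows "((\<lambda>s. F (x + s *\<^sub>R v)) has_vector_derivative G x) (at 0)"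
proof -
  have key: "\<exists>d>0. \<forall>\<tau>. \<bar>\<tau>\<bar> < d \<longrightarrow> norm (F (x + \<tau> *\<^sub>R v) - F x - \<tau> *\<^sub>R G x) \<le> \<epsilon> * \<bar>\<tau>\<bar>" if \<epsilon>: "\<epsilon> > 0" for \<epsilon>
  proof -
    have "isCont G x" using G by (simp add: continuous_on_eq_continuous_at)
    then obtain d0 where d0: "d0 > 0" "\<And>y. dist y x < d0 \<Longrightarrow> dist (G y) (G x) < \<epsilon>"
      using \<epsilon> unfolding continuous_at_eps_delta by blast
    define d where "d = d0 / (1 + norm v + norm e)"
    have nn: "1 + norm v + norm e > 0" using norm_ge_zero[of v] norm_ge_zero[of e] by linarith
    have d: "d > 0" using d0 nn by (simp add: d_def)
    have Gn: "norm (G (x + s *\<^sub>R e + \<sigma> *\<^sub>R v) - G x) \<le> \<epsilon>" if "\<bar>s\<bar> < d" "\<bar>\<sigma>\<bar> < d" for s \<sigma>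
    proof -
      have "dist (x + s *\<^sub>R e + \<sigma> *\<^sub>R v) x \<le> \<bar>s\<bar> * norm e + \<bar>\<sigma>\<bar> * norm v"
        using norm_triangle_ineq[of "s *\<^sub>R e" "\<sigma> *\<^sub>R v"] by (simp add: dist_norm add.assoc)
      also have "\<dots> \<le> d * norm e + d * norm v" using that by (intro add_mono mult_right_mono) auto
      also have "\<dots> < d * (1 + norm v + norm e)" using d by (simp add: algebra_simps)
      also have "\<dots> = d0" using nn by (simp add: d_def)
      finally show ?thesis using d0(2)[of "x + s *\<^sub>R e + \<sigma> *\<^sub>R v"] by (simp add: dist_norm)
    qed
    have D: "norm ((f (x + s *\<^sub>R e + \<tau> *\<^sub>R v) - f (x + \<tau> *\<^sub>R v)) - (f (x + s *\<^sub>R e) - f x) - \<tau> *\<^sub>R (s *\<^sub>R G x)) \<le> (\<epsilon> * \<bar>s\<bar>) * \<bar>\<tau>\<bar>"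
      if s: "\<bar>s\<bar> < d" and \<tau>: "\<bar>\<tau>\<bar> < d" for s \<tau>
    proof -
      let ?k = "\<lambda>y. f (y + s *\<^sub>R e) - f y"
      have dk: "((\<lambda>\<sigma>. ?k (y + \<sigma> *\<^sub>R v)) has_vector_derivative (g (y + s *\<^sub>R e) - g y)) (at 0)" for y
        using has_vector_derivative_diff[OF fg[of "y + s *\<^sub>R e"] fg[of y]] by (simp add: algebra_simps)
      have "norm (?k (x + \<tau> *\<^sub>R v) - ?k x - \<tau> *\<^sub>R (s *\<^sub>R G x)) \<le> (\<epsilon> * \<bar>s\<bar>) * \<bar>\<tau>\<bar>"
      proof (rule mean_value_line[OF dk])
        fix \<sigma> assume "\<bar>\<sigma>\<bar> \<le> \<bar>\<tau>\<bar>"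
        then have \<sigma>: "\<bar>\<sigma>\<bar> < d" using \<tau> by linarith
        show "norm (g (x + \<sigma> *\<^sub>R v + s *\<^sub>R e) - g (x + \<sigma> *\<^sub>R v) - s *\<^sub>R G x) \<le> \<epsilon> * \<bar>s\<bar>"
        proof (rule mean_value_line[OF gG])
          fix \<sigma>' assume "\<bar>\<sigma>'\<bar> \<le> \<bar>s\<bar>"
          then show "norm (G (x + \<sigma> *\<^sub>R v + \<sigma>' *\<^sub>R e) - G x) \<le> \<epsilon>"
            using Gn[of \<sigma>' \<sigma>] s \<sigma> by (simp add: algebra_simps)
        qed
      qed
      then show ?thesis by (simp add: algebra_simps)
    qed
    have "norm (F (x + \<tau> *\<^sub>R v) - F x - \<tau> *\<^sub>R G x) \<le> \<epsilon> * \<bar>\<tau>\<bar>" if \<tau>: "\<bar>\<tau>\<bar> < d" for \<tau>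
    proof -
      let ?q = "\<lambda>s. (f (x + \<tau> *\<^sub>R v + s *\<^sub>R e) - f (x + \<tau> *\<^sub>R v)) /\<^sub>R s - (f (x + s *\<^sub>R e) - f x) /\<^sub>R s - \<tau> *\<^sub>R G x"
      have q: "((\<lambda>s. (f (y + s *\<^sub>R e) - f y) /\<^sub>R s) \<longlongrightarrow> F y) (at 0)" for y
      proof -
        have lim: "((\<lambda>h. norm (f (y + h *\<^sub>R e) - f y - h *\<^sub>R F y) / norm h) \<longlongrightarrow> 0) (at 0)"
          using fF[of y] unfolding has_vector_derivative_def has_derivative_at by simp
        have "norm (f (y + h *\<^sub>R e) - f y - h *\<^sub>R F y) / norm h = norm ((f (y + h *\<^sub>R e) - f y) /\<^sub>R h - F y)" if "h \<noteq> 0" for h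
        proof -
          have "(f (y + h *\<^sub>R e) - f y) /\<^sub>R h - F y = (f (y + h *\<^sub>R e) - f y - h *\<^sub>R F y) /\<^sub>R h"
            using that by (simp add: scaleR_diff_right)
          then show ?thesis by (simp add: divide_inverse mult.commute)
        qed
        then have "eventually (\<lambda>h. norm (f (y + h *\<^sub>R e) - f y - h *\<^sub>R F y) / norm h = norm ((f (y + h *\<^sub>R e) - f y) /\<^sub>R h - F y)) (at 0)"
          by (intro eventually_at_filter[THEN iffD2] always_eventually) simp
        from Lim_transform_eventually[OF lim this] show ?thesis
          by (rule LIM_zero_cancel[OF tendsto_norm_zero_cancel])
      qed
      have "(?q \<longlongrightarrow> F (x + \<tau> *\<^sub>R v) - F x - \<tau> *\<^sub>R G x) (at 0)"
        by (intro tendsto_diff q tendsto_const)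
      then have "((\<lambda>s. norm (?q s)) \<longlongrightarrow> norm (F (x + \<tau> *\<^sub>R v) - F x - \<tau> *\<^sub>R G x)) (at 0)"
        by (rule tendsto_norm)
      then show ?thesis
      proof (rule tendsto_upperbound)
        have "eventually (\<lambda>s. \<bar>s\<bar> < d \<and> s \<noteq> 0) (at (0::real))"
          unfolding eventually_at using d by (auto intro!: exI[of _ d])
        then show "eventually (\<lambda>s. norm (?q s) \<le> \<epsilon> * \<bar>\<tau>\<bar>) (at 0)"
        proof eventually_elim
          fix s :: real assume s: "\<bar>s\<bar> < d \<and> s \<noteq> 0"
          have "?q s = ((f (x + s *\<^sub>R e + \<tau> *\<^sub>R v) - f (x + \<tau> *\<^sub>R v)) - (f (x + s *\<^sub>R e) - f x) - \<tau> *\<^sub>R (s *\<^sub>R G x)) /\<^sub>R s"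
            using s by (simp add: algebra_simps scaleR_diff_right)
          then have "norm (?q s) = norm ((f (x + s *\<^sub>R e + \<tau> *\<^sub>R v) - f (x + \<tau> *\<^sub>R v)) - (f (x + s *\<^sub>R e) - f x) - \<tau> *\<^sub>R (s *\<^sub>R G x)) / \<bar>s\<bar>"
            by (simp add: divide_inverse mult.commute)
          also have "\<dots> \<le> (\<epsilon> * \<bar>s\<bar>) * \<bar>\<tau>\<bar> / \<bar>s\<bar>" using D[of s \<tau>] s \<tau> by (intro divide_right_mono) auto
          also have "\<dots> = \<epsilon> * \<bar>\<tau>\<bar>" using s by simp
          finally show "norm (?q s) \<le> \<epsilon> * \<bar>\<tau>\<bar>" .
        qed
      qed simp
    qed
    then show ?thesis using d by blast
  qed
  show ?thesis
    unfolding has_vector_derivative_def has_derivative_at_alt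
    using key by (auto simp: bounded_linear_scaleR_left)
qed

text \<open>The increment is split into steps along the coordinate axes, each of which is estimated by the mean
  value inequality; adding one axis at a time gives the induction over sets of basis vectors.\<close>

lemma continuous_partials_directional:
  fixes f :: "'a::euclidean_space \<Rightarrow> complex"
  assumes d: "\<And>b x. b \<in> Basis \<Longrightarrow> ((\<lambda>s. f (x + s *\<^sub>R b)) has_vector_derivative g b x) (at 0)"
    and g: "\<And>b. b \<in> Basis \<Longrightarrow> continuous_on UNIV (g b)"
  shows "((\<lambda>s. f (x + s *\<^sub>R v)) has_vector_derivative (\<Sum>b\<in>Basis. (v \<bullet> b) *\<^sub>R g b x)) (at 0)"
proof -
  have part: "\<exists>\<delta>>0. \<forall>s. \<bar>s\<bar> < \<delta> \<longrightarrow> norm (f (x + s *\<^sub>R (\<Sum>b\<in>B. (v \<bullet> b) *\<^sub>R b)) - f x - s *\<^sub>R (\<Sum>b\<in>B. (v \<bullet> b) *\<^sub>R g b x)) \<le> \<epsilon> * \<bar>s\<bar>"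
    if "finite B" "B \<subseteq> Basis" "\<epsilon> > 0" for B \<epsilon>
    using that
  proof (induction B arbitrary: \<epsilon> rule: finite_induct)
    case empty
    then show ?case by (auto intro!: exI[of _ 1])
  next
    case (insert b B)
    let ?v = "\<Sum>b\<in>B. (v \<bullet> b) *\<^sub>R b"
    have bB: "b \<in> Basis" using insert.prems by simp
    obtain \<delta>1 where \<delta>1: "\<delta>1 > 0" "\<And>s. \<bar>s\<bar> < \<delta>1 \<Longrightarrow> norm (f (x + s *\<^sub>R ?v) - f x - s *\<^sub>R (\<Sum>b\<in>B. (v \<bullet> b) *\<^sub>R g b x)) \<le> (\<epsilon>/2) * \<bar>s\<bar>"
      using insert.IH[of "\<epsilon>/2"] insert.prems by auto
    define K where "K = 1 + \<bar>v \<bullet> b\<bar>"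
    have K: "K > 0" "\<bar>v \<bullet> b\<bar> \<le> K" by (auto simp: K_def)
    have "isCont (g b) x" using g[OF bB] by (simp add: continuous_on_eq_continuous_at)
    moreover have "\<epsilon> / 2 / K > 0" using insert.prems K by simp
    ultimately obtain d0 where d0: "d0 > 0" "\<And>y. dist y x < d0 \<Longrightarrow> dist (g b y) (g b x) < \<epsilon> / 2 / K"
      unfolding continuous_at_eps_delta by blast
    define \<delta>2 where "\<delta>2 = d0 / (norm ?v + K)"
    have nK: "norm ?v + K > 0" using K norm_ge_zero[of ?v] by linarith
    have \<delta>2: "\<delta>2 > 0" using d0 nK by (simp add: \<delta>2_def)
    have "norm (f (x + s *\<^sub>R (\<Sum>b\<in>insert b B. (v \<bullet> b) *\<^sub>R b)) - f x - s *\<^sub>R (\<Sum>b\<in>insert b B. (v \<bullet> b) *\<^sub>R g b x)) \<le> \<epsilon> * \<bar>s\<bar>"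
      if s: "\<bar>s\<bar> < min \<delta>1 \<delta>2" for s
    proof -
      let ?p = "x + s *\<^sub>R ?v" and ?\<tau> = "s * (v \<bullet> b)"
      have "norm (f (?p + ?\<tau> *\<^sub>R b) - f ?p - ?\<tau> *\<^sub>R g b x) \<le> (\<epsilon> / 2 / K) * \<bar>?\<tau>\<bar>"
      proof (rule mean_value_line[OF d[OF bB]])
        fix \<sigma> assume \<sigma>: "\<bar>\<sigma>\<bar> \<le> \<bar>?\<tau>\<bar>"
        have "dist (?p + \<sigma> *\<^sub>R b) x \<le> \<bar>s\<bar> * norm ?v + \<bar>\<sigma>\<bar> * norm b"
          using norm_triangle_ineq[of "s *\<^sub>R ?v" "\<sigma> *\<^sub>R b"] by (simp add: dist_norm add.assoc)
        also have "\<dots> \<le> \<bar>s\<bar> * norm ?v + \<bar>s\<bar> * K"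
          using \<sigma> K bB mult_left_mono[OF K(2), of "\<bar>s\<bar>"] by (simp add: abs_mult)
        also have "\<dots> = \<bar>s\<bar> * (norm ?v + K)" by (simp add: algebra_simps)
        also have "\<dots> < \<delta>2 * (norm ?v + K)" using s nK by (intro mult_strict_right_mono) auto
        also have "\<dots> = d0" using nK by (simp add: \<delta>2_def)
        finally show "norm (g b (?p + \<sigma> *\<^sub>R b) - g b x) \<le> \<epsilon> / 2 / K" using d0(2)[of "?p + \<sigma> *\<^sub>R b"] by (simp add: dist_norm)
      qed
      also have "(\<epsilon> / 2 / K) * \<bar>?\<tau>\<bar> \<le> (\<epsilon> / 2) * \<bar>s\<bar>"
      proof -
        have "(\<epsilon> / 2 / K) * \<bar>?\<tau>\<bar> = (\<epsilon> / 2) * \<bar>s\<bar> * (\<bar>v \<bullet> b\<bar> / K)" by (simp add: abs_mult)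
        also have "\<dots> \<le> (\<epsilon> / 2) * \<bar>s\<bar> * 1" using K insert.prems by (intro mult_left_mono) auto
        finally show ?thesis by simp
      qed
      finally have 1: "norm (f (?p + ?\<tau> *\<^sub>R b) - f ?p - ?\<tau> *\<^sub>R g b x) \<le> (\<epsilon> / 2) * \<bar>s\<bar>" .
      have 2: "norm (f ?p - f x - s *\<^sub>R (\<Sum>b\<in>B. (v \<bullet> b) *\<^sub>R g b x)) \<le> (\<epsilon> / 2) * \<bar>s\<bar>" using \<delta>1(2)[of s] s by auto
      have e: "f (x + s *\<^sub>R (\<Sum>b\<in>insert b B. (v \<bullet> b) *\<^sub>R b)) - f x - s *\<^sub>R (\<Sum>b\<in>insert b B. (v \<bullet> b) *\<^sub>R g b x)
        = (f (?p + ?\<tau> *\<^sub>R b) - f ?p - ?\<tau> *\<^sub>R g b x) + (f ?p - f x - s *\<^sub>R (\<Sum>b\<in>B. (v \<bullet> b) *\<^sub>R g b x))"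
        using insert.hyps by (simp add: scaleR_add_right add_ac)
      show ?thesis unfolding e using norm_triangle_mono[OF 1 2] by simp
    qed
    then show ?case using \<delta>1(1) \<delta>2 by (intro exI[of _ "min \<delta>1 \<delta>2"]) auto
  qed
  have "\<exists>\<delta>>0. \<forall>s. \<bar>s\<bar> < \<delta> \<longrightarrow> norm (f (x + s *\<^sub>R v) - f x - s *\<^sub>R (\<Sum>b\<in>Basis. (v \<bullet> b) *\<^sub>R g b x)) \<le> \<epsilon> * \<bar>s\<bar>" if "\<epsilon> > 0" for \<epsilon>
    using part[OF finite_Basis order_refl that] by (simp add: euclidean_representation)
  then show ?thesis
    unfolding has_vector_derivative_def has_derivative_at_alt by (auto simp: bounded_linear_scaleR_left)
qed

locale phase_box =
  fixes l \<rho> :: real and u :: "'a::euclidean_space"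
  assumes l: "0 < l" and \<rho>: "0 < \<rho>"
begin

definition adm :: "real \<Rightarrow> ('a \<Rightarrow> 'a \<Rightarrow> complex) \<Rightarrow> bool" where
  "adm M c \<longleftrightarrow> continuous_on UNIV (\<lambda>p. c (fst p) (snd p)) \<and> (\<forall>w \<xi>. cmod (c w \<xi>) \<le> M) \<and>
     (\<forall>w \<xi>. c w \<xi> \<noteq> 0 \<longrightarrow> dist u w \<le> l \<and> norm \<xi> \<le> \<rho>)"

definition has_dxi :: "'a \<Rightarrow> ('a \<Rightarrow> 'a \<Rightarrow> complex) \<Rightarrow> ('a \<Rightarrow> 'a \<Rightarrow> complex) \<Rightarrow> bool" where
  "has_dxi b c c' \<longleftrightarrow> (\<forall>w \<xi>. ((\<lambda>s. c w (\<xi> + s *\<^sub>R b)) has_vector_derivative (c' w \<xi> / complex_of_real \<rho>)) (at 0))"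

definition has_dw :: "'a \<Rightarrow> ('a \<Rightarrow> 'a \<Rightarrow> complex) \<Rightarrow> ('a \<Rightarrow> 'a \<Rightarrow> complex) \<Rightarrow> bool" where
  "has_dw b c c' \<longleftrightarrow> (\<forall>w \<xi>. ((\<lambda>s. c (w + s *\<^sub>R b) \<xi>) has_vector_derivative (c' w \<xi> / complex_of_real l)) (at 0))"

text \<open>Symbols whose derivatives, in the units \<open>\<rho>\<close> for \<open>\<xi>\<close> and \<open>l\<close> for \<open>w\<close>, are bounded by \<open>M\<close>:
  \<open>r\<close> derivatives in \<open>\<xi>\<close>, applied after \<open>k\<close> derivatives in \<open>w\<close>.\<close>

primrec xi_class :: "nat \<Rightarrow> real \<Rightarrow> ('a \<Rightarrow> 'a \<Rightarrow> complex) \<Rightarrow> bool" where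
  "xi_class 0 M c = adm M c"
| "xi_class (Suc r) M c = (adm M c \<and> (\<forall>b\<in>Basis. \<exists>c'. has_dxi b c c' \<and> xi_class r M c'))"

primrec w_class :: "nat \<Rightarrow> nat \<Rightarrow> real \<Rightarrow> ('a \<Rightarrow> 'a \<Rightarrow> complex) \<Rightarrow> bool" where
  "w_class 0 r M c = xi_class r M c"
| "w_class (Suc k) r M c = (xi_class r M c \<and> (\<forall>b\<in>Basis. \<exists>c'. has_dw b c c' \<and> w_class k r M c'))"

lemma adm_nonneg: "adm M c \<Longrightarrow> 0 \<le> M"
  unfolding adm_def using norm_ge_zero order_trans by blast

lemma xi_class_adm: "xi_class r M c \<Longrightarrow> adm M c"
  by (cases r) auto

lemma w_class_xi: "w_class k r M c \<Longrightarrow> xi_class r M c"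
  by (cases k) auto

lemma xi_class_Suc: "xi_class (Suc r) M c \<Longrightarrow> xi_class r M c"
proof (induction r arbitrary: c)
  case (Suc r)
  show ?case unfolding xi_class.simps(2)[of r]
  proof (intro conjI ballI)
    show "adm M c" using Suc.prems by simp
    fix b :: 'a assume "b \<in> Basis"
    then obtain c' where "has_dxi b c c'" "xi_class (Suc r) M c'" using Suc.prems by auto
    then show "\<exists>c'. has_dxi b c c' \<and> xi_class r M c'" using Suc.IH by blast
  qed
qed simp

lemma adm_add: "adm M c \<Longrightarrow> adm M' c' \<Longrightarrow> adm (M + M') (\<lambda>w \<xi>. c w \<xi> + c' w \<xi>)"
  unfolding adm_def by (auto intro!: continuous_intros norm_triangle_mono) (metis add_0)+

lemma adm_scale:
  assumes "adm M c" "cmod k * M \<le> M'" shows "adm M' (\<lambda>w \<xi>. k * c w \<xi>)"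
proof -
  have "cmod (k * c w \<xi>) \<le> M'" for w \<xi>
    using assms mult_left_mono[of "cmod (c w \<xi>)" M "cmod k"] by (auto simp: adm_def norm_mult intro: order_trans)
  then show ?thesis using assms by (auto simp: adm_def intro!: continuous_intros)
qed

lemma adm_coord:
  assumes "adm M c" "e \<in> Basis" shows "adm M (\<lambda>w \<xi>. complex_of_real (\<xi> \<bullet> e / \<rho>) * c w \<xi>)"
proof -
  have "cmod (complex_of_real (\<xi> \<bullet> e / \<rho>) * c w \<xi>) \<le> M" for w \<xi>
  proof (cases "c w \<xi> = 0")
    case False
    then have "norm \<xi> \<le> \<rho>" using assms by (simp add: adm_def)
    then have "\<bar>\<xi> \<bullet> e / \<rho>\<bar> \<le> 1" using Basis_le_norm[OF assms(2), of \<xi>] \<rho> by simp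
    then have "\<bar>\<xi> \<bullet> e / \<rho>\<bar> * cmod (c w \<xi>) \<le> 1 * M" using assms by (intro mult_mono) (auto simp: adm_def)
    then show ?thesis by (simp add: norm_mult norm_divide)
  qed (use adm_nonneg[OF assms(1)] in simp)
  then show ?thesis using assms \<rho> by (auto simp: adm_def intro!: continuous_intros)
qed

lemma has_dxi_add: "has_dxi b c c' \<Longrightarrow> has_dxi b d d' \<Longrightarrow> has_dxi b (\<lambda>w \<xi>. c w \<xi> + d w \<xi>) (\<lambda>w \<xi>. c' w \<xi> + d' w \<xi>)"
  unfolding has_dxi_def add_divide_distrib by (auto intro!: has_vector_derivative_add)

lemma has_dw_add: "has_dw b c c' \<Longrightarrow> has_dw b d d' \<Longrightarrow> has_dw b (\<lambda>w \<xi>. c w \<xi> + d w \<xi>) (\<lambda>w \<xi>. c' w \<xi> + d' w \<xi>)"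
  unfolding has_dw_def add_divide_distrib by (auto intro!: has_vector_derivative_add)

lemma has_dxi_scale: "has_dxi b c c' \<Longrightarrow> has_dxi b (\<lambda>w \<xi>. k * c w \<xi>) (\<lambda>w \<xi>. k * c' w \<xi>)"
  unfolding has_dxi_def by (intro allI) (simp only: times_divide_eq_right[symmetric] has_vector_derivative_mult_right)

lemma has_dw_scale: "has_dw b c c' \<Longrightarrow> has_dw b (\<lambda>w \<xi>. f \<xi> * c w \<xi>) (\<lambda>w \<xi>. f \<xi> * c' w \<xi>)"
  unfolding has_dw_def by (intro allI) (simp only: times_divide_eq_right[symmetric] has_vector_derivative_mult_right)

lemma has_dxi_coord:
  assumes "has_dxi b c c'"
  shows "has_dxi b (\<lambda>w \<xi>. complex_of_real (\<xi> \<bullet> e / \<rho>) * c w \<xi>)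
     (\<lambda>w \<xi>. complex_of_real (b \<bullet> e) * c w \<xi> + complex_of_real (\<xi> \<bullet> e / \<rho>) * c' w \<xi>)"
  unfolding has_dxi_def
proof (intro allI)
  fix w \<xi>
  have "((\<lambda>s. complex_of_real ((\<xi> + s *\<^sub>R b) \<bullet> e / \<rho>)) has_vector_derivative complex_of_real (b \<bullet> e / \<rho>)) (at 0)"
    using \<rho> by (intro has_vector_derivative_of_real) (auto simp: inner_add_left intro!: derivative_eq_intros)
  moreover have "((\<lambda>s. c w (\<xi> + s *\<^sub>R b)) has_vector_derivative (c' w \<xi> / complex_of_real \<rho>)) (at 0)"
    using assms by (simp add: has_dxi_def)
  ultimately have "((\<lambda>s. complex_of_real ((\<xi> + s *\<^sub>R b) \<bullet> e / \<rho>) * c w (\<xi> + s *\<^sub>R b)) has_vector_derivative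
     complex_of_real ((\<xi> + 0 *\<^sub>R b) \<bullet> e / \<rho>) * (c' w \<xi> / complex_of_real \<rho>) + complex_of_real (b \<bullet> e / \<rho>) * c w (\<xi> + 0 *\<^sub>R b)) (at 0)"
    by (rule has_vector_derivative_mult)
  then show "((\<lambda>s. complex_of_real ((\<xi> + s *\<^sub>R b) \<bullet> e / \<rho>) * c w (\<xi> + s *\<^sub>R b)) has_vector_derivative
     (complex_of_real (b \<bullet> e) * c w \<xi> + complex_of_real (\<xi> \<bullet> e / \<rho>) * c' w \<xi>) / complex_of_real \<rho>) (at 0)"
    by (simp add: add_divide_distrib add.commute)
qed

lemma xi_class_add: "xi_class r M c \<Longrightarrow> xi_class r M' c' \<Longrightarrow> xi_class r (M + M') (\<lambda>w \<xi>. c w \<xi> + c' w \<xi>)"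
proof (induction r arbitrary: c c')
  case (Suc r)
  show ?case unfolding xi_class.simps
  proof (intro conjI ballI)
    show "adm (M + M') (\<lambda>w \<xi>. c w \<xi> + c' w \<xi>)" using Suc.prems by (auto intro: adm_add)
    fix b :: 'a assume b: "b \<in> Basis"
    obtain d where "has_dxi b c d" "xi_class r M d" using Suc.prems b by auto
    moreover obtain d' where "has_dxi b c' d'" "xi_class r M' d'" using Suc.prems b by auto
    ultimately show "\<exists>d. has_dxi b (\<lambda>w \<xi>. c w \<xi> + c' w \<xi>) d \<and> xi_class r (M + M') d"
      using has_dxi_add Suc.IH by blast
  qed
qed (simp add: adm_add)

lemma xi_class_scale: "xi_class r M c \<Longrightarrow> cmod k * M \<le> M' \<Longrightarrow> xi_class r M' (\<lambda>w \<xi>. k * c w \<xi>)"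
proof (induction r arbitrary: c)
  case (Suc r)
  show ?case unfolding xi_class.simps
  proof (intro conjI ballI)
    show "adm M' (\<lambda>w \<xi>. k * c w \<xi>)" using Suc.prems by (auto intro: adm_scale)
    fix b :: 'a assume b: "b \<in> Basis"
    obtain d where "has_dxi b c d" "xi_class r M d" using Suc.prems b by auto
    then show "\<exists>d. has_dxi b (\<lambda>w \<xi>. k * c w \<xi>) d \<and> xi_class r M' d"
      using has_dxi_scale Suc.IH[OF _ Suc.prems(2)] by blast
  qed
qed (simp add: adm_scale)

lemma xi_class_mono: "xi_class r M c \<Longrightarrow> M \<le> M' \<Longrightarrow> xi_class r M' c"
  using xi_class_scale[of r M c 1 M'] by simp

text \<open>On the support \<open>\<bar>\<xi>\<^sub>e / \<rho>\<bar> \<le> 1\<close> and its scaled derivative is at most \<open>1\<close>, so that each derivative at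
  most doubles the bound.\<close>

lemma xi_class_coord:
  assumes e: "e \<in> Basis"
  shows "xi_class r M c \<Longrightarrow> xi_class r (2 ^ r * M) (\<lambda>w \<xi>. complex_of_real (\<xi> \<bullet> e / \<rho>) * c w \<xi>)"
proof (induction r arbitrary: c)
  case 0
  then show ?case using adm_coord[OF _ e] by simp
next
  case (Suc r)
  have M: "0 \<le> M" using Suc.prems adm_nonneg by auto
  then have M2: "M \<le> 2 ^ r * M" using mult_right_mono[of 1 "2 ^ r" M] by simp
  have M3: "M \<le> 2 ^ Suc r * M" using M2 M by simp
  show ?case unfolding xi_class.simps
  proof (intro conjI ballI)
    have "adm (2 ^ Suc r * M) (\<lambda>w \<xi>. 1 * (complex_of_real (\<xi> \<bullet> e / \<rho>) * c w \<xi>))"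
      using Suc.prems M3 by (intro adm_scale[OF adm_coord[OF _ e]]) auto
    then show "adm (2 ^ Suc r * M) (\<lambda>w \<xi>. complex_of_real (\<xi> \<bullet> e / \<rho>) * c w \<xi>)" by simp
    fix b :: 'a assume b: "b \<in> Basis"
    obtain d where d: "has_dxi b c d" "xi_class r M d" using Suc.prems b by auto
    have "xi_class r M (\<lambda>w \<xi>. complex_of_real (b \<bullet> e) * c w \<xi>)"
    proof (rule xi_class_scale[OF xi_class_Suc[OF Suc.prems]])
      have "\<bar>b \<bullet> e\<bar> \<le> 1" using b e by (simp add: inner_Basis)
      then show "cmod (complex_of_real (b \<bullet> e)) * M \<le> M" using M mult_right_mono[of "\<bar>b \<bullet> e\<bar>" 1 M] by simp
    qed
    from xi_class_add[OF this Suc.IH[OF d(2)]]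
    have "xi_class r (M + 2 ^ r * M) (\<lambda>w \<xi>. complex_of_real (b \<bullet> e) * c w \<xi> + complex_of_real (\<xi> \<bullet> e / \<rho>) * d w \<xi>)" .
    then have "xi_class r (2 ^ Suc r * M) (\<lambda>w \<xi>. complex_of_real (b \<bullet> e) * c w \<xi> + complex_of_real (\<xi> \<bullet> e / \<rho>) * d w \<xi>)"
      by (rule xi_class_mono) (use M2 in \<open>simp add: mult.commute\<close>)
    then show "\<exists>d. has_dxi b (\<lambda>w \<xi>. complex_of_real (\<xi> \<bullet> e / \<rho>) * c w \<xi>) d \<and> xi_class r (2 ^ Suc r * M) d"
      using has_dxi_coord[OF d(1)] by blast
  qed
qed

lemma w_class_Suc: "w_class (Suc k) r M c \<Longrightarrow> w_class k r M c"
proof (induction k arbitrary: c)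
  case (Suc k)
  show ?case unfolding w_class.simps(2)[of k]
  proof (intro conjI ballI)
    show "xi_class r M c" using Suc.prems by simp
    fix b :: 'a assume "b \<in> Basis"
    then obtain c' where "has_dw b c c'" "w_class (Suc k) r M c'" using Suc.prems by auto
    then show "\<exists>c'. has_dw b c c' \<and> w_class k r M c'" using Suc.IH by blast
  qed
qed simp

lemma w_class_add: "w_class k r M c \<Longrightarrow> w_class k r M' c' \<Longrightarrow> w_class k r (M + M') (\<lambda>w \<xi>. c w \<xi> + c' w \<xi>)"
proof (induction k arbitrary: c c')
  case (Suc k)
  show ?case unfolding w_class.simps
  proof (intro conjI ballI)
    show "xi_class r (M + M') (\<lambda>w \<xi>. c w \<xi> + c' w \<xi>)" using Suc.prems by (auto intro: xi_class_add)
    fix b :: 'a assume b: "b \<in> Basis"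
    obtain d where "has_dw b c d" "w_class k r M d" using Suc.prems b by auto
    moreover obtain d' where "has_dw b c' d'" "w_class k r M' d'" using Suc.prems b by auto
    ultimately show "\<exists>d. has_dw b (\<lambda>w \<xi>. c w \<xi> + c' w \<xi>) d \<and> w_class k r (M + M') d"
      using has_dw_add Suc.IH by blast
  qed
qed (simp add: xi_class_add)

lemma w_class_scale: "w_class k r M c \<Longrightarrow> cmod a * M \<le> M' \<Longrightarrow> w_class k r M' (\<lambda>w \<xi>. a * c w \<xi>)"
proof (induction k arbitrary: c)
  case (Suc k)
  show ?case unfolding w_class.simps
  proof (intro conjI ballI)
    show "xi_class r M' (\<lambda>w \<xi>. a * c w \<xi>)" using Suc.prems by (auto intro: xi_class_scale)
    fix b :: 'a assume b: "b \<in> Basis"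
    obtain d where "has_dw b c d" "w_class k r M d" using Suc.prems b by auto
    then show "\<exists>d. has_dw b (\<lambda>w \<xi>. a * c w \<xi>) d \<and> w_class k r M' d"
      using has_dw_scale[of b c d "\<lambda>_. a"] Suc.IH[OF _ Suc.prems(2)] by blast
  qed
qed (simp add: xi_class_scale)

lemma w_class_coord:
  assumes e: "e \<in> Basis"
  shows "w_class k r M c \<Longrightarrow> w_class k r (2 ^ r * M) (\<lambda>w \<xi>. complex_of_real (\<xi> \<bullet> e / \<rho>) * c w \<xi>)"
proof (induction k arbitrary: c)
  case (Suc k)
  show ?case unfolding w_class.simps
  proof (intro conjI ballI)
    show "xi_class r (2 ^ r * M) (\<lambda>w \<xi>. complex_of_real (\<xi> \<bullet> e / \<rho>) * c w \<xi>)"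
      by (rule xi_class_coord[OF e w_class_xi[OF Suc.prems]])
    fix b :: 'a assume b: "b \<in> Basis"
    obtain d where "has_dw b c d" "w_class k r M d" using Suc.prems b by auto
    then show "\<exists>d. has_dw b (\<lambda>w \<xi>. complex_of_real (\<xi> \<bullet> e / \<rho>) * c w \<xi>) d \<and> w_class k r (2 ^ r * M) d"
      using has_dw_scale[of b c d "\<lambda>\<xi>. complex_of_real (\<xi> \<bullet> e / \<rho>)"] Suc.IH by blast
  qed
qed (use xi_class_coord[OF e] in simp)

end

context phase_box
begin

text \<open>Differentiating the operator with symbol \<open>c\<close> in \<open>x\<^sub>b\<close> gives the operator whose symbol is
  \<open>\<i> \<alpha> \<xi>\<^sub>b c + (1 - t) \<partial>\<^sub>b c\<close>; both terms cost a factor of order \<open>\<alpha> \<rho>\<close>, because \<open>1 / l \<le> \<alpha> \<rho> / l\<^sub>0\<close>.\<close>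

lemma w_class_step:
  assumes W: "w_class (Suc k) r M c" and b: "b \<in> Basis"
    and \<alpha>: "0 < \<alpha>" and l0: "0 < l\<^sub>0" "l\<^sub>0 \<le> \<alpha> * l * \<rho>" and t: "0 \<le> t" "t \<le> 1"
  shows "\<exists>D. has_dw b c D \<and> w_class k r M D \<and> w_class k r (\<alpha> * \<rho> * (2 ^ r + 1 / l\<^sub>0) * M)
    (\<lambda>w \<xi>. \<i> * of_real (\<alpha> * (\<xi> \<bullet> b)) * c w \<xi> + complex_of_real ((1 - t) / l) * D w \<xi>)"
proof -
  obtain D where D: "has_dw b c D" "w_class k r M D" using W b by auto
  have M: "0 \<le> M" by (rule adm_nonneg[OF xi_class_adm[OF w_class_xi[OF W]]])
  have 1: "w_class k r (\<alpha> * \<rho> * 2 ^ r * M) (\<lambda>w \<xi>. (\<i> * of_real (\<alpha> * \<rho>)) * (complex_of_real (\<xi> \<bullet> b / \<rho>) * c w \<xi>))"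
    by (rule w_class_scale[OF w_class_coord[OF b w_class_Suc[OF W]]]) (use \<alpha> \<rho> in \<open>simp add: norm_mult\<close>)
  have "1 / l \<le> \<alpha> * \<rho> / l\<^sub>0" using l l0 by (simp add: field_simps)
  then have "(1 - t) / l \<le> \<alpha> * \<rho> / l\<^sub>0" using t l by (auto simp: field_simps intro: order_trans[rotated])
  then have 2: "w_class k r (\<alpha> * \<rho> * (1 / l\<^sub>0) * M) (\<lambda>w \<xi>. complex_of_real ((1 - t) / l) * D w \<xi>)"
  proof (intro w_class_scale[OF D(2)])
    assume "(1 - t) / l \<le> \<alpha> * \<rho> / l\<^sub>0"
    moreover have "cmod (complex_of_real ((1 - t) / l)) = (1 - t) / l" unfolding norm_of_real using t l by simp
    ultimately show "cmod (complex_of_real ((1 - t) / l)) * M \<le> \<alpha> * \<rho> * (1 / l\<^sub>0) * M"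
      using M by (intro mult_right_mono) auto
  qed
  have e: "(\<i> * of_real (\<alpha> * \<rho>)) * (complex_of_real (\<xi> \<bullet> b / \<rho>) * c w \<xi>) = \<i> * of_real (\<alpha> * (\<xi> \<bullet> b)) * c w \<xi>" for w \<xi>
    using \<rho> by simp
  have "\<alpha> * \<rho> * (2 ^ r + 1 / l\<^sub>0) * M = \<alpha> * \<rho> * 2 ^ r * M + \<alpha> * \<rho> * (1 / l\<^sub>0) * M"
    by (simp only: distrib_left distrib_right)
  then show ?thesis using w_class_add[OF 1 2] D unfolding e by (intro exI[of _ D]) simp
qed

end

text \<open>Hence every derivative of the symbol is supported where the symbol is.\<close>

lemma iter_deriv_zero_on_open:
  assumes U: "open U" and 0: "\<And>z. z \<in> U \<Longrightarrow> a z = 0"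
  shows "z \<in> U \<Longrightarrow> iter_deriv bs a z = 0"
proof (induction bs arbitrary: z)
  case (Cons b bs)
  have "((\<lambda>s. iter_deriv bs a (z + s *\<^sub>R b)) has_vector_derivative 0) (at 0)"
  proof (rule has_vector_derivative_transform_within_open[OF has_vector_derivative_const])
    show "open ((\<lambda>s::real. z + s *\<^sub>R b) -` U)" by (rule open_vimage[OF U]) (intro continuous_intros)
    show "0 \<in> (\<lambda>s::real. z + s *\<^sub>R b) -` U" using Cons.prems by simp
    show "0 = iter_deriv bs a (z + s *\<^sub>R b)" if "s \<in> (\<lambda>s::real. z + s *\<^sub>R b) -` U" for s
      using Cons.IH that by simp
  qed
  then show ?case by (simp add: vector_derivative_at)
qed (use 0 in simp)

lemma symbol_norm_entry:
  fixes a :: "'a::euclidean_space \<times> 'a \<Rightarrow> complex"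
  assumes "set bs \<subseteq> Basis" "length bs \<le> n" "set cs \<subseteq> Basis" "length cs \<le> m" "0 < l" "0 < \<rho>"
  shows "ennreal (l ^ length bs * \<rho> ^ length cs * cmod (iter_deriv (phase_dirs bs cs) a z)) \<le> symbol_norm n m a l \<rho>"
proof -
  let ?k = "length bs" and ?r = "length cs"
  let ?L = "\<lambda>k. {bs. set bs \<subseteq> (Basis::'a set) \<and> length bs = k}"
  have fin: "finite (?L k)" for k by (rule finite_lists_length_eq[OF finite_Basis])
  have "(cmod (iter_deriv (phase_dirs bs cs) a z))\<^sup>2 \<le> (\<Sum>cs\<in>?L ?r. (cmod (iter_deriv (phase_dirs bs cs) a z))\<^sup>2)"
    by (rule member_le_sum) (use assms fin in auto)
  also have "\<dots> \<le> (\<Sum>bs\<in>?L ?k. \<Sum>cs\<in>?L ?r. (cmod (iter_deriv (phase_dirs bs cs) a z))\<^sup>2)"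
    by (rule member_le_sum[of bs]) (use assms fin in \<open>auto intro: sum_nonneg\<close>)
  finally have "cmod (iter_deriv (phase_dirs bs cs) a z) \<le> grad_norm ?k ?r a z"
    unfolding grad_norm_def by (rule real_le_rsqrt)
  then have "ennreal (l ^ ?k * \<rho> ^ ?r * cmod (iter_deriv (phase_dirs bs cs) a z)) \<le> ennreal (l ^ ?k * \<rho> ^ ?r * grad_norm ?k ?r a z)"
    using assms by (intro ennreal_leI mult_left_mono) auto
  also have "\<dots> \<le> (SUP z. ennreal (l ^ ?k * \<rho> ^ ?r * grad_norm ?k ?r a z))" by (rule SUP_upper) simp
  also have "\<dots> \<le> (MAX r\<in>{0..m}. SUP z. ennreal (l ^ ?k * \<rho> ^ r * grad_norm ?k r a z))"
    by (rule Max_ge) (use assms in auto)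
  also have "\<dots> \<le> symbol_norm n m a l \<rho>"
    unfolding symbol_norm_def by (rule Max_ge) (use assms in auto)
  finally show ?thesis .
qed

lemma symbol_norm_finite:
  fixes a :: "'a::euclidean_space \<times> 'a \<Rightarrow> complex"
  assumes a: "a \<in> symbol_class n m" and l: "0 < l" "0 < \<rho>"
  shows "symbol_norm n m a l \<rho> < \<infinity>"
proof -
  obtain l' \<rho>' where l': "0 < l'" "0 < \<rho>'" and fin: "symbol_norm n m a l' \<rho>' < \<infinity>"
    using a by (auto simp: symbol_class_def)
  have "(SUP z. ennreal (l ^ k * \<rho> ^ r * grad_norm k r a z)) < top" if "k \<in> {0..n}" "r \<in> {0..m}" for k r
  proof -
    have "(SUP z. ennreal (l' ^ k * \<rho>' ^ r * grad_norm k r a z)) \<le> (MAX r\<in>{0..m}. SUP z. ennreal (l' ^ k * \<rho>' ^ r * grad_norm k r a z))"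
      by (rule Max_ge) (use that in auto)
    also have "\<dots> \<le> symbol_norm n m a l' \<rho>'"
      unfolding symbol_norm_def by (rule Max_ge) (use that in auto)
    finally have f: "(SUP z. ennreal (l' ^ k * \<rho>' ^ r * grad_norm k r a z)) < top" using fin by (simp add: less_top order.strict_trans1)
    let ?q = "(l / l') ^ k * (\<rho> / \<rho>') ^ r"
    have q: "?q \<ge> 0" using l l' by simp
    have "ennreal (l ^ k * \<rho> ^ r * grad_norm k r a z) = ennreal ?q * ennreal (l' ^ k * \<rho>' ^ r * grad_norm k r a z)" for z
    proof -
      have "0 \<le> grad_norm k r a z" unfolding grad_norm_def by (intro real_sqrt_ge_zero sum_nonneg) auto
      then show ?thesis using l l' q by (subst ennreal_mult[symmetric]) (auto simp: power_divide)
    qed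
    then have "(SUP z. ennreal (l ^ k * \<rho> ^ r * grad_norm k r a z)) = ennreal ?q * (SUP z. ennreal (l' ^ k * \<rho>' ^ r * grad_norm k r a z))"
      by (simp add: SUP_mult_left_ennreal)
    then show ?thesis using f by (simp add: ennreal_mult_less_top)
  qed
  then show ?thesis unfolding symbol_norm_def by (subst Max_less_iff) auto
qed

lemma phase_dirs_Cons: "phase_dirs (b # bs) cs = (b, 0) # phase_dirs bs cs"
  by (simp add: phase_dirs_def)

lemma symbol_w_derivative:
  assumes "iter_differentiable (phase_dirs (b # bs) cs) a"
  shows "((\<lambda>s. iter_deriv (phase_dirs bs cs) a (z + s *\<^sub>R (b, 0))) has_vector_derivative iter_deriv (phase_dirs (b # bs) cs) a z) (at 0)"
proof -
  have "\<forall>x. (\<lambda>s. iter_deriv (phase_dirs bs cs) a (x + s *\<^sub>R (b, 0))) differentiable (at (0::real))"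
    using assms unfolding phase_dirs_Cons iter_differentiable.simps by (rule conjunct2)
  then show ?thesis unfolding phase_dirs_Cons iter_deriv.simps
    by (intro vector_derivative_works[THEN iffD1]) (rule spec)
qed

text \<open>The iterated derivatives of the definition are taken in \<open>\<xi>\<close> first, whereas a further derivative in
  \<open>\<xi>\<close> is wanted after those in \<open>w\<close>; it is moved inside past one \<open>w\<close> direction at a time.\<close>

lemma symbol_xi_derivative:
  fixes a :: "'a::euclidean_space \<times> 'a \<Rightarrow> complex"
  assumes a: "a \<in> symbol_class n m"
    and cs: "set (c # cs) \<subseteq> Basis" "length (c # cs) \<le> m"
  shows "set bs \<subseteq> Basis \<Longrightarrow> length bs \<le> n \<Longrightarrow>
    ((\<lambda>s. iter_deriv (phase_dirs bs cs) a (z + s *\<^sub>R (0, c))) has_vector_derivative iter_deriv (phase_dirs bs (c # cs)) a z) (at 0)"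
proof (induction bs arbitrary: z)
  case Nil
  have "iter_differentiable (phase_dirs [] (c # cs)) a"
    using a cs by (force simp: symbol_class_def)
  then have "\<forall>x. (\<lambda>s. iter_deriv (phase_dirs [] cs) a (x + s *\<^sub>R (0, c))) differentiable (at (0::real))"
    unfolding phase_dirs_def list.map append_Nil iter_differentiable.simps by (rule conjunct2)
  moreover have "iter_deriv (phase_dirs [] (c # cs)) a z = vector_derivative (\<lambda>s. iter_deriv (phase_dirs [] cs) a (z + s *\<^sub>R (0, c))) (at 0)"
    by (simp only: phase_dirs_def list.map append_Nil iter_deriv.simps)
  ultimately show ?case by (simp only: vector_derivative_works[symmetric]) 
next
  case (Cons b bs)
  have D: "iter_differentiable (phase_dirs (b # bs) cs) a" "iter_differentiable (phase_dirs (b # bs) (c # cs)) a"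
    "continuous_on UNIV (iter_deriv (phase_dirs (b # bs) (c # cs)) a)"
    using a cs Cons.prems by (simp_all add: symbol_class_def)
  show ?case
  proof (rule directional_derivatives_commute)
    show "((\<lambda>s. iter_deriv (phase_dirs bs cs) a (x + s *\<^sub>R (0, c))) has_vector_derivative iter_deriv (phase_dirs bs (c # cs)) a x) (at 0)" for x
      using Cons by simp
    show "((\<lambda>s. iter_deriv (phase_dirs bs cs) a (x + s *\<^sub>R (b, 0))) has_vector_derivative iter_deriv (phase_dirs (b # bs) cs) a x) (at 0)" for x
      by (rule symbol_w_derivative[OF D(1)])
    show "((\<lambda>s. iter_deriv (phase_dirs bs (c # cs)) a (x + s *\<^sub>R (b, 0))) has_vector_derivative iter_deriv (phase_dirs (b # bs) (c # cs)) a x) (at 0)" for x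
      by (rule symbol_w_derivative[OF D(2)])
  qed (rule D(3))
qed

context phase_box
begin

lemma symbol_w_class:
  fixes a :: "'a \<times> 'a \<Rightarrow> complex" and \<mu> :: 'a
  assumes a: "a \<in> symbol_class n m" and supp: "closure {z. a z \<noteq> 0} \<subseteq> ball u l \<times> ball \<mu> \<rho>"
  shows "w_class n m (enn2real (symbol_norm n m a l \<rho>)) (\<lambda>w \<xi>. a (w, \<xi> + \<mu>))"
proof -
  define N where "N = enn2real (symbol_norm n m a l \<rho>)"
  have N: "symbol_norm n m a l \<rho> = ennreal N"
    using symbol_norm_finite[OF a l \<rho>] by (simp add: N_def less_top)
  have N0: "N \<ge> 0" by (simp add: N_def)
  define S where "S bs cs w \<xi> = complex_of_real (l ^ length bs * \<rho> ^ length cs) * iter_deriv (phase_dirs bs cs) a (w, \<xi> + \<mu>)" for bs cs w \<xi>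
  have adm: "adm N (S bs cs)" if bs: "set bs \<subseteq> Basis" "length bs \<le> n" and cs: "set cs \<subseteq> Basis" "length cs \<le> m" for bs cs
    unfolding adm_def
  proof (intro conjI allI impI)
    have c: "continuous_on UNIV (iter_deriv (phase_dirs bs cs) a)" using a bs cs by (simp add: symbol_class_def)
    have "continuous_on UNIV (\<lambda>p::'a \<times> 'a. iter_deriv (phase_dirs bs cs) a (fst p, snd p + \<mu>))"
      by (rule continuous_on_compose2[OF c]) (auto intro!: continuous_intros)
    then show "continuous_on UNIV (\<lambda>p. S bs cs (fst p) (snd p))" unfolding S_def by (intro continuous_intros)
    fix w \<xi>
    have "ennreal (l ^ length bs * \<rho> ^ length cs * cmod (iter_deriv (phase_dirs bs cs) a (w, \<xi> + \<mu>))) \<le> ennreal N"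
      using symbol_norm_entry[OF bs cs l \<rho>, of a] N by simp
    then have "l ^ length bs * \<rho> ^ length cs * cmod (iter_deriv (phase_dirs bs cs) a (w, \<xi> + \<mu>)) \<le> N"
      using N0 by (simp add: ennreal_le_iff)
    then show "cmod (S bs cs w \<xi>) \<le> N" using l \<rho> by (simp add: S_def norm_mult norm_power)
    have "open (- (cball u l \<times> cball \<mu> \<rho>))" by (intro open_Compl closed_Times closed_cball)
    moreover have "a z = 0" if "z \<in> - (cball u l \<times> cball \<mu> \<rho>)" for z
      using that supp closure_subset[of "{z. a z \<noteq> 0}"] by (fastforce simp: mem_Times_iff)
    ultimately have "(w, \<xi> + \<mu>) \<in> - (cball u l \<times> cball \<mu> \<rho>) \<Longrightarrow> iter_deriv (phase_dirs bs cs) a (w, \<xi> + \<mu>) = 0"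
      by (rule iter_deriv_zero_on_open)
    moreover assume "S bs cs w \<xi> \<noteq> 0"
    ultimately have "(w, \<xi> + \<mu>) \<in> cball u l \<times> cball \<mu> \<rho>" by (auto simp: S_def)
    then show "dist u w \<le> l" "norm \<xi> \<le> \<rho>" by (auto simp: dist_norm)
  qed
  have xi: "xi_class r N (S bs cs)" if "set bs \<subseteq> Basis" "length bs \<le> n" "set cs \<subseteq> Basis" "length cs + r \<le> m" for r bs cs
    using that
  proof (induction r arbitrary: cs)
    case (Suc r)
    show ?case unfolding xi_class.simps
    proof (intro conjI ballI)
      show "adm N (S bs cs)" using Suc.prems by (intro adm) auto
      fix b :: 'a assume b: "b \<in> Basis"
      have "has_dxi b (S bs cs) (S bs (b # cs))"
        unfolding has_dxi_def
      proof (intro allI)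
        fix w \<xi>
        have "((\<lambda>s. iter_deriv (phase_dirs bs cs) a ((w, \<xi> + \<mu>) + s *\<^sub>R (0, b))) has_vector_derivative iter_deriv (phase_dirs bs (b # cs)) a (w, \<xi> + \<mu>)) (at 0)"
          using Suc.prems b by (intro symbol_xi_derivative[OF a]) auto
        from has_vector_derivative_mult_right[OF this, of "complex_of_real (l ^ length bs * \<rho> ^ length cs)"]
        show "((\<lambda>s. S bs cs w (\<xi> + s *\<^sub>R b)) has_vector_derivative S bs (b # cs) w \<xi> / complex_of_real \<rho>) (at 0)"
          using \<rho> by (simp add: S_def algebra_simps)
      qed
      moreover have "xi_class r N (S bs (b # cs))" using Suc.prems b by (intro Suc.IH) auto
      ultimately show "\<exists>c'. has_dxi b (S bs cs) c' \<and> xi_class r N c'" by blast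
    qed
  qed (simp add: adm)
  have "w_class k m N (S bs [])" if "set bs \<subseteq> Basis" "length bs + k \<le> n" for k bs
    using that
  proof (induction k arbitrary: bs)
    case (Suc k)
    show ?case unfolding w_class.simps
    proof (intro conjI ballI)
      show "xi_class m N (S bs [])" using Suc.prems by (intro xi) auto
      fix b :: 'a assume b: "b \<in> Basis"
      have "has_dw b (S bs []) (S (b # bs) [])"
        unfolding has_dw_def
      proof (intro allI)
        fix w \<xi>
        have "iter_differentiable (phase_dirs (b # bs) []) a"
          using a Suc.prems b by (simp add: symbol_class_def)
        from symbol_w_derivative[OF this, of "(w, \<xi> + \<mu>)"]
        have "((\<lambda>s. iter_deriv (phase_dirs bs []) a ((w, \<xi> + \<mu>) + s *\<^sub>R (b, 0))) has_vector_derivative iter_deriv (phase_dirs (b # bs) []) a (w, \<xi> + \<mu>)) (at 0)" .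
        from has_vector_derivative_mult_right[OF this, of "complex_of_real (l ^ length bs)"]
        show "((\<lambda>s. S bs [] (w + s *\<^sub>R b) \<xi>) has_vector_derivative S (b # bs) [] w \<xi> / complex_of_real l) (at 0)"
          using l by (simp add: S_def algebra_simps)
      qed
      moreover have "w_class k m N (S (b # bs) [])" using Suc.prems b by (intro Suc.IH) auto
      ultimately show "\<exists>c'. has_dw b (S bs []) c' \<and> w_class k m N c'" by blast
    qed
  qed (simp add: xi)
  from this[of "[]" n] have "w_class n m N (S [] [])" by simp
  moreover have "S [] [] = (\<lambda>w \<xi>. a (w, \<xi> + \<mu>))" by (simp add: S_def phase_dirs_def fun_eq_iff)
  ultimately show ?thesis by (simp add: N_def)
qed

end

section \<open>The Poincare inequality on convex sets\<close>

lemma LINT_FTC_line: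
  fixes f :: "'b::real_normed_vector \<Rightarrow> complex"
  assumes d: "\<And>x. ((\<lambda>s. f (x + s *\<^sub>R v)) has_vector_derivative g x) (at 0)"
    and g: "continuous_on UNIV g"
  shows "f (x + v) - f x = (LINT s|lborel. indicator {0..1} s *\<^sub>R g (x + s *\<^sub>R v))"
proof -
  have "(LINT s|lborel. indicator {0..1} s *\<^sub>R g (x + s *\<^sub>R v)) = f (x + 1 *\<^sub>R v) - f (x + 0 *\<^sub>R v)"
  proof (rule integral_FTC_Icc)
    show "continuous_on {0..1} (\<lambda>s::real. g (x + s *\<^sub>R v))"
      by (rule continuous_on_compose2[OF g]) (auto intro!: continuous_intros)
  qed (auto intro: directional_derivative_along_line[OF d])
  then show ?thesis by simp
qed

lemma integrable_inverse_square: "integrable lborel (\<lambda>s::real. inverse (1 + s\<^sup>2))"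
  using integrable_inverse_1_plus_square by (simp add: set_integrable_def)

lemma integrable_pair_slices:
  fixes F :: "real \<Rightarrow> 'b::euclidean_space \<Rightarrow> complex"
  assumes [measurable]: "jointly_measurable F"
    and B: "\<And>s. (\<integral>\<^sup>+y. ennreal (cmod (F s y)) \<partial>lborel) \<le> B * indicator {0..1} s" "B < \<infinity>"
  shows "integrable (lborel \<Otimes>\<^sub>M lborel) (case_prod F)"
proof (rule integrableI_bounded)
  show "case_prod F \<in> borel_measurable (lborel \<Otimes>\<^sub>M lborel)" unfolding split_beta' by measurable
  have "(\<integral>\<^sup>+p. ennreal (cmod (case_prod F p)) \<partial>(lborel \<Otimes>\<^sub>M lborel)) = (\<integral>\<^sup>+s. \<integral>\<^sup>+y. ennreal (cmod (F s y)) \<partial>lborel \<partial>lborel)"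
    by (subst lborel.nn_integral_fst[symmetric]) (simp_all add: split_beta')
  also have "\<dots> \<le> (\<integral>\<^sup>+s. B * indicator {0..1::real} s \<partial>lborel)" by (rule nn_integral_mono) (rule B(1))
  also have "\<dots> = B * emeasure lborel {0..1::real}" by (simp add: nn_integral_cmult_indicator)
  also have "\<dots> < \<infinity>" using B(2) by (simp add: ennreal_mult_less_top)
  finally show "(\<integral>\<^sup>+p. ennreal (cmod (case_prod F p)) \<partial>(lborel \<Otimes>\<^sub>M lborel)) < \<infinity>" .
qed

text \<open>The integral of a derivative vanishes, by invariance under the translation by \<open>b\<close>.\<close>

lemma LINT_directional_derivative_zero:
  fixes f :: "'a::euclidean_space \<Rightarrow> complex"
  assumes d: "\<And>x. ((\<lambda>s. f (x + s *\<^sub>R b)) has_vector_derivative f' x) (at 0)"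
    and f': "continuous_on UNIV f'" and f: "integrable lborel f"
    and M: "\<And>x. cmod (f' x) \<le> M" "\<And>x. f' x \<noteq> 0 \<Longrightarrow> norm x \<le> r"
  shows "(LINT x|lborel. f' x) = 0"
proof -
  have [measurable]: "f' \<in> borel_measurable borel" using f' by (rule borel_measurable_continuous_onI)
  have M0: "M \<ge> 0" using M(1)[of 0] norm_ge_zero order_trans by blast
  let ?F = "\<lambda>(s::real) x. indicator {0..1} s *\<^sub>R f' (x + s *\<^sub>R b)"
  have int: "integrable (lborel \<Otimes>\<^sub>M lborel) (case_prod ?F)"
  proof (rule integrable_pair_bound[where a = "indicator {0..1}" and b = "\<lambda>x. M * indicator (cball 0 (r + norm b)) x"])
    show "jointly_measurable ?F" by measurable
    show "0 \<le> M * indicator (cball 0 (r + norm b)) y" for y :: 'a using M0 by simp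
    show "0 \<le> (indicator {0..1::real} s :: real)" for s by simp
    show "integrable lborel (indicator {0..1::real} :: real \<Rightarrow> real)" by simp
    show "integrable lborel (\<lambda>x::'a. M * indicator (cball 0 (r + norm b)) x)" 
      by (intro integrable_mult_right integrable_real_indicator emeasure_lborel_cball_finite) simp
    fix s :: real and x :: 'a
    show "cmod (?F s x) \<le> indicator {0..1} s * (M * indicator (cball 0 (r + norm b)) x)"
    proof (cases "s \<in> {0..1} \<and> f' (x + s *\<^sub>R b) \<noteq> 0")
      case True
      then have "norm (x + s *\<^sub>R b) \<le> r" using M(2) by blast
      moreover have "norm (s *\<^sub>R b) \<le> norm b" using True mult_right_mono[of "\<bar>s\<bar>" 1 "norm b"] by auto
      ultimately have "norm x \<le> r + norm b" using norm_triangle_ineq4[of "x + s *\<^sub>R b" "s *\<^sub>R b"] by simp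
      then show ?thesis using True M(1)[of "x + s *\<^sub>R b"] by (simp add: indicator_def)
    next
      case False
      then have "?F s x = 0" by (cases "s \<in> {0..1}") simp_all
      then have "cmod (?F s x) = 0" by (simp only: norm_zero)
      moreover have "0 \<le> indicator {0..1} s * (M * indicator (cball 0 (r + norm b)) x)" using M0 by simp
      ultimately show ?thesis by linarith
    qed
  qed
  have sh: "(LINT x|lborel. h (x + v)) = (LINT x|lborel. h x)" if [measurable]: "h \<in> borel_measurable borel" for h :: "'a \<Rightarrow> complex" and v
  proof -
    have "(LINT x|lborel. h x) = (LINT x|distr lborel borel ((+) v). h x)" by (simp only: lborel_distr_plus)
    also have "\<dots> = (LINT x|lborel. h (v + x))" by (rule integral_distr) measurable
    finally show ?thesis by (simp only: add.commute)
  qed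
  have [measurable]: "f \<in> borel_measurable borel" using borel_measurable_integrable[OF f] by simp
  have f2: "integrable lborel (\<lambda>x. f (x + b))"
  proof -
    have "integrable (distr lborel borel ((+) b)) f" using f by (simp only: lborel_distr_plus)
    then have "integrable lborel (\<lambda>x. f (b + x))" by (subst (asm) integrable_distr_eq) measurable
    then show ?thesis by (simp only: add.commute)
  qed
  have "0 = (LINT x|lborel. f (x + b)) - (LINT x|lborel. f x)" by (simp add: sh)
  also have "\<dots> = (LINT x|lborel. f (x + b) - f x)" using f f2 by simp
  also have "\<dots> = (LINT x|lborel. LINT s|lborel. ?F s x)" unfolding LINT_FTC_line[OF d f'] ..
  also have "\<dots> = (LINT s|lborel. LINT x|lborel. ?F s x)"
    by (rule lborel_pair.Fubini_integral[OF int])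
  also have "\<dots> = (LINT s|lborel. indicator {0..1::real} s *\<^sub>R (LINT x|lborel. f' x))"
    by (simp add: sh)
  also have "\<dots> = (LINT x|lborel. f' x)" by simp
  finally show ?thesis by simp
qed

text \<open>For \<open>s \<ge> 1/2\<close> the point \<open>x' + s (x - x')\<close> is substituted for \<open>x\<close>, otherwise for \<open>x'\<close>; the
  Jacobian is at most \<open>2\<^sup>d\<close>, and convexity keeps the new variable in \<open>Q\<close>.\<close>

lemma nn_integral_segment_le:
  fixes F :: "'a::euclidean_space \<Rightarrow> ennreal"
  assumes F[measurable]: "F \<in> borel_measurable borel" and Q[measurable]: "Q \<in> sets borel" and cv: "convex Q"
    and s: "0 \<le> s" "s \<le> 1"
  shows "(\<integral>\<^sup>+x'. \<integral>\<^sup>+x. F (x' + s *\<^sub>R (x - x')) * indicator Q x * indicator Q x' \<partial>lborel \<partial>lborel)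
     \<le> 2 ^ DIM('a) * emeasure lborel Q * (\<integral>\<^sup>+x. F x * indicator Q x \<partial>lborel)"
proof -
  have main: "(\<integral>\<^sup>+x'. \<integral>\<^sup>+x. F (x' + s *\<^sub>R (x - x')) * indicator Q x * indicator Q x' \<partial>lborel \<partial>lborel)
     \<le> 2 ^ DIM('a) * emeasure lborel Q * (\<integral>\<^sup>+x. F x * indicator Q x \<partial>lborel)"
    if s: "1/2 \<le> s" "s \<le> 1" for s
  proof -
    have "(\<integral>\<^sup>+x. F (x' + s *\<^sub>R (x - x')) * indicator Q x * indicator Q x' \<partial>lborel)
        \<le> (2 ^ DIM('a) * (\<integral>\<^sup>+x. F x * indicator Q x \<partial>lborel)) * indicator Q x'" for x'
    proof (cases "x' \<in> Q")
      case True
      have "(\<integral>\<^sup>+x. F (x' + s *\<^sub>R (x - x')) * indicator Q x * indicator Q x' \<partial>lborel)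
          \<le> (\<integral>\<^sup>+x. (F ((1 - s) *\<^sub>R x' + s *\<^sub>R x) * indicator Q ((1 - s) *\<^sub>R x' + s *\<^sub>R x)) \<partial>lborel)"
      proof (rule nn_integral_mono)
        fix x
        have e: "x' + s *\<^sub>R (x - x') = (1 - s) *\<^sub>R x' + s *\<^sub>R x" by (simp add: algebra_simps)
        have "x \<in> Q \<Longrightarrow> (1 - s) *\<^sub>R x' + s *\<^sub>R x \<in> Q" using cv True s by (intro convexD) auto
        then show "F (x' + s *\<^sub>R (x - x')) * indicator Q x * indicator Q x' \<le> F ((1 - s) *\<^sub>R x' + s *\<^sub>R x) * indicator Q ((1 - s) *\<^sub>R x' + s *\<^sub>R x)"
          unfolding e by (auto simp: indicator_def)
      qed
      also have "\<dots> \<le> 2 ^ DIM('a) * (\<integral>\<^sup>+x. F x * indicator Q x \<partial>lborel)"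
      proof -
        have "(\<integral>\<^sup>+x. F x * indicator Q x \<partial>lborel) = ennreal (\<bar>s\<bar> ^ DIM('a)) *
          (\<integral>\<^sup>+x. (F ((1 - s) *\<^sub>R x' + s *\<^sub>R x) * indicator Q ((1 - s) *\<^sub>R x' + s *\<^sub>R x)) \<partial>lborel)"
          using s by (subst lborel_affine[of s "(1 - s) *\<^sub>R x'"]) (simp_all add: nn_integral_density nn_integral_distr nn_integral_cmult)
        then have "2 ^ DIM('a) * (\<integral>\<^sup>+x. F x * indicator Q x \<partial>lborel) = (ennreal (2 ^ DIM('a)) * ennreal (\<bar>s\<bar> ^ DIM('a))) *
          (\<integral>\<^sup>+x. (F ((1 - s) *\<^sub>R x' + s *\<^sub>R x) * indicator Q ((1 - s) *\<^sub>R x' + s *\<^sub>R x)) \<partial>lborel)"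
          by (simp add: mult.assoc ennreal_power[symmetric])
        moreover have "1 \<le> ennreal (2 ^ DIM('a)) * ennreal (\<bar>s\<bar> ^ DIM('a))"
        proof -
          have "1 \<le> (2 * s) ^ DIM('a)" using s by (intro one_le_power) auto
          then have "ennreal 1 \<le> ennreal ((2 * s) ^ DIM('a))" by (rule ennreal_leI)
          then show ?thesis using s by (simp add: ennreal_mult[symmetric] power_mult_distrib)
        qed
        ultimately show ?thesis
          using mult_right_mono[of 1 "ennreal (2 ^ DIM('a)) * ennreal (\<bar>s\<bar> ^ DIM('a))"] by simp
      qed
      finally show ?thesis using True by simp
    qed simp
    then have "(\<integral>\<^sup>+x'. \<integral>\<^sup>+x. F (x' + s *\<^sub>R (x - x')) * indicator Q x * indicator Q x' \<partial>lborel \<partial>lborel)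
       \<le> (\<integral>\<^sup>+x'. (2 ^ DIM('a) * (\<integral>\<^sup>+x. F x * indicator Q x \<partial>lborel)) * indicator Q x' \<partial>lborel)"
      by (rule nn_integral_mono)
    also have "\<dots> = 2 ^ DIM('a) * emeasure lborel Q * (\<integral>\<^sup>+x. F x * indicator Q x \<partial>lborel)"
      by (subst nn_integral_cmult_indicator) (simp_all add: mult_ac)
    finally show ?thesis .
  qed
  show ?thesis
  proof (cases "1/2 \<le> s")
    case False
    have "(\<integral>\<^sup>+x'. \<integral>\<^sup>+x. F (x' + s *\<^sub>R (x - x')) * indicator Q x * indicator Q x' \<partial>lborel \<partial>lborel)
      = (\<integral>\<^sup>+x. \<integral>\<^sup>+x'. F (x' + s *\<^sub>R (x - x')) * indicator Q x * indicator Q x' \<partial>lborel \<partial>lborel)"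
      by (rule lborel_pair.Fubini') measurable
    also have "\<dots> = (\<integral>\<^sup>+x. \<integral>\<^sup>+x'. F (x + (1 - s) *\<^sub>R (x' - x)) * indicator Q x' * indicator Q x \<partial>lborel \<partial>lborel)"
    proof (intro nn_integral_cong)
      fix x x' :: 'a
      have "x' + s *\<^sub>R (x - x') = x + (1 - s) *\<^sub>R (x' - x)" by (simp add: algebra_simps)
      then show "F (x' + s *\<^sub>R (x - x')) * indicator Q x * indicator Q x' = F (x + (1 - s) *\<^sub>R (x' - x)) * indicator Q x' * indicator Q x"
        by (simp only: mult_ac)
    qed
    also have "\<dots> \<le> 2 ^ DIM('a) * emeasure lborel Q * (\<integral>\<^sup>+x. F x * indicator Q x \<partial>lborel)"
      by (rule main) (use False s in auto)
    finally show ?thesis .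
  qed (use main s in auto)
qed

text \<open>If the mean vanishes, the energy is at most the mean over \<open>x\<close> and \<open>y\<close> in \<open>Q\<close> of \<open>\<bar>U x - U y\<bar>\<^sup>2\<close>, and the
  difference is the integral of the gradient along the segment, which stays in \<open>Q\<close>.\<close>

lemma poincare_mean_zero:
  fixes U :: "'a::euclidean_space \<Rightarrow> complex" and V :: "'a \<Rightarrow> 'a \<Rightarrow> complex"
  assumes U[measurable]: "U \<in> borel_measurable borel"
    and V[measurable]: "\<And>b. b \<in> Basis \<Longrightarrow> V b \<in> borel_measurable borel"
    and Q[measurable]: "Q \<in> sets borel" and cv: "convex Q"
    and fin: "emeasure lborel Q < \<infinity>"
    and diam: "\<And>x x'. x \<in> Q \<Longrightarrow> x' \<in> Q \<Longrightarrow> dist x x' \<le> \<delta>"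
    and FTC: "\<And>x x'. U x - U x' = (LINT s|lborel. indicator {0..1::real} s *\<^sub>R (\<Sum>b\<in>Basis. ((x - x') \<bullet> b) *\<^sub>R V b (x' + s *\<^sub>R (x - x'))))"
    and int: "integrable lborel (\<lambda>x. indicator Q x *\<^sub>R U x)" and zero: "(LINT x|lborel. indicator Q x *\<^sub>R U x) = 0"
  shows "sq_mass U Q
     \<le> ennreal (\<delta>\<^sup>2 * 2 ^ DIM('a)) * (\<Sum>b\<in>Basis. sq_mass (V b) Q)"
proof (cases "emeasure lborel Q = 0")
  case True
  then have "sq_mass U Q = 0"
    by (intro nn_integral_null_set) (simp add: null_sets_def)
  then show ?thesis by simp
next
  case False
  let ?m = "emeasure lborel Q"
  define q where "q = measure lborel Q"
  have q: "?m = ennreal q" "q > 0" 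
  proof -
    have "?m \<noteq> top" using fin by simp
    then show e: "?m = ennreal q" unfolding q_def by (rule emeasure_eq_ennreal_measure)
    have "q \<ge> 0" by (simp add: q_def)
    moreover have "q \<noteq> 0" using False e by auto
    ultimately show "q > 0" by simp
  qed
  have diff: "cmod_sq (U x - U x') \<le> ennreal (\<delta>\<^sup>2) * (\<integral>\<^sup>+s. (\<Sum>b\<in>Basis. cmod_sq (V b (x' + s *\<^sub>R (x - x')))) * indicator {0..1::real} s \<partial>lborel)"
    if x: "x \<in> Q" "x' \<in> Q" for x x'
  proof -
    let ?G = "\<lambda>s. \<Sum>b\<in>Basis. ((x - x') \<bullet> b) *\<^sub>R V b (x' + s *\<^sub>R (x - x'))"
    have cs: "(cmod (?G s))\<^sup>2 \<le> \<delta>\<^sup>2 * (\<Sum>b\<in>Basis. (cmod (V b (x' + s *\<^sub>R (x - x'))))\<^sup>2)" for s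
    proof -
      have "cmod (?G s) \<le> (\<Sum>b\<in>Basis. \<bar>(x - x') \<bullet> b\<bar> * cmod (V b (x' + s *\<^sub>R (x - x'))))"
        by (rule order_trans[OF norm_sum]) simp
      then have "(cmod (?G s))\<^sup>2 \<le> (\<Sum>b\<in>Basis. \<bar>(x - x') \<bullet> b\<bar> * cmod (V b (x' + s *\<^sub>R (x - x'))))\<^sup>2"
        by (rule power_mono) simp
      also have "\<dots> \<le> (\<Sum>b\<in>Basis. \<bar>(x - x') \<bullet> b\<bar>\<^sup>2) * (\<Sum>b\<in>Basis. (cmod (V b (x' + s *\<^sub>R (x - x'))))\<^sup>2)"
        by (rule Cauchy_Schwarz_ineq_sum)
      also have "(\<Sum>b\<in>Basis. \<bar>(x - x') \<bullet> b\<bar>\<^sup>2) = (dist x x')\<^sup>2"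
        by (simp only: dist_norm power2_norm_eq_inner power2_abs, subst euclidean_inner, simp only: power2_eq_square)
      also have "(dist x x')\<^sup>2 * (\<Sum>b\<in>Basis. (cmod (V b (x' + s *\<^sub>R (x - x'))))\<^sup>2) \<le> \<delta>\<^sup>2 * (\<Sum>b\<in>Basis. (cmod (V b (x' + s *\<^sub>R (x - x'))))\<^sup>2)"
        using diam[OF x] by (intro mult_right_mono power_mono sum_nonneg) auto
      finally show ?thesis .
    qed
    have [measurable]: "?G \<in> borel_measurable borel" by measurable
    have "cmod_sq (U x - U x') = cmod_sq (LINT s|lborel. complex_of_real (indicator {0..1::real} s) * (complex_of_real (indicator {0..1::real} s) * ?G s))"
      unfolding FTC[of x x'] by (intro arg_cong[where f = "\<lambda>z. ennreal ((cmod z)\<^sup>2)"] Bochner_Integration.integral_cong refl)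
        (simp add: scaleR_conv_of_real indicator_def)
    also have "\<dots> \<le> (\<integral>\<^sup>+s. cmod_sq (complex_of_real (indicator {0..1::real} s)) \<partial>lborel) *
       (\<integral>\<^sup>+s. cmod_sq (complex_of_real (indicator {0..1::real} s) * ?G s) \<partial>lborel)"
      by (rule Cauchy_Schwarz_LINT) measurable
    also have "(\<integral>\<^sup>+s. cmod_sq (complex_of_real (indicator {0..1::real} s)) \<partial>lborel) = (\<integral>\<^sup>+s. indicator {0..1::real} s \<partial>lborel)"
      by (intro nn_integral_cong) (auto simp: indicator_def)
    also have "\<dots> = 1" by simp
    also have "(\<integral>\<^sup>+s. cmod_sq (complex_of_real (indicator {0..1::real} s) * ?G s) \<partial>lborel)
      \<le> (\<integral>\<^sup>+s. ennreal (\<delta>\<^sup>2) * ((\<Sum>b\<in>Basis. cmod_sq (V b (x' + s *\<^sub>R (x - x')))) * indicator {0..1::real} s) \<partial>lborel)"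
    proof (rule nn_integral_mono)
      fix s :: real
      have "cmod_sq (?G s) \<le> ennreal (\<delta>\<^sup>2) * (\<Sum>b\<in>Basis. cmod_sq (V b (x' + s *\<^sub>R (x - x'))))"
        using ennreal_leI[OF cs[of s]] by (simp add: ennreal_mult sum_nonneg sum_ennreal)
      then show "cmod_sq (complex_of_real (indicator {0..1::real} s) * ?G s)
        \<le> ennreal (\<delta>\<^sup>2) * ((\<Sum>b\<in>Basis. cmod_sq (V b (x' + s *\<^sub>R (x - x')))) * indicator {0..1::real} s)"
        by (auto simp: indicator_def)
    qed
    also have "\<dots> = ennreal (\<delta>\<^sup>2) * (\<integral>\<^sup>+s. (\<Sum>b\<in>Basis. cmod_sq (V b (x' + s *\<^sub>R (x - x')))) * indicator {0..1::real} s \<partial>lborel)"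
      by (rule nn_integral_cmult) measurable
    finally show ?thesis by (simp add: mult_left_mono)
  qed
  have mean: "cmod_sq (U x) * ?m \<le> (\<integral>\<^sup>+x'. cmod_sq (U x - U x') * indicator Q x' \<partial>lborel)" for x
  proof -
    have iq: "integrable lborel (\<lambda>x'. complex_of_real (indicator Q x') * U x)"
      by (intro integrable_mult_left integrable_of_real integrable_real_indicator) (use fin in auto)
    have iU: "integrable lborel (\<lambda>x'. complex_of_real (indicator Q x') * U x')" using int by (simp add: scaleR_conv_of_real)
    have "(LINT x'|lborel. complex_of_real (indicator Q x') * (complex_of_real (indicator Q x') * (U x - U x')))
       = (LINT x'|lborel. complex_of_real (indicator Q x') * U x - complex_of_real (indicator Q x') * U x')"
      by (intro Bochner_Integration.integral_cong refl) (simp add: indicator_def)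
    also have "\<dots> = (LINT x'|lborel. complex_of_real (indicator Q x') * U x) - (LINT x'|lborel. complex_of_real (indicator Q x') * U x')"
      by (rule Bochner_Integration.integral_diff[OF iq iU])
    also have "\<dots> = complex_of_real q * U x" using zero by (simp add: scaleR_conv_of_real q_def)
    finally have "cmod_sq (complex_of_real q * U x)
      \<le> (\<integral>\<^sup>+x'. cmod_sq (complex_of_real (indicator Q x')) \<partial>lborel) * (\<integral>\<^sup>+x'. cmod_sq (complex_of_real (indicator Q x') * (U x - U x')) \<partial>lborel)"
      using Cauchy_Schwarz_LINT[of "\<lambda>x'. complex_of_real (indicator Q x')" lborel "\<lambda>x'. complex_of_real (indicator Q x') * (U x - U x')"] by simp
    also have "(\<integral>\<^sup>+x'. cmod_sq (complex_of_real (indicator Q x')) \<partial>lborel) = (\<integral>\<^sup>+x'. indicator Q x' \<partial>lborel)"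
      by (intro nn_integral_cong) (auto simp: indicator_def)
    also have "\<dots> = ennreal q" using q by simp
    also have "(\<integral>\<^sup>+x'. cmod_sq (complex_of_real (indicator Q x') * (U x - U x')) \<partial>lborel)
      = (\<integral>\<^sup>+x'. cmod_sq (U x - U x') * indicator Q x' \<partial>lborel)"
      by (intro nn_integral_cong) (auto simp: indicator_def)
    also have "cmod_sq (complex_of_real q * U x) = ennreal q * (cmod_sq (U x) * ennreal q)"
      using q(2) by (simp add: norm_mult ennreal_mult[symmetric] power2_eq_square mult_ac)
    finally have "ennreal q * (cmod_sq (U x) * ennreal q) \<le> ennreal q * (\<integral>\<^sup>+x'. cmod_sq (U x - U x') * indicator Q x' \<partial>lborel)" .
    then have "cmod_sq (U x) * ennreal q \<le> (\<integral>\<^sup>+x'. cmod_sq (U x - U x') * indicator Q x' \<partial>lborel)"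
      by (rule ennreal_mult_le_mult_iff[THEN iffD1, rotated 2]) (use q in auto)
    then show ?thesis using q by simp
  qed
  let ?S = "\<lambda>x. \<Sum>b\<in>Basis. cmod_sq (V b x)"
  have [measurable]: "?S \<in> borel_measurable borel" by measurable
  have "sq_mass U Q * ?m = (\<integral>\<^sup>+x. cmod_sq (U x) * ?m * indicator Q x \<partial>lborel)"
    by (subst nn_integral_multc[symmetric]) (simp_all add: mult_ac)
  also have "\<dots> \<le> (\<integral>\<^sup>+x. (\<integral>\<^sup>+x'. cmod_sq (U x - U x') * indicator Q x' \<partial>lborel) * indicator Q x \<partial>lborel)"
    by (intro nn_integral_mono mult_right_mono mean) simp
  also have "\<dots> = (\<integral>\<^sup>+x. (\<integral>\<^sup>+x'. cmod_sq (U x - U x') * indicator Q x' * indicator Q x \<partial>lborel) \<partial>lborel)"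
    by (intro nn_integral_cong nn_integral_multc[symmetric]) measurable
  also have "\<dots> \<le> (\<integral>\<^sup>+x. (\<integral>\<^sup>+x'. ennreal (\<delta>\<^sup>2) * (\<integral>\<^sup>+s. ?S (x' + s *\<^sub>R (x - x')) * indicator {0..1::real} s * indicator Q x * indicator Q x' \<partial>lborel) \<partial>lborel) \<partial>lborel)"
  proof (intro nn_integral_mono)
    fix x x' :: 'a
    show "cmod_sq (U x - U x') * indicator Q x' * indicator Q x
      \<le> ennreal (\<delta>\<^sup>2) * (\<integral>\<^sup>+s. ?S (x' + s *\<^sub>R (x - x')) * indicator {0..1::real} s * indicator Q x * indicator Q x' \<partial>lborel)"
      using diff[of x x'] by (cases "x \<in> Q"; cases "x' \<in> Q") auto
  qed
  also have "\<dots> = ennreal (\<delta>\<^sup>2) * (\<integral>\<^sup>+x. (\<integral>\<^sup>+x'. (\<integral>\<^sup>+s. ?S (x' + s *\<^sub>R (x - x')) * indicator {0..1::real} s * indicator Q x * indicator Q x' \<partial>lborel) \<partial>lborel) \<partial>lborel)"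
    by (simp add: nn_integral_cmult)
  also have "(\<integral>\<^sup>+x. (\<integral>\<^sup>+x'. (\<integral>\<^sup>+s. ?S (x' + s *\<^sub>R (x - x')) * indicator {0..1::real} s * indicator Q x * indicator Q x' \<partial>lborel) \<partial>lborel) \<partial>lborel)
    = (\<integral>\<^sup>+x. (\<integral>\<^sup>+s. (\<integral>\<^sup>+x'. ?S (x' + s *\<^sub>R (x - x')) * indicator {0..1::real} s * indicator Q x * indicator Q x' \<partial>lborel) \<partial>lborel) \<partial>lborel)"
    by (intro nn_integral_cong lborel_pair.Fubini') measurable
  also have "\<dots> = (\<integral>\<^sup>+s. (\<integral>\<^sup>+x. (\<integral>\<^sup>+x'. ?S (x' + s *\<^sub>R (x - x')) * indicator {0..1::real} s * indicator Q x * indicator Q x' \<partial>lborel) \<partial>lborel) \<partial>lborel)"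
    by (rule lborel_pair.Fubini') measurable
  also have "\<dots> = (\<integral>\<^sup>+s. (\<integral>\<^sup>+x'. (\<integral>\<^sup>+x. ?S (x' + s *\<^sub>R (x - x')) * indicator {0..1::real} s * indicator Q x * indicator Q x' \<partial>lborel) \<partial>lborel) \<partial>lborel)"
    by (intro nn_integral_cong lborel_pair.Fubini') measurable
  also have "\<dots> \<le> (\<integral>\<^sup>+s. (2 ^ DIM('a) * ?m * (\<integral>\<^sup>+x. ?S x * indicator Q x \<partial>lborel)) * indicator {0..1::real} s \<partial>lborel)"
  proof (rule nn_integral_mono)
    fix s :: real
    show "(\<integral>\<^sup>+x'. (\<integral>\<^sup>+x. ?S (x' + s *\<^sub>R (x - x')) * indicator {0..1::real} s * indicator Q x * indicator Q x' \<partial>lborel) \<partial>lborel)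
      \<le> (2 ^ DIM('a) * ?m * (\<integral>\<^sup>+x. ?S x * indicator Q x \<partial>lborel)) * indicator {0..1::real} s"
      using nn_integral_segment_le[of ?S Q s] cv by (cases "s \<in> {0..1}") auto
  qed
  also have "\<dots> = 2 ^ DIM('a) * ?m * (\<integral>\<^sup>+x. ?S x * indicator Q x \<partial>lborel)"
    by (simp add: nn_integral_cmult_indicator)
  also have "(\<integral>\<^sup>+x. ?S x * indicator Q x \<partial>lborel) = (\<Sum>b\<in>Basis. sq_mass (V b) Q)"
    unfolding sum_distrib_right by (rule nn_integral_sum) measurable
  finally have *: "sq_mass U Q * ?m
      \<le> ennreal (\<delta>\<^sup>2) * (2 ^ DIM('a) * ?m * (\<Sum>b\<in>Basis. sq_mass (V b) Q))"
    by (simp add: mult_left_mono)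
  have "?m * sq_mass U Q
      \<le> ?m * (ennreal (\<delta>\<^sup>2 * 2 ^ DIM('a)) * (\<Sum>b\<in>Basis. sq_mass (V b) Q))"
    using * by (simp add: ennreal_mult ennreal_power[symmetric] mult_ac)
  then show ?thesis
    by (rule ennreal_mult_le_mult_iff[THEN iffD1, rotated 2]) (use q in auto)
qed

section \<open>Kernels of pseudodifferential operators\<close>

lemma has_vector_derivative_exp_line:
  "((\<lambda>s. exp (\<i> * of_real (A + s * B))) has_vector_derivative (\<i> * of_real B) * exp (\<i> * of_real A)) (at 0)"
proof -
  have "((\<lambda>z. exp (\<i> * of_real A + z * (\<i> * of_real B))) has_field_derivative
     (\<i> * of_real B) * exp (\<i> * of_real A + complex_of_real 0 * (\<i> * of_real B))) (at (complex_of_real 0))"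
    by (auto intro!: derivative_eq_intros)
  from has_vector_derivative_real_field[OF this, of UNIV]
  show ?thesis by (simp add: algebra_simps)
qed

text \<open>With \<open>z = x - y\<close> at fixed \<open>x\<close>, and then \<open>w = x - t z\<close> at fixed \<open>z\<close>, only a reflection and translations
  are involved.\<close>

lemma nn_integral_shear:
  fixes F :: "'a::euclidean_space \<Rightarrow> 'a \<Rightarrow> ennreal"
  assumes F[measurable]: "jointly_measurable F"
  shows "(\<integral>\<^sup>+x. \<integral>\<^sup>+y. F ((1 - t) *\<^sub>R x + t *\<^sub>R y) (x - y) \<partial>lborel \<partial>lborel) = (\<integral>\<^sup>+w. \<integral>\<^sup>+z. F w z \<partial>lborel \<partial>lborel)"
proof -
  have mm: "(\<lambda>x. F (f x) (g x)) \<in> borel_measurable N" if [measurable]: "f \<in> measurable N borel" "g \<in> measurable N borel" for f g N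
    using measurable_compose[OF measurable_Pair[OF that] F] by simp
  have "(\<integral>\<^sup>+x. \<integral>\<^sup>+y. F ((1 - t) *\<^sub>R x + t *\<^sub>R y) (x - y) \<partial>lborel \<partial>lborel) = (\<integral>\<^sup>+x. \<integral>\<^sup>+z. F (x + (- t) *\<^sub>R z) z \<partial>lborel \<partial>lborel)"
  proof (rule nn_integral_cong)
    fix x :: 'a
    have "(\<integral>\<^sup>+y. F (x + (- t) *\<^sub>R (x - y)) (x - y) \<partial>lborel) = (\<integral>\<^sup>+z. F (x + (- t) *\<^sub>R z) z \<partial>lborel)"
      by (rule nn_integral_reflect_shift(1)) (rule mm; measurable)
    moreover have "(1 - t) *\<^sub>R x + t *\<^sub>R y = x + (- t) *\<^sub>R (x - y)" for y by (simp add: algebra_simps)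
    ultimately show "(\<integral>\<^sup>+y. F ((1 - t) *\<^sub>R x + t *\<^sub>R y) (x - y) \<partial>lborel) = (\<integral>\<^sup>+z. F (x + (- t) *\<^sub>R z) z \<partial>lborel)" by simp
  qed
  also have "\<dots> = (\<integral>\<^sup>+z. \<integral>\<^sup>+x. F (x + (- t) *\<^sub>R z) z \<partial>lborel \<partial>lborel)"
    by (rule lborel_pair.Fubini') (unfold split_beta', rule mm; measurable)
  also have "\<dots> = (\<integral>\<^sup>+z. \<integral>\<^sup>+w. F w z \<partial>lborel \<partial>lborel)"
    by (intro nn_integral_cong nn_integral_reflect_shift(2)) (rule mm; measurable)
  also have "\<dots> = (\<integral>\<^sup>+w. \<integral>\<^sup>+z. F w z \<partial>lborel \<partial>lborel)"
    by (rule lborel_pair.Fubini') (unfold split_beta', rule mm; measurable)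
  finally show ?thesis .
qed

locale pdo = phase_box l \<rho> u for l \<rho> :: real and u :: "'a::euclidean_space" +
  fixes \<alpha> t l\<^sub>0 :: real
  assumes \<alpha>: "0 < \<alpha>" and t: "0 \<le> t" "t \<le> 1" and l0: "0 < l\<^sub>0" "l\<^sub>0 \<le> \<alpha> * l * \<rho>"
begin

definition mid :: "'a \<Rightarrow> 'a \<Rightarrow> 'a" where "mid x y = (1 - t) *\<^sub>R x + t *\<^sub>R y"

definition ephase :: "'a \<Rightarrow> 'a \<Rightarrow> complex" where
  "ephase z \<xi> = exp (\<i> * of_real (\<alpha> * (z \<bullet> \<xi>)))"

definition pker :: "('a \<Rightarrow> 'a \<Rightarrow> complex) \<Rightarrow> 'a \<Rightarrow> 'a \<Rightarrow> complex" where
  "pker c x y = (LINT \<xi>|lborel. ephase (x - y) \<xi> * c (mid x y) \<xi>)"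

definition ballvol :: real where "ballvol = measure lborel (cball (0::'a) \<rho>)"

lemma ballvol_nonneg: "0 \<le> ballvol" by (simp add: ballvol_def)

lemma norm_ephase[simp]: "cmod (ephase z \<xi>) = 1" by (simp add: ephase_def)

lemma adm_compose:
  assumes c: "adm M c" and f: "f \<in> measurable N borel" and g: "g \<in> measurable N borel"
  shows "(\<lambda>x. c (f x) (g x)) \<in> borel_measurable N"
proof -
  have "(\<lambda>p. c (fst p) (snd p)) \<in> borel_measurable borel"
    using c by (intro borel_measurable_continuous_onI) (simp add: adm_def)
  then have "jointly_measurable c" by (simp only: borel_prod)
  from measurable_compose[OF measurable_Pair[OF f g] this] show ?thesis by simp
qed

lemma adm_continuous:
  assumes c: "adm M c" and f: "continuous_on UNIV f" and g: "continuous_on UNIV g"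
  shows "continuous_on UNIV (\<lambda>x. c (f x) (g x))"
proof -
  have "continuous_on UNIV (\<lambda>p. c (fst p) (snd p))" using c by (simp add: adm_def)
  from continuous_on_compose2[OF this continuous_on_Pair[OF f g]] show ?thesis by simp
qed

lemma ephase_measurable[measurable]:
  assumes [measurable]: "f \<in> measurable N borel" "g \<in> measurable N borel"
  shows "(\<lambda>x. ephase (f x) (g x)) \<in> borel_measurable N"
  unfolding ephase_def by measurable

lemma mid_measurable[measurable]:
  assumes [measurable]: "f \<in> measurable N borel" "g \<in> measurable N borel"
  shows "(\<lambda>x. mid (f x) (g x)) \<in> borel_measurable N"
  unfolding mid_def by measurable

lemma adm_bound:
  assumes "adm M c" shows "cmod (c w \<xi>) \<le> M * indicator (cball 0 \<rho>) \<xi>"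
  using assms adm_nonneg[OF assms] by (cases "c w \<xi> = 0") (auto simp: adm_def indicator_def)

lemma integrable_ball: "integrable lborel (\<lambda>\<xi>::'a. (M::real) * indicator (cball 0 \<rho>) \<xi>)"
  by (intro integrable_mult_right integrable_real_indicator emeasure_lborel_cball_finite) simp

lemma adm_integrable:
  assumes c: "adm M c" shows "integrable lborel (\<lambda>\<xi>. ephase z \<xi> * c w \<xi>)"
proof (rule Bochner_Integration.integrable_bound[OF integrable_ball[of M]])
  have [measurable]: "(\<lambda>\<xi>. c w \<xi>) \<in> borel_measurable borel" by (rule adm_compose[OF c]) measurable
  show "(\<lambda>\<xi>. ephase z \<xi> * c w \<xi>) \<in> borel_measurable lborel" by measurable
  show "AE \<xi> in lborel. norm (ephase z \<xi> * c w \<xi>) \<le> norm (M * indicator (cball 0 \<rho>) \<xi>)"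
    using adm_bound[OF c, of w] adm_nonneg[OF c] by (simp add: norm_mult abs_of_nonneg)
qed

lemma pker_norm:
  assumes c: "adm M c" shows "cmod (pker c x y) \<le> M * ballvol"
proof -
  have "cmod (pker c x y) \<le> (LINT \<xi>|lborel. cmod (ephase (x - y) \<xi> * c (mid x y) \<xi>))"
    unfolding pker_def by (rule integral_norm_bound)
  also have "\<dots> \<le> (LINT \<xi>|lborel. M * indicator (cball (0::'a) \<rho>) \<xi>)"
  proof (rule integral_mono[OF _ integrable_ball])
    show "integrable lborel (\<lambda>\<xi>. cmod (ephase (x - y) \<xi> * c (mid x y) \<xi>))"
      by (rule integrable_norm[OF adm_integrable[OF c]])
    show "cmod (ephase (x - y) \<xi> * c (mid x y) \<xi>) \<le> M * indicator (cball (0::'a) \<rho>) \<xi>" for \<xi>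
      using adm_bound[OF c] by (simp add: norm_mult)
  qed
  also have "\<dots> = M * ballvol" by (simp add: ballvol_def)
  finally show ?thesis .
qed

lemma pker_measurable:
  assumes c: "adm M c"
  shows "jointly_measurable (pker c)"
proof -
  have [measurable]: "(\<lambda>p. c (mid (fst (fst p)) (snd (fst p))) (snd p)) \<in> borel_measurable ((borel \<Otimes>\<^sub>M borel) \<Otimes>\<^sub>M lborel)"
    by (rule adm_compose[OF c]) measurable
  have "(\<lambda>(p, \<xi>). ephase (fst p - snd p) \<xi> * c (mid (fst p) (snd p)) \<xi>) \<in> borel_measurable ((borel \<Otimes>\<^sub>M borel) \<Otimes>\<^sub>M lborel)"
    unfolding split_beta' by measurable
  from lborel.borel_measurable_lebesgue_integral[OF this] show ?thesis by (simp add: pker_def)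
qed

lemma pker_compose:
  assumes c: "adm M c" and f: "f \<in> measurable N borel" and g: "g \<in> measurable N borel"
  shows "(\<lambda>x. pker c (f x) (g x)) \<in> borel_measurable N"
  using measurable_compose[OF measurable_Pair[OF f g] pker_measurable[OF c]] by simp

text \<open>Integration by parts in \<open>\<xi>\<close>.\<close>

lemma pker_parts:
  assumes c: "adm M c" and c': "adm M' c'" and d: "has_dxi b c c'"
  shows "complex_of_real (\<alpha> * \<rho> * ((x - y) \<bullet> b)) * pker c x y = \<i> * pker c' x y"
proof -
  let ?z = "x - y" and ?w = "mid x y"
  let ?A = "\<i> * of_real (\<alpha> * (?z \<bullet> b))"
  let ?f' = "\<lambda>\<xi>. ?A * (ephase ?z \<xi> * c ?w \<xi>) + (ephase ?z \<xi> * c' ?w \<xi>) / complex_of_real \<rho>"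
  have "(LINT \<xi>|lborel. ?f' \<xi>) = 0"
  proof (rule LINT_directional_derivative_zero)
    fix \<xi> :: 'a
    have 1: "((\<lambda>s. ephase ?z (\<xi> + s *\<^sub>R b)) has_vector_derivative ?A * ephase ?z \<xi>) (at 0)"
      using has_vector_derivative_exp_line[of "\<alpha> * (?z \<bullet> \<xi>)" "\<alpha> * (?z \<bullet> b)"]
      by (simp add: ephase_def inner_add_right algebra_simps)
    have 2: "((\<lambda>s. c ?w (\<xi> + s *\<^sub>R b)) has_vector_derivative c' ?w \<xi> / complex_of_real \<rho>) (at 0)"
      using d by (simp add: has_dxi_def)
    show "((\<lambda>s. ephase ?z (\<xi> + s *\<^sub>R b) * c ?w (\<xi> + s *\<^sub>R b)) has_vector_derivative ?f' \<xi>) (at 0)"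
      using has_vector_derivative_mult[OF 1 2] by (simp add: algebra_simps)
    have "cmod (?f' \<xi>) \<le> cmod (?A * (ephase ?z \<xi> * c ?w \<xi>)) + cmod ((ephase ?z \<xi> * c' ?w \<xi>) / complex_of_real \<rho>)"
      by (rule norm_triangle_ineq)
    also have "\<dots> \<le> cmod ?A * M + M' / \<rho>"
      using c c' \<rho> by (intro add_mono) (auto simp: norm_mult norm_divide adm_def intro!: mult_left_mono divide_right_mono)
    finally show "cmod (?f' \<xi>) \<le> cmod ?A * M + M' / \<rho>" .
    assume "?f' \<xi> \<noteq> 0"
    then have "c ?w \<xi> \<noteq> 0 \<or> c' ?w \<xi> \<noteq> 0" by auto
    then show "norm \<xi> \<le> \<rho>" using c c' by (auto simp: adm_def)
  next
    have "continuous_on UNIV (\<lambda>\<xi>. c ?w \<xi>)" "continuous_on UNIV (\<lambda>\<xi>. c' ?w \<xi>)"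
      by (rule adm_continuous[OF c] adm_continuous[OF c']; intro continuous_intros)+
    then show "continuous_on UNIV ?f'" unfolding ephase_def using \<rho> by (intro continuous_intros) auto
  qed (rule adm_integrable[OF c])
  moreover have "(LINT \<xi>|lborel. ?f' \<xi>) = ?A * pker c x y + pker c' x y / complex_of_real \<rho>"
    unfolding pker_def using adm_integrable[OF c] adm_integrable[OF c'] by simp
  ultimately have "?A * pker c x y = - (pker c' x y / complex_of_real \<rho>)" by (simp add: add_eq_0_iff2)
  then have "\<i> * (\<i> * of_real (\<alpha> * \<rho> * (?z \<bullet> b)) * pker c x y) = - (\<i> * pker c' x y)"
    using \<rho> by (simp add: field_simps)
  then show ?thesis by (simp add: mult.assoc[symmetric])
qed

lemma pker_parts_norm:
  assumes c: "adm M c" and c': "adm M' c'" and d: "has_dxi b c c'"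
  shows "\<alpha> * \<rho> * \<bar>(x - y) \<bullet> b\<bar> * cmod (pker c x y) = cmod (pker c' x y)"
proof -
  have "cmod (complex_of_real (\<alpha> * \<rho> * ((x - y) \<bullet> b)) * pker c x y) = cmod (\<i> * pker c' x y)"
    using pker_parts[OF assms] by simp
  then show ?thesis using \<alpha> \<rho> by (simp add: norm_mult abs_mult)
qed

text \<open>Each integration by parts costs one derivative of the symbol and gains one factor.\<close>

lemma pker_power:
  assumes b: "b \<in> Basis"
  shows "xi_class r M c \<Longrightarrow> \<exists>c'. adm M c' \<and> (\<forall>x y. (\<alpha> * \<rho> * \<bar>(x - y) \<bullet> b\<bar>) ^ r * cmod (pker c x y) = cmod (pker c' x y))"
proof (induction r arbitrary: c)
  case (Suc r)
  then obtain c1 where c1: "has_dxi b c c1" "xi_class r M c1" using b by auto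
  obtain c' where c': "adm M c'" "\<And>x y. (\<alpha> * \<rho> * \<bar>(x - y) \<bullet> b\<bar>) ^ r * cmod (pker c1 x y) = cmod (pker c' x y)"
    using Suc.IH[OF c1(2)] by blast
  have "(\<alpha> * \<rho> * \<bar>(x - y) \<bullet> b\<bar>) ^ Suc r * cmod (pker c x y) = cmod (pker c' x y)" for x y
  proof -
    have "(\<alpha> * \<rho> * \<bar>(x - y) \<bullet> b\<bar>) ^ Suc r * cmod (pker c x y)
      = (\<alpha> * \<rho> * \<bar>(x - y) \<bullet> b\<bar>) ^ r * (\<alpha> * \<rho> * \<bar>(x - y) \<bullet> b\<bar> * cmod (pker c x y))" by simp
    also have "\<dots> = cmod (pker c' x y)"
      unfolding pker_parts_norm[OF xi_class_adm[OF Suc.prems] xi_class_adm[OF c1(2)] c1(1)] by (rule c'(2))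
    finally show ?thesis .
  qed
  then show ?case using c'(1) by blast
qed auto

definition decay :: "'a \<Rightarrow> real" where
  "decay z = (\<Prod>b\<in>Basis. inverse (1 + \<alpha> * \<rho> * \<bar>z \<bullet> b\<bar>))"

lemma decay_measurable[measurable]: "decay \<in> borel_measurable borel"
  unfolding decay_def[abs_def] by measurable

text \<open>One derivative in each coordinate direction suffices for a square integrable majorant.\<close>

lemma pker_decay_coordinates:
  assumes "finite S" "S \<subseteq> Basis"
  shows "xi_class (card S) M c \<Longrightarrow> cmod (pker c x y) * (\<Prod>b\<in>S. 1 + \<alpha> * \<rho> * \<bar>(x - y) \<bullet> b\<bar>) \<le> 2 ^ card S * (M * ballvol)"
  using assms
proof (induction S arbitrary: c rule: finite_induct)
  case empty
  then show ?case using pker_norm by simp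
next
  case (insert b S)
  let ?P = "\<Prod>b\<in>S. 1 + \<alpha> * \<rho> * \<bar>(x - y) \<bullet> b\<bar>"
  have X: "xi_class (Suc (card S)) M c" using insert.prems insert.hyps by simp
  then obtain c' where c': "has_dxi b c c'" "xi_class (card S) M c'" using insert.prems by auto
  have P: "0 \<le> ?P" using \<alpha> \<rho> by (intro prod_nonneg) (auto intro!: add_nonneg_nonneg)
  have "cmod (pker c x y) * (\<Prod>b\<in>insert b S. 1 + \<alpha> * \<rho> * \<bar>(x - y) \<bullet> b\<bar>)
      = cmod (pker c x y) * ?P + (\<alpha> * \<rho> * \<bar>(x - y) \<bullet> b\<bar> * cmod (pker c x y)) * ?P"
    using insert.hyps by (simp add: algebra_simps)
  also have "\<dots> = cmod (pker c x y) * ?P + cmod (pker c' x y) * ?P"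
    unfolding pker_parts_norm[OF xi_class_adm[OF X] xi_class_adm[OF c'(2)] c'(1)] ..
  also have "\<dots> \<le> 2 ^ card S * (M * ballvol) + 2 ^ card S * (M * ballvol)"
    using insert.IH[OF xi_class_Suc[OF X]] insert.IH[OF c'(2)] insert.prems by (intro add_mono) auto
  also have "\<dots> = 2 ^ card (insert b S) * (M * ballvol)" using insert.hyps by simp
  finally show ?case .
qed

lemma xi_class_le: "xi_class r M c \<Longrightarrow> r' \<le> r \<Longrightarrow> xi_class r' M c"
proof (induction r)
  case (Suc r)
  then show ?case using xi_class_Suc by (cases "r' = Suc r") auto
qed simp

lemma pker_decay:
  assumes X: "xi_class r M c" and r: "DIM('a) \<le> r"
  shows "cmod (pker c x y) \<le> (2 ^ DIM('a) * (M * ballvol)) * decay (x - y)"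
proof -
  let ?P = "\<Prod>b\<in>Basis. 1 + \<alpha> * \<rho> * \<bar>(x - y) \<bullet> b\<bar>"
  have P: "?P > 0" using \<alpha> \<rho> by (intro prod_pos) (auto intro!: add_pos_nonneg)
  have "cmod (pker c x y) * ?P \<le> 2 ^ DIM('a) * (M * ballvol)"
    by (rule pker_decay_coordinates) (use xi_class_le[OF X r] in auto)
  then have "cmod (pker c x y) \<le> 2 ^ DIM('a) * (M * ballvol) / ?P" using P by (simp add: pos_le_divide_eq)
  also have "\<dots> = (2 ^ DIM('a) * (M * ballvol)) * decay (x - y)"
    by (simp add: decay_def divide_inverse prod_inversef[symmetric] o_def)
  finally show ?thesis .
qed

lemma decay_square_finite: "(\<integral>\<^sup>+y. ennreal ((decay y)\<^sup>2) \<partial>lborel) < \<infinity>"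
proof -
  have one: "(\<integral>\<^sup>+s. ennreal ((inverse (1 + \<alpha> * \<rho> * \<bar>s\<bar>))\<^sup>2) \<partial>lborel) < \<infinity>"
  proof -
    let ?a = "\<alpha> * \<rho>"
    have a: "?a > 0" using \<alpha> \<rho> by simp
    have "integrable lborel (\<lambda>s::real. inverse (1 + (0 + ?a * s)\<^sup>2))"
      using a by (intro lborel_integrable_real_affine[OF integrable_inverse_square]) auto
    then have "(\<integral>\<^sup>+s. ennreal (norm (inverse (1 + (0 + ?a * s)\<^sup>2))) \<partial>lborel) < \<infinity>"
      by (simp add: integrable_iff_bounded)
    moreover have "(\<integral>\<^sup>+s. ennreal ((inverse (1 + ?a * \<bar>s\<bar>))\<^sup>2) \<partial>lborel) \<le> (\<integral>\<^sup>+s. ennreal (norm (inverse (1 + (0 + ?a * s)\<^sup>2))) \<partial>lborel)"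
    proof (intro nn_integral_mono ennreal_leI)
      fix s :: real
      have "0 \<le> ?a * \<bar>s\<bar>" using a by simp
      then have "1 + (?a * s)\<^sup>2 \<le> (1 + ?a * \<bar>s\<bar>)\<^sup>2" by (simp add: power2_sum power_mult_distrib)
      then have "inverse ((1 + ?a * \<bar>s\<bar>)\<^sup>2) \<le> inverse (1 + (?a * s)\<^sup>2)"
        by (rule le_imp_inverse_le) (simp add: add_pos_nonneg)
      then show "(inverse (1 + ?a * \<bar>s\<bar>))\<^sup>2 \<le> norm (inverse (1 + (0 + ?a * s)\<^sup>2))"
        by (simp add: power_inverse)
    qed
    ultimately show ?thesis by (rule order.strict_trans1[rotated])
  qed
  have "(\<integral>\<^sup>+y. ennreal ((decay y)\<^sup>2) \<partial>lborel) = (\<integral>\<^sup>+y. (\<Prod>b\<in>Basis. ennreal ((inverse (1 + \<alpha> * \<rho> * \<bar>(y::'a) \<bullet> b\<bar>))\<^sup>2)) \<partial>lborel)"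
    by (intro nn_integral_cong) (simp add: decay_def prod_power_distrib prod_ennreal)
  also have "\<dots> = (\<Prod>b\<in>(Basis::'a set). \<integral>\<^sup>+s. ennreal ((inverse (1 + \<alpha> * \<rho> * \<bar>s\<bar>))\<^sup>2) \<partial>lborel)"
    by (rule nn_integral_lborel_prod) auto
  also have "\<dots> < \<infinity>" using one by (simp add: power_less_top_ennreal)
  finally show ?thesis .
qed

text \<open>In the variables \<open>w = (1 - t) x + t y\<close> and \<open>z = x - y\<close> the Hilbert-Schmidt norm is computed
  by the Plancherel inequality, uniformly in \<open>t\<close>.\<close>

definition hs_unit :: real where
  "hs_unit = (2 * pi / \<alpha>) ^ DIM('a) * (measure lborel (cball u l) * ballvol)"

lemma hs_unit_nonneg: "0 \<le> hs_unit"
  using \<alpha> by (simp add: hs_unit_def ballvol_nonneg)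

lemma pker_hs:
  assumes c: "adm M c"
  shows "hs_norm_sq (pker c) \<le> ennreal (hs_unit * M\<^sup>2)"
proof -
  have M: "M \<ge> 0" by (rule adm_nonneg[OF c])
  define F where "F w z = cmod_sq (LINT \<xi>|lborel. ephase z \<xi> * c w \<xi>)" for w z
  have [measurable]: "(\<lambda>p. c (fst (fst p)) (snd p)) \<in> borel_measurable ((borel \<Otimes>\<^sub>M borel) \<Otimes>\<^sub>M lborel)"
    by (rule adm_compose[OF c]) measurable
  have "(\<lambda>(p, \<xi>). ephase (snd p) \<xi> * c (fst p) \<xi>) \<in> borel_measurable ((borel \<Otimes>\<^sub>M borel) \<Otimes>\<^sub>M lborel)"
    unfolding split_beta' by measurable
  from lborel.borel_measurable_lebesgue_integral[OF this]
  have [measurable]: "jointly_measurable F" unfolding F_def by measurable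
  have "hs_norm_sq (pker c)
     = (\<integral>\<^sup>+x. \<integral>\<^sup>+y. F ((1 - t) *\<^sub>R x + t *\<^sub>R y) (x - y) \<partial>lborel \<partial>lborel)"
    by (simp add: F_def pker_def mid_def)
  also have "\<dots> = (\<integral>\<^sup>+w. \<integral>\<^sup>+z. F w z \<partial>lborel \<partial>lborel)" by (rule nn_integral_shear) measurable
  also have "\<dots> \<le> (\<integral>\<^sup>+w. ennreal ((2 * pi / \<alpha>) ^ DIM('a) * (M\<^sup>2 * ballvol)) * indicator (cball u l) w \<partial>lborel)"
  proof (rule nn_integral_mono)
    fix w :: 'a
    have cw: "(\<lambda>\<xi>. c w \<xi>) \<in> borel_measurable lborel" by (rule adm_compose[OF c]) measurable
    have ci: "integrable lborel (\<lambda>\<xi>. c w \<xi>)"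
      by (rule Bochner_Integration.integrable_bound[OF integrable_ball[of M] cw])
        (use adm_bound[OF c, of w] M in \<open>simp add: abs_of_nonneg\<close>)
    have "(\<integral>\<^sup>+z. F w z \<partial>lborel) \<le> ennreal ((2 * pi / \<alpha>) ^ DIM('a)) * (\<integral>\<^sup>+\<xi>. cmod_sq (c w \<xi>) \<partial>lborel)"
      unfolding F_def ephase_def by (rule plancherel_le[OF ci \<alpha>])
    also have "(\<integral>\<^sup>+\<xi>. cmod_sq (c w \<xi>) \<partial>lborel) \<le> (\<integral>\<^sup>+\<xi>. (ennreal (M\<^sup>2) * indicator (cball u l) w) * indicator (cball (0::'a) \<rho>) \<xi> \<partial>lborel)"
    proof (rule nn_integral_mono)
      fix \<xi> :: 'a
      show "cmod_sq (c w \<xi>) \<le> (ennreal (M\<^sup>2) * indicator (cball u l) w) * indicator (cball 0 \<rho>) \<xi>"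
      proof (cases "c w \<xi> = 0")
        case False
        then have "w \<in> cball u l" "\<xi> \<in> cball 0 \<rho>" "(cmod (c w \<xi>))\<^sup>2 \<le> M\<^sup>2" using c by (auto simp: adm_def intro: power_mono)
        then show ?thesis by (simp add: ennreal_leI)
      qed simp
    qed
    also have "\<dots> = (ennreal (M\<^sup>2) * indicator (cball u l) w) * ennreal ballvol"
      using emeasure_lborel_cball_finite[of "0::'a" \<rho>]
      by (subst nn_integral_cmult_indicator) (simp_all add: ballvol_def emeasure_eq_ennreal_measure)
    also have "ennreal ((2 * pi / \<alpha>) ^ DIM('a)) * \<dots> = ennreal ((2 * pi / \<alpha>) ^ DIM('a) * (M\<^sup>2 * ballvol)) * indicator (cball u l) w"
      using \<alpha> ballvol_nonneg by (simp add: ennreal_mult indicator_def)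
    finally show "(\<integral>\<^sup>+z. F w z \<partial>lborel) \<le> ennreal ((2 * pi / \<alpha>) ^ DIM('a) * (M\<^sup>2 * ballvol)) * indicator (cball u l) w"
      by (simp add: mult_left_mono)
  qed
  also have "\<dots> = ennreal ((2 * pi / \<alpha>) ^ DIM('a) * (M\<^sup>2 * ballvol)) * ennreal (measure lborel (cball u l))"
    using emeasure_lborel_cball_finite[of u l]
    by (subst nn_integral_cmult_indicator) (simp_all add: emeasure_eq_ennreal_measure)
  also have "\<dots> = ennreal (hs_unit * M\<^sup>2)"
    using \<alpha> ballvol_nonneg by (subst ennreal_mult[symmetric]) (auto simp: hs_unit_def mult_ac)
  finally show ?thesis .
qed

text \<open>On the set \<open>\<bar>x - y\<bar> \<ge> s\<close> some coordinate of \<open>x - y\<close> is at least \<open>s / d\<close>; \<open>r\<close> integrations by parts in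
  that coordinate replace the symbol by one of its \<open>r\<close>-th derivatives.\<close>

lemma pker_hs_far:
  assumes X: "xi_class r M c" and s: "0 < s"
  shows "(\<integral>\<^sup>+x. sq_mass (pker c x) {y. s \<le> dist x y} \<partial>lborel)
     \<le> ennreal (real DIM('a) * (real DIM('a) / (\<alpha> * \<rho> * s)) ^ (2 * r) * (hs_unit * M\<^sup>2))"
proof -
  let ?d = "real DIM('a)"
  let ?q = "(?d / (\<alpha> * \<rho> * s)) ^ r"
  have d: "?d > 0" by simp
  have q: "?q \<ge> 0" using \<alpha> \<rho> s by simp
  have "\<forall>b\<in>Basis. \<exists>c'. adm M c' \<and> (\<forall>x y. (\<alpha> * \<rho> * \<bar>(x - y) \<bullet> b\<bar>) ^ r * cmod (pker c x y) = cmod (pker c' x y))"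
    using pker_power[OF _ X] by blast
  then obtain C where C: "\<And>b. b \<in> Basis \<Longrightarrow> adm M (C b)"
    "\<And>b x y. b \<in> Basis \<Longrightarrow> (\<alpha> * \<rho> * \<bar>(x - y) \<bullet> b\<bar>) ^ r * cmod (pker c x y) = cmod (pker (C b) x y)" by metis
  have pw: "cmod_sq (pker c x y) * indicator {y. s \<le> dist x y} y \<le> (\<Sum>b\<in>Basis. ennreal (?q\<^sup>2) * cmod_sq (pker (C b) x y))" for x y
  proof (cases "s \<le> dist x y")
    case True
    have "\<exists>b\<in>Basis. s / ?d \<le> \<bar>(x - y) \<bullet> b\<bar>"
    proof (rule ccontr)
      assume "\<not> ?thesis"
      then have "(\<Sum>b\<in>(Basis::'a set). \<bar>(x - y) \<bullet> b\<bar>) < (\<Sum>b\<in>(Basis::'a set). s / ?d)"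
        by (intro sum_strict_mono) auto
      then have "(\<Sum>b\<in>(Basis::'a set). \<bar>(x - y) \<bullet> b\<bar>) < s" by simp
      then show False using norm_le_l1[of "x - y"] True by (simp add: dist_norm)
    qed
    then obtain b where b: "b \<in> Basis" "s / ?d \<le> \<bar>(x - y) \<bullet> b\<bar>" by blast
    have "1 \<le> ?d / (\<alpha> * \<rho> * s) * (\<alpha> * \<rho> * \<bar>(x - y) \<bullet> b\<bar>)"
      using b(2) s \<alpha> \<rho> d by (simp add: field_simps)
    then have "1 \<le> (?d / (\<alpha> * \<rho> * s) * (\<alpha> * \<rho> * \<bar>(x - y) \<bullet> b\<bar>)) ^ r" by (rule one_le_power)
    then have "1 * cmod (pker c x y) \<le> (?q * (\<alpha> * \<rho> * \<bar>(x - y) \<bullet> b\<bar>) ^ r) * cmod (pker c x y)"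
      unfolding power_mult_distrib[symmetric] by (intro mult_right_mono) auto
    then have "cmod (pker c x y) \<le> ?q * cmod (pker (C b) x y)" using C(2)[OF b(1), of x y] by (simp add: mult.assoc)
    then have "(cmod (pker c x y))\<^sup>2 \<le> ?q\<^sup>2 * (cmod (pker (C b) x y))\<^sup>2"
      unfolding power_mult_distrib[symmetric] by (rule power_mono) simp
    then have "cmod_sq (pker c x y) \<le> ennreal (?q\<^sup>2) * cmod_sq (pker (C b) x y)"
      by (simp add: ennreal_mult[symmetric] ennreal_leI)
    also have "\<dots> \<le> (\<Sum>b\<in>Basis. ennreal (?q\<^sup>2) * cmod_sq (pker (C b) x y))"
      by (rule member_le_sum[OF b(1)]) auto
    finally show ?thesis using True by simp
  qed simp
  have pm: "(\<lambda>p. pker (C b) (fst p) (snd p)) \<in> borel_measurable (borel \<Otimes>\<^sub>M borel)" if "b \<in> Basis" for b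
    by (rule pker_measurable[OF C(1)[OF that]])
  have pc: "(\<lambda>y. pker (C b) x y) \<in> borel_measurable lborel" if "b \<in> Basis" for b x
    by (rule pker_compose[OF C(1)[OF that]]) measurable
  have "(\<integral>\<^sup>+x. sq_mass (pker c x) {y. s \<le> dist x y} \<partial>lborel)
     \<le> (\<integral>\<^sup>+x. \<integral>\<^sup>+y. (\<Sum>b\<in>Basis. ennreal (?q\<^sup>2) * cmod_sq (pker (C b) x y)) \<partial>lborel \<partial>lborel)"
    by (intro nn_integral_mono pw)
  also have "\<dots> = (\<integral>\<^sup>+x. (\<Sum>b\<in>Basis. ennreal (?q\<^sup>2) * sq_norm (pker (C b) x)) \<partial>lborel)"
  proof (rule nn_integral_cong)
    fix x :: 'a
    have m: "(\<lambda>y. cmod_sq (pker (C b) x y)) \<in> borel_measurable lborel" if "b \<in> Basis" for b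
      using pc[OF that, of x] by measurable
    have "(\<integral>\<^sup>+y. (\<Sum>b\<in>Basis. ennreal (?q\<^sup>2) * cmod_sq (pker (C b) x y)) \<partial>lborel)
       = (\<Sum>b\<in>Basis. \<integral>\<^sup>+y. ennreal (?q\<^sup>2) * cmod_sq (pker (C b) x y) \<partial>lborel)"
      by (rule nn_integral_sum) (use m in measurable)
    also have "\<dots> = (\<Sum>b\<in>Basis. ennreal (?q\<^sup>2) * sq_norm (pker (C b) x))"
      by (intro sum.cong refl nn_integral_cmult m)
    finally show "(\<integral>\<^sup>+y. (\<Sum>b\<in>Basis. ennreal (?q\<^sup>2) * cmod_sq (pker (C b) x y)) \<partial>lborel)
       = (\<Sum>b\<in>Basis. ennreal (?q\<^sup>2) * sq_norm (pker (C b) x))" .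
  qed
  also have "\<dots> = (\<Sum>b\<in>Basis. ennreal (?q\<^sup>2) * hs_norm_sq (pker (C b)))"
  proof -
    have m: "(\<lambda>x. sq_norm (pker (C b) x)) \<in> borel_measurable lborel" if "b \<in> Basis" for b
      using pm[OF that] by measurable
    have "(\<integral>\<^sup>+x. (\<Sum>b\<in>Basis. ennreal (?q\<^sup>2) * sq_norm (pker (C b) x)) \<partial>lborel)
      = (\<Sum>b\<in>Basis. \<integral>\<^sup>+x. ennreal (?q\<^sup>2) * sq_norm (pker (C b) x) \<partial>lborel)"
      by (rule nn_integral_sum) (use m in measurable)
    also have "\<dots> = (\<Sum>b\<in>Basis. ennreal (?q\<^sup>2) * hs_norm_sq (pker (C b)))"
      by (intro sum.cong refl nn_integral_cmult m)
    finally show ?thesis .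
  qed
  also have "\<dots> \<le> (\<Sum>b\<in>(Basis::'a set). ennreal (?q\<^sup>2) * ennreal (hs_unit * M\<^sup>2))"
    by (intro sum_mono mult_left_mono pker_hs C(1)) auto
  also have "\<dots> = ennreal (\<Sum>b\<in>(Basis::'a set). ?q\<^sup>2 * (hs_unit * M\<^sup>2))"
    using hs_unit_nonneg by (subst sum_ennreal[symmetric]) (auto simp: ennreal_mult)
  also have "(\<Sum>b\<in>(Basis::'a set). ?q\<^sup>2 * (hs_unit * M\<^sup>2)) = ?d * (?d / (\<alpha> * \<rho> * s)) ^ (2 * r) * (hs_unit * M\<^sup>2)"
    by (simp add: power_mult[symmetric] mult.commute[of r])
  finally show ?thesis .
qed

text \<open>The symbol of \<open>\<partial>\<^sub>b\<close> applied to the operator with symbol \<open>c\<close>.\<close>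

definition xderiv :: "'a \<Rightarrow> ('a \<Rightarrow> 'a \<Rightarrow> complex) \<Rightarrow> ('a \<Rightarrow> 'a \<Rightarrow> complex) \<Rightarrow> bool" where
  "xderiv b c c' \<longleftrightarrow> (\<exists>D. has_dw b c D \<and> continuous_on UNIV (\<lambda>p. D (fst p) (snd p)) \<and>
     (\<forall>w \<xi>. c' w \<xi> = \<i> * of_real (\<alpha> * (\<xi> \<bullet> b)) * c w \<xi> + complex_of_real ((1 - t) / l) * D w \<xi>))"

lemma phase_symbol_derivative:
  assumes c: "adm M c" and cb: "\<And>b. b \<in> Basis \<Longrightarrow> xderiv b c (cb b)"
  shows "((\<lambda>s. ephase (p + s *\<^sub>R v - y) \<xi> * c (mid (p + s *\<^sub>R v) y) \<xi>) has_vector_derivative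
     (\<Sum>b\<in>Basis. (v \<bullet> b) *\<^sub>R (ephase (p - y) \<xi> * cb b (mid p y) \<xi>))) (at 0)"
proof -
  have "\<forall>b\<in>Basis. \<exists>D. has_dw b c D \<and> continuous_on UNIV (\<lambda>p. D (fst p) (snd p)) \<and>
     (\<forall>w \<xi>. cb b w \<xi> = \<i> * of_real (\<alpha> * (\<xi> \<bullet> b)) * c w \<xi> + complex_of_real ((1 - t) / l) * D w \<xi>)"
    using cb by (simp add: xderiv_def)
  from bchoice[OF this] obtain D where D': "\<forall>b\<in>Basis. has_dw b c (D b) \<and> continuous_on UNIV (\<lambda>p. D b (fst p) (snd p)) \<and>
     (\<forall>w \<xi>. cb b w \<xi> = \<i> * of_real (\<alpha> * (\<xi> \<bullet> b)) * c w \<xi> + complex_of_real ((1 - t) / l) * D b w \<xi>)" by (elim exE)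
  have D: "has_dw b c (D b)" if "b \<in> Basis" for b by (rule conjunct1[OF bspec[OF D' that]])
  have Dc: "continuous_on UNIV (\<lambda>p. D b (fst p) (snd p))" if "b \<in> Basis" for b
    by (rule conjunct1[OF conjunct2[OF bspec[OF D' that]]])
  have De: "cb b w \<xi> = \<i> * of_real (\<alpha> * (\<xi> \<bullet> b)) * c w \<xi> + complex_of_real ((1 - t) / l) * D b w \<xi>" if "b \<in> Basis" for b w \<xi>
    by (rule spec[OF spec[OF conjunct2[OF conjunct2[OF bspec[OF D' that]]]]])
  let ?e = "ephase (p - y) \<xi>" and ?w = "mid p y"
  have m: "mid (p + s *\<^sub>R v) y = ?w + s *\<^sub>R ((1 - t) *\<^sub>R v)" for s
    by (simp add: mid_def algebra_simps)
  have 1: "((\<lambda>s. ephase (p + s *\<^sub>R v - y) \<xi>) has_vector_derivative (\<i> * of_real (\<alpha> * (v \<bullet> \<xi>))) * ?e) (at 0)"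
    using has_vector_derivative_exp_line[of "\<alpha> * ((p - y) \<bullet> \<xi>)" "\<alpha> * (v \<bullet> \<xi>)"]
    by (simp add: ephase_def inner_add_left inner_diff_left algebra_simps)
  have 2: "((\<lambda>s. c (?w + s *\<^sub>R ((1 - t) *\<^sub>R v)) \<xi>) has_vector_derivative (\<Sum>b\<in>Basis. (((1 - t) *\<^sub>R v) \<bullet> b) *\<^sub>R (D b ?w \<xi> / complex_of_real l))) (at 0)"
  proof (rule continuous_partials_directional[where f = "\<lambda>w. c w \<xi>" and g = "\<lambda>b w. D b w \<xi> / complex_of_real l"])
    fix b x :: 'a assume b: "b \<in> Basis"
    show "((\<lambda>s. c (x + s *\<^sub>R b) \<xi>) has_vector_derivative D b x \<xi> / complex_of_real l) (at 0)"
      using D[OF b] by (simp add: has_dw_def)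
  next
    fix b :: 'a assume b: "b \<in> Basis"
    have "continuous_on UNIV (\<lambda>w. D b w \<xi>)"
      using continuous_on_compose2[OF Dc[OF b], of UNIV "\<lambda>w. (w, \<xi>)"] by (simp add: continuous_intros)
    then show "continuous_on UNIV (\<lambda>w. D b w \<xi> / complex_of_real l)"
      using l by (intro continuous_on_divide continuous_intros) auto
  qed
  have vx: "complex_of_real (v \<bullet> \<xi>) = (\<Sum>b\<in>Basis. complex_of_real ((v \<bullet> b) * (\<xi> \<bullet> b)))"
    by (subst euclidean_inner) simp
  have sum: "(\<Sum>b\<in>Basis. (v \<bullet> b) *\<^sub>R (?e * cb b ?w \<xi>))
     = ?e * (\<Sum>b\<in>Basis. (((1 - t) *\<^sub>R v) \<bullet> b) *\<^sub>R (D b ?w \<xi> / complex_of_real l)) + (\<i> * of_real (\<alpha> * (v \<bullet> \<xi>))) * ?e * c ?w \<xi>"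
  proof -
    have "(\<Sum>b\<in>Basis. (v \<bullet> b) *\<^sub>R (?e * cb b ?w \<xi>))
       = (\<Sum>b\<in>Basis. ?e * ((((1 - t) *\<^sub>R v) \<bullet> b) *\<^sub>R (D b ?w \<xi> / complex_of_real l)) + (\<i> * of_real \<alpha> * ?e * c ?w \<xi>) * complex_of_real ((v \<bullet> b) * (\<xi> \<bullet> b)))"
    proof (rule sum.cong[OF refl])
      fix b :: 'a assume b: "b \<in> Basis"
      show "(v \<bullet> b) *\<^sub>R (?e * cb b ?w \<xi>) = ?e * ((((1 - t) *\<^sub>R v) \<bullet> b) *\<^sub>R (D b ?w \<xi> / complex_of_real l)) + (\<i> * of_real \<alpha> * ?e * c ?w \<xi>) * complex_of_real ((v \<bullet> b) * (\<xi> \<bullet> b))"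
        unfolding De[OF b] by (simp add: scaleR_conv_of_real algebra_simps diff_divide_distrib)
    qed
    also have "\<dots> = ?e * (\<Sum>b\<in>Basis. (((1 - t) *\<^sub>R v) \<bullet> b) *\<^sub>R (D b ?w \<xi> / complex_of_real l)) + (\<i> * of_real \<alpha> * ?e * c ?w \<xi>) * complex_of_real (v \<bullet> \<xi>)"
      unfolding vx sum.distrib sum_distrib_left ..
    finally show ?thesis by (simp add: mult_ac)
  qed
  show ?thesis using has_vector_derivative_mult[OF 1 2] unfolding m sum by (simp add: mid_def)
qed

lemma pker_FTC:
  assumes c: "adm M c" and cb: "\<And>b. b \<in> Basis \<Longrightarrow> xderiv b c (cb b)" and M': "\<And>b. b \<in> Basis \<Longrightarrow> adm M' (cb b)"
  shows "pker c x y - pker c x' y = (LINT s|lborel. indicator {0..1} s *\<^sub>R (\<Sum>b\<in>Basis. ((x - x') \<bullet> b) *\<^sub>R pker (cb b) (x' + s *\<^sub>R (x - x')) y))"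
proof -
  let ?v = "x - x'"
  let ?g = "\<lambda>p \<xi>. \<Sum>b\<in>Basis. (?v \<bullet> b) *\<^sub>R (ephase (p - y) \<xi> * cb b (mid p y) \<xi>)"
  let ?F = "\<lambda>(s::real) \<xi>. indicator {0..1} s *\<^sub>R ?g (x' + s *\<^sub>R ?v) \<xi>"
  let ?K = "(\<Sum>b\<in>Basis. \<bar>?v \<bullet> b\<bar>) * M'"
  have M'0: "M' \<ge> 0" using SOME_Basis adm_nonneg[OF M'] by blast
  have cont: "continuous_on UNIV (\<lambda>p. ?g p \<xi>)" for \<xi>
  proof (intro continuous_on_sum continuous_on_scaleR continuous_on_const continuous_on_mult)
    show "continuous_on UNIV (\<lambda>p. ephase (p - y) \<xi>)" unfolding ephase_def by (intro continuous_intros)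
    show "continuous_on UNIV (\<lambda>p. cb b (mid p y) \<xi>)" if "b \<in> Basis" for b
      by (rule adm_continuous[OF M'[OF that]]) (auto simp: mid_def intro!: continuous_intros)
  qed
  have ftc: "ephase (x - y) \<xi> * c (mid x y) \<xi> - ephase (x' - y) \<xi> * c (mid x' y) \<xi> = (LINT s|lborel. ?F s \<xi>)" for \<xi>
    using LINT_FTC_line[of "\<lambda>p. ephase (p - y) \<xi> * c (mid p y) \<xi>" ?v "\<lambda>p. ?g p \<xi>" x', OF phase_symbol_derivative[OF c cb] cont]
    by simp
  have gi: "integrable lborel (\<lambda>\<xi>. (?v \<bullet> b) *\<^sub>R (ephase (p - y) \<xi> * cb b (mid p y) \<xi>))" if "b \<in> Basis" for b p
    by (intro integrable_scaleR_right adm_integrable[OF M'[OF that]])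
  have int: "integrable (lborel \<Otimes>\<^sub>M lborel) (case_prod ?F)"
  proof (rule integrable_pair_bound[where a = "indicator {0..1}" and b = "\<lambda>\<xi>. ?K * indicator (cball 0 \<rho>) \<xi>"])
    have m: "(\<lambda>p::real \<times> 'a. cb b (mid (x' + fst p *\<^sub>R ?v) y) (snd p)) \<in> borel_measurable (borel \<Otimes>\<^sub>M borel)" if "b \<in> Basis" for b
      by (rule adm_compose[OF M'[OF that]]) measurable
    show "jointly_measurable ?F"
      by (intro borel_measurable_scaleR borel_measurable_sum borel_measurable_times m) measurable
    show "integrable lborel (indicator {0..1::real} :: real \<Rightarrow> real)" by simp
    show "integrable lborel (\<lambda>\<xi>::'a. ?K * indicator (cball 0 \<rho>) \<xi>)" by (rule integrable_ball)
    fix s :: real and \<xi> :: 'a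
    show "0 \<le> (indicator {0..1::real} s :: real)" by simp
    show "0 \<le> ?K * indicator (cball 0 \<rho>) \<xi>" using M'0 by (intro mult_nonneg_nonneg sum_nonneg) auto
    have "cmod (?g p \<xi>) \<le> ?K * indicator (cball 0 \<rho>) \<xi>" for p
    proof -
      have "cmod (?g p \<xi>) \<le> (\<Sum>b\<in>Basis. \<bar>?v \<bullet> b\<bar> * (M' * indicator (cball 0 \<rho>) \<xi>))"
      proof (rule order_trans[OF norm_sum sum_mono])
        fix b :: 'a assume "b \<in> Basis"
        then show "cmod ((?v \<bullet> b) *\<^sub>R (ephase (p - y) \<xi> * cb b (mid p y) \<xi>)) \<le> \<bar>?v \<bullet> b\<bar> * (M' * indicator (cball 0 \<rho>) \<xi>)"
          using mult_left_mono[OF adm_bound[OF M', of b "mid p y" \<xi>], of "\<bar>?v \<bullet> b\<bar>"] by (simp add: norm_mult)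
      qed
      then show ?thesis by (simp add: sum_distrib_right mult.assoc)
    qed
    then show "cmod (?F s \<xi>) \<le> indicator {0..1} s * (?K * indicator (cball 0 \<rho>) \<xi>)"
      using mult_left_mono[of "cmod (?g (x' + s *\<^sub>R ?v) \<xi>)" _ "indicator {0..1} s"] by simp
  qed
  have "pker c x y - pker c x' y = (LINT \<xi>|lborel. ephase (x - y) \<xi> * c (mid x y) \<xi> - ephase (x' - y) \<xi> * c (mid x' y) \<xi>)"
    unfolding pker_def by (rule Bochner_Integration.integral_diff[symmetric]; rule adm_integrable[OF c])
  also have "\<dots> = (LINT \<xi>|lborel. LINT s|lborel. ?F s \<xi>)" unfolding ftc ..
  also have "\<dots> = (LINT s|lborel. LINT \<xi>|lborel. ?F s \<xi>)" by (rule lborel_pair.Fubini_integral[OF int])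
  also have "\<dots> = (LINT s|lborel. indicator {0..1} s *\<^sub>R (\<Sum>b\<in>Basis. (?v \<bullet> b) *\<^sub>R pker (cb b) (x' + s *\<^sub>R ?v) y))"
  proof (rule Bochner_Integration.integral_cong[OF refl])
    fix s :: real
    have "(LINT \<xi>|lborel. ?g (x' + s *\<^sub>R ?v) \<xi>) = (\<Sum>b\<in>Basis. (?v \<bullet> b) *\<^sub>R pker (cb b) (x' + s *\<^sub>R ?v) y)"
      unfolding pker_def by (subst Bochner_Integration.integral_sum[OF gi]) simp_all
    then show "(LINT \<xi>|lborel. ?F s \<xi>) = indicator {0..1} s *\<^sub>R (\<Sum>b\<in>Basis. (?v \<bullet> b) *\<^sub>R pker (cb b) (x' + s *\<^sub>R ?v) y)"
      by simp
  qed
  finally show ?thesis .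
qed

definition Uop :: "('a \<Rightarrow> 'a \<Rightarrow> complex) \<Rightarrow> ('a \<Rightarrow> complex) \<Rightarrow> 'a \<Rightarrow> complex" where
  "Uop c v x = (LINT y|lborel. pker c x y * v y)"

lemma pker_section_L2:
  assumes X: "xi_class r M c" and r: "DIM('a) \<le> r"
  shows "sq_norm (pker c x)
    \<le> ennreal ((2 ^ DIM('a) * (M * ballvol))\<^sup>2) * (\<integral>\<^sup>+y. ennreal ((decay y)\<^sup>2) \<partial>lborel)"
proof -
  let ?C = "2 ^ DIM('a) * (M * ballvol)"
  have "sq_norm (pker c x) \<le> (\<integral>\<^sup>+y. ennreal (?C\<^sup>2) * ennreal ((decay (x - y))\<^sup>2) \<partial>lborel)"
  proof (rule nn_integral_mono)
    fix y :: 'a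
    have "(cmod (pker c x y))\<^sup>2 \<le> (?C * decay (x - y))\<^sup>2" by (rule power_mono[OF pker_decay[OF X r]]) simp
    then show "cmod_sq (pker c x y) \<le> ennreal (?C\<^sup>2) * ennreal ((decay (x - y))\<^sup>2)"
      unfolding power_mult_distrib by (simp add: ennreal_mult[symmetric] ennreal_leI)
  qed
  also have "\<dots> = ennreal (?C\<^sup>2) * (\<integral>\<^sup>+y. ennreal ((decay (x - y))\<^sup>2) \<partial>lborel)" by (rule nn_integral_cmult) measurable
  also have "(\<integral>\<^sup>+y. ennreal ((decay (x - y))\<^sup>2) \<partial>lborel) = (\<integral>\<^sup>+y. ennreal ((decay y)\<^sup>2) \<partial>lborel)"
    by (rule nn_integral_reflect_shift(1)) measurable
  finally show ?thesis .
qed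

lemma pker_section_finite:
  assumes "xi_class r M c" "DIM('a) \<le> r"
  shows "sq_norm (pker c x) < \<infinity>"
  by (rule order.strict_trans1[OF pker_section_L2[OF assms]])
    (use decay_square_finite in \<open>simp add: ennreal_mult_less_top\<close>)

lemma Uop_integrable:
  assumes "xi_class r M c" "DIM('a) \<le> r" and v: "bsq v"
  shows "integrable lborel (\<lambda>y. pker c x y * v y)"
proof (rule integrable_mult_L2)
  show "(\<lambda>y. pker c x y) \<in> borel_measurable lborel"
    by (rule pker_compose[OF xi_class_adm[OF assms(1)]]) measurable
qed (use v pker_section_finite[OF assms(1,2)] in \<open>auto simp: bsq_def\<close>)

lemma Uop_measurable:
  assumes "adm M c" and v: "bsq v" shows "Uop c v \<in> borel_measurable borel"
  unfolding Uop_def[abs_def] by (rule borel_measurable_kernel_int[OF pker_measurable[OF assms(1)]]) (use v in \<open>simp add: bsq_def\<close>)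

lemma Uop_bounded:
  assumes X: "xi_class r M c" "DIM('a) \<le> r" and v: "bsq v"
  shows "\<exists>B. \<forall>x. cmod (Uop c v x) \<le> B"
proof -
  let ?D = "\<integral>\<^sup>+y. ennreal ((decay (y::'a))\<^sup>2) \<partial>lborel"
  let ?V = "sq_norm v"
  let ?B = "ennreal ((2 ^ DIM('a) * (M * ballvol))\<^sup>2) * ?D * ?V"
  have "?D < \<infinity>" by (rule decay_square_finite)
  moreover have "?V < \<infinity>" using v by (simp add: bsq_def)
  ultimately have fin: "?B < \<infinity>" by (simp add: ennreal_mult_less_top)
  have "cmod (Uop c v x) \<le> sqrt (enn2real ?B)" for x
  proof -
    have "cmod_sq (Uop c v x) \<le> sq_norm (pker c x) * ?V"
      unfolding Uop_def
    proof (rule Cauchy_Schwarz_LINT)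
      show "(\<lambda>y. pker c x y) \<in> borel_measurable lborel"
        by (rule pker_compose[OF xi_class_adm[OF X(1)]]) measurable
    qed (use v in \<open>simp add: bsq_def\<close>)
    also have "\<dots> \<le> ?B" by (rule mult_right_mono[OF pker_section_L2[OF X]]) simp
    also have "?B = ennreal (enn2real ?B)" using fin by (simp add: less_top)
    finally have "(cmod (Uop c v x))\<^sup>2 \<le> enn2real ?B" by (subst (asm) ennreal_le_iff) auto
    then show ?thesis by (rule real_le_rsqrt)
  qed
  then show ?thesis by blast
qed

lemma Uop_FTC:
  assumes X: "xi_class r M c" "DIM('a) \<le> r" and cb: "\<And>b. b \<in> Basis \<Longrightarrow> xderiv b c (cb b)"
    and M': "\<And>b. b \<in> Basis \<Longrightarrow> xi_class r M' (cb b)" and v: "bsq v"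
  shows "Uop c v x - Uop c v x' = (LINT s|lborel. indicator {0..1} s *\<^sub>R (\<Sum>b\<in>Basis. ((x - x') \<bullet> b) *\<^sub>R Uop (cb b) v (x' + s *\<^sub>R (x - x'))))"
proof -
  let ?z = "x - x'"
  let ?h = "\<lambda>s y. \<Sum>b\<in>Basis. (?z \<bullet> b) *\<^sub>R pker (cb b) (x' + s *\<^sub>R ?z) y"
  let ?F = "\<lambda>(s::real) y. indicator {0..1} s *\<^sub>R (?h s y * v y)"
  let ?D = "\<integral>\<^sup>+y. ennreal ((decay (y::'a))\<^sup>2) \<partial>lborel"
  let ?V = "sq_norm v"
  let ?W = "ennreal ((2 ^ DIM('a) * (M' * ballvol))\<^sup>2) * ?D"
  let ?B = "\<Sum>b\<in>Basis. ennreal \<bar>?z \<bullet> b\<bar> * (?W + ?V)"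
  have A: "adm M c" "\<And>b. b \<in> Basis \<Longrightarrow> adm M' (cb b)" using X M' xi_class_adm by auto
  have Dfin: "?D < \<infinity>" by (rule decay_square_finite)
  have Vfin: "?V < \<infinity>" and vm[measurable]: "v \<in> borel_measurable borel" using v by (auto simp: bsq_def)
  have Bfin: "?B < \<infinity>" using Dfin Vfin by (simp add: ennreal_mult_less_top)
  have pm: "(\<lambda>y. pker (cb b) p y) \<in> borel_measurable borel" if "b \<in> Basis" for b p
    by (rule pker_compose[OF A(2)[OF that]]) measurable
  have int: "integrable (lborel \<Otimes>\<^sub>M lborel) (case_prod ?F)"
  proof (rule integrable_pair_slices[OF _ _ Bfin])
    have m: "(\<lambda>p::real \<times> 'a. pker (cb b) (x' + fst p *\<^sub>R ?z) (snd p)) \<in> borel_measurable (borel \<Otimes>\<^sub>M borel)" if "b \<in> Basis" for b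
      by (rule pker_compose[OF A(2)[OF that]]) measurable
    show "jointly_measurable ?F"
      by (intro borel_measurable_scaleR borel_measurable_times borel_measurable_sum m) measurable
    fix s :: real
    have "(\<integral>\<^sup>+y. ennreal (cmod (?h s y * v y)) \<partial>lborel) \<le> ?B"
    proof -
      have "(\<integral>\<^sup>+y. ennreal (cmod (?h s y * v y)) \<partial>lborel)
        \<le> (\<integral>\<^sup>+y. (\<Sum>b\<in>Basis. ennreal \<bar>?z \<bullet> b\<bar> * (cmod_sq (pker (cb b) (x' + s *\<^sub>R ?z) y) + cmod_sq (v y))) \<partial>lborel)"
      proof (rule nn_integral_mono)
        fix y :: 'a
        have "cmod (?h s y * v y) \<le> (\<Sum>b\<in>Basis. \<bar>?z \<bullet> b\<bar> * ((cmod (pker (cb b) (x' + s *\<^sub>R ?z) y))\<^sup>2 + (cmod (v y))\<^sup>2))"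
          unfolding sum_distrib_right
        proof (rule order_trans[OF norm_sum sum_mono])
          fix b :: 'a
          let ?p = "pker (cb b) (x' + s *\<^sub>R ?z) y"
          have "cmod ?p * cmod (v y) \<le> (cmod ?p)\<^sup>2 + (cmod (v y))\<^sup>2"
            using sum_squares_bound[of "cmod ?p" "cmod (v y)"] mult_nonneg_nonneg[of "cmod ?p" "cmod (v y)"]
            by (simp del: mult_nonneg_nonneg)
          then show "cmod ((?z \<bullet> b) *\<^sub>R ?p * v y) \<le> \<bar>?z \<bullet> b\<bar> * ((cmod ?p)\<^sup>2 + (cmod (v y))\<^sup>2)"
            using mult_left_mono[of "cmod ?p * cmod (v y)" _ "\<bar>?z \<bullet> b\<bar>"] by (simp add: norm_mult mult.assoc)
        qed
        then have "ennreal (cmod (?h s y * v y)) \<le> ennreal (\<Sum>b\<in>Basis. \<bar>?z \<bullet> b\<bar> * ((cmod (pker (cb b) (x' + s *\<^sub>R ?z) y))\<^sup>2 + (cmod (v y))\<^sup>2))"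
          by (rule ennreal_leI)
        also have "\<dots> = (\<Sum>b\<in>Basis. ennreal \<bar>?z \<bullet> b\<bar> * (cmod_sq (pker (cb b) (x' + s *\<^sub>R ?z) y) + cmod_sq (v y)))"
          by (subst sum_ennreal[symmetric]) (auto simp: ennreal_mult ennreal_plus)
        finally show "ennreal (cmod (?h s y * v y)) \<le> (\<Sum>b\<in>Basis. ennreal \<bar>?z \<bullet> b\<bar> * (cmod_sq (pker (cb b) (x' + s *\<^sub>R ?z) y) + cmod_sq (v y)))" .
      qed
      also have "\<dots> = (\<Sum>b\<in>Basis. \<integral>\<^sup>+y. ennreal \<bar>?z \<bullet> b\<bar> * (cmod_sq (pker (cb b) (x' + s *\<^sub>R ?z) y) + cmod_sq (v y)) \<partial>lborel)"
        by (rule nn_integral_sum) (use pm in measurable)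
      also have "\<dots> \<le> ?B"
      proof (rule sum_mono)
        fix b :: 'a assume b: "b \<in> Basis"
        note [measurable] = pm[OF b]
        have "(\<integral>\<^sup>+y. ennreal \<bar>?z \<bullet> b\<bar> * (cmod_sq (pker (cb b) (x' + s *\<^sub>R ?z) y) + cmod_sq (v y)) \<partial>lborel)
          = ennreal \<bar>?z \<bullet> b\<bar> * ((\<integral>\<^sup>+y. cmod_sq (pker (cb b) (x' + s *\<^sub>R ?z) y) \<partial>lborel) + ?V)"
          by (simp add: nn_integral_cmult nn_integral_add)
        also have "\<dots> \<le> ennreal \<bar>?z \<bullet> b\<bar> * (?W + ?V)"
          by (intro mult_left_mono add_right_mono pker_section_L2[OF M'[OF b] X(2)]) simp
        finally show "(\<integral>\<^sup>+y. ennreal \<bar>?z \<bullet> b\<bar> * (cmod_sq (pker (cb b) (x' + s *\<^sub>R ?z) y) + cmod_sq (v y)) \<partial>lborel) \<le> ennreal \<bar>?z \<bullet> b\<bar> * (?W + ?V)" .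
      qed
      finally show ?thesis .
    qed
    then show "(\<integral>\<^sup>+y. ennreal (cmod (?F s y)) \<partial>lborel) \<le> ?B * indicator {0..1} s"
      by (cases "s \<in> {0..1}") auto
  qed
  have "Uop c v x - Uop c v x' = (LINT y|lborel. pker c x y * v y - pker c x' y * v y)"
    unfolding Uop_def by (rule Bochner_Integration.integral_diff[symmetric]; rule Uop_integrable[OF X v])
  also have "\<dots> = (LINT y|lborel. LINT s|lborel. ?F s y)"
  proof (rule Bochner_Integration.integral_cong[OF refl])
    fix y :: 'a
    have e: "pker c x y - pker c x' y = (LINT s|lborel. indicator {0..1} s *\<^sub>R ?h s y)"
      by (rule pker_FTC[OF A(1) cb A(2)])
    have "pker c x y * v y - pker c x' y * v y = (LINT s|lborel. indicator {0..1} s *\<^sub>R ?h s y) * v y"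
      unfolding left_diff_distrib[symmetric] e ..
    also have "\<dots> = (LINT s|lborel. (indicator {0..1} s *\<^sub>R ?h s y) * v y)" by (rule integral_mult_left_zero[symmetric])
    finally show "pker c x y * v y - pker c x' y * v y = (LINT s|lborel. ?F s y)" by simp
  qed
  also have "\<dots> = (LINT s|lborel. LINT y|lborel. ?F s y)" by (rule lborel_pair.Fubini_integral[OF int])
  also have "\<dots> = (LINT s|lborel. indicator {0..1} s *\<^sub>R (\<Sum>b\<in>Basis. (?z \<bullet> b) *\<^sub>R Uop (cb b) v (x' + s *\<^sub>R ?z)))"
  proof (rule Bochner_Integration.integral_cong[OF refl])
    fix s :: real
    have "(LINT y|lborel. ?h s y * v y) = (LINT y|lborel. (\<Sum>b\<in>Basis. (?z \<bullet> b) *\<^sub>R (pker (cb b) (x' + s *\<^sub>R ?z) y * v y)))"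
      by (simp add: sum_distrib_right)
    also have "\<dots> = (\<Sum>b\<in>Basis. LINT y|lborel. (?z \<bullet> b) *\<^sub>R (pker (cb b) (x' + s *\<^sub>R ?z) y * v y))"
      by (intro Bochner_Integration.integral_sum integrable_scaleR_right Uop_integrable[OF M' X(2) v])
    finally have "(LINT y|lborel. ?h s y * v y) = (\<Sum>b\<in>Basis. (?z \<bullet> b) *\<^sub>R Uop (cb b) v (x' + s *\<^sub>R ?z))"
      by (simp add: Uop_def)
    then show "(LINT y|lborel. ?F s y) = indicator {0..1} s *\<^sub>R (\<Sum>b\<in>Basis. (?z \<bullet> b) *\<^sub>R Uop (cb b) v (x' + s *\<^sub>R ?z))"
      by simp
  qed
  finally show ?thesis .
qed

lemma Uop_poincare:
  assumes X: "xi_class r M c" "DIM('a) \<le> r" and cb: "\<And>b. b \<in> Basis \<Longrightarrow> xderiv b c (cb b)"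
    and M': "\<And>b. b \<in> Basis \<Longrightarrow> xi_class r M' (cb b)" and v: "bsq v"
    and Q: "Q \<in> sets borel" "convex Q" "emeasure lborel Q < \<infinity>"
    and diam: "\<And>x x'. x \<in> Q \<Longrightarrow> x' \<in> Q \<Longrightarrow> dist x x' \<le> \<delta>"
    and zero: "(LINT x|lborel. indicator Q x *\<^sub>R Uop c v x) = 0"
  shows "sq_mass (Uop c v) Q
     \<le> ennreal (\<delta>\<^sup>2 * 2 ^ DIM('a)) * (\<Sum>b\<in>Basis. sq_mass (Uop (cb b) v) Q)"
proof (rule poincare_mean_zero[OF _ _ Q diam Uop_FTC[OF X cb M' v] _ zero])
  show U: "Uop c v \<in> borel_measurable borel" by (rule Uop_measurable[OF xi_class_adm[OF X(1)] v])
  show "Uop (cb b) v \<in> borel_measurable borel" if "b \<in> Basis" for b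
    by (rule Uop_measurable[OF xi_class_adm[OF M'[OF that]] v])
  obtain B where B: "\<And>x. cmod (Uop c v x) \<le> B" using Uop_bounded[OF X v] by blast
  show "integrable lborel (\<lambda>x. indicator Q x *\<^sub>R Uop c v x)"
  proof (rule Bochner_Integration.integrable_bound)
    show "integrable lborel (\<lambda>x. B * indicator Q x)"
      by (intro integrable_mult_right integrable_real_indicator) (use Q in auto)
    show "(\<lambda>x. indicator Q x *\<^sub>R Uop c v x) \<in> borel_measurable lborel"
      using Q(1) U by measurable
    show "AE x in lborel. norm (indicator Q x *\<^sub>R Uop c v x) \<le> norm (B * indicator Q x)"
      using B order_trans[OF norm_ge_zero B] by (intro always_eventually allI) (auto simp: indicator_def)
  qed
qed

end

section \<open>Finite-dimensional approximation on cells\<close>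

definition brep :: "'a::euclidean_space L2 \<Rightarrow> 'a \<Rightarrow> complex" where
  "brep g = (SOME v. bsq v \<and> g = abs_L2 v \<and> (AE x in lebesgue. rep_L2 g x = v x))"

lemma brep: "bsq (brep g)" "g = abs_L2 (brep g)" "AE x in lebesgue. rep_L2 g x = brep g x"
proof -
  have "\<exists>v. bsq v \<and> g = abs_L2 v \<and> (AE x in lebesgue. rep_L2 g x = v x)"
    by (rule L2_borel_rep[of g]) blast
  then have B: "bsq (brep g) \<and> g = abs_L2 (brep g) \<and> (AE x in lebesgue. rep_L2 g x = brep g x)"
    unfolding brep_def by (rule someI_ex)
  show "bsq (brep g)" by (rule conjunct1[OF B])
  show "g = abs_L2 (brep g)" by (rule conjunct1[OF conjunct2[OF B]])
  show "AE x in lebesgue. rep_L2 g x = brep g x" by (rule conjunct2[OF conjunct2[OF B]])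
qed

definition words :: "nat \<Rightarrow> 'a::euclidean_space list set" where
  "words k = {bs. set bs \<subseteq> Basis \<and> length bs = k}"

lemma card_words: "card (words k :: 'a::euclidean_space list set) = DIM('a) ^ k"
  unfolding words_def by (rule card_lists_length_eq[OF finite_Basis])

lemma sum_words_Suc:
  fixes f :: "'a::euclidean_space list \<Rightarrow> ennreal"
  shows "(\<Sum>bs\<in>words (Suc k). f bs) = (\<Sum>bs\<in>words k. \<Sum>b\<in>Basis. f (b # bs))"
proof -
  have e: "(words (Suc k) :: 'a list set) = (\<lambda>(bs, b). b # bs) ` (words k \<times> Basis)"
    unfolding words_def by (auto simp: image_iff length_Suc_conv)
  have "(\<Sum>bs\<in>words (Suc k). f bs) = (\<Sum>p\<in>words k \<times> Basis. f (snd p # fst p))"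
    unfolding e by (subst sum.reindex) (auto simp: inj_on_def split_beta')
  also have "\<dots> = (\<Sum>bs\<in>words k. \<Sum>b\<in>Basis. f (b # bs))"
    by (subst sum.cartesian_product) (simp add: split_beta')
  finally show ?thesis .
qed

definition cell_index :: "real \<Rightarrow> 'a::euclidean_space \<Rightarrow> 'a \<Rightarrow> int" where
  "cell_index \<delta> x = restrict (\<lambda>b. \<lfloor>x \<bullet> b / \<delta>\<rfloor>) Basis"

text \<open>Cells are indexed by integer functions on the basis. An index that is not a restriction to the basis
  labels the empty cell.\<close>

definition cell :: "real \<Rightarrow> ('a::euclidean_space \<Rightarrow> int) \<Rightarrow> 'a set" where
  "cell \<delta> k = {x. cell_index \<delta> x = k}"

lemma cell_alt: "k \<in> extensional Basis \<Longrightarrow> cell \<delta> k = {x. \<forall>b\<in>Basis. \<lfloor>x \<bullet> b / \<delta>\<rfloor> = k b}"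
  by (auto simp: cell_def cell_index_def fun_eq_iff extensional_def)

lemma cell_empty: "k \<notin> extensional Basis \<Longrightarrow> cell \<delta> k = {}"
  by (auto simp: cell_def cell_index_def)

lemma cell_measurable[measurable]: "cell \<delta> k \<in> sets borel"
proof (cases "k \<in> extensional Basis")
  case True
  have "{x. \<forall>b\<in>Basis. \<lfloor>x \<bullet> b / \<delta>\<rfloor> = k b} = (\<Inter>b\<in>Basis. {x. \<lfloor>x \<bullet> b / \<delta>\<rfloor> = k b})" by auto
  moreover have "{x::'a. \<lfloor>x \<bullet> b / \<delta>\<rfloor> = k b} \<in> sets borel" for b
  proof -
    have "{x::'a. \<lfloor>x \<bullet> b / \<delta>\<rfloor> = k b} = {x. of_int (k b) \<le> x \<bullet> b / \<delta>} \<inter> {x. x \<bullet> b / \<delta> < of_int (k b) + 1}"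
      by (auto simp: floor_eq_iff)
    also have "\<dots> \<in> sets borel" by measurable
    finally show ?thesis .
  qed
  ultimately show ?thesis unfolding cell_alt[OF True] by (metis (no_types, lifting) finite_Basis nonempty_Basis sets.finite_INT)
qed (simp add: cell_empty)

lemma cell_convex: assumes "0 < \<delta>" shows "convex (cell \<delta> k)"
proof (cases "k \<in> extensional Basis")
  case True
  have "cell \<delta> k = {x. \<forall>b\<in>Basis. \<delta> * of_int (k b) \<le> b \<bullet> x \<and> b \<bullet> x < \<delta> * (of_int (k b) + 1)}"
    unfolding cell_alt[OF True] using assms by (auto simp: floor_eq_iff field_simps inner_commute)
  also have "\<dots> = (\<Inter>b\<in>Basis. {x. \<delta> * of_int (k b) \<le> b \<bullet> x} \<inter> {x. b \<bullet> x < \<delta> * (of_int (k b) + 1)})" by auto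
  also have "convex \<dots>" by (intro convex_INT convex_Int convex_halfspace_ge convex_halfspace_lt)
  finally show ?thesis .
qed (simp add: cell_empty)

lemma cell_diam:
  fixes x x' :: "'a::euclidean_space"
  assumes \<delta>: "0 < \<delta>" and x: "x \<in> cell \<delta> k" "x' \<in> cell \<delta> k"
  shows "dist x x' \<le> real DIM('a) * \<delta>"
proof -
  have "\<bar>(x - x') \<bullet> b\<bar> \<le> \<delta>" if b: "b \<in> Basis" for b
  proof -
    have "cell_index \<delta> x b = cell_index \<delta> x' b" using x by (simp add: cell_def)
    then have "\<lfloor>x \<bullet> b / \<delta>\<rfloor> = \<lfloor>x' \<bullet> b / \<delta>\<rfloor>" using b by (simp add: cell_index_def)
    then have "\<bar>x \<bullet> b / \<delta> - x' \<bullet> b / \<delta>\<bar> \<le> 1" by linarith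
    then have "\<bar>(x - x') \<bullet> b / \<delta>\<bar> \<le> 1" by (simp add: inner_diff_left diff_divide_distrib)
    then show ?thesis using \<delta> by simp
  qed
  then have "(\<Sum>b\<in>Basis. \<bar>(x - x') \<bullet> b\<bar>) \<le> (\<Sum>b\<in>(Basis::'a set). \<delta>)" by (rule sum_mono)
  then show ?thesis using norm_le_l1[of "x - x'"] by (simp add: dist_norm)
qed

lemma cell_finite:
  fixes k :: "'a::euclidean_space \<Rightarrow> int"
  assumes "0 < \<delta>" shows "emeasure lborel (cell \<delta> k) < \<infinity>"
proof (rule emeasure_bounded_finite)
  show "bounded (cell \<delta> k)"
  proof (cases "cell \<delta> k = {}")
    case False
    then obtain x where "x \<in> cell \<delta> k" by blast
    then show ?thesis unfolding bounded_def using cell_diam[OF assms] by blast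
  qed simp
qed

lemma cells_count:
  fixes u :: "'a::euclidean_space"
  assumes \<delta>: "0 < \<delta>" and r: "0 \<le> r"
  shows "finite (cell_index \<delta> ` cball u r)" "real (card (cell_index \<delta> ` cball u r)) \<le> (2 * r / \<delta> + 2) ^ DIM('a)"
proof -
  let ?I = "\<lambda>b. {\<lfloor>(u \<bullet> b - r) / \<delta>\<rfloor>..\<lfloor>(u \<bullet> b + r) / \<delta>\<rfloor>}"
  have sub: "cell_index \<delta> ` cball u r \<subseteq> PiE Basis ?I"
  proof
    fix k assume "k \<in> cell_index \<delta> ` cball u r"
    then obtain x where x: "dist u x \<le> r" "k = cell_index \<delta> x" by auto
    have "\<lfloor>x \<bullet> b / \<delta>\<rfloor> \<in> ?I b" if "b \<in> Basis" for b
    proof -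
      have "\<bar>(x - u) \<bullet> b\<bar> \<le> r" using Basis_le_norm[OF that, of "x - u"] x(1) by (simp add: dist_norm norm_minus_commute)
      then have "u \<bullet> b - r \<le> x \<bullet> b" "x \<bullet> b \<le> u \<bullet> b + r" by (auto simp: inner_diff_left)
      then show ?thesis using \<delta> by (auto intro!: floor_mono divide_right_mono)
    qed
    then show "k \<in> PiE Basis ?I" by (simp add: x(2) cell_index_def)
  qed
  have fin: "finite (PiE Basis ?I)" by (intro finite_PiE) auto
  show "finite (cell_index \<delta> ` cball u r)" by (rule finite_subset[OF sub fin])
  have "card (cell_index \<delta> ` cball u r) \<le> card (PiE Basis ?I)" by (rule card_mono[OF fin sub])
  also have "\<dots> = (\<Prod>b\<in>Basis. card (?I b))" by (simp add: card_PiE)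
  finally have "real (card (cell_index \<delta> ` cball u r)) \<le> real (\<Prod>b\<in>Basis. card (?I b))"
    by (rule of_nat_mono)
  then have "real (card (cell_index \<delta> ` cball u r)) \<le> (\<Prod>b\<in>Basis. real (card (?I b)))"
    by (simp only: of_nat_prod)
  also have "\<dots> \<le> (\<Prod>b\<in>(Basis::'a set). 2 * r / \<delta> + 2)"
  proof (rule prod_mono)
    fix b :: 'a
    have "(u \<bullet> b - r) / \<delta> \<le> (u \<bullet> b + r) / \<delta>" using \<delta> r by (intro divide_right_mono) auto
    then have "\<lfloor>(u \<bullet> b - r) / \<delta>\<rfloor> \<le> \<lfloor>(u \<bullet> b + r) / \<delta>\<rfloor>" by (rule floor_mono)
    then have "real (card (?I b)) = real_of_int (\<lfloor>(u \<bullet> b + r) / \<delta>\<rfloor> - \<lfloor>(u \<bullet> b - r) / \<delta>\<rfloor> + 1)" by simp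
    also have "\<dots> \<le> (u \<bullet> b + r) / \<delta> - (u \<bullet> b - r) / \<delta> + 2" by linarith
    also have "\<dots> = 2 * r / \<delta> + 2" using \<delta> by (simp add: field_simps)
    finally show "0 \<le> real (card (?I b)) \<and> real (card (?I b)) \<le> 2 * r / \<delta> + 2" by simp
  qed
  finally show "real (card (cell_index \<delta> ` cball u r)) \<le> (2 * r / \<delta> + 2) ^ DIM('a)" by simp
qed

context pdo
begin

definition step_const :: "nat \<Rightarrow> real" where "step_const r = \<alpha> * \<rho> * (2 ^ r + 1 / l\<^sub>0)"

lemma w_class_xderiv:
  assumes "w_class (Suc k) r M c" "b \<in> Basis"
  shows "\<exists>c'. xderiv b c c' \<and> w_class k r (step_const r * M) c'"
proof -
  obtain D where D: "has_dw b c D" "w_class k r M D" "w_class k r (\<alpha> * \<rho> * (2 ^ r + 1 / l\<^sub>0) * M)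
    (\<lambda>w \<xi>. \<i> * of_real (\<alpha> * (\<xi> \<bullet> b)) * c w \<xi> + complex_of_real ((1 - t) / l) * D w \<xi>)"
    using w_class_step[OF assms \<alpha> l0 t] by blast
  let ?c' = "\<lambda>w \<xi>. \<i> * of_real (\<alpha> * (\<xi> \<bullet> b)) * c w \<xi> + complex_of_real ((1 - t) / l) * D w \<xi>"
  have "continuous_on UNIV (\<lambda>p. D (fst p) (snd p))"
    using xi_class_adm[OF w_class_xi[OF D(2)]] by (simp add: adm_def)
  then have "xderiv b c ?c'" unfolding xderiv_def using D(1) by (intro exI[of _ D] conjI allI refl)
  moreover have "w_class k r (step_const r * M) ?c'" using D(3) by (simp only: step_const_def)
  ultimately show ?thesis by (intro exI[of _ ?c'] conjI)
qed

text \<open>\<open>Uop (word_symbol n r M c bs)\<close> is the derivative of \<open>Uop c\<close> in the directions \<open>bs\<close>. The derivative of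
  the symbol is chosen with its class, which fixes the remaining order \<open>n - length bs\<close>.\<close>

primrec word_symbol :: "nat \<Rightarrow> nat \<Rightarrow> real \<Rightarrow> ('a \<Rightarrow> 'a \<Rightarrow> complex) \<Rightarrow> 'a list \<Rightarrow> 'a \<Rightarrow> 'a \<Rightarrow> complex" where
  "word_symbol n r M c [] = c"
| "word_symbol n r M c (b # bs) = (SOME c'. xderiv b (word_symbol n r M c bs) c' \<and>
     w_class (n - Suc (length bs)) r (step_const r ^ Suc (length bs) * M) c')"

lemma word_symbol_step:
  assumes "w_class (n - length bs) r (step_const r ^ length bs * M) (word_symbol n r M c bs)"
    and "length bs < n" "b \<in> Basis"
  shows "xderiv b (word_symbol n r M c bs) (word_symbol n r M c (b # bs)) \<and>
     w_class (n - Suc (length bs)) r (step_const r ^ Suc (length bs) * M) (word_symbol n r M c (b # bs))"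
proof -
  have "n - length bs = Suc (n - Suc (length bs))" using assms(2) by simp
  then have "\<exists>c'. xderiv b (word_symbol n r M c bs) c' \<and> w_class (n - Suc (length bs)) r (step_const r ^ Suc (length bs) * M) c'"
    using w_class_xderiv[of "n - Suc (length bs)" r "step_const r ^ length bs * M" "word_symbol n r M c bs" b] assms
    by (simp add: mult.assoc)
  from someI_ex[OF this] show ?thesis by simp
qed

lemma word_symbol_class:
  assumes c: "w_class n r M c"
  shows "set bs \<subseteq> Basis \<Longrightarrow> length bs \<le> n \<Longrightarrow> w_class (n - length bs) r (step_const r ^ length bs * M) (word_symbol n r M c bs)"
proof (induction bs)
  case (Cons b bs)
  then show ?case using word_symbol_step[of n bs r M c b] by auto
qed (use c in simp)

text \<open>Iterating the Poincare inequality: if the mean over \<open>Q\<close> vanishes for every derivative of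
  order less than \<open>k\<close>, then the function is controlled by the derivatives of order \<open>k\<close> alone.\<close>

lemma Uop_poincare_iterated:
  assumes c: "w_class n r M c" and r: "DIM('a) \<le> r" and v: "bsq v"
    and Q: "Q \<in> sets borel" "convex Q" "emeasure lborel Q < \<infinity>"
    and diam: "\<And>x x'. x \<in> Q \<Longrightarrow> x' \<in> Q \<Longrightarrow> dist x x' \<le> \<delta>"
    and zero: "\<And>bs. set bs \<subseteq> Basis \<Longrightarrow> length bs < n \<Longrightarrow> (LINT x|lborel. indicator Q x *\<^sub>R Uop (word_symbol n r M c bs) v x) = 0"
  shows "k \<le> n \<Longrightarrow> (sq_mass (Uop c v) Q)
    \<le> ennreal (\<delta>\<^sup>2 * 2 ^ DIM('a)) ^ k * (\<Sum>bs\<in>words k. sq_mass (Uop (word_symbol n r M c bs) v) Q)"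
proof (induction k)
  case 0
  have "words 0 = {[] :: 'a list}" by (auto simp: words_def)
  then show ?case by simp
next
  case (Suc k)
  let ?P = "ennreal (\<delta>\<^sup>2 * 2 ^ DIM('a))"
  let ?I = "\<lambda>bs. sq_mass (Uop (word_symbol n r M c bs) v) Q"
  have "?I bs \<le> ?P * (\<Sum>b\<in>Basis. ?I (b # bs))" if bs: "bs \<in> words k" for bs
  proof -
    have len: "set bs \<subseteq> Basis" "length bs < n" using bs Suc.prems by (auto simp: words_def)
    have W: "w_class (n - length bs) r (step_const r ^ length bs * M) (word_symbol n r M c bs)"
      using word_symbol_class[OF c len(1)] len(2) by simp
    show ?thesis
    proof (rule Uop_poincare[OF w_class_xi[OF W] r _ _ v Q diam zero[OF len]])
      fix b :: 'a assume b: "b \<in> Basis"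
      show "xderiv b (word_symbol n r M c bs) (word_symbol n r M c (b # bs))"
        by (rule conjunct1[OF word_symbol_step[OF W len(2) b]])
      show "xi_class r (step_const r ^ Suc (length bs) * M) (word_symbol n r M c (b # bs))"
        by (rule w_class_xi[OF conjunct2[OF word_symbol_step[OF W len(2) b]]])
    qed
  qed
  then have "(\<Sum>bs\<in>words k. ?I bs) \<le> (\<Sum>bs\<in>words k. ?P * (\<Sum>b\<in>Basis. ?I (b # bs)))" by (rule sum_mono)
  also have "\<dots> = ?P * (\<Sum>bs\<in>words (Suc k). ?I bs)" by (simp only: sum_words_Suc sum_distrib_left)
  finally have "?P ^ k * (\<Sum>bs\<in>words k. ?I bs) \<le> ?P ^ k * (?P * (\<Sum>bs\<in>words (Suc k). ?I bs))" by (rule mult_left_mono) simp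
  with Suc show ?case by (simp add: mult.assoc mult.left_commute) 
qed

end

text \<open>The phases \<open>e\<^bsup>i \<alpha> x \<mu>\<^esup>\<close> and \<open>e\<^bsup>-i \<alpha> y \<mu>\<^esup>\<close>, which move the frequency ball to the origin, are absorbed
  into \<open>h1\<close> and \<open>h2\<close>; the bounds and the separation hold at every point because suitable Borel
  representatives are taken.\<close>

locale cutoff_pdo = pdo l \<rho> u \<alpha> t l\<^sub>0 for l \<rho> :: real and u :: "'a::euclidean_space" and \<alpha> t l\<^sub>0 :: real +
  fixes h1 h2 :: "'a \<Rightarrow> complex" and A1 A2 R :: real
  assumes h1m[measurable]: "h1 \<in> borel_measurable borel" and h2m[measurable]: "h2 \<in> borel_measurable borel"
    and h1: "\<And>x. cmod (h1 x) \<le> A1" and h2: "\<And>x. cmod (h2 x) \<le> A2"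
    and sep: "\<And>x y. h1 x \<noteq> 0 \<Longrightarrow> h2 y \<noteq> 0 \<Longrightarrow> R \<le> dist x y" and R: "l \<le> R"
begin

lemma A12: "0 \<le> A1" "0 \<le> A2"
  using order_trans[OF norm_ge_zero h1] order_trans[OF norm_ge_zero h2] by auto

definition amp :: real where "amp = (\<alpha> / (2 * pi)) ^ DIM('a)"

lemma amp_nonneg: "0 \<le> amp" using \<alpha> by (simp add: amp_def)

definition kern :: "('a \<Rightarrow> 'a \<Rightarrow> complex) \<Rightarrow> 'a \<Rightarrow> 'a \<Rightarrow> complex" where
  "kern c x y = h1 x * (complex_of_real amp * pker c x y) * h2 y"

lemma kern_measurable:
  assumes c: "adm M c"
  shows "jointly_measurable (kern c)"
proof -
  note [measurable] = pker_measurable[OF c]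
  show ?thesis unfolding kern_def by measurable
qed

lemma kern_hs:
  assumes c: "adm M c"
  shows "hs_kernel (kern c)"
  unfolding hs_kernel_def
proof
  show "jointly_measurable (kern c)" by (rule kern_measurable[OF c])
  note [measurable] = pker_measurable[OF c]
  let ?C = "(A1 * amp * A2)\<^sup>2"
  have "hs_norm_sq (kern c)
      \<le> (\<integral>\<^sup>+x. \<integral>\<^sup>+y. ennreal ?C * cmod_sq (pker c x y) \<partial>lborel \<partial>lborel)"
  proof (intro nn_integral_mono)
    fix x y
    have "cmod (kern c x y) = cmod (h1 x) * (amp * cmod (pker c x y)) * cmod (h2 y)"
      using amp_nonneg by (simp add: kern_def norm_mult)
    also have "\<dots> \<le> A1 * (amp * cmod (pker c x y)) * A2"
      using h1 h2 A12 amp_nonneg by (intro mult_mono mult_nonneg_nonneg) auto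
    also have "\<dots> = (A1 * amp * A2) * cmod (pker c x y)" by simp
    finally have "(cmod (kern c x y))\<^sup>2 \<le> ?C * (cmod (pker c x y))\<^sup>2"
      unfolding power_mult_distrib[symmetric] by (rule power_mono) simp
    then show "cmod_sq (kern c x y) \<le> ennreal ?C * cmod_sq (pker c x y)"
      by (simp add: ennreal_mult[symmetric] ennreal_leI)
  qed
  also have "\<dots> = ennreal ?C * hs_norm_sq (pker c)"
  proof -
    have [measurable]: "(\<lambda>y. pker c x y) \<in> borel_measurable borel" for x by (rule pker_compose[OF c]) measurable
    have "(\<integral>\<^sup>+y. ennreal ?C * cmod_sq (pker c x y) \<partial>lborel) = ennreal ?C * sq_norm (pker c x)" for x
      by (rule nn_integral_cmult) measurable
    moreover have "(\<integral>\<^sup>+x. ennreal ?C * sq_norm (pker c x) \<partial>lborel)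
       = ennreal ?C * hs_norm_sq (pker c)"
      by (rule nn_integral_cmult) measurable
    ultimately show ?thesis by (simp only:)
  qed
  also have "\<dots> \<le> ennreal ?C * ennreal (hs_unit * M\<^sup>2)" by (intro mult_left_mono pker_hs[OF c]) simp
  also have "\<dots> < \<infinity>" by (simp add: ennreal_mult_less_top)
  finally show "hs_norm_sq (kern c) < \<infinity>" .
qed

definition cut :: "'a L2 \<Rightarrow> 'a \<Rightarrow> complex" where "cut g y = h2 y * brep g y"

lemma cut_bsq: "bsq (cut g)"
proof (rule bsq_bound[OF _ brep(1)])
  have [measurable]: "brep g \<in> borel_measurable borel" using brep(1)[of g] by (simp add: bsq_def)
  show "cut g \<in> borel_measurable borel" unfolding cut_def by measurable
  show "cmod (cut g y) \<le> A2 * cmod (brep g y)" for y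
    unfolding cut_def norm_mult by (rule mult_right_mono[OF h2]) simp
qed

lemma Uop_cut:
  assumes c: "adm M c"
  shows "Uop c (cut g) x = (LINT y|lebesgue. (pker c x y * h2 y) * rep_L2 g y)"
proof -
  note [measurable] = pker_measurable[OF c]
  have [measurable]: "(\<lambda>y. pker c x y) \<in> borel_measurable borel" by (rule pker_compose[OF c]) measurable
  have "(LINT y|lebesgue. (pker c x y * h2 y) * rep_L2 g y) = (LINT y|lborel. (pker c x y * h2 y) * brep g y)"
    by (rule LINT_rep_L2[OF _ brep(1,3)]) measurable
  then show ?thesis by (simp add: Uop_def cut_def mult.assoc)
qed

text \<open>Orthonormal families enter only through this pointwise inequality, so that sums over \<open>g\<close> are bounded
  by Hilbert-Schmidt norms of kernels, independently of the number of functions.\<close>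

lemma Uop_cut_Bessel:
  assumes c: "adm M c" and G: "orthonormal_L2 G"
  shows "(\<Sum>g\<in>G. cmod_sq (Uop c (cut g) x)) \<le> (\<integral>\<^sup>+y. cmod_sq (pker c x y * h2 y) \<partial>lborel)"
  unfolding Uop_cut[OF c]
proof (rule Bessel_LINT[OF G])
  have [measurable]: "(\<lambda>y. pker c x y) \<in> borel_measurable borel" by (rule pker_compose[OF c]) measurable
  show "(\<lambda>y. pker c x y * h2 y) \<in> borel_measurable borel" by measurable
qed

lemma Uop_cut_cinner:
  assumes X: "xi_class r M c" "DIM('a) \<le> r"
  shows "Uop c (cut g) x = cinner_L2 g (abs_L2 (\<lambda>y. cnj (pker c x y * h2 y)))"
proof -
  have [measurable]: "(\<lambda>y. pker c x y) \<in> borel_measurable borel" by (rule pker_compose[OF xi_class_adm[OF X(1)]]) measurable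
  have b: "bsq (\<lambda>y. pker c x y)" using pker_section_finite[OF X] by (simp add: bsq_def)
  have m: "(\<lambda>y. pker c x y * h2 y) \<in> borel_measurable borel" by measurable
  have m': "(\<lambda>y. cnj (pker c x y * h2 y)) \<in> borel_measurable borel"
    by (rule borel_measurable_continuous_on[OF _ m]) (intro continuous_intros)
  have b': "bsq (\<lambda>y. cnj (pker c x y * h2 y))"
  proof (rule bsq_bound[OF m' b])
    show "cmod (cnj (pker c x y * h2 y)) \<le> A2 * cmod (pker c x y)" for y
      using mult_right_mono[OF h2[of y] norm_ge_zero[of "pker c x y"]] by (simp add: norm_mult mult.commute)
  qed
  have "cinner_L2 (abs_L2 (brep g)) (abs_L2 (\<lambda>y. cnj (pker c x y * h2 y))) = (LINT y|lborel. brep g y * cnj (cnj (pker c x y * h2 y)))"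
    by (rule cinner_abs_L2[OF brep(1) b'])
  also have "\<dots> = Uop c (cut g) x" unfolding Uop_def cut_def by (simp add: mult_ac)
  finally show ?thesis using brep(2)[of g] by simp
qed

text \<open>Boundedness of \<open>Uop c (cut g)\<close> makes its mean over a set of finite measure linear in \<open>g\<close>.\<close>

lemma clinear_fun_cell_mean:
  assumes X: "xi_class r M c" "DIM('a) \<le> r" and Q: "Q \<in> sets borel" "emeasure lborel Q < \<infinity>"
  shows "clinear_fun (\<lambda>g. LINT x|lborel. indicator Q x *\<^sub>R Uop c (cut g) x)"
proof -
  have int: "integrable lborel (\<lambda>x. indicator Q x *\<^sub>R Uop c (cut g) x)" for g
  proof -
    obtain B where B: "\<And>x. cmod (Uop c (cut g) x) \<le> B" using Uop_bounded[OF X cut_bsq] by blast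
    show ?thesis
    proof (rule Bochner_Integration.integrable_bound)
      show "integrable lborel (\<lambda>x. B * indicator Q x)"
        by (intro integrable_mult_right integrable_real_indicator) (use Q in auto)
      show "(\<lambda>x. indicator Q x *\<^sub>R Uop c (cut g) x) \<in> borel_measurable lborel"
        using Q(1) Uop_measurable[OF xi_class_adm[OF X(1)] cut_bsq] by measurable
      show "AE x in lborel. norm (indicator Q x *\<^sub>R Uop c (cut g) x) \<le> norm (B * indicator Q x)"
        using B order_trans[OF norm_ge_zero B] by (intro always_eventually allI) (auto simp: indicator_def)
    qed
  qed
  have add: "Uop c (cut (f + g)) x = Uop c (cut f) x + Uop c (cut g) x" for f g x
    unfolding Uop_cut_cinner[OF X] by (rule cinner_L2_add_left)
  have sc: "Uop c (cut (scaleC_L2 a f)) x = a * Uop c (cut f) x" for a f x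
    unfolding Uop_cut_cinner[OF X] by (rule cinner_L2_scale_left)
  show ?thesis unfolding clinear_fun_def
  proof (intro conjI allI)
    fix f g
    show "(LINT x|lborel. indicator Q x *\<^sub>R Uop c (cut (f + g)) x) = (LINT x|lborel. indicator Q x *\<^sub>R Uop c (cut f) x) + (LINT x|lborel. indicator Q x *\<^sub>R Uop c (cut g) x)"
      unfolding add scaleR_add_right by (rule Bochner_Integration.integral_add[OF int int])
  next
    fix a f
    have "(LINT x|lborel. indicator Q x *\<^sub>R Uop c (cut (scaleC_L2 a f)) x) = (LINT x|lborel. a * (indicator Q x *\<^sub>R Uop c (cut f) x))"
      unfolding sc by (simp add: scaleR_conv_of_real mult.left_commute)
    then show "(LINT x|lborel. indicator Q x *\<^sub>R Uop c (cut (scaleC_L2 a f)) x) = a * (LINT x|lborel. indicator Q x *\<^sub>R Uop c (cut f) x)"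
      by (simp only: integral_mult_right_zero)
  qed
qed

lemma norm_kern_op:
  assumes c: "adm M c"
  shows "ennreal ((norm (kernel_op (kern c) g))\<^sup>2) \<le> ennreal ((A1 * amp)\<^sup>2) * sq_mass (Uop c (cut g)) {x. h1 x \<noteq> 0}"
proof -
  have km: "jointly_measurable (kern c)" by (rule kern_measurable[OF c])
  have [measurable]: "Uop c (cut g) \<in> borel_measurable borel" by (rule Uop_measurable[OF c cut_bsq])
  have e: "(LINT y|lborel. kern c x y * brep g y) = h1 x * complex_of_real amp * Uop c (cut g) x" for x
  proof -
    have "(LINT y|lborel. kern c x y * brep g y) = (LINT y|lborel. (h1 x * complex_of_real amp) * (pker c x y * cut g y))"
      by (simp add: kern_def cut_def mult_ac)
    then show ?thesis by (simp add: Uop_def)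
  qed
  have "bsq (\<lambda>x. LINT y|lborel. kern c x y * brep g y)" by (rule kernel_int_L2(2)[OF kern_hs[OF c] brep(1)])
  then have b: "bsq (\<lambda>x. h1 x * complex_of_real amp * Uop c (cut g) x)" unfolding e .
  have "kernel_op (kern c) g = abs_L2 (\<lambda>x. LINT y|lborel. kern c x y * brep g y)"
    by (rule kernel_op_rep[OF km brep(1,3)])
  then have "ennreal ((norm (kernel_op (kern c) g))\<^sup>2) = (\<integral>\<^sup>+x. cmod_sq (h1 x * complex_of_real amp * Uop c (cut g) x) \<partial>lborel)"
    unfolding e using norm_abs_L2_sq[OF b] by simp
  also have "\<dots> \<le> (\<integral>\<^sup>+x. ennreal ((A1 * amp)\<^sup>2) * (cmod_sq (Uop c (cut g) x) * indicator {x. h1 x \<noteq> 0} x) \<partial>lborel)"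
  proof (rule nn_integral_mono)
    fix x
    have "cmod (h1 x * complex_of_real amp * Uop c (cut g) x) = cmod (h1 x) * amp * cmod (Uop c (cut g) x)"
      using amp_nonneg by (simp add: norm_mult)
    also have "\<dots> \<le> A1 * amp * cmod (Uop c (cut g) x)"
      using h1 amp_nonneg by (intro mult_right_mono) auto
    finally have "(cmod (h1 x * complex_of_real amp * Uop c (cut g) x))\<^sup>2 \<le> (A1 * amp)\<^sup>2 * (cmod (Uop c (cut g) x))\<^sup>2"
      unfolding power_mult_distrib[symmetric] by (intro power_mono) auto
    then have "cmod_sq (h1 x * complex_of_real amp * Uop c (cut g) x) \<le> ennreal ((A1 * amp)\<^sup>2) * cmod_sq (Uop c (cut g) x)"
      by (simp add: ennreal_mult[symmetric] ennreal_leI)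
    then show "cmod_sq (h1 x * complex_of_real amp * Uop c (cut g) x) \<le> ennreal ((A1 * amp)\<^sup>2) * (cmod_sq (Uop c (cut g) x) * indicator {x. h1 x \<noteq> 0} x)"
      by (cases "h1 x = 0") auto
  qed
  also have "\<dots> = ennreal ((A1 * amp)\<^sup>2) * sq_mass (Uop c (cut g)) {x. h1 x \<noteq> 0}"
    by (rule nn_integral_cmult) measurable
  finally show ?thesis .
qed

text \<open>On the support of the kernel, \<open>x\<close> is at distance at most \<open>l + dist x y\<close> from \<open>u\<close>, whatever \<open>t\<close>.\<close>

lemma pker_support:
  assumes c: "adm M c" and "pker c x y \<noteq> 0"
  shows "dist u x \<le> l + dist x y"
proof -
  have "\<exists>\<xi>. c (mid x y) \<xi> \<noteq> 0"
  proof (rule ccontr)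
    assume "\<not> ?thesis"
    then have "pker c x y = 0" by (simp add: pker_def)
    then show False using assms(2) by simp
  qed
  then have m: "dist u (mid x y) \<le> l" using c by (auto simp: adm_def)
  have "mid x y - x = t *\<^sub>R (y - x)" by (simp add: mid_def algebra_simps)
  then have "dist (mid x y) x = t * dist x y" using t by (simp add: dist_norm norm_minus_commute)
  also have "\<dots> \<le> 1 * dist x y" using t by (intro mult_right_mono) auto
  finally show ?thesis using m dist_triangle[of u x "mid x y"] by simp
qed

text \<open>The outer radii are \<open>4 R\<close>, \<open>8 R\<close>, \<dots>. The factor four leaves room for the radius \<open>l \<le> R\<close> of the symbol
  and the diameter of a cell in the lower bounds for \<open>dist x y\<close>; for \<open>j = 0\<close> the separation of the
  supports takes the place of the distance to \<open>u\<close>.\<close>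

definition shell :: "nat \<Rightarrow> 'a set" where
  "shell j = {x. h1 x \<noteq> 0 \<and> dist u x \<le> 2 ^ (j + 2) * R \<and> (j = 0 \<or> 2 ^ (j + 1) * R < dist u x)}"

lemma R_pos: "0 < R" using l R by linarith

lemma shell_far:
  assumes c: "adm M c" and \<delta>: "0 < \<delta>" "real DIM('a) * \<delta> \<le> R / 4" and k: "k \<in> cell_index \<delta> ` shell j"
    and x: "x \<in> cell \<delta> k" and y: "h2 y \<noteq> 0" "pker c x y \<noteq> 0"
  shows "2 ^ j * R / 2 \<le> dist x y"
proof -
  obtain x0 where x0: "x0 \<in> shell j" "k = cell_index \<delta> x0" using k by blast
  have "x0 \<in> cell \<delta> k" using x0 by (simp add: cell_def)
  then have d: "dist x x0 \<le> R / 4" using cell_diam[OF \<delta>(1) x] \<delta>(2) by fastforce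
  show ?thesis
  proof (cases "j = 0")
    case True
    have "R \<le> dist x0 y" using sep y(1) x0(1) by (simp add: shell_def)
    then show ?thesis using d dist_triangle[of x0 y x] R_pos True by (simp add: dist_commute)
  next
    case False
    then have "2 ^ (j + 1) * R < dist u x0" using x0(1) by (simp add: shell_def)
    then have "2 * (2 ^ j * R) < dist u x + R / 4" using d dist_triangle[of u x0 x] by simp
    moreover have "dist u x \<le> R + dist x y" using pker_support[OF c y(2)] R by simp
    moreover have "2 * R \<le> 2 ^ j * R"
      using False R_pos power_increasing[of 1 j "2::real"] by (intro mult_right_mono) auto
    ultimately show ?thesis using R_pos by linarith
  qed
qed

lemma outer_far:
  assumes c: "adm M c" and x: "2 ^ (J + 2) * R < dist u x" and y: "pker c x y \<noteq> 0"
  shows "2 ^ J * R / 2 \<le> dist x y"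
proof -
  have "R \<le> 2 ^ J * R" using R_pos mult_right_mono[of 1 "2 ^ J" R] by simp
  moreover have "4 * (2 ^ J * R) < dist u x" using x by (simp add: power_add)
  moreover have "dist u x \<le> l + dist x y" by (rule pker_support[OF c y])
  ultimately show ?thesis using R R_pos by linarith
qed

lemma shells_cover:
  assumes "h1 x \<noteq> 0" "dist u x \<le> 2 ^ (J + 2) * R"
  shows "\<exists>j\<le>J. x \<in> shell j"
  using assms(2)
proof (induction J)
  case 0
  then show ?case using assms(1) by (auto simp: shell_def)
next
  case (Suc J)
  show ?case
  proof (cases "dist u x \<le> 2 ^ (J + 2) * R")
    case True
    then show ?thesis using Suc.IH le_SucI by blast
  next
    case False
    then have "x \<in> shell (Suc J)" using Suc.prems assms(1) by (simp add: shell_def)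
    then show ?thesis by blast
  qed
qed

text \<open>The bound of \<open>pker_hs_far\<close> for a symbol in \<open>xi_class m M\<close>.\<close>

definition far_bound :: "nat \<Rightarrow> real \<Rightarrow> real \<Rightarrow> real" where
  "far_bound m s M = real DIM('a) * (real DIM('a) / (\<alpha> * \<rho> * s)) ^ (2 * m) * (hs_unit * M\<^sup>2)"

lemma far_bound_nonneg: "0 < s \<Longrightarrow> 0 \<le> far_bound m s M"
  using \<alpha> \<rho> hs_unit_nonneg by (simp add: far_bound_def)

lemma sq_cut_le:
  assumes "h2 y \<noteq> 0 \<Longrightarrow> pker c x y \<noteq> 0 \<Longrightarrow> s \<le> dist x y"
  shows "cmod_sq (pker c x y * h2 y) \<le> ennreal (A2\<^sup>2) * (cmod_sq (pker c x y) * indicator {y. s \<le> dist x y} y)"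
proof (cases "h2 y = 0 \<or> pker c x y = 0")
  case False
  have "(cmod (pker c x y * h2 y))\<^sup>2 \<le> A2\<^sup>2 * (cmod (pker c x y))\<^sup>2"
    unfolding norm_mult power_mult_distrib using power_mono[OF h2[of y], of 2]
    by (subst mult.commute) (auto intro: mult_right_mono)
  then have "cmod_sq (pker c x y * h2 y) \<le> ennreal (A2\<^sup>2) * cmod_sq (pker c x y)"
    by (simp add: ennreal_mult[symmetric] ennreal_leI)
  then show ?thesis using assms False by simp
qed auto

lemma shell_cells_hs:
  assumes X: "xi_class m M c" and \<delta>: "0 < \<delta>" "real DIM('a) * \<delta> \<le> R / 4" and K: "finite (cell_index \<delta> ` shell j)"
  shows "(\<Sum>k\<in>cell_index \<delta> ` shell j. \<integral>\<^sup>+x. (\<integral>\<^sup>+y. cmod_sq (pker c x y * h2 y) \<partial>lborel) * indicator (cell \<delta> k) x \<partial>lborel)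
    \<le> ennreal (A2\<^sup>2) * ennreal (far_bound m (2 ^ j * R / 2) M)"
proof -
  let ?K = "cell_index \<delta> ` shell j"
  let ?s = "2 ^ j * R / 2"
  note c = xi_class_adm[OF X]
  note [measurable] = pker_measurable[OF c]
  let ?f = "\<lambda>x. \<integral>\<^sup>+y. cmod_sq (pker c x y * h2 y) \<partial>lborel"
  let ?F = "\<lambda>x. \<integral>\<^sup>+y. ennreal (A2\<^sup>2) * (cmod_sq (pker c x y) * indicator {y. ?s \<le> dist x y} y) \<partial>lborel"
  have "(\<Sum>k\<in>?K. \<integral>\<^sup>+x. ?f x * indicator (cell \<delta> k) x \<partial>lborel) = (\<integral>\<^sup>+x. (\<Sum>k\<in>?K. ?f x * indicator (cell \<delta> k) x) \<partial>lborel)"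
    by (rule nn_integral_sum[symmetric]) measurable
  also have "\<dots> \<le> (\<integral>\<^sup>+x. ?F x \<partial>lborel)"
  proof (rule nn_integral_mono)
    fix x :: 'a
    have s: "(\<Sum>k\<in>?K. ?f x * indicator (cell \<delta> k) x) = (\<Sum>k\<in>?K. if k = cell_index \<delta> x then ?f x else 0)"
      by (intro sum.cong refl) (auto simp: cell_def indicator_def)
    show "(\<Sum>k\<in>?K. ?f x * indicator (cell \<delta> k) x) \<le> ?F x"
    proof (cases "cell_index \<delta> x \<in> ?K")
      case True
      have "x \<in> cell \<delta> (cell_index \<delta> x)" by (simp add: cell_def)
      then have "?f x \<le> ?F x"
        by (intro nn_integral_mono sq_cut_le shell_far[OF c \<delta> True])
      moreover have "(\<Sum>k\<in>?K. ?f x * indicator (cell \<delta> k) x) = ?f x"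
        unfolding s using K True by (simp add: sum.delta)
      ultimately show ?thesis by simp
    next
      case False
      have "(\<Sum>k\<in>?K. ?f x * indicator (cell \<delta> k) x) = 0"
        unfolding s using K False by (simp add: sum.delta)
      then show ?thesis by simp
    qed
  qed
  also have "\<dots> = ennreal (A2\<^sup>2) * (\<integral>\<^sup>+x. sq_mass (pker c x) {y. ?s \<le> dist x y} \<partial>lborel)"
  proof -
    have pc[measurable]: "(\<lambda>y. pker c x y) \<in> borel_measurable borel" for x by (rule pker_compose[OF c]) measurable
    have i: "(\<lambda>p. indicator {y. ?s \<le> dist (fst p) y} (snd p) :: ennreal) \<in> borel_measurable ((borel :: 'a measure) \<Otimes>\<^sub>M borel)"
    proof -
      have "(\<lambda>p::'a \<times> 'a. indicator {y. ?s \<le> dist (fst p) y} (snd p) :: ennreal) = indicator {p. ?s \<le> dist (fst p) (snd p)}"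
        by (auto simp: fun_eq_iff indicator_def)
      moreover have "{p::'a \<times> 'a. ?s \<le> dist (fst p) (snd p)} \<in> sets (borel \<Otimes>\<^sub>M borel)"
        unfolding borel_prod by (intro borel_closed closed_Collect_le continuous_intros)
      ultimately show ?thesis by simp
    qed
    have "?F x = ennreal (A2\<^sup>2) * sq_mass (pker c x) {y. ?s \<le> dist x y}" for x
      by (rule nn_integral_cmult) measurable
    then show ?thesis by (simp only:) (rule nn_integral_cmult; use i in measurable)
  qed
  also have "\<dots> \<le> ennreal (A2\<^sup>2) * ennreal (far_bound m ?s M)"
    unfolding far_bound_def using R_pos by (intro mult_left_mono pker_hs_far[OF X]) auto
  finally show ?thesis .
qed

lemma outer_hs:
  assumes X: "xi_class m M c" and s: "0 < s"
    and far: "\<And>x y. x \<in> S \<Longrightarrow> h2 y \<noteq> 0 \<Longrightarrow> pker c x y \<noteq> 0 \<Longrightarrow> s \<le> dist x y"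
  shows "(\<integral>\<^sup>+x. (\<integral>\<^sup>+y. cmod_sq (pker c x y * h2 y) \<partial>lborel) * indicator S x \<partial>lborel)
    \<le> ennreal (A2\<^sup>2) * ennreal (far_bound m s M)"
proof -
  note c = xi_class_adm[OF X]
  note [measurable] = pker_measurable[OF c]
  have pc[measurable]: "(\<lambda>y. pker c x y) \<in> borel_measurable borel" for x by (rule pker_compose[OF c]) measurable
  have i: "(\<lambda>p. indicator {y. s \<le> dist (fst p) y} (snd p) :: ennreal) \<in> borel_measurable ((borel :: 'a measure) \<Otimes>\<^sub>M borel)"
  proof -
    have "(\<lambda>p::'a \<times> 'a. indicator {y. s \<le> dist (fst p) y} (snd p) :: ennreal) = indicator {p. s \<le> dist (fst p) (snd p)}"
      by (auto simp: fun_eq_iff indicator_def)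
    moreover have "{p::'a \<times> 'a. s \<le> dist (fst p) (snd p)} \<in> sets (borel \<Otimes>\<^sub>M borel)"
      unfolding borel_prod by (intro borel_closed closed_Collect_le continuous_intros)
    ultimately show ?thesis by simp
  qed
  have "(\<integral>\<^sup>+x. (\<integral>\<^sup>+y. cmod_sq (pker c x y * h2 y) \<partial>lborel) * indicator S x \<partial>lborel)
    \<le> (\<integral>\<^sup>+x. ennreal (A2\<^sup>2) * sq_mass (pker c x) {y. s \<le> dist x y} \<partial>lborel)"
  proof (rule nn_integral_mono)
    fix x :: 'a
    show "(\<integral>\<^sup>+y. cmod_sq (pker c x y * h2 y) \<partial>lborel) * indicator S x
      \<le> ennreal (A2\<^sup>2) * sq_mass (pker c x) {y. s \<le> dist x y}"
    proof (cases "x \<in> S")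
      case True
      have "(\<integral>\<^sup>+y. cmod_sq (pker c x y * h2 y) \<partial>lborel)
         \<le> (\<integral>\<^sup>+y. ennreal (A2\<^sup>2) * (cmod_sq (pker c x y) * indicator {y. s \<le> dist x y} y) \<partial>lborel)"
        by (intro nn_integral_mono sq_cut_le far[OF True])
      also have "\<dots> = ennreal (A2\<^sup>2) * sq_mass (pker c x) {y. s \<le> dist x y}"
        by (rule nn_integral_cmult) measurable
      finally show ?thesis using True by simp
    qed simp
  qed
  also have "\<dots> = ennreal (A2\<^sup>2) * (\<integral>\<^sup>+x. sq_mass (pker c x) {y. s \<le> dist x y} \<partial>lborel)"
    by (rule nn_integral_cmult; use i in measurable)
  also have "\<dots> \<le> ennreal (A2\<^sup>2) * ennreal (far_bound m s M)"
    unfolding far_bound_def by (intro mult_left_mono pker_hs_far[OF X s]) simp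
  finally show ?thesis .
qed

lemma sum_cell_Bessel:
  assumes c: "adm M c" and G: "orthonormal_L2 G" and S[measurable]: "S \<in> sets borel"
  shows "(\<Sum>g\<in>G. sq_mass (Uop c (cut g)) S)
     \<le> (\<integral>\<^sup>+x. (\<integral>\<^sup>+y. cmod_sq (pker c x y * h2 y) \<partial>lborel) * indicator S x \<partial>lborel)"
proof -
  have [measurable]: "Uop c (cut g) \<in> borel_measurable borel" for g by (rule Uop_measurable[OF c cut_bsq])
  have "(\<Sum>g\<in>G. sq_mass (Uop c (cut g)) S)
     = (\<integral>\<^sup>+x. (\<Sum>g\<in>G. cmod_sq (Uop c (cut g) x) * indicator S x) \<partial>lborel)"
    by (rule nn_integral_sum[symmetric]) measurable
  also have "\<dots> \<le> (\<integral>\<^sup>+x. (\<integral>\<^sup>+y. cmod_sq (pker c x y * h2 y) \<partial>lborel) * indicator S x \<partial>lborel)"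
    unfolding sum_distrib_right[symmetric] by (intro nn_integral_mono mult_right_mono Uop_cut_Bessel[OF c G]) simp
  finally show ?thesis .
qed

text \<open>The approximation error of a level: cells of size \<open>\<delta> j\<close> on the shell \<open>j \<le> J\<close>, and nothing
  beyond the last shell.\<close>

lemma level_error:
  assumes c: "w_class n m N c" and m: "DIM('a) \<le> m" and G: "orthonormal_L2 G"
    and \<delta>: "\<And>j. j \<le> J \<Longrightarrow> 0 < \<delta> j" "\<And>j. j \<le> J \<Longrightarrow> real DIM('a) * \<delta> j \<le> R / 4"
    and zero: "\<And>g j k bs. g \<in> G \<Longrightarrow> j \<le> J \<Longrightarrow> k \<in> cell_index (\<delta> j) ` shell j \<Longrightarrow> set bs \<subseteq> Basis \<Longrightarrow> length bs < n
       \<Longrightarrow> (LINT x|lborel. indicator (cell (\<delta> j) k) x *\<^sub>R Uop (word_symbol n m N c bs) (cut g) x) = 0"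
  shows "(\<Sum>g\<in>G. sq_mass (Uop c (cut g)) {x. h1 x \<noteq> 0})
    \<le> ennreal (A2\<^sup>2) * ennreal ((\<Sum>j\<le>J. ((real DIM('a) * \<delta> j)\<^sup>2 * 2 ^ DIM('a)) ^ n * (real DIM('a) ^ n * far_bound m (2 ^ j * R / 2) (step_const m ^ n * N)))
       + far_bound m (2 ^ J * R / 2) N)"
proof -
  let ?W = "\<lambda>bs. word_symbol n m N c bs"
  let ?U = "\<lambda>c g x. cmod_sq (Uop c (cut g) x)"
  let ?K = "\<lambda>j. cell_index (\<delta> j) ` shell j"
  let ?P = "\<lambda>j. (real DIM('a) * \<delta> j)\<^sup>2 * 2 ^ DIM('a)"
  let ?fb = "\<lambda>j. far_bound m (2 ^ j * R / 2) (step_const m ^ n * N)"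
  let ?S1 = "{x. h1 x \<noteq> 0}" and ?S2 = "{x. h1 x \<noteq> 0 \<and> 2 ^ (J + 2) * R < dist u x}"
  have xc: "xi_class m N c" by (rule w_class_xi[OF c])
  have ac: "adm N c" by (rule xi_class_adm[OF xc])
  have Wx: "xi_class m (step_const m ^ n * N) (?W bs)" if "bs \<in> words n" for bs
    using w_class_xi[OF word_symbol_class[OF c, of bs]] that by (auto simp: words_def)
  have [measurable]: "Uop c (cut g) \<in> borel_measurable borel" for g by (rule Uop_measurable[OF ac cut_bsq])
  have Kf: "finite (?K j)" if "j \<le> J" for j
  proof (rule finite_subset[OF _ cells_count(1)[OF \<delta>(1)[OF that]]])
    show "?K j \<subseteq> cell_index (\<delta> j) ` cball u (2 ^ (j + 2) * R)" by (intro image_mono) (auto simp: shell_def)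
  qed (use R_pos in simp)
  have S2[measurable]: "?S2 \<in> sets borel" by measurable
  \<comment> \<open>The support of \<open>h1\<close> is covered by the cells that meet a shell, and the region beyond the last one.\<close>
  have cover: "indicator ?S1 x \<le> (\<Sum>j\<le>J. \<Sum>k\<in>?K j. indicator (cell (\<delta> j) k) x) + (indicator ?S2 x :: ennreal)" for x
  proof (cases "h1 x \<noteq> 0 \<and> dist u x \<le> 2 ^ (J + 2) * R")
    case True
    then obtain j where j: "j \<le> J" "x \<in> shell j" using shells_cover by blast
    have "(1::ennreal) = indicator (cell (\<delta> j) (cell_index (\<delta> j) x)) x" by (simp add: cell_def)
    also have "\<dots> \<le> (\<Sum>k\<in>?K j. indicator (cell (\<delta> j) k) x)"
      by (rule member_le_sum) (use j Kf in auto)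
    also have "\<dots> \<le> (\<Sum>j\<le>J. \<Sum>k\<in>?K j. indicator (cell (\<delta> j) k) x)"
      by (rule member_le_sum) (use j in auto)
    finally show ?thesis using True by (simp add: add_increasing2)
  next
    case False
    then have "indicator ?S1 x \<le> (indicator ?S2 x :: ennreal)" by (auto simp: indicator_def)
    then show ?thesis by (rule order_trans) simp
  qed
  have "(\<integral>\<^sup>+x. ?U c g x * indicator ?S1 x \<partial>lborel) \<le> (\<Sum>j\<le>J. \<Sum>k\<in>?K j. \<integral>\<^sup>+x. ?U c g x * indicator (cell (\<delta> j) k) x \<partial>lborel) + (\<integral>\<^sup>+x. ?U c g x * indicator ?S2 x \<partial>lborel)" for g
  proof -
    have "(\<integral>\<^sup>+x. ?U c g x * indicator ?S1 x \<partial>lborel) \<le> (\<integral>\<^sup>+x. (\<Sum>j\<le>J. \<Sum>k\<in>?K j. ?U c g x * indicator (cell (\<delta> j) k) x) + ?U c g x * indicator ?S2 x \<partial>lborel)"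
      unfolding sum_distrib_left[symmetric] distrib_left[symmetric] by (intro nn_integral_mono mult_left_mono cover) simp
    also have "\<dots> = (\<integral>\<^sup>+x. (\<Sum>j\<le>J. \<Sum>k\<in>?K j. ?U c g x * indicator (cell (\<delta> j) k) x) \<partial>lborel) + (\<integral>\<^sup>+x. ?U c g x * indicator ?S2 x \<partial>lborel)"
      by (rule nn_integral_add) measurable
    also have "(\<integral>\<^sup>+x. (\<Sum>j\<le>J. \<Sum>k\<in>?K j. ?U c g x * indicator (cell (\<delta> j) k) x) \<partial>lborel) = (\<Sum>j\<le>J. \<integral>\<^sup>+x. (\<Sum>k\<in>?K j. ?U c g x * indicator (cell (\<delta> j) k) x) \<partial>lborel)"
      by (rule nn_integral_sum) measurable
    also have "\<dots> = (\<Sum>j\<le>J. \<Sum>k\<in>?K j. \<integral>\<^sup>+x. ?U c g x * indicator (cell (\<delta> j) k) x \<partial>lborel)"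
      by (intro sum.cong refl nn_integral_sum) measurable
    finally show ?thesis .
  qed
  then have "(\<Sum>g\<in>G. \<integral>\<^sup>+x. ?U c g x * indicator ?S1 x \<partial>lborel)
    \<le> (\<Sum>g\<in>G. (\<Sum>j\<le>J. \<Sum>k\<in>?K j. \<integral>\<^sup>+x. ?U c g x * indicator (cell (\<delta> j) k) x \<partial>lborel) + (\<integral>\<^sup>+x. ?U c g x * indicator ?S2 x \<partial>lborel))"
    by (rule sum_mono)
  also have "\<dots> = (\<Sum>g\<in>G. \<Sum>j\<le>J. \<Sum>k\<in>?K j. \<integral>\<^sup>+x. ?U c g x * indicator (cell (\<delta> j) k) x \<partial>lborel) + (\<Sum>g\<in>G. \<integral>\<^sup>+x. ?U c g x * indicator ?S2 x \<partial>lborel)"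
    by (rule sum.distrib)
  also have "(\<Sum>g\<in>G. \<integral>\<^sup>+x. ?U c g x * indicator ?S2 x \<partial>lborel) \<le> ennreal (A2\<^sup>2) * ennreal (far_bound m (2 ^ J * R / 2) N)"
  proof (rule order_trans[OF sum_cell_Bessel[OF ac G S2] outer_hs[OF xc]])
    show "0 < 2 ^ J * R / 2" using R_pos by simp
    show "2 ^ J * R / 2 \<le> dist x y" if "x \<in> ?S2" "h2 y \<noteq> 0" "pker c x y \<noteq> 0" for x y
      using outer_far[OF ac _ that(3)] that(1) by simp
  qed
  also have "(\<Sum>g\<in>G. \<Sum>j\<le>J. \<Sum>k\<in>?K j. \<integral>\<^sup>+x. ?U c g x * indicator (cell (\<delta> j) k) x \<partial>lborel)
    \<le> (\<Sum>j\<le>J. ennreal (A2\<^sup>2) * ennreal (?P j ^ n * (real DIM('a) ^ n * ?fb j)))"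
  proof -
    have "(\<Sum>g\<in>G. \<Sum>j\<le>J. \<Sum>k\<in>?K j. \<integral>\<^sup>+x. ?U c g x * indicator (cell (\<delta> j) k) x \<partial>lborel)
      = (\<Sum>j\<le>J. \<Sum>k\<in>?K j. \<Sum>g\<in>G. \<integral>\<^sup>+x. ?U c g x * indicator (cell (\<delta> j) k) x \<partial>lborel)"
      by (subst sum.swap, rule sum.cong[OF refl], rule sum.swap)
    also have "\<dots> \<le> (\<Sum>j\<le>J. ennreal (A2\<^sup>2) * ennreal (?P j ^ n * (real DIM('a) ^ n * ?fb j)))"
    proof (rule sum_mono)
      fix j assume "j \<in> {..J}"
      then have j: "j \<le> J" by simp
      have fb0: "0 \<le> ?fb j" using R_pos by (intro far_bound_nonneg) simp
      have Pn: "ennreal (?P j) ^ n = ennreal (?P j ^ n)" by (rule ennreal_power) simp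
      have "(\<integral>\<^sup>+x. ?U c g x * indicator (cell (\<delta> j) k) x \<partial>lborel)
          \<le> ennreal (?P j ^ n) * (\<Sum>bs\<in>words n. \<integral>\<^sup>+x. ?U (?W bs) g x * indicator (cell (\<delta> j) k) x \<partial>lborel)"
        if "g \<in> G" "k \<in> ?K j" for g k
        unfolding Pn[symmetric]
        by (rule Uop_poincare_iterated[OF c m cut_bsq cell_measurable cell_convex[OF \<delta>(1)[OF j]] cell_finite[OF \<delta>(1)[OF j]] cell_diam[OF \<delta>(1)[OF j]] zero[OF that(1) j that(2)] order_refl])
      then have "(\<Sum>k\<in>?K j. \<Sum>g\<in>G. \<integral>\<^sup>+x. ?U c g x * indicator (cell (\<delta> j) k) x \<partial>lborel)
        \<le> (\<Sum>k\<in>?K j. \<Sum>g\<in>G. ennreal (?P j ^ n) * (\<Sum>bs\<in>words n. \<integral>\<^sup>+x. ?U (?W bs) g x * indicator (cell (\<delta> j) k) x \<partial>lborel))"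
        by (intro sum_mono)
      also have "\<dots> = ennreal (?P j ^ n) * (\<Sum>k\<in>?K j. \<Sum>g\<in>G. \<Sum>bs\<in>words n. \<integral>\<^sup>+x. ?U (?W bs) g x * indicator (cell (\<delta> j) k) x \<partial>lborel)"
        by (simp only: sum_distrib_left)
      also have "(\<Sum>k\<in>?K j. \<Sum>g\<in>G. \<Sum>bs\<in>words n. \<integral>\<^sup>+x. ?U (?W bs) g x * indicator (cell (\<delta> j) k) x \<partial>lborel)
        = (\<Sum>k\<in>?K j. \<Sum>bs\<in>words n. \<Sum>g\<in>G. \<integral>\<^sup>+x. ?U (?W bs) g x * indicator (cell (\<delta> j) k) x \<partial>lborel)"
        by (rule sum.cong[OF refl], rule sum.swap)
      also have "\<dots> = (\<Sum>bs\<in>words n. \<Sum>k\<in>?K j. \<Sum>g\<in>G. \<integral>\<^sup>+x. ?U (?W bs) g x * indicator (cell (\<delta> j) k) x \<partial>lborel)"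
        by (rule sum.swap)
      also have "\<dots> \<le> (\<Sum>bs\<in>(words n :: 'a list set). ennreal (A2\<^sup>2) * ennreal (?fb j))"
      proof (rule sum_mono)
        fix bs :: "'a list" assume bs: "bs \<in> words n"
        have "(\<Sum>k\<in>?K j. \<Sum>g\<in>G. \<integral>\<^sup>+x. ?U (?W bs) g x * indicator (cell (\<delta> j) k) x \<partial>lborel)
          \<le> (\<Sum>k\<in>?K j. \<integral>\<^sup>+x. (\<integral>\<^sup>+y. cmod_sq (pker (?W bs) x y * h2 y) \<partial>lborel) * indicator (cell (\<delta> j) k) x \<partial>lborel)"
          by (intro sum_mono sum_cell_Bessel[OF xi_class_adm[OF Wx[OF bs]] G cell_measurable])
        also have "\<dots> \<le> ennreal (A2\<^sup>2) * ennreal (?fb j)"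
          by (rule shell_cells_hs[OF Wx[OF bs] \<delta>(1)[OF j] \<delta>(2)[OF j] Kf[OF j]])
        finally show "(\<Sum>k\<in>?K j. \<Sum>g\<in>G. \<integral>\<^sup>+x. ?U (?W bs) g x * indicator (cell (\<delta> j) k) x \<partial>lborel) \<le> ennreal (A2\<^sup>2) * ennreal (?fb j)" .
      qed
      also have "\<dots> = ennreal (A2\<^sup>2) * ennreal (real DIM('a) ^ n * ?fb j)"
        using fb0 by (simp add: card_words ennreal_mult ennreal_of_nat_eq_real_of_nat mult.left_commute)
      also have "ennreal (?P j ^ n) * \<dots> = ennreal (A2\<^sup>2) * ennreal (?P j ^ n * (real DIM('a) ^ n * ?fb j))"
        using fb0 by (subst ennreal_mult[of "?P j ^ n"]) (auto simp: mult.left_commute)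
      finally show "(\<Sum>k\<in>?K j. \<Sum>g\<in>G. \<integral>\<^sup>+x. ?U c g x * indicator (cell (\<delta> j) k) x \<partial>lborel) \<le> ennreal (A2\<^sup>2) * ennreal (?P j ^ n * (real DIM('a) ^ n * ?fb j))"
        by (simp add: mult_left_mono)
    qed
    finally show ?thesis .
  qed
  finally have "(\<Sum>g\<in>G. \<integral>\<^sup>+x. ?U c g x * indicator ?S1 x \<partial>lborel)
    \<le> (\<Sum>j\<le>J. ennreal (A2\<^sup>2) * ennreal (?P j ^ n * (real DIM('a) ^ n * ?fb j))) + ennreal (A2\<^sup>2) * ennreal (far_bound m (2 ^ J * R / 2) N)"
    by (simp add: add_mono)
  also have "\<dots> = ennreal (A2\<^sup>2) * ennreal ((\<Sum>j\<le>J. ?P j ^ n * (real DIM('a) ^ n * ?fb j)) + far_bound m (2 ^ J * R / 2) N)"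
  proof -
    have nn: "0 \<le> ?P j ^ n * (real DIM('a) ^ n * ?fb j)" for j
      using R_pos by (intro mult_nonneg_nonneg far_bound_nonneg) auto
    have nn2: "0 \<le> far_bound m (2 ^ J * R / 2) N" using R_pos by (intro far_bound_nonneg) simp
    show ?thesis
      unfolding sum_distrib_left[symmetric] distrib_left[symmetric]
      using nn nn2 by (simp add: sum_ennreal ennreal_plus[symmetric] sum_nonneg del: ennreal_plus)
  qed
  finally show ?thesis .
qed

end

section \<open>Summation of the singular value bounds\<close>

lemma powr_increment_ge:
  fixes a :: real assumes a: "0 < a" "a \<le> 1"
  shows "a * (real k + 1) powr (a - 1) \<le> (real k + 1) powr a - real k powr a"
proof (cases "k = 0")
  case False
  have "\<exists>z. real k < z \<and> z < real k + 1 \<and> (real k + 1) powr a - real k powr a = (real k + 1 - real k) * (a * z powr (a - 1))"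
    using False by (intro MVT2) (auto intro!: derivative_eq_intros simp: powr_diff)
  then obtain z where z: "real k < z" "z < real k + 1" "(real k + 1) powr a - real k powr a = a * z powr (a - 1)" by auto
  have "(real k + 1) powr (a - 1) \<le> z powr (a - 1)"
    using z a False by (intro powr_mono2') auto
  then show ?thesis unfolding z(3) using a by (intro mult_left_mono) auto
qed (use a in simp)

lemma powr_decrement_ge:
  fixes b :: real assumes b: "0 < b"
  shows "b / 2 powr (b + 1) * (real k + 1) powr (- (b + 1)) \<le> (real k + 1) powr (- b) - (real k + 2) powr (- b)"
proof -
  have "\<exists>z. real k + 1 < z \<and> z < real k + 2 \<and> (real k + 2) powr (- b) - (real k + 1) powr (- b) = (real k + 2 - (real k + 1)) * (- b * z powr (- b - 1))"
    by (intro MVT2) (auto intro!: derivative_eq_intros simp: powr_diff)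
  then obtain z where z0: "real k + 1 < z" "z < real k + 2" "(real k + 2) powr (- b) - (real k + 1) powr (- b) = (real k + 2 - (real k + 1)) * (- b * z powr (- b - 1))"
    by (elim exE conjE)
  have "- b - 1 = - (b + 1)" by simp
  then have "(real k + 1) powr (- b) - (real k + 2) powr (- b) = b * z powr (- (b + 1))" using z0(3) by simp
  note z = z0(1,2) this
  have "(2 * (real k + 1)) powr (- (b + 1)) \<le> z powr (- (b + 1))"
    using z b by (intro powr_mono2') auto
  then have "2 powr (- (b + 1)) * (real k + 1) powr (- (b + 1)) \<le> z powr (- (b + 1))" by (subst powr_mult[symmetric])
  then have "b * (2 powr (- (b + 1)) * (real k + 1) powr (- (b + 1))) \<le> b * z powr (- (b + 1))"
    using b by (intro mult_left_mono) auto
  moreover have "2 powr (- (b + 1)) = inverse (2 powr (b + 1))" by (rule powr_minus)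
  ultimately show ?thesis unfolding z(3) by (simp add: divide_inverse mult.assoc)
qed

text \<open>Both this and the next sum telescope after comparison with increments of a power.\<close>

lemma head_sum_le:
  fixes Y a :: real assumes a: "0 < a" "a \<le> 1" and Y: "0 < Y"
  shows "(\<Sum>k<K. if real k + 1 < Y then (real k + 1) powr (a - 1) else 0) \<le> (min (real K) Y) powr a / a"
proof (induction K)
  case (Suc K)
  show ?case
  proof (cases "real K + 1 < Y")
    case True
    have "(real K + 1) powr (a - 1) \<le> ((real K + 1) powr a - real K powr a) / a"
      using powr_increment_ge[OF a, of K] a by (simp add: pos_le_divide_eq mult.commute)
    moreover have "min (real K) Y = real K" "min (real (Suc K)) Y = real K + 1" using True by auto
    ultimately show ?thesis using Suc True by (simp add: diff_divide_distrib add.commute)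
  next
    case False
    have "(min (real K) Y) powr a / a \<le> (min (real (Suc K)) Y) powr a / a"
      using a Y by (intro divide_right_mono powr_mono2) auto
    then show ?thesis using Suc False by simp
  qed
qed (use a Y in simp)

lemma tail_sum_le:
  fixes Y b :: real assumes b: "0 < b" and Y: "0 < Y"
  shows "(\<Sum>k<K. if real k + 1 < Y then 0 else (real k + 1) powr (- (b + 1)))
    \<le> 2 powr (b + 1) / b * (Y powr (- b) - (max (real K + 1) Y) powr (- b))"
proof (induction K)
  case 0
  have "(max 1 Y) powr (- b) \<le> Y powr (- b)" using b Y by (intro powr_mono2') auto
  then show ?case using b by simp
next
  case (Suc K)
  let ?D = "2 powr (b + 1) / b"
  have D: "?D > 0" using b by simp
  show ?case
  proof (cases "real K + 1 < Y")
    case True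
    have "(max (real (Suc K) + 1) Y) powr (- b) \<le> Y powr (- b)" using b Y by (intro powr_mono2') auto
    moreover have "max (real K + 1) Y = Y" using True by simp
    ultimately show ?thesis using Suc True D mult_nonneg_nonneg[of ?D "Y powr (- b) - (max (real (Suc K) + 1) Y) powr (- b)"] by simp
  next
    case False
    have "(real K + 1) powr (- (b + 1)) = ?D * (b / 2 powr (b + 1) * (real K + 1) powr (- (b + 1)))"
      using b by simp
    also have "\<dots> \<le> ?D * ((real K + 1) powr (- b) - (real K + 2) powr (- b))"
      using D by (intro mult_left_mono powr_decrement_ge[OF b]) auto
    finally have "(real K + 1) powr (- (b + 1)) \<le> ?D * ((real K + 1) powr (- b) - (real K + 2) powr (- b))" .
    moreover have "max (real K + 1) Y = real K + 1" "max (real (Suc K) + 1) Y = real K + 2" using False by auto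
    ultimately show ?thesis using Suc False by (simp add: right_diff_distrib add.commute)
  qed
qed

text \<open>The first bound is used for \<open>k + 1 < Y\<close>, the second one beyond; the two partial sums balance.\<close>

lemma schatten_sum_bound:
  fixes s :: "nat \<Rightarrow> real" and q \<Gamma> Y p :: real
  assumes q: "0 < q" "q \<le> 1" and \<Gamma>: "0 \<le> \<Gamma>" and Y: "0 < Y" and p: "1 < q / 2 + p * q" and B: "1 \<le> B"
    and s0: "\<And>k. 0 \<le> s k"
    and s1: "\<And>k. s k \<le> \<Gamma> * (real k + 1) powr (- (1/2))"
    and s2: "\<And>k. Y \<le> real k + 1 \<Longrightarrow> s k \<le> \<Gamma> * (real k + 1) powr (- (1/2)) * (B * ((real k + 1) / Y) powr (- p))"
  shows "summable (\<lambda>k. s k powr q)"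
    and "(\<Sum>k. s k powr q) \<le> (2 + B powr q * 2 powr (q / 2 + p * q) / (q / 2 + p * q - 1)) * \<Gamma> powr q * Y powr (1 - q / 2)"
proof -
  define a where "a = 1 - q / 2"
  define b where "b = q / 2 + p * q - 1"
  have a: "1/2 \<le> a" "0 < a" "a \<le> 1" and b: "0 < b" using q p by (auto simp: a_def b_def)
  let ?C = "(2 + B powr q * 2 powr (b + 1) / b) * \<Gamma> powr q * Y powr a"
  let ?h = "\<lambda>k. if real k + 1 < Y then (real k + 1) powr (a - 1) else 0"
  let ?t = "\<lambda>k. if real k + 1 < Y then 0 else (real k + 1) powr (- (b + 1))"
  have pw: "s k powr q \<le> \<Gamma> powr q * (?h k + (B powr q * Y powr (p * q)) * ?t k)" for k
  proof (cases "real k + 1 < Y")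
    case True
    have "s k powr q \<le> (\<Gamma> * (real k + 1) powr (- (1/2))) powr q" using s0 s1 q by (intro powr_mono2) auto
    also have "\<dots> = \<Gamma> powr q * (real k + 1) powr (a - 1)"
      using \<Gamma> by (simp add: powr_mult powr_powr a_def)
    finally show ?thesis using True by simp
  next
    case False
    have "s k powr q \<le> (\<Gamma> * (real k + 1) powr (- (1/2)) * (B * ((real k + 1) / Y) powr (- p))) powr q"
      using s0 s2 q False by (intro powr_mono2) auto
    also have "\<dots> = \<Gamma> powr q * (real k + 1) powr (- (q/2)) * (B powr q * ((real k + 1) / Y) powr (- (p * q)))"
      using \<Gamma> B Y by (simp add: powr_mult powr_powr)
    also have "((real k + 1) / Y) powr (- (p * q)) = (real k + 1) powr (- (p * q)) * Y powr (p * q)"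
      using Y by (simp add: powr_divide powr_minus field_simps)
    also have "\<Gamma> powr q * (real k + 1) powr (- (q/2)) * (B powr q * ((real k + 1) powr (- (p * q)) * Y powr (p * q)))
      = \<Gamma> powr q * (B powr q * Y powr (p * q)) * ((real k + 1) powr (- (q/2)) * (real k + 1) powr (- (p * q)))" by simp
    also have "(real k + 1) powr (- (q/2)) * (real k + 1) powr (- (p * q)) = (real k + 1) powr (- (b + 1))"
      by (simp add: powr_add[symmetric] b_def)
    finally show ?thesis using False by simp
  qed
  have part: "(\<Sum>k<K. s k powr q) \<le> ?C" for K
  proof -
    have "(\<Sum>k<K. s k powr q) \<le> (\<Sum>k<K. \<Gamma> powr q * (?h k + (B powr q * Y powr (p * q)) * ?t k))"
      by (intro sum_mono pw)
    also have "\<dots> = \<Gamma> powr q * ((\<Sum>k<K. ?h k) + (B powr q * Y powr (p * q)) * (\<Sum>k<K. ?t k))"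
      by (simp only: sum_distrib_left[symmetric] sum.distrib)
    also have "\<dots> \<le> \<Gamma> powr q * (2 * Y powr a + (B powr q * Y powr (p * q)) * (2 powr (b + 1) / b * Y powr (- b)))"
    proof (intro mult_left_mono add_mono)
      have "(\<Sum>k<K. ?h k) \<le> (min (real K) Y) powr a / a" by (rule head_sum_le[OF a(2,3) Y])
      also have "\<dots> \<le> Y powr a / (1/2)" using a Y by (intro frac_le powr_mono2) auto
      finally show "(\<Sum>k<K. ?h k) \<le> 2 * Y powr a" by simp
      have "(\<Sum>k<K. ?t k) \<le> 2 powr (b + 1) / b * (Y powr (- b) - (max (real K + 1) Y) powr (- b))" by (rule tail_sum_le[OF b Y])
      also have "\<dots> \<le> 2 powr (b + 1) / b * Y powr (- b)" using b by (intro mult_left_mono) auto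
      finally show "(\<Sum>k<K. ?t k) \<le> 2 powr (b + 1) / b * Y powr (- b)" .
    qed auto
    also have "\<dots> = \<Gamma> powr q * (2 * Y powr a + B powr q * 2 powr (b + 1) / b * (Y powr (p * q) * Y powr (- b)))" by simp
    also have "Y powr (p * q) * Y powr (- b) = Y powr a" using Y by (simp add: powr_add[symmetric] a_def b_def)
    finally show ?thesis by (simp add: algebra_simps)
  qed
  show sm: "summable (\<lambda>k. s k powr q)" by (rule summableI_nonneg_bounded[OF _ part]) simp
  have "(\<Sum>k. s k powr q) \<le> ?C" by (rule suminf_le_const[OF sm part])
  then show "(\<Sum>k. s k powr q) \<le> (2 + B powr q * 2 powr (q / 2 + p * q) / (q / 2 + p * q - 1)) * \<Gamma> powr q * Y powr (1 - q / 2)"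
    by (simp add: a_def b_def)
qed

lemma geometric_sum_le:
  fixes x :: real assumes "0 \<le> x" "x < 1" shows "(\<Sum>j\<le>J. x ^ j) \<le> 1 / (1 - x)"
proof -
  have "(\<Sum>j\<le>J. x ^ j) = (1 - x ^ Suc J) / (1 - x)" using assms by (simp add: sum_gp0)
  also have "\<dots> \<le> 1 / (1 - x)" using assms by (intro divide_right_mono) auto
  finally show ?thesis .
qed

definition words_upto :: "nat \<Rightarrow> 'a::euclidean_space list set" where
  "words_upto n = {bs. set bs \<subseteq> Basis \<and> length bs < n}"

lemma finite_words_upto: "finite (words_upto n)"
  unfolding words_upto_def
  by (rule finite_subset[OF _ finite_lists_length_le[OF finite_Basis, of n]]) auto

context cutoff_pdo
begin

definition big :: real where "big = \<alpha> * R * \<rho>"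

text \<open>The largest cells have side \<open>eta / (\<alpha> \<rho>)\<close>. Their diameter must not exceed \<open>R / 4\<close>, which follows from
  \<open>l\<^sub>0 \<le> \<alpha> R \<rho>\<close>; \<open>eta \<le> 1\<close> keeps \<open>eta\<close> out of the energy bounds.\<close>

definition eta :: real where "eta = min 1 (l\<^sub>0 / (4 * real DIM('a)))"

definition cell_size :: "real \<Rightarrow> nat \<Rightarrow> nat \<Rightarrow> real" where
  "cell_size \<theta> J j = eta * 2 powr (\<theta> * (real j - real J)) / (\<alpha> * \<rho>)"

lemma big_ge: "\<alpha> * l * \<rho> \<le> big" "l\<^sub>0 \<le> big" "0 < big"
proof -
  show 1: "\<alpha> * l * \<rho> \<le> big" unfolding big_def using R \<alpha> \<rho> by (intro mult_right_mono mult_left_mono) auto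
  then show 2: "l\<^sub>0 \<le> big" using l0 by linarith
  then show "0 < big" using l0 by linarith
qed

lemma eta_bounds: "0 < eta" "eta \<le> 1" "real DIM('a) * eta \<le> l\<^sub>0 / 4" "eta * (4 * real DIM('a)) \<le> l\<^sub>0"
proof -
  have d: "real DIM('a) > 0" by simp
  show "0 < eta" "eta \<le> 1" using l0 d by (auto simp: eta_def)
  have "eta \<le> l\<^sub>0 / (4 * real DIM('a))" by (simp add: eta_def)
  then show "eta * (4 * real DIM('a)) \<le> l\<^sub>0" using d by (simp add: pos_le_divide_eq)
  then show "real DIM('a) * eta \<le> l\<^sub>0 / 4" by (simp add: mult.commute mult.left_commute)
qed

lemma cell_size_bounds:
  assumes \<theta>: "0 < \<theta>" and j: "j \<le> J"
  shows "0 < cell_size \<theta> J j" "real DIM('a) * cell_size \<theta> J j \<le> R / 4"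
proof -
  show "0 < cell_size \<theta> J j" using eta_bounds \<alpha> \<rho> by (simp add: cell_size_def)
  have "2 powr (\<theta> * (real j - real J)) \<le> 2 powr 0" using \<theta> j by (intro powr_mono mult_nonneg_nonpos) auto
  then have p: "2 powr (\<theta> * (real j - real J)) \<le> 1" by simp
  have "real DIM('a) * cell_size \<theta> J j = (real DIM('a) * eta) * 2 powr (\<theta> * (real j - real J)) / (\<alpha> * \<rho>)"
    by (simp add: cell_size_def)
  also have "\<dots> \<le> (l\<^sub>0 / 4) * 1 / (\<alpha> * \<rho>)"
    using eta_bounds p \<alpha> \<rho> l0 by (intro divide_right_mono mult_mono) auto
  also have "\<dots> \<le> (big / 4) * 1 / (\<alpha> * \<rho>)"
    using big_ge \<alpha> \<rho> by (intro divide_right_mono) auto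
  also have "\<dots> = R / 4" using \<alpha> \<rho> by (simp add: big_def)
  finally show "real DIM('a) * cell_size \<theta> J j \<le> R / 4" .
qed

text \<open>Finer cells near the centre: since \<open>\<theta> > 1\<close>, the shell \<open>j = 0\<close> carries most of the cells and
  the shell \<open>j = J\<close> most of the error, so that both sums over \<open>j\<close> are geometric.\<close>

lemma shell_count:
  assumes \<theta>: "1 < \<theta>" and j: "j \<le> J"
  shows "finite (cell_index (cell_size \<theta> J j) ` shell j)"
    "real (card (cell_index (cell_size \<theta> J j) ` shell j)) \<le> (12 * big / eta) ^ DIM('a) * 2 powr (real DIM('a) * \<theta> * real J) * (2 powr (- (\<theta> - 1) * real DIM('a))) ^ j"
proof -
  let ?\<delta> = "cell_size \<theta> J j" and ?r = "2 ^ (j + 2) * R" and ?d = "real DIM('a)"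
  have \<delta>: "0 < ?\<delta>" using cell_size_bounds(1)[of \<theta> j J] \<theta> j by simp
  have r: "0 \<le> ?r" using R_pos by simp
  have sub: "cell_index ?\<delta> ` shell j \<subseteq> cell_index ?\<delta> ` cball u ?r" by (intro image_mono) (auto simp: shell_def)
  show "finite (cell_index ?\<delta> ` shell j)" by (rule finite_subset[OF sub cells_count(1)[OF \<delta> r]])
  have "real (card (cell_index ?\<delta> ` shell j)) \<le> real (card (cell_index ?\<delta> ` cball u ?r))"
    using card_mono[OF cells_count(1)[OF \<delta> r] sub] by simp
  also have "\<dots> \<le> (2 * ?r / ?\<delta> + 2) ^ DIM('a)" by (rule cells_count(2)[OF \<delta> r])
  also have "\<dots> \<le> (3 * ?r / ?\<delta>) ^ DIM('a)"
  proof (rule power_mono)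
    have "?\<delta> \<le> ?d * ?\<delta>" using \<delta> mult_right_mono[of 1 ?d ?\<delta>] by (simp add: Suc_le_eq)
    also have "\<dots> \<le> R / 4" by (rule cell_size_bounds(2)) (use \<theta> j in auto)
    finally have "?\<delta> \<le> R / 4" .
    moreover have "4 * R \<le> ?r" using R_pos mult_right_mono[of 1 "2 ^ j" R] by (simp add: power_add)
    ultimately have "2 * ?\<delta> \<le> ?r" using R_pos by linarith
    then have "2 \<le> ?r / ?\<delta>" using \<delta> by (simp add: pos_le_divide_eq)
    moreover have "3 * ?r / ?\<delta> = 2 * ?r / ?\<delta> + ?r / ?\<delta>" unfolding add_divide_distrib[symmetric] by (rule arg_cong[where f = "\<lambda>x. x / ?\<delta>"]) linarith
    ultimately show "2 * ?r / ?\<delta> + 2 \<le> 3 * ?r / ?\<delta>" by (simp only: add_left_mono)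
    show "0 \<le> 2 * ?r / ?\<delta> + 2" using r \<delta> by simp
  qed
  also have "3 * ?r / ?\<delta> = (12 * big / eta) * (2 ^ j / 2 powr (\<theta> * (real j - real J)))"
    using \<alpha> \<rho> eta_bounds(1) by (simp add: cell_size_def big_def power_add field_simps)
  also have "2 ^ j / 2 powr (\<theta> * (real j - real J)) = 2 powr (\<theta> * real J) * 2 powr (- (\<theta> - 1) * real j)"
    by (simp add: powr_realpow[symmetric] powr_diff[symmetric] powr_add[symmetric] algebra_simps)
  also have "((12 * big / eta) * (2 powr (\<theta> * real J) * 2 powr (- (\<theta> - 1) * real j))) ^ DIM('a)
    = (12 * big / eta) ^ DIM('a) * ((2 powr (\<theta> * real J)) ^ DIM('a) * (2 powr (- (\<theta> - 1) * real j)) ^ DIM('a))"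
    by (simp only: power_mult_distrib)
  also have "(2 powr (\<theta> * real J)) ^ DIM('a) = 2 powr (?d * \<theta> * real J)"
    by (simp add: powr_realpow[symmetric] powr_powr mult_ac)
  also have "(2 powr (- (\<theta> - 1) * real j)) ^ DIM('a) = (2 powr (- (\<theta> - 1) * ?d)) ^ j"
    by (simp add: powr_realpow[symmetric] powr_powr mult_ac)
  finally show "real (card (cell_index ?\<delta> ` shell j)) \<le> (12 * big / eta) ^ DIM('a) * 2 powr (?d * \<theta> * real J) * (2 powr (- (\<theta> - 1) * ?d)) ^ j"
    by (simp only: mult.assoc)
qed

definition level_const :: "real \<Rightarrow> nat \<Rightarrow> nat \<Rightarrow> real" where
  "level_const \<theta> n m = (real DIM('a) ^ 2 * 2 ^ DIM('a) * (2 ^ m + 1 / l\<^sub>0) ^ 2) ^ n * real DIM('a) ^ n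
     * (1 / (1 - (2 powr (- (\<theta> - 1))) ^ (2 * n))) + 1"

lemma level_const_ge: assumes "1 < \<theta>" "0 < n" shows "1 \<le> level_const \<theta> n m"
proof -
  have "(2 powr (- (\<theta> - 1))) ^ (2 * n) < (1::real)"
    using assms by (intro power_less_one_iff[THEN iffD2]) (auto simp: powr_less_one)
  then show ?thesis unfolding level_const_def using l0 by (auto intro!: mult_nonneg_nonneg)
qed

text \<open>In the term of index \<open>j\<close> the cells contribute \<open>2\<^bsup>2 n \<theta> (j - J)\<^esup>\<close> and the decay of the kernel contributes
  \<open>2\<^bsup>-2 m j\<^esup> \<le> 2\<^bsup>-2 n j\<^esup>\<close>; the product is \<open>2\<^bsup>-2 n J\<^esup>\<close> times a geometric progression in \<open>J - j\<close>.\<close>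

lemma level_sum_le:
  assumes \<theta>: "1 < \<theta>" and n: "0 < n" "n \<le> m"
  shows "(\<Sum>j\<le>J. ((real DIM('a) * cell_size \<theta> J j)\<^sup>2 * 2 ^ DIM('a)) ^ n * (real DIM('a) ^ n * far_bound m (2 ^ j * R / 2) (step_const m ^ n * N)))
       + far_bound m (2 ^ J * R / 2) N
    \<le> real DIM('a) * (2 * real DIM('a) / big) ^ (2 * m) * (hs_unit * N\<^sup>2) * level_const \<theta> n m * (2 powr (- real J)) ^ (2 * n)"
proof -
  let ?d = "real DIM('a)" and ?\<kappa> = "2 ^ m + 1 / l\<^sub>0"
  let ?F = "?d * (2 * ?d / big) ^ (2 * m) * (hs_unit * N\<^sup>2)"
  let ?x = "(2 powr (- (\<theta> - 1))) ^ (2 * n)"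
  let ?D = "(?d ^ 2 * 2 ^ DIM('a) * ?\<kappa> ^ 2) ^ n * ?d ^ n"
  have F0: "?F \<ge> 0" using hs_unit_nonneg big_ge by simp
  have D0: "?D \<ge> 0" using l0 by simp
  have x: "0 \<le> ?x" "?x < 1"
    using \<theta> n by (auto intro!: power_less_one_iff[THEN iffD2] simp: powr_less_one)
  have fb: "far_bound m (2 ^ j * R / 2) M' \<le> ?d * (2 * ?d / big) ^ (2 * m) * (hs_unit * M'\<^sup>2) * (2 powr (- real j)) ^ (2 * n)" for j M'
  proof -
    have e: "?d / (\<alpha> * \<rho> * (2 ^ j * R / 2)) = (2 * ?d / big) * (2 powr (- real j))"
      using \<alpha> \<rho> R_pos by (simp add: big_def powr_minus powr_realpow field_simps)
    have "(2 powr (- real j)) ^ (2 * m) \<le> (2 powr (- real j)) ^ (2 * n)"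
      using n by (intro power_decreasing) (use powr_mono[of "- real j" 0 "2::real"] in auto)
    then have "?d * (2 * ?d / big) ^ (2 * m) * (hs_unit * M'\<^sup>2) * (2 powr (- real j)) ^ (2 * m) \<le> ?d * (2 * ?d / big) ^ (2 * m) * (hs_unit * M'\<^sup>2) * (2 powr (- real j)) ^ (2 * n)"
      using hs_unit_nonneg big_ge by (intro mult_left_mono) auto
    then show ?thesis unfolding far_bound_def e power_mult_distrib[of "2 * ?d / big"] by (simp add: mult_ac)
  qed
  have lev: "((?d * cell_size \<theta> J j)\<^sup>2 * 2 ^ DIM('a)) ^ n * (?d ^ n * far_bound m (2 ^ j * R / 2) (step_const m ^ n * N)) \<le> ?F * ?D * (2 powr (- real J)) ^ (2 * n) * ?x ^ (J - j)"
    if j: "j \<le> J" for j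
  proof -
    let ?p = "2 powr (\<theta> * (real j - real J))"
    have cs: "cell_size \<theta> J j * step_const m = eta * ?p * ?\<kappa>"
      using \<alpha> \<rho> by (simp add: cell_size_def step_const_def)
    have "((?d * cell_size \<theta> J j)\<^sup>2 * 2 ^ DIM('a)) ^ n * (?d ^ n * far_bound m (2 ^ j * R / 2) (step_const m ^ n * N))
      \<le> ((?d * cell_size \<theta> J j)\<^sup>2 * 2 ^ DIM('a)) ^ n * (?d ^ n * (?d * (2 * ?d / big) ^ (2 * m) * (hs_unit * (step_const m ^ n * N)\<^sup>2) * (2 powr (- real j)) ^ (2 * n)))"
      by (intro mult_left_mono fb) auto
    also have "\<dots> = ?F * ?d ^ n * (((?d * cell_size \<theta> J j)\<^sup>2 * 2 ^ DIM('a)) ^ n * (step_const m ^ n)\<^sup>2) * (2 powr (- real j)) ^ (2 * n)"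
      by (simp add: power_mult_distrib mult_ac)
    also have "((?d * cell_size \<theta> J j)\<^sup>2 * 2 ^ DIM('a)) ^ n * (step_const m ^ n)\<^sup>2 = (?d ^ 2 * 2 ^ DIM('a) * (cell_size \<theta> J j * step_const m)\<^sup>2) ^ n"
      by (simp add: power_mult_distrib power_mult[symmetric] mult_ac)
    also have "\<dots> = (?d ^ 2 * 2 ^ DIM('a) * ?\<kappa> ^ 2) ^ n * (eta * ?p) ^ (2 * n)"
      unfolding cs by (simp add: power_mult_distrib power_mult[symmetric] mult_ac)
    also have "?F * ?d ^ n * ((?d ^ 2 * 2 ^ DIM('a) * ?\<kappa> ^ 2) ^ n * (eta * ?p) ^ (2 * n)) * (2 powr (- real j)) ^ (2 * n)
      = ?F * ?D * ((eta * ?p) ^ (2 * n) * (2 powr (- real j)) ^ (2 * n))" by (simp only: mult_ac)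
    also have "\<dots> \<le> ?F * ?D * (?p ^ (2 * n) * (2 powr (- real j)) ^ (2 * n))"
      using F0 D0 eta_bounds hs_unit_nonneg by (intro mult_left_mono mult_right_mono power_mono mult_nonneg_nonneg) (auto intro: mult_left_le_one_le)
    also have "?p ^ (2 * n) * (2 powr (- real j)) ^ (2 * n) = (2 powr (- real J)) ^ (2 * n) * ?x ^ (J - j)"
    proof -
      have "?p * 2 powr (- real j) = 2 powr (- real J) * 2 powr (- (\<theta> - 1) * real (J - j))"
        using j by (simp add: powr_add[symmetric] algebra_simps)
      also have "2 powr (- (\<theta> - 1) * real (J - j)) = (2 powr (- (\<theta> - 1))) ^ (J - j)"
        by (simp add: powr_realpow[symmetric] powr_powr)
      finally show ?thesis unfolding power_mult_distrib[symmetric] 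
        by (simp add: power_mult_distrib power_mult[symmetric] mult_ac)
    qed
    finally show ?thesis by (simp only: mult.assoc)
  qed
  have "(\<Sum>j\<le>J. ((?d * cell_size \<theta> J j)\<^sup>2 * 2 ^ DIM('a)) ^ n * (?d ^ n * far_bound m (2 ^ j * R / 2) (step_const m ^ n * N)))
    \<le> (\<Sum>j\<le>J. ?F * ?D * (2 powr (- real J)) ^ (2 * n) * ?x ^ (J - j))"
    by (intro sum_mono lev) simp
  also have "\<dots> = ?F * ?D * (2 powr (- real J)) ^ (2 * n) * (\<Sum>j\<le>J. ?x ^ (J - j))" by (simp only: sum_distrib_left)
  also have "(\<Sum>j\<le>J. ?x ^ (J - j)) = (\<Sum>j\<le>J. ?x ^ j)"
    by (rule sum.reindex_bij_witness[of _ "\<lambda>j. J - j" "\<lambda>j. J - j"]) auto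
  also have "?F * ?D * (2 powr (- real J)) ^ (2 * n) * \<dots> \<le> ?F * ?D * (2 powr (- real J)) ^ (2 * n) * (1 / (1 - ?x))"
    using F0 D0 by (intro mult_left_mono geometric_sum_le[OF x]) auto
  finally have "(\<Sum>j\<le>J. ((?d * cell_size \<theta> J j)\<^sup>2 * 2 ^ DIM('a)) ^ n * (?d ^ n * far_bound m (2 ^ j * R / 2) (step_const m ^ n * N)))
       + far_bound m (2 ^ J * R / 2) N \<le> ?F * ?D * (2 powr (- real J)) ^ (2 * n) * (1 / (1 - ?x)) + ?F * (2 powr (- real J)) ^ (2 * n)"
    using fb[of J N] by (intro add_mono) auto
  also have "\<dots> = ?F * level_const \<theta> n m * (2 powr (- real J)) ^ (2 * n)"
    unfolding level_const_def by (simp only: distrib_left distrib_right mult_1_right mult_ac)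
  finally show ?thesis .
qed

end

section \<open>The Schatten bound for the reduced operator\<close>

lemma inverse_sqrt_powr: "0 < x \<Longrightarrow> x powr (- (1/2)) = 1 / sqrt x"
  by (subst powr_minus) (simp add: powr_half_sqrt inverse_eq_divide)

context cutoff_pdo
begin

text \<open>The energy bound without functionals: \<open>far_bound\<close> at distance \<open>R / 2\<close>.\<close>

definition base_energy :: "nat \<Rightarrow> real \<Rightarrow> real" where
  "base_energy m N = (A1 * amp)\<^sup>2 * A2\<^sup>2 * (real DIM('a) * (2 * real DIM('a) / big) ^ (2 * m) * (hs_unit * N\<^sup>2))"

lemma base_energy_nonneg: "0 \<le> base_energy m N"
  using hs_unit_nonneg by (simp add: base_energy_def)

lemma energy_from_Uop:
  assumes c: "adm M c" and E: "0 \<le> E"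
    and le: "(\<Sum>g\<in>G. sq_mass (Uop c (cut g)) {x. h1 x \<noteq> 0}) \<le> ennreal (A2\<^sup>2) * ennreal E"
  shows "(\<Sum>g\<in>G. (norm (kernel_op (kern c) g))\<^sup>2) \<le> (A1 * amp)\<^sup>2 * A2\<^sup>2 * E"
proof -
  have "ennreal (\<Sum>g\<in>G. (norm (kernel_op (kern c) g))\<^sup>2) = (\<Sum>g\<in>G. ennreal ((norm (kernel_op (kern c) g))\<^sup>2))"
    by (rule sum_ennreal[symmetric]) simp
  also have "\<dots> \<le> (\<Sum>g\<in>G. ennreal ((A1 * amp)\<^sup>2) * sq_mass (Uop c (cut g)) {x. h1 x \<noteq> 0})"
    by (intro sum_mono norm_kern_op[OF c])
  also have "\<dots> \<le> ennreal ((A1 * amp)\<^sup>2) * (ennreal (A2\<^sup>2) * ennreal E)"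
    unfolding sum_distrib_left[symmetric] by (intro mult_left_mono le) simp
  also have "\<dots> = ennreal ((A1 * amp)\<^sup>2 * A2\<^sup>2 * E)"
    using E by (simp add: ennreal_mult mult.assoc)
  finally show ?thesis using E by (subst (asm) ennreal_le_iff) auto
qed

lemma energy_unrestricted:
  assumes X: "xi_class m N c" and G: "orthonormal_L2 G"
  shows "(\<Sum>g\<in>G. (norm (kernel_op (kern c) g))\<^sup>2) \<le> base_energy m N"
proof -
  have c: "adm N c" by (rule xi_class_adm[OF X])
  have "(\<Sum>g\<in>G. sq_mass (Uop c (cut g)) {x. h1 x \<noteq> 0})
    \<le> ennreal (A2\<^sup>2) * ennreal (far_bound m (R / 2) N)"
  proof (rule order_trans[OF sum_cell_Bessel[OF c G] outer_hs[OF X]])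
    show "{x. h1 x \<noteq> 0} \<in> sets borel" by measurable
    show "0 < R / 2" using R_pos by simp
    show "R / 2 \<le> dist x y" if "x \<in> {x. h1 x \<noteq> 0}" "h2 y \<noteq> 0" "pker c x y \<noteq> 0" for x y
      using sep[of x y] that R_pos by simp
  qed
  then have "(\<Sum>g\<in>G. (norm (kernel_op (kern c) g))\<^sup>2) \<le> (A1 * amp)\<^sup>2 * A2\<^sup>2 * far_bound m (R / 2) N"
    using R_pos by (intro energy_from_Uop[OF c] far_bound_nonneg) auto
  moreover have "real DIM('a) / (\<alpha> * \<rho> * (R / 2)) = 2 * real DIM('a) / big" by (simp add: big_def mult_ac)
  ultimately show ?thesis by (simp add: base_energy_def far_bound_def)
qed

definition level_functionals ::
    "real \<Rightarrow> nat \<Rightarrow> nat \<Rightarrow> real \<Rightarrow> ('a \<Rightarrow> 'a \<Rightarrow> complex) \<Rightarrow> nat \<Rightarrow> ('a L2 \<Rightarrow> complex) set" where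
  "level_functionals \<theta> n m N c J =
     (\<lambda>(j, k, bs) g. LINT x|lborel. indicator (cell (cell_size \<theta> J j) k) x *\<^sub>R Uop (word_symbol n m N c bs) (cut g) x)
       ` (SIGMA j:{..J}. (cell_index (cell_size \<theta> J j) ` shell j) \<times> words_upto n)"

lemma level_functionals_finite:
  assumes "1 < \<theta>"
  shows "finite (level_functionals \<theta> n m N c J)"
  unfolding level_functionals_def
  by (intro finite_imageI finite_SigmaI finite_cartesian_product shell_count(1)[OF assms] finite_words_upto) auto

lemma level_functionals_linear:
  assumes c: "w_class n m N c" and m: "DIM('a) \<le> m" and \<theta>: "1 < \<theta>" and \<phi>: "\<phi> \<in> level_functionals \<theta> n m N c J"
  shows "clinear_fun \<phi>"
proof -
  obtain j k bs where j: "j \<le> J" and bs: "set bs \<subseteq> Basis" "length bs < n"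
    and e: "\<phi> = (\<lambda>g. LINT x|lborel. indicator (cell (cell_size \<theta> J j) k) x *\<^sub>R Uop (word_symbol n m N c bs) (cut g) x)"
    using \<phi> unfolding level_functionals_def words_upto_def by auto
  have "0 < cell_size \<theta> J j" using cell_size_bounds(1)[OF _ j, of \<theta>] \<theta> by simp
  from cell_finite[OF this] show ?thesis
    unfolding e
    using w_class_xi[OF word_symbol_class[OF c bs(1)]] bs(2)
    by (intro clinear_fun_cell_mean[OF _ m]) auto
qed

definition count_const :: "real \<Rightarrow> nat \<Rightarrow> real" where
  "count_const \<theta> n = 1 + real (card (words_upto n :: 'a list set)) * (12 / eta) ^ DIM('a) / (1 - 2 powr (- (\<theta> - 1) * real DIM('a)))"

lemma count_ratio: "1 < \<theta> \<Longrightarrow> 2 powr (- (\<theta> - 1) * real DIM('a)) < 1"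
  by (rule powr_less_one) (auto simp: mult_neg_pos)

lemma count_const_ge: "1 < \<theta> \<Longrightarrow> 1 \<le> count_const \<theta> n"
  unfolding count_const_def using count_ratio[of \<theta>] eta_bounds by simp

lemma card_level_functionals:
  assumes \<theta>: "1 < \<theta>"
  shows "real (card (level_functionals \<theta> n m N c J)) \<le> count_const \<theta> n * big ^ DIM('a) * 2 powr (real DIM('a) * \<theta> * real J)"
proof -
  let ?K = "\<lambda>j. cell_index (cell_size \<theta> J j) ` shell j" and ?W = "words_upto n :: 'a list set"
  let ?d = "real DIM('a)"
  let ?x = "2 powr (- (\<theta> - 1) * ?d)"
  have fin: "finite (SIGMA j:{..J}. ?K j \<times> ?W)"
    by (intro finite_SigmaI finite_cartesian_product shell_count(1)[OF \<theta>] finite_words_upto) auto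
  have "card (level_functionals \<theta> n m N c J) \<le> card (SIGMA j:{..J}. ?K j \<times> ?W)"
    unfolding level_functionals_def by (rule card_image_le[OF fin])
  also have "\<dots> = (\<Sum>j\<le>J. card (?K j \<times> ?W))"
    by (rule card_SigmaI) (use shell_count(1)[OF \<theta>] finite_words_upto in auto)
  finally have "real (card (level_functionals \<theta> n m N c J)) \<le> real (\<Sum>j\<le>J. card (?K j \<times> ?W))" by (rule of_nat_mono)
  also have "\<dots> = (\<Sum>j\<le>J. real (card (?K j)) * real (card ?W))" by (simp add: card_cartesian_product)
  also have "\<dots> \<le> (\<Sum>j\<le>J. ((12 * big / eta) ^ DIM('a) * 2 powr (?d * \<theta> * real J) * ?x ^ j) * real (card ?W))"
    by (intro sum_mono mult_right_mono shell_count(2)[OF \<theta>]) auto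
  also have "\<dots> = (12 * big / eta) ^ DIM('a) * 2 powr (?d * \<theta> * real J) * real (card ?W) * (\<Sum>j\<le>J. ?x ^ j)"
    by (simp only: sum_distrib_left sum_distrib_right mult_ac)
  also have "\<dots> \<le> (12 * big / eta) ^ DIM('a) * 2 powr (?d * \<theta> * real J) * real (card ?W) * (1 / (1 - ?x))"
    using eta_bounds(1) big_ge(3) count_ratio[OF \<theta>]
    by (intro mult_left_mono geometric_sum_le mult_nonneg_nonneg zero_le_power divide_nonneg_pos) auto
  also have "\<dots> = (count_const \<theta> n - 1) * (big ^ DIM('a) * 2 powr (?d * \<theta> * real J))"
    by (simp add: count_const_def power_mult_distrib power_divide)
  also have "\<dots> \<le> count_const \<theta> n * (big ^ DIM('a) * 2 powr (?d * \<theta> * real J))"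
    using big_ge(3) by (intro mult_right_mono mult_nonneg_nonneg) auto
  finally show ?thesis by (simp add: mult.assoc)
qed

lemma energy_level:
  assumes c: "w_class n m N c" and m: "DIM('a) \<le> m" and n: "0 < n" "n \<le> m" and \<theta>: "1 < \<theta>"
    and G: "orthonormal_L2 G" and zero: "\<And>g \<phi>. g \<in> G \<Longrightarrow> \<phi> \<in> level_functionals \<theta> n m N c J \<Longrightarrow> \<phi> g = 0"
  shows "(\<Sum>g\<in>G. (norm (kernel_op (kern c) g))\<^sup>2) \<le> base_energy m N * (level_const \<theta> n m * (2 powr (- real J)) ^ (2 * n))"
proof -
  let ?L = "(\<Sum>j\<le>J. ((real DIM('a) * cell_size \<theta> J j)\<^sup>2 * 2 ^ DIM('a)) ^ n * (real DIM('a) ^ n * far_bound m (2 ^ j * R / 2) (step_const m ^ n * N)))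
       + far_bound m (2 ^ J * R / 2) N"
  have \<theta>0: "0 < \<theta>" using \<theta> by simp
  have L0: "0 \<le> ?L"
    using R_pos by (intro add_nonneg_nonneg sum_nonneg mult_nonneg_nonneg zero_le_power zero_le_power2 far_bound_nonneg) auto
  have le: "(\<Sum>g\<in>G. sq_mass (Uop c (cut g)) {x. h1 x \<noteq> 0}) \<le> ennreal (A2\<^sup>2) * ennreal ?L"
  proof (rule level_error[OF c m G cell_size_bounds(1)[OF \<theta>0] cell_size_bounds(2)[OF \<theta>0]])
    fix g :: "'a L2" and j :: nat and k :: "'a \<Rightarrow> int" and bs :: "'a list"
    assume "g \<in> G" and jk: "j \<le> J" "k \<in> cell_index (cell_size \<theta> J j) ` shell j" "set bs \<subseteq> Basis" "length bs < n"
    have "(\<lambda>g. LINT x|lborel. indicator (cell (cell_size \<theta> J j) k) x *\<^sub>R Uop (word_symbol n m N c bs) (cut g) x) \<in> level_functionals \<theta> n m N c J"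
      unfolding level_functionals_def by (rule image_eqI[where x = "(j, k, bs)"]) (use jk in \<open>auto simp: words_upto_def\<close>)
    from zero[OF \<open>g \<in> G\<close> this] show "(LINT x|lborel. indicator (cell (cell_size \<theta> J j) k) x *\<^sub>R Uop (word_symbol n m N c bs) (cut g) x) = 0" .
  qed auto
  have "(\<Sum>g\<in>G. (norm (kernel_op (kern c) g))\<^sup>2) \<le> (A1 * amp)\<^sup>2 * A2\<^sup>2 * ?L"
    by (rule energy_from_Uop[OF xi_class_adm[OF w_class_xi[OF c]] L0 le])
  also have "\<dots> \<le> (A1 * amp)\<^sup>2 * A2\<^sup>2 * (real DIM('a) * (2 * real DIM('a) / big) ^ (2 * m) * (hs_unit * N\<^sup>2) * level_const \<theta> n m * (2 powr (- real J)) ^ (2 * n))"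
    by (intro mult_left_mono level_sum_le[OF \<theta> n]) auto
  finally show ?thesis by (simp only: base_energy_def mult.assoc)
qed

definition size_const :: "nat \<Rightarrow> real" where
  "size_const m = sqrt (2 * real DIM('a)) * (2 * real DIM('a)) ^ m * unit_ball_vol (real DIM('a))"

text \<open>Chosen such that \<open>front\<^sup>2\<close> dominates twice the base energy; the factor two pays for \<open>k + 1 - card P\<close>
  being only half of \<open>k + 1\<close>.\<close>

definition front :: "nat \<Rightarrow> real \<Rightarrow> real" where
  "front m N = A1 * A2 * N * size_const m * big powr (real DIM('a) / 2 - real m)"

lemma amp_hs_unit: "amp\<^sup>2 * hs_unit \<le> big ^ DIM('a) * (unit_ball_vol (real DIM('a)))\<^sup>2"
proof -
  let ?\<omega> = "unit_ball_vol (real DIM('a))"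
  have v: "measure lborel (cball u l) = ?\<omega> * l ^ DIM('a)" "ballvol = ?\<omega> * \<rho> ^ DIM('a)"
    unfolding ballvol_def using l \<rho> by (auto intro!: content_cball)
  have pi: "(1::real) \<le> (2 * pi) ^ DIM('a)" using pi_ge_two by (intro one_le_power) auto
  have "amp\<^sup>2 * hs_unit = (\<alpha> / (2 * pi)) ^ DIM('a) * ((\<alpha> / (2 * pi)) * (2 * pi / \<alpha>)) ^ DIM('a) * (?\<omega>\<^sup>2 * (l ^ DIM('a) * \<rho> ^ DIM('a)))"
    unfolding amp_def hs_unit_def v power_mult_distrib by (simp only: power2_eq_square mult_ac)
  also have "(\<alpha> / (2 * pi)) * (2 * pi / \<alpha>) = 1" using \<alpha> by simp
  also have "(\<alpha> / (2 * pi)) ^ DIM('a) * 1 ^ DIM('a) * (?\<omega>\<^sup>2 * (l ^ DIM('a) * \<rho> ^ DIM('a))) = (\<alpha> * l * \<rho>) ^ DIM('a) * ?\<omega>\<^sup>2 / (2 * pi) ^ DIM('a)"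
    by (simp add: power_divide power_mult_distrib)
  also have "\<dots> \<le> (\<alpha> * l * \<rho>) ^ DIM('a) * ?\<omega>\<^sup>2 / 1"
    using pi \<alpha> l \<rho> by (intro divide_left_mono) auto
  also have "\<dots> \<le> big ^ DIM('a) * ?\<omega>\<^sup>2"
    using big_ge(1) \<alpha> l \<rho> by (simp add: mult_right_mono power_mono)
  finally show ?thesis .
qed

lemma base_energy_le:
  shows "2 * base_energy m N \<le> (front m N)\<^sup>2"
proof -
  let ?d = "real DIM('a)" and ?\<omega> = "unit_ball_vol (real DIM('a))"
  have "2 * base_energy m N = (2 * (A1 * A2 * N)\<^sup>2 * ?d * (2 * ?d / big) ^ (2 * m)) * (amp\<^sup>2 * hs_unit)"
    by (simp add: base_energy_def power_mult_distrib)
  also have "\<dots> \<le> (2 * (A1 * A2 * N)\<^sup>2 * ?d * (2 * ?d / big) ^ (2 * m)) * (big ^ DIM('a) * ?\<omega>\<^sup>2)"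
    using big_ge(3) by (intro mult_left_mono amp_hs_unit) simp_all
  also have "\<dots> = (A1 * A2 * N)\<^sup>2 * (2 * ?d * ((2 * ?d) ^ m)\<^sup>2 * ?\<omega>\<^sup>2) * (big ^ DIM('a) / big ^ (2 * m))"
  proof -
    have "(2 * ?d / big) ^ (2 * m) = ((2 * ?d) ^ m)\<^sup>2 / big ^ (2 * m)" by (simp only: power_divide power_even_eq)
    then show ?thesis by (simp only:) (simp add: mult_ac)
  qed
  also have "2 * ?d * ((2 * ?d) ^ m)\<^sup>2 * ?\<omega>\<^sup>2 = (size_const m)\<^sup>2"
    unfolding size_const_def power_mult_distrib[of _ ?\<omega>] power_mult_distrib[of "sqrt (2 * ?d)"] by (subst real_sqrt_pow2) auto
  also have "big ^ DIM('a) / big ^ (2 * m) = (big powr (?d / 2 - real m))\<^sup>2"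
  proof -
    have "(big powr (?d / 2 - real m))\<^sup>2 = big powr ((?d / 2 - real m) + (?d / 2 - real m))"
      by (simp only: power2_eq_square powr_add)
    also have "(?d / 2 - real m) + (?d / 2 - real m) = real DIM('a) - real (2 * m)" by simp
    also have "big powr \<dots> = big ^ DIM('a) / big ^ (2 * m)"
      unfolding powr_diff powr_realpow[OF big_ge(3)] by (rule refl)
    finally show ?thesis by (rule sym)
  qed
  finally show ?thesis by (simp add: front_def power_mult_distrib)
qed

lemma front_nonneg: "0 \<le> N \<Longrightarrow> 0 \<le> front m N"
  using A12 by (simp add: front_def size_const_def)

lemma singular_value_front:
  assumes X: "xi_class m N c" and N: "0 \<le> N"
  shows "0 \<le> singular_value (kernel_op (kern c)) k" "singular_value (kernel_op (kern c)) k \<le> front m N * (real k + 1) powr (- (1/2))"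
proof -
  note hs = kern_hs[OF xi_class_adm[OF X]]
  note * = singular_value_bounds[OF clinear_map_kernel_op[OF hs] kernel_op_adjoint[OF hs], of "{}" k "base_energy m N"]
  show "0 \<le> singular_value (kernel_op (kern c)) k" by (rule *(1)) (use energy_unrestricted[OF X] in auto)
  have "singular_value (kernel_op (kern c)) k \<le> sqrt (base_energy m N / real (k + 1 - card ({} :: ('a L2 \<Rightarrow> complex) set)))"
    by (rule *(2)) (use energy_unrestricted[OF X] in auto)
  also have "\<dots> \<le> sqrt ((front m N)\<^sup>2 / (real k + 1))"
    using base_energy_le[of m N] base_energy_nonneg[of m N] by (intro real_sqrt_le_mono frac_le) auto
  also have "\<dots> = front m N * (real k + 1) powr (- (1/2))"
    using front_nonneg[OF N] by (simp add: real_sqrt_divide inverse_sqrt_powr)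
  finally show "singular_value (kernel_op (kern c)) k \<le> front m N * (real k + 1) powr (- (1/2))" .
qed

end

context cutoff_pdo
begin

text \<open>The level \<open>J\<close> is the largest one at which twice the number of functionals is at most \<open>k + 1\<close>; rounding
  \<open>J\<close> down costs the factor \<open>2\<^sup>n\<close>.\<close>

lemma singular_value_level:
  assumes c: "w_class n m N c" and N: "0 \<le> N" and m: "DIM('a) \<le> m" and n: "0 < n" "n \<le> m" and \<theta>: "1 < \<theta>"
    and k: "2 * count_const \<theta> n * big ^ DIM('a) \<le> real k + 1"
  shows "singular_value (kernel_op (kern c)) k \<le> front m N * (real k + 1) powr (- (1/2))
    * ((sqrt (level_const \<theta> n m) * 2 ^ n) * ((real k + 1) / (2 * count_const \<theta> n * big ^ DIM('a))) powr (- (real n / (real DIM('a) * \<theta>))))"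
proof -
  let ?d = "real DIM('a)"
  define Y where "Y = 2 * count_const \<theta> n * big ^ DIM('a)"
  \<comment> \<open>Solves \<open>2\<^bsup>d \<theta> z\<^esup> = (k + 1) / Y\<close>.\<close>
  define z where "z = log 2 ((real k + 1) / Y) / (?d * \<theta>)"
  define J where "J = nat \<lfloor>z\<rfloor>"
  let ?P = "level_functionals \<theta> n m N c J"
  let ?l = "level_const \<theta> n m * (2 powr (- real J)) ^ (2 * n)"
  have Y: "0 < Y" using count_const_ge[OF \<theta>, of n] big_ge(3) by (simp add: Y_def)
  have d\<theta>: "0 < ?d * \<theta>" using \<theta> by simp
  have ratio: "1 \<le> (real k + 1) / Y" using k Y by (simp add: Y_def[symmetric])
  have "0 \<le> z" unfolding z_def using ratio d\<theta> by (intro divide_nonneg_pos) auto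
  then have J: "real J \<le> z" "z < real J + 1" by (auto simp: J_def)
  have "?d * \<theta> * z = log 2 ((real k + 1) / Y)" 
  proof -
    have "?d * \<theta> \<noteq> 0" using d\<theta> by linarith
    then show ?thesis unfolding z_def times_divide_eq_right by (rule nonzero_mult_div_cancel_left)
  qed
  then have pz: "2 powr (?d * \<theta> * z) = (real k + 1) / Y" using ratio by (simp only:) (rule powr_log_cancel; linarith)
  have "2 powr (?d * \<theta> * real J) \<le> 2 powr (?d * \<theta> * z)" using J d\<theta> by (intro powr_mono mult_left_mono) auto
  then have pJ: "Y * 2 powr (?d * \<theta> * real J) \<le> real k + 1" unfolding pz using Y by (simp add: pos_le_divide_eq mult.commute)
  have "2 * real (card ?P) \<le> Y * 2 powr (?d * \<theta> * real J)"
    using card_level_functionals[OF \<theta>, of n m N c J] by (simp add: Y_def)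
  then have card: "2 * real (card ?P) \<le> real k + 1" using pJ by linarith
  then have cardk: "card ?P \<le> k" by linarith
  have l1: "1 \<le> level_const \<theta> n m" by (rule level_const_ge[OF \<theta> n(1)])
  note hs = kern_hs[OF xi_class_adm[OF w_class_xi[OF c]]]
  have "singular_value (kernel_op (kern c)) k \<le> sqrt (base_energy m N * ?l / real (k + 1 - card ?P))"
    by (rule singular_value_bounds(2)[OF clinear_map_kernel_op[OF hs] kernel_op_adjoint[OF hs] level_functionals_finite[OF \<theta>]
       level_functionals_linear[OF c m \<theta>] cardk energy_level[OF c m n \<theta>]])
  also have "\<dots> \<le> sqrt (((front m N)\<^sup>2 * ?l) / (real k + 1))"
  proof (rule real_sqrt_le_mono)
    have "base_energy m N * ?l / real (k + 1 - card ?P) \<le> base_energy m N * ?l / ((real k + 1) / 2)"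
      using card cardk base_energy_nonneg[of m N] l1 by (intro divide_left_mono) (auto simp: of_nat_diff)
    also have "\<dots> = (2 * base_energy m N) * ?l / (real k + 1)" by simp
    also have "\<dots> \<le> (front m N)\<^sup>2 * ?l / (real k + 1)"
      using base_energy_le[of m N] l1 by (intro divide_right_mono mult_right_mono) auto
    finally show "base_energy m N * ?l / real (k + 1 - card ?P) \<le> (front m N)\<^sup>2 * ?l / (real k + 1)" .
  qed
  also have "\<dots> = front m N * (real k + 1) powr (- (1/2)) * (sqrt (level_const \<theta> n m) * (2 powr (- real J)) ^ n)"
  proof -
    have "?l = level_const \<theta> n m * ((2 powr (- real J)) ^ n)\<^sup>2" by (simp only: power_even_eq)
    then have "sqrt (((front m N)\<^sup>2 * ?l) / (real k + 1)) = front m N * (sqrt (level_const \<theta> n m) * (2 powr (- real J)) ^ n) / sqrt (real k + 1)"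
      using front_nonneg[OF N] by (simp only: real_sqrt_divide real_sqrt_mult real_sqrt_abs) simp
    also have "\<dots> = front m N * (1 / sqrt (real k + 1)) * (sqrt (level_const \<theta> n m) * (2 powr (- real J)) ^ n)" by simp
    also have "1 / sqrt (real k + 1) = (real k + 1) powr (- (1/2))" by (rule inverse_sqrt_powr[symmetric]) simp
    finally show ?thesis .
  qed
  also have "\<dots> \<le> front m N * (real k + 1) powr (- (1/2)) * (sqrt (level_const \<theta> n m) * (2 ^ n * ((real k + 1) / Y) powr (- (real n / (?d * \<theta>)))))"
  proof (intro mult_left_mono)
    have "(2 powr (- real J)) ^ n = 2 powr (- (real n * real J))" by (simp add: powr_power mult.commute)
    also have "\<dots> \<le> 2 powr (real n + - (real n * z))"
      using mult_left_mono[of z "real J + 1" "real n"] J by (intro powr_mono) (auto simp: algebra_simps)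
    also have "\<dots> = 2 ^ n * 2 powr (- (real n * z))" by (simp only: powr_add) (simp add: powr_realpow)
    also have "2 powr (- (real n * z)) = (2 powr (?d * \<theta> * z)) powr (- (real n / (?d * \<theta>)))"
    proof -
      have "?d * \<theta> * z * (- (real n / (?d * \<theta>))) = - (real n * z)" 
      proof -
        have "x * z * (- (y / x)) = - (y * z)" if "x \<noteq> 0" for x y z :: real using that by simp
        then show ?thesis using d\<theta> by (metis less_irrefl)
      qed
      then show ?thesis unfolding powr_powr by (simp only:)
    qed
    finally show "(2 powr (- real J)) ^ n \<le> 2 ^ n * ((real k + 1) / Y) powr (- (real n / (?d * \<theta>)))" unfolding pz .
    show "0 \<le> sqrt (level_const \<theta> n m)" using l1 by (intro real_sqrt_ge_zero) linarith
    show "0 \<le> front m N * (real k + 1) powr (- (1/2))" by (rule mult_nonneg_nonneg[OF front_nonneg[OF N] powr_ge_zero])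
  qed
  finally show ?thesis unfolding Y_def by (simp only: mult.assoc)
qed

definition schatten_const :: "real \<Rightarrow> nat \<Rightarrow> nat \<Rightarrow> real" where
  "schatten_const q n m = (let \<theta> = 1 + q / 2; p = real n / (real DIM('a) * \<theta>) in
     (2 + (sqrt (level_const \<theta> n m) * 2 ^ n) powr q * 2 powr (q / 2 + p * q) / (q / 2 + p * q - 1)) powr (1 / q)
     * size_const m * (2 * count_const \<theta> n) powr (1 / q - 1 / 2))"

text \<open>Here \<open>d < q n\<close> is needed, in the form \<open>1 - q / 2 \<le> 1 / \<theta> < p q\<close>.\<close>

lemma kernel_op_schatten:
  assumes c: "w_class n m N c" and N: "0 \<le> N" and q: "0 < q" "q \<le> 1" and n: "real DIM('a) < q * real n" "n \<le> m"
  shows "kernel_op (kern c) \<in> schatten_class q"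
    and "schatten_norm q (kernel_op (kern c)) \<le> schatten_const q n m * A1 * A2 * big powr (real DIM('a) / q - real m) * N"
proof -
  let ?d = "real DIM('a)" and ?s = "singular_value (kernel_op (kern c))"
  define \<theta> where "\<theta> = 1 + q / 2"
  define p where "p = real n / (?d * \<theta>)"
  define Y where "Y = 2 * count_const \<theta> n * big ^ DIM('a)"
  define B where "B = sqrt (level_const \<theta> n m) * 2 ^ n"
  define K where "K = 2 + B powr q * 2 powr (q / 2 + p * q) / (q / 2 + p * q - 1)"
  have X: "xi_class m N c" by (rule w_class_xi[OF c])
  have \<theta>: "1 < \<theta>" using q by (simp add: \<theta>_def)
  have dpos: "0 < ?d" by simp
  then have n0: "0 < n" using n(1) by (cases n) auto
  have "q * real n \<le> real n" using q by (simp add: mult_left_le_one_le)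
  then have "?d \<le> real m" using n by linarith
  then have m: "DIM('a) \<le> m" by simp
  \<comment> \<open>\<open>(1 - q/2) (1 + q/2) < 1\<close>, and \<open>\<theta> p q = q n / d > 1\<close>.\<close>
  have pq: "1 < q / 2 + p * q"
  proof -
    have "(1 - q / 2) * \<theta> \<le> 1" by (simp add: \<theta>_def algebra_simps)
    then have "1 - q / 2 \<le> 1 / \<theta>" using \<theta> by (simp only: pos_le_divide_eq)
    also have "1 / \<theta> < p * q" using n(1) \<theta> dpos by (simp add: p_def field_simps)
    finally show ?thesis by simp
  qed
  have cc: "1 \<le> count_const \<theta> n" by (rule count_const_ge[OF \<theta>])
  have Y: "0 < Y" using cc big_ge(3) by (simp add: Y_def)
  have B: "1 \<le> B"
    using mult_mono[of 1 "sqrt (level_const \<theta> n m)" 1 "2 ^ n"] level_const_ge[OF \<theta> n0, of m] by (simp add: B_def)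
  have F: "0 \<le> front m N" by (rule front_nonneg[OF N])
  have K0: "0 \<le> K" using pq by (simp add: K_def)
  note sb = schatten_sum_bound[OF q F Y pq B singular_value_front(1)[OF X N] singular_value_front(2)[OF X N]
      singular_value_level[OF c N m n0 n(2) \<theta>, folded Y_def B_def p_def]]
  have "summable (\<lambda>k. ?s k powr q)" by (rule sb(1))
  then show "kernel_op (kern c) \<in> schatten_class q"
    unfolding schatten_class_def using compact_kernel_op[OF kern_hs[OF xi_class_adm[OF X]]] by simp
  have "(\<Sum>k. ?s k powr q) \<le> K * front m N powr q * Y powr (1 - q / 2)" using sb(2) by (simp only: K_def)
  then have "schatten_norm q (kernel_op (kern c)) \<le> (K * front m N powr q * Y powr (1 - q / 2)) powr (1 / q)"
    unfolding schatten_norm_def using q by (intro powr_mono2 suminf_nonneg sb(1)) auto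
  also have "\<dots> = K powr (1 / q) * front m N * Y powr (1 / q - 1 / 2)"
    using K0 F Y q by (simp add: powr_mult powr_powr diff_divide_distrib)
  also have "Y powr (1 / q - 1 / 2) = (2 * count_const \<theta> n) powr (1 / q - 1 / 2) * big powr (?d / q - ?d / 2)"
    using cc big_ge(3) by (simp add: Y_def powr_mult powr_realpow[symmetric] powr_powr right_diff_distrib)
  also have "K powr (1 / q) * front m N * ((2 * count_const \<theta> n) powr (1 / q - 1 / 2) * big powr (?d / q - ?d / 2))
    = (K powr (1 / q) * size_const m * (2 * count_const \<theta> n) powr (1 / q - 1 / 2)) * A1 * A2 * (big powr (?d / 2 - real m) * big powr (?d / q - ?d / 2)) * N"
    by (simp add: front_def)
  also have "big powr (?d / 2 - real m) * big powr (?d / q - ?d / 2) = big powr (?d / q - real m)"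
    by (simp add: powr_add[symmetric])
  also have "K powr (1 / q) * size_const m * (2 * count_const \<theta> n) powr (1 / q - 1 / 2) = schatten_const q n m"
    by (simp add: schatten_const_def Let_def K_def B_def p_def \<theta>_def)
  finally show "schatten_norm q (kernel_op (kern c)) \<le> schatten_const q n m * A1 * A2 * big powr (?d / q - real m) * N" .
qed

end

section \<open>Density of the Schwartz functions\<close>

lemma L2_dominated_convergence:
  fixes X :: "nat \<Rightarrow> 'a::euclidean_space \<Rightarrow> complex" and w :: "'a \<Rightarrow> complex"
  assumes X[measurable]: "\<And>n. X n \<in> borel_measurable borel" and f[measurable]: "f \<in> borel_measurable borel" and w: "bsq w"
    and Xw: "\<And>n x. cmod (X n x) \<le> C * cmod (w x)" and fw: "\<And>x. cmod (f x) \<le> C * cmod (w x)"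
    and lim: "AE x in lborel. (\<lambda>n. X n x) \<longlonglongrightarrow> f x"
  shows "(\<lambda>n. abs_L2 (X n)) \<longlonglongrightarrow> abs_L2 f"
proof -
  have Xb: "bsq (X n)" for n by (rule bsq_bound[OF X w Xw])
  have fb: "bsq f" by (rule bsq_bound[OF f w fw])
  have [measurable]: "w \<in> borel_measurable borel" using w by (simp add: bsq_def)
  have "(\<lambda>n. LINT x|lborel. (cmod (X n x - f x))\<^sup>2) \<longlonglongrightarrow> (LINT x|lborel. (0::real) * cmod (f x))"
  proof (rule integral_dominated_convergence)
    show "integrable lborel (\<lambda>x::'a. (2 * C)\<^sup>2 * (cmod (w x))\<^sup>2)"
      by (rule integrable_mult_right[OF bsq_integrable[OF w]])
    show "AE x in lborel. (\<lambda>n. (cmod (X n x - f x))\<^sup>2) \<longlonglongrightarrow> 0 * cmod (f x)"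
      using lim
    proof eventually_elim
      case (elim x)
      have "(\<lambda>n. (cmod (X n x - f x))\<^sup>2) \<longlonglongrightarrow> (cmod (f x - f x))\<^sup>2"
        by (intro tendsto_intros elim)
      then show ?case by simp
    qed
    show "AE x in lborel. norm ((cmod (X n x - f x))\<^sup>2) \<le> (2 * C)\<^sup>2 * (cmod (w x))\<^sup>2" for n
    proof (intro always_eventually allI)
      fix x
      have "cmod (X n x - f x) \<le> 2 * C * cmod (w x)"
        using norm_triangle_ineq4[of "X n x" "f x"] Xw[of n x] fw[of x] by linarith
      then show "norm ((cmod (X n x - f x))\<^sup>2) \<le> (2 * C)\<^sup>2 * (cmod (w x))\<^sup>2"
        unfolding power_mult_distrib[symmetric] by (simp add: power_mono)
    qed
  qed measurable
  moreover have "(LINT x|lborel. (cmod (X n x - f x))\<^sup>2) = (norm (abs_L2 (X n) - abs_L2 f))\<^sup>2" for n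
  proof -
    have "ennreal ((norm (abs_L2 (X n) - abs_L2 f))\<^sup>2) = (\<integral>\<^sup>+x. cmod_sq (X n x - f x) \<partial>lborel)"
      unfolding abs_L2_diff[OF bsq_square_integrable[OF Xb] bsq_square_integrable[OF fb], symmetric]
      by (rule norm_abs_L2_sq[OF bsq_diff[OF Xb fb]])
    also have "\<dots> = ennreal (LINT x|lborel. (cmod (X n x - f x))\<^sup>2)"
      by (rule nn_integral_eq_integral[OF bsq_integrable[OF bsq_diff[OF Xb fb]]]) simp
    finally show ?thesis by (subst (asm) ennreal_inj) auto
  qed
  ultimately have "(\<lambda>n. (norm (abs_L2 (X n) - abs_L2 f))\<^sup>2) \<longlonglongrightarrow> 0" by simp
  then have "(\<lambda>n. sqrt ((norm (abs_L2 (X n) - abs_L2 f))\<^sup>2)) \<longlonglongrightarrow> sqrt 0" by (rule tendsto_real_sqrt)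
  then have "(\<lambda>n. norm (abs_L2 (X n) - abs_L2 f)) \<longlonglongrightarrow> 0" by simp
  then have "(\<lambda>n. abs_L2 (X n) - abs_L2 f) \<longlonglongrightarrow> 0" by (rule tendsto_norm_zero_cancel)
  then show ?thesis by (rule LIM_zero_cancel)
qed

definition closed_csubspace :: "'a::euclidean_space L2 set \<Rightarrow> bool" where
  "closed_csubspace V \<longleftrightarrow> (\<forall>f\<in>V. \<forall>g\<in>V. f + g \<in> V) \<and> (\<forall>c. \<forall>f\<in>V. scaleC_L2 c f \<in> V)
     \<and> (\<forall>X f. (\<forall>n. X n \<in> V) \<longrightarrow> X \<longlonglongrightarrow> f \<longrightarrow> f \<in> V)"

lemma bsq_indicator:
  fixes A :: "'a::euclidean_space set"
  assumes [measurable]: "A \<in> sets borel" and "bounded A"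
  shows "bsq (indicator A :: 'a \<Rightarrow> complex)"
proof -
  have "sq_norm (indicator A) = (\<integral>\<^sup>+x. indicator A x \<partial>lborel)"
    by (intro nn_integral_cong) (simp add: indicator_def)
  also have "\<dots> < \<infinity>" using emeasure_bounded_finite[OF assms(2)] by simp
  finally show ?thesis by (simp add: bsq_def)
qed

text \<open>Boxes generate the Borel sets, bounded Borel sets generate the bounded simple functions, and
  these approximate every element of \<open>L\<^sup>2\<close> with domination.\<close>

lemma closed_csubspace_box_UNIV:
  fixes V :: "'a::euclidean_space L2 set"
  assumes V: "closed_csubspace V" and box: "\<And>a b. abs_L2 (indicator (box a b)) \<in> V"
  shows "V = UNIV"
proof -
  have add: "f + g \<in> V" if "f \<in> V" "g \<in> V" for f g using V that by (simp add: closed_csubspace_def)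
  have sc: "scaleC_L2 c f \<in> V" if "f \<in> V" for c f using V that by (simp add: closed_csubspace_def)
  have lim: "f \<in> V" if "\<And>n. X n \<in> V" "X \<longlonglongrightarrow> f" for X f using V that by (simp only: closed_csubspace_def) blast
  have zero: "0 \<in> V" using sc[OF box[of 0 0], of 0] by simp
  have fin_sum: "(\<Sum>i\<in>I. f i) \<in> V" if "finite I" "\<And>i. i \<in> I \<Longrightarrow> f i \<in> V" for I :: "'i set" and f
    using that by (induction I rule: finite_induct) (auto simp: zero add)
  have ind: "abs_L2 (indicator (A \<inter> box a b)) \<in> V" if A: "A \<in> sets borel" for A and a b :: 'a
  proof -
    let ?\<Omega> = "box a b" and ?G = "range (\<lambda>(a, b). box a b :: 'a set)"
    have sets: "sigma_sets UNIV ?G = sets borel" by (subst borel_eq_box) simp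
    have i: "bsq (indicator (A \<inter> ?\<Omega>) :: 'a \<Rightarrow> complex)" if "A \<in> sets borel" for A
      by (rule bsq_indicator) (use that bounded_box in \<open>auto intro: bounded_subset\<close>)
    have S: "Int_stable ?G" unfolding Int_stable_def by (auto simp: Int_interval box_Int_box image_iff)
    have G: "?G \<subseteq> Pow UNIV" by simp
    have "A \<in> sigma_sets UNIV ?G" using A sets by simp
    then show ?thesis
    proof (induction A rule: sigma_sets_induct_disjoint[OF S G, consumes 1, case_names basic empty compl union])
      case (basic A)
      then obtain a' b' where "A = box a' b'" by auto
      then have "A \<inter> ?\<Omega> = box (\<Sum>i\<in>Basis. max (a' \<bullet> i) (a \<bullet> i) *\<^sub>R i) (\<Sum>i\<in>Basis. min (b' \<bullet> i) (b \<bullet> i) *\<^sub>R i)"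
        by (simp only: box_Int_box)
      then show ?case using box by simp
    next
      case empty
      have "abs_L2 (indicator ({} \<inter> ?\<Omega>) :: 'a \<Rightarrow> complex) = 0" unfolding zero_L2_def by (rule arg_cong[where f = abs_L2]) auto
      then show ?case using zero by (simp only:)
    next
      case (compl A)
      have A: "A \<in> sets borel" using compl.hyps sets by simp
      have "abs_L2 (indicator ((UNIV - A) \<inter> ?\<Omega>) :: 'a \<Rightarrow> complex) = abs_L2 (\<lambda>x. indicator ?\<Omega> x + (-1) * indicator (A \<inter> ?\<Omega>) x)"
        by (rule arg_cong[where f = abs_L2]) (auto simp: indicator_def fun_eq_iff)
      also have "\<dots> = abs_L2 (indicator ?\<Omega>) + scaleC_L2 (-1) (abs_L2 (indicator (A \<inter> ?\<Omega>)))"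
        using bsq_square_integrable[OF i[of UNIV]] bsq_square_integrable[OF i[OF A]]
        by (subst abs_L2_plus) (simp_all only: abs_L2_scale square_integrable_cmult sets.top space_borel Int_UNIV_left simp_thms UNIV_I borel_open open_UNIV)
      also have "\<dots> \<in> V" by (rule add[OF box sc[OF compl.IH]])
      finally show ?case .
    next
      case (union A)
      have A: "A i \<in> sets borel" for i using union.hyps sets by auto
      have fs: "abs_L2 (\<lambda>x. \<Sum>i<n. indicator (A i \<inter> ?\<Omega>) x) \<in> V \<and> bsq (\<lambda>x. \<Sum>i<n. indicator (A i \<inter> ?\<Omega>) x :: complex)" for n
      proof (induction n)
        case 0
        then show ?case using zero by (simp add: zero_L2_def[symmetric] bsq_def)
      next
        case (Suc n)
        have "abs_L2 (\<lambda>x. (\<Sum>i<n. indicator (A i \<inter> ?\<Omega>) x) + indicator (A n \<inter> ?\<Omega>) x) \<in> V"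
          using Suc add[OF conjunct1[OF Suc] union.IH[of n]]
          by (subst abs_L2_plus[OF bsq_square_integrable bsq_square_integrable]) (simp_all add: i[OF A])
        moreover have "bsq (\<lambda>x. (\<Sum>i<n. indicator (A i \<inter> ?\<Omega>) x) + indicator (A n \<inter> ?\<Omega>) x :: complex)"
          using Suc by (intro bsq_add i A) auto
        ultimately show ?case by simp
      qed
      have e: "(\<Sum>i<n. indicator (A i \<inter> ?\<Omega>) x) = (indicator (\<Union>i<n. A i \<inter> ?\<Omega>) x :: complex)" for n x
      proof (induction n)
        case (Suc n)
        have "x \<notin> A i" if "x \<in> A n" "i < n" for i using disjoint_family_onD[OF union.hyps(1) UNIV_I UNIV_I, of i n] that by auto
        then show ?case using Suc by (auto simp: indicator_def less_Suc_eq)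
      qed simp
      have "(\<lambda>n. abs_L2 (indicator (\<Union>i<n. A i \<inter> ?\<Omega>) :: 'a \<Rightarrow> complex)) \<longlonglongrightarrow> abs_L2 (indicator ((\<Union>i. A i) \<inter> ?\<Omega>))"
      proof (rule L2_dominated_convergence[where w = "indicator ?\<Omega>" and C = 1])
        show "bsq (indicator ?\<Omega> :: 'a \<Rightarrow> complex)" by (rule bsq_indicator) auto
        show "AE x in lborel. (\<lambda>n. indicator (\<Union>i<n. A i \<inter> ?\<Omega>) x :: complex) \<longlonglongrightarrow> indicator ((\<Union>i. A i) \<inter> ?\<Omega>) x"
        proof (intro always_eventually allI)
          fix x
          show "(\<lambda>n. indicator (\<Union>i<n. A i \<inter> ?\<Omega>) x :: complex) \<longlonglongrightarrow> indicator ((\<Union>i. A i) \<inter> ?\<Omega>) x"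
          proof (cases "x \<in> (\<Union>i. A i) \<inter> ?\<Omega>")
            case True
            then obtain i where i: "x \<in> A i \<inter> ?\<Omega>" by auto
            have "\<forall>\<^sub>F n in sequentially. indicator (\<Union>i<n. A i \<inter> ?\<Omega>) x = (1 :: complex)"
              using eventually_gt_at_top[of i] by eventually_elim (use i in \<open>auto simp: indicator_def\<close>)
            then show ?thesis using True by (simp add: tendsto_eventually)
          next
            case False
            then have "indicator (\<Union>i<n. A i \<inter> ?\<Omega>) x = (0 :: complex)" for n by (auto simp: indicator_def)
            then show ?thesis using False by simp
          qed
        qed
      qed (use A in \<open>auto simp: indicator_def\<close>)
      moreover have "abs_L2 (indicator (\<Union>i<n. A i \<inter> ?\<Omega>) :: 'a \<Rightarrow> complex) \<in> V" for n
        using conjunct1[OF fs[of n]] unfolding e .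
      ultimately show ?case by (rule lim[rotated])
    qed
  qed
  have "f \<in> V" for f :: "'a L2"
  proof -
    obtain g where g: "bsq g" "f = abs_L2 g" by (rule L2_borel_rep[of f])
    have [measurable]: "g \<in> borel_measurable borel" using g(1) by (simp add: bsq_def)
    obtain F where F: "\<And>i. simple_function borel (F i)" "\<And>x. (\<lambda>i. F i x) \<longlonglongrightarrow> g x" "\<And>i x. dist (F i x) 0 \<le> 2 * dist (g x) 0"
      using borel_measurable_implies_sequence_metric[of g borel "0::complex"] by auto
    \<comment> \<open>Truncation to boxes keeps the simple functions square integrable.\<close>
    let ?\<Omega> = "\<lambda>n::nat. box (- (real n *\<^sub>R One)) (real n *\<^sub>R One :: 'a)"
    let ?s = "\<lambda>n x. F n x * indicator (?\<Omega> n) x"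
    have [measurable]: "F i \<in> borel_measurable borel" for i by (rule borel_measurable_simple_function[OF F(1)])
    have sV: "abs_L2 (?s n) \<in> V" for n
    proof -
      let ?A = "\<lambda>z. (F n -` {z} \<inter> space borel)"
      have fin: "finite (range (F n))" using simple_functionD(1)[OF F(1)[of n]] by simp
      have A: "?A z \<in> sets borel" for z by measurable
      have i: "bsq (indicator (?A z \<inter> ?\<Omega> n) :: 'a \<Rightarrow> complex)" for z
        by (rule bsq_indicator) (use A in \<open>auto intro: bounded_subset[OF bounded_box]\<close>)
      have gen: "abs_L2 (\<lambda>x. \<Sum>z\<in>Z. z * indicator (?A z \<inter> ?\<Omega> n) x) \<in> V \<and> square_integrable (\<lambda>x. \<Sum>z\<in>Z. z * indicator (?A z \<inter> ?\<Omega> n) x)"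
        if "finite Z" for Z
        using that
      proof (induction Z rule: finite_induct)
        case empty
        then show ?case using zero by (simp add: zero_L2_def[symmetric] square_integrable_zero)
      next
        case (insert z Z)
        have z: "square_integrable (\<lambda>x. z * indicator (?A z \<inter> ?\<Omega> n) x)" by (rule square_integrable_cmult[OF bsq_square_integrable[OF i]])
        have "abs_L2 (\<lambda>x. z * indicator (?A z \<inter> ?\<Omega> n) x + (\<Sum>z\<in>Z. z * indicator (?A z \<inter> ?\<Omega> n) x)) \<in> V"
          unfolding abs_L2_plus[OF z conjunct2[OF insert.IH]] abs_L2_scale[OF bsq_square_integrable[OF i]]
          by (rule add[OF sc[OF ind[OF A]] conjunct1[OF insert.IH]])
        moreover have "square_integrable (\<lambda>x. z * indicator (?A z \<inter> ?\<Omega> n) x + (\<Sum>z\<in>Z. z * indicator (?A z \<inter> ?\<Omega> n) x))"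
          by (rule square_integrable_add[OF z conjunct2[OF insert.IH]])
        ultimately show ?case by (simp only: sum.insert[OF insert.hyps])
      qed
      have "?s n x = (\<Sum>z\<in>range (F n). z * indicator (?A z \<inter> ?\<Omega> n) x)" for x
      proof -
        have "(\<Sum>z\<in>range (F n). z * indicator (?A z \<inter> ?\<Omega> n) x) = (\<Sum>z\<in>range (F n). if z = F n x then z * indicator (?\<Omega> n) x else 0)"
          by (intro sum.cong refl) (auto simp: indicator_def)
        then show ?thesis using fin by (simp add: sum.delta)
      qed
      then show ?thesis using conjunct1[OF gen[OF fin]] by simp
    qed
    have "(\<lambda>n. abs_L2 (?s n)) \<longlonglongrightarrow> abs_L2 g"
    proof (rule L2_dominated_convergence[OF _ _ g(1), where C = 2])
      show "cmod (?s n x) \<le> 2 * cmod (g x)" for n x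
        using F(3)[of n x] by (simp add: indicator_def)
      show "AE x in lborel. (\<lambda>n. ?s n x) \<longlonglongrightarrow> g x"
      proof (intro always_eventually allI)
        fix x :: 'a
        obtain N where N: "norm x < real N" using reals_Archimedean2 by blast
        have "\<forall>\<^sub>F n in sequentially. F n x = ?s n x"
          using eventually_ge_at_top[of N]
        proof eventually_elim
          case (elim n)
          have "\<bar>x \<bullet> b\<bar> < real n" if "b \<in> Basis" for b using Basis_le_norm[OF that, of x] N elim by linarith
          then have "x \<in> ?\<Omega> n" by (auto simp: mem_box abs_less_iff) (metis minus_less_iff)
          then show ?case by simp
        qed
        then show "(\<lambda>n. ?s n x) \<longlonglongrightarrow> g x" using F(2)[of x] by (rule Lim_transform_eventually[rotated])
      qed
    qed simp_all
    then show "f \<in> V" unfolding g(2) by (rule lim[OF sV])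
  qed
  then show ?thesis by blast
qed

lemma polynomial_directional_derivative:
  assumes "real_polynomial_function p"
  shows "\<exists>p'. real_polynomial_function p' \<and> (\<forall>x. ((\<lambda>s. p (x + s *\<^sub>R b)) has_real_derivative p' x) (at 0))"
  using assms
proof (induction p rule: real_polynomial_function.induct)
  case (linear f)
  have "((\<lambda>s. f (x + s *\<^sub>R b)) has_real_derivative f b) (at 0)" for x
  proof -
    have "(\<lambda>s. f (x + s *\<^sub>R b)) = (\<lambda>s. f x + s * f b)"
      using linear by (simp add: linear_simps)
    then show ?thesis by (auto intro!: derivative_eq_intros)
  qed
  then show ?case by (intro exI[of _ "\<lambda>_. f b"]) auto
next
  case (const c)
  then show ?case by (intro exI[of _ "\<lambda>_. 0"]) auto
next
  case (add f g)
  then obtain f' g' where "real_polynomial_function f'" "\<And>x. ((\<lambda>s. f (x + s *\<^sub>R b)) has_real_derivative f' x) (at 0)"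
    "real_polynomial_function g'" "\<And>x. ((\<lambda>s. g (x + s *\<^sub>R b)) has_real_derivative g' x) (at 0)" by blast
  then show ?case by (intro exI[of _ "\<lambda>x. f' x + g' x"]) (auto intro!: derivative_intros)
next
  case (mult f g)
  then obtain f' g' where f': "real_polynomial_function f'" "\<And>x. ((\<lambda>s. f (x + s *\<^sub>R b)) has_real_derivative f' x) (at 0)"
    and g': "real_polynomial_function g'" "\<And>x. ((\<lambda>s. g (x + s *\<^sub>R b)) has_real_derivative g' x) (at 0)" by blast
  have "((\<lambda>s. f (x + s *\<^sub>R b) * g (x + s *\<^sub>R b)) has_real_derivative f' x * g x + g' x * f x) (at 0)" for x
    using DERIV_mult[OF f'(2)[of x] g'(2)[of x]] by simp
  then show ?case using mult.hyps f'(1) g'(1) by (intro exI[of _ "\<lambda>x. f' x * g x + g' x * f x"]) auto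
qed

lemma polynomial_growth:
  assumes "real_polynomial_function p"
  shows "\<exists>C k. 0 \<le> C \<and> (\<forall>x. \<bar>p x\<bar> \<le> C * (1 + norm x) ^ k)"
  using assms
proof (induction p rule: real_polynomial_function.induct)
  case (linear f)
  obtain K where K: "0 \<le> K" "\<And>x. norm (f x) \<le> norm x * K" using bounded_linear.nonneg_bounded[OF linear] by blast
  have "\<bar>f x\<bar> \<le> K * (1 + norm x) ^ 1" for x using K(1) K(2)[of x] by (simp add: algebra_simps)
  then show ?case using K(1) by blast
next
  case (const c)
  have "\<bar>c\<bar> \<le> \<bar>c\<bar> * (1 + norm x) ^ 0" for x :: 'a by simp
  then show ?case using abs_ge_zero[of c] by blast
next
  case (add f g)
  then obtain C k D j where f: "0 \<le> C" "\<And>x. \<bar>f x\<bar> \<le> C * (1 + norm x) ^ k" and g: "0 \<le> D" "\<And>x. \<bar>g x\<bar> \<le> D * (1 + norm x) ^ j"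
    by blast
  have "\<bar>f x + g x\<bar> \<le> (C + D) * (1 + norm x) ^ (k + j)" for x
  proof -
    have "C * (1 + norm x) ^ k \<le> C * (1 + norm x) ^ (k + j)" "D * (1 + norm x) ^ j \<le> D * (1 + norm x) ^ (k + j)"
      using f(1) g(1) by (auto intro!: mult_left_mono power_increasing)
    then show ?thesis using f(2)[of x] g(2)[of x] by (simp add: distrib_right)
  qed
  then show ?case using f(1) g(1) by (intro exI[of _ "C + D"] exI[of _ "k + j"]) auto
next
  case (mult f g)
  then obtain C k D j where f: "0 \<le> C" "\<And>x. \<bar>f x\<bar> \<le> C * (1 + norm x) ^ k" and g: "0 \<le> D" "\<And>x. \<bar>g x\<bar> \<le> D * (1 + norm x) ^ j"
    by blast
  have "\<bar>f x * g x\<bar> \<le> (C * D) * (1 + norm x) ^ (k + j)" for x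
    unfolding abs_mult using mult_mono[OF f(2)[of x] g(2)[of x]] f(1) by (simp add: power_add mult_ac)
  then show ?case using f(1) g(1) by (intro exI[of _ "C * D"] exI[of _ "k + j"]) auto
qed

text \<open>Polynomials times \<open>exp (- S)\<close> are stable under differentiation.\<close>

lemma iter_deriv_polynomial_exp:
  assumes S: "real_polynomial_function S"
  shows "\<exists>p. real_polynomial_function p \<and> iter_deriv bs (\<lambda>x. complex_of_real (exp (- S x))) = (\<lambda>x. complex_of_real (p x * exp (- S x)))
     \<and> iter_differentiable bs (\<lambda>x. complex_of_real (exp (- S x)))"
proof (induction bs)
  case Nil
  show ?case by (intro exI[of _ "\<lambda>_. 1"]) auto
next
  case (Cons b bs)
  then obtain p where p: "real_polynomial_function p" "iter_deriv bs (\<lambda>x. complex_of_real (exp (- S x))) = (\<lambda>x. complex_of_real (p x * exp (- S x)))"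
    "iter_differentiable bs (\<lambda>x. complex_of_real (exp (- S x)))" by blast
  obtain p' where p': "real_polynomial_function p'" "\<And>x. ((\<lambda>s. p (x + s *\<^sub>R b)) has_real_derivative p' x) (at 0)"
    using polynomial_directional_derivative[OF p(1), of b] by blast
  obtain S' where S': "real_polynomial_function S'" "\<And>x. ((\<lambda>s. S (x + s *\<^sub>R b)) has_real_derivative S' x) (at 0)"
    using polynomial_directional_derivative[OF S, of b] by blast
  have d: "((\<lambda>s. complex_of_real (p (x + s *\<^sub>R b) * exp (- S (x + s *\<^sub>R b)))) has_vector_derivative complex_of_real ((p' x - p x * S' x) * exp (- S x))) (at 0)" for x
  proof -
    have "((\<lambda>s. p (x + s *\<^sub>R b) * exp (- S (x + s *\<^sub>R b))) has_real_derivative (p' x - p x * S' x) * exp (- S x)) (at 0)"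
      by (rule derivative_eq_intros p'(2) S'(2) refl | simp add: algebra_simps)+
    then have "((\<lambda>s. p (x + s *\<^sub>R b) * exp (- S (x + s *\<^sub>R b))) has_vector_derivative (p' x - p x * S' x) * exp (- S x)) (at 0)"
      by (simp only: has_real_derivative_iff_has_vector_derivative)
    from bounded_linear.has_vector_derivative[OF bounded_linear_of_real this] show ?thesis .
  qed
  have "iter_deriv (b # bs) (\<lambda>x. complex_of_real (exp (- S x))) = (\<lambda>x. complex_of_real ((p' x - p x * S' x) * exp (- S x)))"
    unfolding iter_deriv.simps p(2) by (intro ext vector_derivative_at d)
  moreover have "iter_differentiable (b # bs) (\<lambda>x. complex_of_real (exp (- S x)))"
    unfolding iter_differentiable.simps p(2) using p(3) d differentiableI_vector by blast
  ultimately show ?case using p(1) p'(1) S'(1) by (intro exI[of _ "\<lambda>x. p' x - p x * S' x"]) auto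
qed

text \<open>A quadratic lower bound for \<open>S\<close> beats every power of \<open>1 + norm x \<le> exp (norm x)\<close>.\<close>

lemma schwartz_exp_polynomial:
  fixes S :: "'a::euclidean_space \<Rightarrow> real"
  assumes S: "real_polynomial_function S" and \<epsilon>: "0 < \<epsilon>" and coercive: "\<And>x. \<epsilon> * (norm x)\<^sup>2 - D \<le> S x"
  shows "(\<lambda>x. complex_of_real (exp (- S x))) \<in> schwartz"
  unfolding schwartz_def
proof (intro CollectI allI impI)
  fix bs :: "'a list" assume "set bs \<subseteq> Basis"
  obtain p where p: "real_polynomial_function p" "iter_deriv bs (\<lambda>x. complex_of_real (exp (- S x))) = (\<lambda>x. complex_of_real (p x * exp (- S x)))"
    "iter_differentiable bs (\<lambda>x. complex_of_real (exp (- S x)))" using iter_deriv_polynomial_exp[OF S, of bs] by blast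
  obtain C j where C: "0 \<le> C" "\<And>x. \<bar>p x\<bar> \<le> C * (1 + norm x) ^ j" using polynomial_growth[OF p(1)] by blast
  have cont: "continuous_on UNIV (\<lambda>x. complex_of_real (p x * exp (- S x)))"
    using continuous_real_polymonial_function[OF p(1)] continuous_real_polymonial_function[OF S]
    by (intro continuous_intros continuous_at_imp_continuous_on) auto
  have "bounded (range (\<lambda>x. (1 + norm x) ^ k *\<^sub>R complex_of_real (p x * exp (- S x))))" for k :: nat
    unfolding bounded_iff
  proof (intro exI ballI)
    fix z assume "z \<in> range (\<lambda>x. (1 + norm x) ^ k *\<^sub>R complex_of_real (p x * exp (- S x)))"
    then obtain x where z: "z = (1 + norm x) ^ k *\<^sub>R complex_of_real (p x * exp (- S x))" by blast
    let ?t = "norm x" and ?n = "real (k + j)"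
    have "norm z = (1 + ?t) ^ k * (\<bar>p x\<bar> * exp (- S x))" unfolding z by (simp add: norm_mult)
    also have "\<dots> \<le> (1 + ?t) ^ k * ((C * (1 + ?t) ^ j) * exp (- S x))" using C(2)[of x] by (intro mult_left_mono mult_right_mono) auto
    also have "\<dots> = C * ((1 + ?t) ^ (k + j) * exp (- S x))" by (simp add: power_add)
    also have "\<dots> \<le> C * (exp (?n * ?t) * exp (D - \<epsilon> * ?t\<^sup>2))"
    proof (intro mult_left_mono mult_mono)
      have "(1 + ?t) ^ (k + j) \<le> exp ?t ^ (k + j)" using exp_ge_add_one_self[of ?t] by (intro power_mono) auto
      then show "(1 + ?t) ^ (k + j) \<le> exp (?n * ?t)" by (simp only: exp_of_nat_mult)
      show "exp (- S x) \<le> exp (D - \<epsilon> * ?t\<^sup>2)" using coercive[of x] by simp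
    qed (use C(1) in auto)
    also have "\<dots> \<le> C * exp (D + ?n\<^sup>2 / (4 * \<epsilon>))"
    proof (intro mult_left_mono C(1))
      have "0 \<le> (2 * \<epsilon> * ?t - ?n)\<^sup>2" by simp
      then have "4 * \<epsilon> * (?n * ?t - \<epsilon> * ?t\<^sup>2) \<le> ?n\<^sup>2" by (simp add: power2_diff power2_eq_square algebra_simps)
      then have "?n * ?t - \<epsilon> * ?t\<^sup>2 \<le> ?n\<^sup>2 / (4 * \<epsilon>)" using \<epsilon> by (simp add: pos_le_divide_eq mult.commute)
      then show "exp (?n * ?t) * exp (D - \<epsilon> * ?t\<^sup>2) \<le> exp (D + ?n\<^sup>2 / (4 * \<epsilon>))" by (simp add: exp_add[symmetric])
    qed
    finally show "norm z \<le> C * exp (D + ?n\<^sup>2 / (4 * \<epsilon>))" .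
  qed
  then show "iter_differentiable bs (\<lambda>x. complex_of_real (exp (- S x))) \<and> continuous_on UNIV (iter_deriv bs (\<lambda>x. complex_of_real (exp (- S x)))) \<and>
     (\<forall>k. bounded (range (\<lambda>x. (1 + norm x) ^ k *\<^sub>R iter_deriv bs (\<lambda>x. complex_of_real (exp (- S x))) x)))"
    unfolding p(2) using p(3) cont by blast
qed

lemma schwartz_integrable:
  fixes v :: "'a::euclidean_space \<Rightarrow> complex"
  assumes v: "v \<in> schwartz"
  shows "continuous_on UNIV v" "integrable lborel v" "bsq v"
proof -
  have "continuous_on UNIV (iter_deriv [] v) \<and> (\<forall>k::nat. bounded (range (\<lambda>x. (1 + norm x) ^ k *\<^sub>R iter_deriv [] v x)))"
    using v[unfolded schwartz_def mem_Collect_eq, THEN spec, of "[]"] by simp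
  then have c: "continuous_on UNIV v" and b: "\<And>k. bounded (range (\<lambda>x. (1 + norm x) ^ k *\<^sub>R v x))" by auto
  show "continuous_on UNIV v" by (rule c)
  have [measurable]: "v \<in> borel_measurable borel" by (rule borel_measurable_continuous_onI[OF c])
  obtain K where K: "\<And>x. norm ((1 + norm x) ^ (2 * DIM('a)) *\<^sub>R v x) \<le> K"
    using b[of "2 * DIM('a)"] unfolding bounded_iff by blast
  define h where "h x = (\<Prod>b\<in>Basis. inverse (1 + (x \<bullet> b)\<^sup>2))" for x :: 'a
  have [measurable]: "h \<in> borel_measurable borel" unfolding h_def[abs_def] by measurable
  have h: "0 \<le> h x" "h x \<le> 1" for x
    unfolding h_def by (auto intro!: prod_nonneg prod_le_1 simp: inverse_le_1_iff add_nonneg_nonneg)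
  have "integrable lborel (\<lambda>s::real. complex_of_real (inverse (1 + s\<^sup>2)))" using integrable_inverse_square by (simp only: complex_of_real_integrable_eq)
  then have "integrable lborel (\<lambda>x::'a. \<Prod>b\<in>Basis. complex_of_real (inverse (1 + (x \<bullet> b)\<^sup>2)))" by (rule integral_prod_Basis(1))
  then have "integrable lborel (\<lambda>x::'a. complex_of_real (h x))" by (simp only: h_def of_real_prod)
  then have hi: "integrable lborel (h :: 'a \<Rightarrow> real)" by (simp only: complex_of_real_integrable_eq)
  have le: "cmod (v x) \<le> K * h x" for x
  proof -
    have "(\<Prod>b\<in>Basis. 1 + (x \<bullet> b)\<^sup>2) \<le> (\<Prod>b\<in>(Basis::'a set). (1 + norm x)\<^sup>2)"
    proof (rule prod_mono)
      fix b :: 'a assume "b \<in> Basis"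
      then have "\<bar>x \<bullet> b\<bar>\<^sup>2 \<le> (norm x)\<^sup>2" by (intro power_mono Basis_le_norm) auto
      then have "1 + (x \<bullet> b)\<^sup>2 \<le> (1 + norm x)\<^sup>2" by (simp add: power2_sum add_increasing2)
      then show "0 \<le> 1 + (x \<bullet> b)\<^sup>2 \<and> 1 + (x \<bullet> b)\<^sup>2 \<le> (1 + norm x)\<^sup>2" by (simp add: add_nonneg_nonneg)
    qed
    also have "\<dots> = (1 + norm x) ^ (2 * DIM('a))" by (simp add: power_mult)
    finally have "(\<Prod>b\<in>Basis. 1 + (x \<bullet> b)\<^sup>2) * cmod (v x) \<le> (1 + norm x) ^ (2 * DIM('a)) * cmod (v x)" by (rule mult_right_mono) simp
    also have "\<dots> \<le> K" using K[of x] by simp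
    finally have "(\<Prod>b\<in>Basis. 1 + (x \<bullet> b)\<^sup>2) * cmod (v x) \<le> K" .
    moreover have "0 < (\<Prod>b\<in>Basis. 1 + (x \<bullet> b)\<^sup>2)" by (rule prod_pos) (simp add: add_pos_nonneg)
    moreover have "h x = inverse (\<Prod>b\<in>Basis. 1 + (x \<bullet> b)\<^sup>2)" by (simp add: h_def prod_inversef[symmetric] o_def)
    ultimately show ?thesis by (simp add: divide_inverse[symmetric] pos_le_divide_eq mult.commute)
  qed
  have K0: "0 \<le> K" using order_trans[OF norm_ge_zero K] .
  show i: "integrable lborel v"
  proof (rule Bochner_Integration.integrable_bound)
    show "integrable lborel (\<lambda>x. K * h x)" by (rule integrable_mult_right[OF hi])
    show "AE x in lborel. norm (v x) \<le> norm (K * h x)" using le order_trans[OF le abs_ge_self] by auto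
  qed simp
  have "integrable lborel (\<lambda>x. (cmod (v x))\<^sup>2)"
  proof (rule Bochner_Integration.integrable_bound)
    show "integrable lborel (\<lambda>x. K\<^sup>2 * h x)" by (rule integrable_mult_right[OF hi])
    show "AE x in lborel. norm ((cmod (v x))\<^sup>2) \<le> norm (K\<^sup>2 * h x)"
    proof (intro always_eventually allI)
      fix x
      have "(cmod (v x))\<^sup>2 \<le> (K * h x)\<^sup>2" by (rule power_mono[OF le]) simp
      also have "\<dots> = K\<^sup>2 * (h x * h x)" by (simp add: power2_eq_square)
      also have "\<dots> \<le> K\<^sup>2 * (h x * 1)" using h by (intro mult_left_mono) auto
      finally show "norm ((cmod (v x))\<^sup>2) \<le> norm (K\<^sup>2 * h x)" using h by simp
    qed
  qed simp
  then show "bsq v" by (simp add: bsq_def integrable_iff_bounded)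
qed

text \<open>With \<open>s\<^sub>b\<close> the affine coordinates in which the box is \<open>\<bar>s\<^sub>b\<bar> < 1\<close>, the functions
  \<open>exp (- \<Sum>\<^sub>b s\<^sub>b\<^bsup>2k\<^esup>)\<close> tend to the indicator of the box, and all of them are dominated by a
  Gaussian because \<open>s\<^sup>2 - 1 \<le> s\<^bsup>2k\<^esup>\<close>.\<close>

lemma closed_csubspace_schwartz_box:
  fixes V :: "'a::euclidean_space L2 set"
  assumes V: "closed_csubspace V" and sch: "\<And>v. v \<in> schwartz \<Longrightarrow> abs_L2 v \<in> V"
  shows "abs_L2 (indicator (box a b)) \<in> V"
proof (cases "box a b = {}")
  case True
  have "scaleC_L2 0 (abs_L2 (\<lambda>x. complex_of_real (exp (- (x \<bullet> x))))) \<in> V"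
  proof -
    have "real_polynomial_function (\<lambda>x::'a. \<Sum>b\<in>Basis. (x \<bullet> b)\<^sup>2)"
      by (intro real_polynomial_function_sum real_polynomial_function_power real_polynomial_function.intros(1) bounded_linear_inner_left) simp
    moreover have "(\<lambda>x::'a. \<Sum>b\<in>Basis. (x \<bullet> b)\<^sup>2) = (\<lambda>x. x \<bullet> x)" by (subst euclidean_inner) (simp add: power2_eq_square)
    ultimately have "(\<lambda>x::'a. complex_of_real (exp (- (x \<bullet> x)))) \<in> schwartz"
      by (intro schwartz_exp_polynomial[of _ 1 0]) (simp_all add: power2_norm_eq_inner)
    from sch[OF this] show ?thesis using V unfolding closed_csubspace_def by blast
  qed
  moreover have "abs_L2 (indicator (box a b) :: 'a \<Rightarrow> complex) = 0" unfolding zero_L2_def True by (rule arg_cong[where f = abs_L2]) auto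
  ultimately show ?thesis by simp
next
  case False
  then have ab: "a \<bullet> i < b \<bullet> i" if "i \<in> Basis" for i using that by (auto simp: box_ne_empty)
  define r where "r i = (b \<bullet> i - a \<bullet> i) / 2" for i
  define s where "s i x = (x \<bullet> i - (a \<bullet> i + b \<bullet> i) / 2) / r i" for i x
  define S where "S k x = (\<Sum>i\<in>Basis. (s i x) ^ (2 * k))" for k :: nat and x
  define f where "f k x = complex_of_real (exp (- S k x))" for k x
  have r: "0 < r i" if "i \<in> Basis" for i using ab[OF that] by (simp add: r_def)
  have pol: "real_polynomial_function (S k)" for k
    unfolding S_def[abs_def] s_def diff_conv_add_uminus
    by (intro real_polynomial_function_sum real_polynomial_function_power real_polynomial_function_divide
        real_polynomial_function.intros(3) real_polynomial_function.intros(1) real_polynomial_function.intros(2) bounded_linear_inner_left) simp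
  have sq: "t\<^sup>2 - 1 \<le> t ^ (2 * Suc k)" for t :: real and k
  proof (cases "1 \<le> t\<^sup>2")
    case True
    have "(t\<^sup>2) ^ 1 \<le> (t\<^sup>2) ^ Suc k" by (rule power_increasing) (use True in auto)
    then show ?thesis by (simp only: power_mult) simp
  next
    case False
    have "0 \<le> t ^ (2 * Suc k)" by (simp only: power_mult zero_le_power zero_le_power2)
    then show ?thesis using False by linarith
  qed
  have S1: "S 1 x - real DIM('a) \<le> S (Suc k) x" for k x
  proof -
    have "(\<Sum>i\<in>(Basis::'a set). (s i x)\<^sup>2 - 1) \<le> S (Suc k) x" unfolding S_def by (intro sum_mono sq)
    then show ?thesis by (simp add: S_def sum_subtractf)
  qed
  have coer: "\<exists>\<epsilon>>0. \<exists>D. \<forall>x. \<epsilon> * (norm x)\<^sup>2 - D \<le> S 1 x"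
  proof -
    \<comment> \<open>From \<open>(s + c)\<^sup>2 / 2 \<le> s\<^sup>2 + c\<^sup>2\<close> in each coordinate.\<close>
    define \<epsilon> where "\<epsilon> = Min ((\<lambda>i. 1 / (2 * (r i)\<^sup>2)) ` (Basis :: 'a set))"
    define D where "D = (\<Sum>i\<in>(Basis::'a set). ((a \<bullet> i + b \<bullet> i) / 2 / r i)\<^sup>2)"
    have \<epsilon>: "0 < \<epsilon>" unfolding \<epsilon>_def using r by (subst Min_gr_iff) (auto simp: less_imp_neq[symmetric])
    have "\<epsilon> * (norm x)\<^sup>2 - D \<le> S 1 x" for x
    proof -
      have "\<epsilon> * (norm x)\<^sup>2 = (\<Sum>i\<in>Basis. \<epsilon> * (x \<bullet> i)\<^sup>2)"
        unfolding power2_norm_eq_inner by (subst euclidean_inner) (simp add: sum_distrib_left power2_eq_square)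
      also have "\<dots> \<le> (\<Sum>i\<in>Basis. (s i x)\<^sup>2 + ((a \<bullet> i + b \<bullet> i) / 2 / r i)\<^sup>2)"
      proof (rule sum_mono)
        fix i :: 'a assume i: "i \<in> Basis"
        let ?c = "(a \<bullet> i + b \<bullet> i) / 2"
        have "\<epsilon> \<le> 1 / (2 * (r i)\<^sup>2)" unfolding \<epsilon>_def using i by (intro Min_le) auto
        then have "\<epsilon> * (x \<bullet> i)\<^sup>2 \<le> 1 / (2 * (r i)\<^sup>2) * (x \<bullet> i)\<^sup>2" by (rule mult_right_mono) simp
        also have "\<dots> = (s i x + ?c / r i)\<^sup>2 / 2"
        proof -
          have "s i x + ?c / r i = (x \<bullet> i) / r i" by (simp add: s_def diff_divide_distrib)
          then show ?thesis by (simp only:) (simp add: power_divide)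
        qed
        also have "\<dots> \<le> (s i x)\<^sup>2 + (?c / r i)\<^sup>2"
        proof -
          have "(y + z)\<^sup>2 / 2 \<le> y\<^sup>2 + z\<^sup>2" for y z :: real using sum_squares_bound[of y z] by (simp add: power2_sum)
          then show ?thesis .
        qed
        finally show "\<epsilon> * (x \<bullet> i)\<^sup>2 \<le> (s i x)\<^sup>2 + (?c / r i)\<^sup>2" .
      qed
      also have "\<dots> = S 1 x + D" by (simp add: S_def D_def sum.distrib)
      finally show ?thesis by simp
    qed
    then show ?thesis using \<epsilon> by blast
  qed
  then obtain \<epsilon> D where \<epsilon>: "0 < \<epsilon>" and D: "\<And>x. \<epsilon> * (norm x)\<^sup>2 - D \<le> S 1 x" by blast
  have fs: "f (Suc k) \<in> schwartz" for k
    unfolding f_def[abs_def]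
  proof (rule schwartz_exp_polynomial[OF pol \<epsilon>])
    show "\<epsilon> * (norm x)\<^sup>2 - (D + real DIM('a)) \<le> S (Suc k) x" for x using D[of x] S1[of x k] by linarith
  qed
  have fm[measurable]: "f (Suc k) \<in> borel_measurable borel" for k
    using schwartz_integrable(3)[OF fs[of k]] by (simp add: bsq_def)
  have s_box: "x \<in> box a b \<longleftrightarrow> (\<forall>i\<in>Basis. \<bar>s i x\<bar> < 1)" "x \<in> cbox a b \<longleftrightarrow> (\<forall>i\<in>Basis. \<bar>s i x\<bar> \<le> 1)" for x
  proof -
    have "(\<bar>s i x\<bar> < 1) = (a \<bullet> i < x \<bullet> i \<and> x \<bullet> i < b \<bullet> i)" "(\<bar>s i x\<bar> \<le> 1) = (a \<bullet> i \<le> x \<bullet> i \<and> x \<bullet> i \<le> b \<bullet> i)" if i: "i \<in> Basis" for i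
    proof -
      have e: "\<bar>s i x\<bar> = \<bar>x \<bullet> i - (a \<bullet> i + b \<bullet> i) / 2\<bar> / r i" using r[OF i] by (simp add: s_def)
      show "(\<bar>s i x\<bar> < 1) = (a \<bullet> i < x \<bullet> i \<and> x \<bullet> i < b \<bullet> i)"
        unfolding e pos_divide_less_eq[OF r[OF i]] unfolding r_def abs_less_iff by (safe; argo)
      show "(\<bar>s i x\<bar> \<le> 1) = (a \<bullet> i \<le> x \<bullet> i \<and> x \<bullet> i \<le> b \<bullet> i)"
        unfolding e pos_divide_le_eq[OF r[OF i]] unfolding r_def abs_le_iff by (safe; argo)
    qed
    then show "x \<in> box a b \<longleftrightarrow> (\<forall>i\<in>Basis. \<bar>s i x\<bar> < 1)" "x \<in> cbox a b \<longleftrightarrow> (\<forall>i\<in>Basis. \<bar>s i x\<bar> \<le> 1)"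
      by (simp_all add: mem_box)
  qed
  have "(\<lambda>k. abs_L2 (f (Suc k))) \<longlonglongrightarrow> abs_L2 (indicator (box a b))"
  proof (rule L2_dominated_convergence[where w = "f (Suc 0)" and C = "exp (real DIM('a))"])
    show "bsq (f (Suc 0))" by (rule schwartz_integrable(3)[OF fs])
    show "cmod (f (Suc k) x) \<le> exp (real DIM('a)) * cmod (f (Suc 0) x)" for k x
      using S1[of x k] by (simp add: f_def exp_add[symmetric])
    show "cmod (indicator (box a b) x) \<le> exp (real DIM('a)) * cmod (f (Suc 0) x)" for x
    proof (cases "x \<in> box a b")
      case True
      have "S 1 x \<le> (\<Sum>i\<in>(Basis::'a set). 1)"
        unfolding S_def using True s_box(1)[of x] by (intro sum_mono) (auto simp: abs_square_le_1 intro!: less_imp_le)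
      then show ?thesis using True by (simp add: f_def exp_add[symmetric])
    qed simp
    have "negligible (cbox a b - box a b)" by (rule negligible_frontier_interval)
    then have "cbox a b - box a b \<in> null_sets lborel"
      unfolding negligible_iff_null_sets by (subst (asm) null_sets_completion_iff) auto
    then have "AE x in lborel. x \<notin> cbox a b - box a b" by (rule AE_not_in)
    then show "AE x in lborel. (\<lambda>k. f (Suc k) x) \<longlonglongrightarrow> indicator (box a b) x"
    proof eventually_elim
      case (elim x)
      show ?case
      proof (cases "x \<in> box a b")
        case True
        have "(\<lambda>k. S k x) \<longlonglongrightarrow> (\<Sum>i\<in>(Basis::'a set). 0)"
          unfolding S_def
        proof (rule tendsto_sum)
          fix i :: 'a assume "i \<in> Basis"
          then have "(s i x)\<^sup>2 < 1" using True s_box(1)[of x] by (simp add: abs_square_less_1)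
          then have "(\<lambda>k. ((s i x)\<^sup>2) ^ k) \<longlonglongrightarrow> 0" by (intro LIMSEQ_power_zero) simp
          then show "(\<lambda>k. (s i x) ^ (2 * k)) \<longlonglongrightarrow> 0" by (simp only: power_mult)
        qed
        then have "(\<lambda>k. S (Suc k) x) \<longlonglongrightarrow> 0" using LIMSEQ_Suc[of "\<lambda>k. S k x" 0] by simp
        then have "(\<lambda>k. f (Suc k) x) \<longlonglongrightarrow> complex_of_real (exp (- 0))" unfolding f_def by (intro tendsto_intros)
        then show ?thesis using True by simp
      next
        case False
        then have "x \<notin> cbox a b" using elim by simp
        then obtain i where i: "i \<in> Basis" "1 < \<bar>s i x\<bar>" using s_box(2)[of x] by (auto simp: not_le)
        have "1 < \<bar>s i x\<bar>\<^sup>2" by (rule one_less_power[OF i(2)]) simp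
        then have g: "1 < (s i x)\<^sup>2" by simp
        have "filterlim (\<lambda>k. ((s i x)\<^sup>2) ^ k) at_top sequentially"
          using filterlim_realpow_sequentially_gt1[of "(s i x)\<^sup>2"] g by (simp add: filterlim_at_infinity_conv_norm_at_top filterlim_at_infinity_imp_filterlim_at_top)
        then have "filterlim (\<lambda>k. S k x) at_top sequentially"
        proof (rule filterlim_at_top_mono)
          show "\<forall>\<^sub>F k in sequentially. ((s i x)\<^sup>2) ^ k \<le> S k x"
          proof (intro always_eventually allI)
            fix k
            have "(s i x) ^ (2 * k) \<le> S k x" unfolding S_def
              by (rule member_le_sum[OF i(1)]) (auto simp: power_mult)
            then show "((s i x)\<^sup>2) ^ k \<le> S k x" by (simp only: power_mult)
          qed
        qed
        then have "filterlim (\<lambda>k. S (Suc k) x) at_top sequentially" by (rule filterlim_compose[OF _ filterlim_Suc])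
        then have "(\<lambda>k. exp (- S (Suc k) x)) \<longlonglongrightarrow> 0"
          by (intro filterlim_compose[OF exp_at_bot] filterlim_compose[OF filterlim_uminus_at_bot_at_top])
        then have "(\<lambda>k. f (Suc k) x) \<longlonglongrightarrow> complex_of_real 0" unfolding f_def by (rule tendsto_of_real)
        then show ?thesis using False by simp
      qed
    qed
  qed simp_all
  moreover have "abs_L2 (f (Suc k)) \<in> V" for k by (rule sch[OF fs])
  ultimately show ?thesis using V unfolding closed_csubspace_def by (metis (no_types))
qed

text \<open>The set where two bounded operators agree is a closed subspace.\<close>

lemma bounded_clinear_eq_on_schwartz:
  fixes A B :: "'a::euclidean_space L2 \<Rightarrow> 'a L2"
  assumes A: "bounded_clinear_L2 A" and B: "bounded_clinear_L2 B"
    and eq: "\<And>v. v \<in> schwartz \<Longrightarrow> A (abs_L2 v) = B (abs_L2 v)"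
  shows "A = B"
proof -
  let ?V = "{f. A f = B f}"
  have bl: "bounded_linear A" "bounded_linear B" and sc: "\<And>c f. A (scaleC_L2 c f) = scaleC_L2 c (A f)" "\<And>c f. B (scaleC_L2 c f) = scaleC_L2 c (B f)"
    using A B by (simp_all add: bounded_clinear_L2_def)
  have V: "closed_csubspace ?V"
    unfolding closed_csubspace_def
  proof (intro conjI ballI allI impI)
    fix X f assume X: "\<forall>n. X n \<in> ?V" "X \<longlonglongrightarrow> f"
    have "(\<lambda>n. A (X n)) \<longlonglongrightarrow> A f" "(\<lambda>n. B (X n)) \<longlonglongrightarrow> B f" by (rule bounded_linear.tendsto[OF bl(1) X(2)], rule bounded_linear.tendsto[OF bl(2) X(2)])
    moreover have "(\<lambda>n. A (X n)) = (\<lambda>n. B (X n))" using X(1) by simp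
    ultimately show "f \<in> ?V" using LIMSEQ_unique[of "\<lambda>n. B (X n)" "A f" "B f"] by simp
  qed (simp_all add: sc bounded_linear.linear[OF bl(1), THEN linear_add] bounded_linear.linear[OF bl(2), THEN linear_add])
  have "?V = UNIV"
    by (rule closed_csubspace_box_UNIV[OF V closed_csubspace_schwartz_box[OF V]]) (simp add: eq)
  then show ?thesis by (intro ext) blast
qed

section \<open>The operator as an integral operator\<close>

lemma hs_kernel_bound:
  assumes k: "hs_kernel k" and m[measurable]: "jointly_measurable k'"
    and le: "\<And>x y. cmod (k' x y) \<le> C * cmod (k x y)"
  shows "hs_kernel k'"
  unfolding hs_kernel_def
proof
  have km[measurable]: "jointly_measurable k" using k by (simp add: hs_kernel_def)
  have sec[measurable]: "k x \<in> borel_measurable borel" for x by (rule kernel_section_measurable[OF km])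
  have "hs_norm_sq k' \<le> (\<integral>\<^sup>+x. \<integral>\<^sup>+y. ennreal (C\<^sup>2) * cmod_sq (k x y) \<partial>lborel \<partial>lborel)"
  proof (intro nn_integral_mono)
    fix x y
    have "(cmod (k' x y))\<^sup>2 \<le> C\<^sup>2 * (cmod (k x y))\<^sup>2"
      unfolding power_mult_distrib[symmetric] by (rule power_mono[OF le]) simp
    then show "cmod_sq (k' x y) \<le> ennreal (C\<^sup>2) * cmod_sq (k x y)"
      by (simp add: ennreal_mult[symmetric] ennreal_leI)
  qed
  also have "\<dots> = (\<integral>\<^sup>+x. ennreal (C\<^sup>2) * sq_norm (k x) \<partial>lborel)"
    by (intro nn_integral_cong nn_integral_cmult) measurable
  also have "\<dots> = ennreal (C\<^sup>2) * hs_norm_sq k"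
    by (rule nn_integral_cmult) measurable
  also have "\<dots> < \<infinity>" using k by (simp add: hs_kernel_def ennreal_mult_less_top)
  finally show "hs_norm_sq k' < \<infinity>" .
qed (rule m)

lemma LINT_lborel_shift:
  fixes f :: "'a::euclidean_space \<Rightarrow> complex"
  assumes "f \<in> borel_measurable borel"
  shows "(LINT x|lborel. f x) = (LINT x|lborel. f (\<mu> + x))"
proof -
  have "(LINT x|lborel. f x) = (LINT x|distr lborel borel ((+) \<mu>). f x)" by (simp only: lborel_distr_plus)
  also have "\<dots> = (LINT x|lborel. f (\<mu> + x))" by (rule integral_distr) (use assms in auto)
  finally show ?thesis .
qed

context pdo
begin

definition op_kernel :: "'a \<Rightarrow> ('a \<Rightarrow> 'a \<Rightarrow> complex) \<Rightarrow> 'a \<Rightarrow> 'a \<Rightarrow> complex" where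
  "op_kernel \<mu> c x y = complex_of_real ((\<alpha> / (2 * pi)) ^ DIM('a)) * (ephase (x - y) \<mu> * pker c x y)"

lemma op_kernel_hs:
  assumes c: "adm M c" shows "hs_kernel (op_kernel \<mu> c)"
proof (rule hs_kernel_bound)
  note [measurable] = pker_measurable[OF c]
  show "hs_kernel (pker c)"
    unfolding hs_kernel_def using pker_hs[OF c] by (auto intro: order.strict_trans1 pker_measurable[OF c])
  show "jointly_measurable (op_kernel \<mu> c)"
    unfolding op_kernel_def by measurable
  show "cmod (op_kernel \<mu> c x y) \<le> (\<alpha> / (2 * pi)) ^ DIM('a) * cmod (pker c x y)" for x y
    unfolding op_kernel_def norm_mult norm_of_real norm_ephase using \<alpha> by simp
qed

text \<open>For a Schwartz function the iterated integral is absolutely convergent, because the symbol has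
  compact support; exchanging the two integrals exhibits the kernel. The centre \<open>\<mu>\<close> of the
  frequency ball only contributes a unimodular factor.\<close>

lemma Op_schwartz_kernel:
  assumes c: "adm M c" and a: "\<And>w \<xi>. c w \<xi> = a (w, \<xi> + \<mu>)" and v: "v \<in> schwartz"
  shows "Op_schwartz \<alpha> t a v x = (LINT y|lborel. op_kernel \<mu> c x y * v y)"
proof -
  have vi: "integrable lborel v" by (rule schwartz_integrable(2)[OF v])
  then have [measurable]: "v \<in> borel_measurable borel" by auto
  define F where "F \<xi> y = ephase (x - y) \<xi> * c (mid x y) (\<xi> - \<mu>) * v y" for \<xi> y
  have e: "exp (\<i> * of_real (\<alpha> * ((x - y) \<bullet> \<xi>))) * a ((1 - t) *\<^sub>R x + t *\<^sub>R y, \<xi>) * v y = F \<xi> y" for \<xi> y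
    using a[of "mid x y" "\<xi> - \<mu>"] by (simp add: F_def ephase_def mid_def)
  have cm: "(\<lambda>p. c (mid x (snd p)) (fst p - \<mu>)) \<in> borel_measurable (borel \<Otimes>\<^sub>M borel)"
    by (rule adm_compose[OF c]) measurable
  have Fm[measurable]: "jointly_measurable F"
    unfolding F_def using cm by measurable
  have Fy: "F \<xi> \<in> borel_measurable borel" for \<xi> by (rule kernel_section_measurable[OF Fm])
  have G: "(\<lambda>\<xi>. LINT y|lborel. F \<xi> y) \<in> borel_measurable borel"
    using lborel.borel_measurable_lebesgue_integral[of F borel] Fm by (simp add: split_beta')
  have "(LINT \<xi>|lebesgue. LINT y|lebesgue. F \<xi> y) = (LINT \<xi>|lebesgue. LINT y|lborel. F \<xi> y)"
    using Fy by (simp add: integral_completion)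
  also have "\<dots> = (LINT \<xi>|lborel. LINT y|lborel. F \<xi> y)" using G by (simp add: integral_completion)
  also have "\<dots> = (LINT y|lborel. LINT \<xi>|lborel. F \<xi> y)"
  proof (rule lborel_pair.Fubini_integral[symmetric])
    have "integrable (lborel \<Otimes>\<^sub>M lborel) (case_prod F)"
    proof (rule integrable_pair_bound[OF Fm])
      show "integrable lborel (\<lambda>\<xi>::'a. (M::real) * indicator (cball \<mu> \<rho>) \<xi>)"
      proof (rule integrable_mult_right)
        have "emeasure lborel (cball \<mu> \<rho>) < \<infinity>" by (rule emeasure_bounded_finite[OF bounded_cball])
        then show "integrable lborel (indicator (cball \<mu> \<rho>) :: 'a \<Rightarrow> real)" by (intro integrable_real_indicator) simp_all
      qed
      show "integrable lborel (\<lambda>y. cmod (v y))" by (rule integrable_norm[OF vi])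
      have "cmod (c 0 0) \<le> M" using c by (simp add: adm_def)
      then have M: "0 \<le> M" using norm_ge_zero[of "c 0 0"] by linarith
      show "0 \<le> M * indicator (cball \<mu> \<rho>) \<xi>" for \<xi> using M by simp
      show "cmod (F \<xi> y) \<le> M * indicator (cball \<mu> \<rho>) \<xi> * cmod (v y)" for \<xi> y
      proof -
        have "cmod (F \<xi> y) = cmod (c (mid x y) (\<xi> - \<mu>)) * cmod (v y)" by (simp add: F_def norm_mult)
        also have "\<dots> \<le> (M * indicator (cball 0 \<rho>) (\<xi> - \<mu>)) * cmod (v y)"
          by (rule mult_right_mono[OF adm_bound[OF c]]) simp
        also have "indicator (cball 0 \<rho>) (\<xi> - \<mu>) = (indicator (cball \<mu> \<rho>) \<xi> :: real)"
          by (simp add: indicator_def dist_norm norm_minus_commute)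
        finally show ?thesis .
      qed
    qed simp
    then show "integrable (lborel \<Otimes>\<^sub>M lborel) (\<lambda>(\<xi>, y). F \<xi> y)" .
  qed
  also have "\<dots> = (LINT y|lborel. (ephase (x - y) \<mu> * pker c x y) * v y)"
  proof (intro Bochner_Integration.integral_cong refl)
    fix y
    have cy: "(\<lambda>\<xi>. c (mid x y) (\<xi> - \<mu>)) \<in> borel_measurable borel" by (rule adm_compose[OF c]) measurable
    have "(LINT \<xi>|lborel. F \<xi> y) = (LINT \<xi>|lborel. ephase (x - y) \<xi> * c (mid x y) (\<xi> - \<mu>)) * v y"
      by (simp add: F_def)
    also have "(LINT \<xi>|lborel. ephase (x - y) \<xi> * c (mid x y) (\<xi> - \<mu>)) = (LINT \<xi>|lborel. ephase (x - y) (\<mu> + \<xi>) * c (mid x y) (\<mu> + \<xi> - \<mu>))"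
      by (rule LINT_lborel_shift) (use cy in measurable)
    also have "\<dots> = (LINT \<xi>|lborel. ephase (x - y) \<mu> * (ephase (x - y) \<xi> * c (mid x y) \<xi>))"
      by (simp add: ephase_def inner_add_right distrib_left exp_add mult.assoc)
    also have "\<dots> = ephase (x - y) \<mu> * pker c x y" by (simp add: pker_def)
    finally show "(LINT \<xi>|lborel. F \<xi> y) = (ephase (x - y) \<mu> * pker c x y) * v y" .
  qed
  finally have *: "(LINT \<xi>|lebesgue. LINT y|lebesgue. F \<xi> y) = (LINT y|lborel. (ephase (x - y) \<mu> * pker c x y) * v y)" .
  have "Op_schwartz \<alpha> t a v x = complex_of_real ((\<alpha> / (2 * pi)) ^ DIM('a)) * (LINT y|lborel. (ephase (x - y) \<mu> * pker c x y) * v y)"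
    unfolding Op_schwartz_def e * ..
  also have "\<dots> = (LINT y|lborel. complex_of_real ((\<alpha> / (2 * pi)) ^ DIM('a)) * ((ephase (x - y) \<mu> * pker c x y) * v y))"
    by (rule integral_mult_right_zero[symmetric])
  finally show ?thesis by (simp only: op_kernel_def mult.assoc)
qed

lemma Op_eq_kernel_op:
  assumes c: "adm M c" and a: "\<And>w \<xi>. c w \<xi> = a (w, \<xi> + \<mu>)"
  shows "Op \<alpha> t a = kernel_op (op_kernel \<mu> c)"
  unfolding Op_def
proof (rule the_equality)
  note hs = op_kernel_hs[OF c, of \<mu>]
  have e: "Op_schwartz \<alpha> t a v = (\<lambda>x. LINT y|lborel. op_kernel \<mu> c x y * v y)" if "v \<in> schwartz" for v
    by (rule ext) (rule Op_schwartz_kernel[OF c a that])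
  show P: "bounded_clinear_L2 (kernel_op (op_kernel \<mu> c)) \<and> (\<forall>v\<in>schwartz. square_integrable (Op_schwartz \<alpha> t a v) \<and>
        kernel_op (op_kernel \<mu> c) (abs_L2 v) = abs_L2 (Op_schwartz \<alpha> t a v))"
  proof (intro conjI ballI)
    show "bounded_clinear_L2 (kernel_op (op_kernel \<mu> c))" by (rule bounded_clinear_kernel_op[OF hs])
    fix v :: "'a \<Rightarrow> complex" assume v: "v \<in> schwartz"
    show "square_integrable (Op_schwartz \<alpha> t a v)"
      unfolding e[OF v] by (rule bsq_square_integrable[OF kernel_int_L2(2)[OF hs schwartz_integrable(3)[OF v]]])
    show "kernel_op (op_kernel \<mu> c) (abs_L2 v) = abs_L2 (Op_schwartz \<alpha> t a v)"
      unfolding e[OF v] by (rule kernel_op_abs[OF hs schwartz_integrable(3)[OF v]])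
  qed
  fix A :: "'a L2 \<Rightarrow> 'a L2"
  assume A: "bounded_clinear_L2 A \<and> (\<forall>v\<in>schwartz. square_integrable (Op_schwartz \<alpha> t a v) \<and> A (abs_L2 v) = abs_L2 (Op_schwartz \<alpha> t a v))"
  show "A = kernel_op (op_kernel \<mu> c)"
  proof (rule bounded_clinear_eq_on_schwartz[OF conjunct1[OF A] conjunct1[OF P]])
    fix v :: "'a \<Rightarrow> complex" assume v: "v \<in> schwartz"
    show "A (abs_L2 v) = kernel_op (op_kernel \<mu> c) (abs_L2 v)"
      using conjunct2[OF A, THEN bspec, OF v] conjunct2[OF P, THEN bspec, OF v] by simp
  qed
qed

end

section \<open>Multiplication by bounded functions\<close>

lemma mult_L2_abs:
  assumes h: "h \<in> borel_measurable lebesgue" and g[measurable]: "g \<in> borel_measurable borel" and ae: "AE x in lebesgue. h x = g x"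
    and gA: "\<And>x. cmod (g x) \<le> A" and v: "bsq v"
  shows "mult_L2 h (abs_L2 v) = abs_L2 (\<lambda>x. g x * v x)" "bsq (\<lambda>x. g x * v x)"
proof -
  have [measurable]: "v \<in> borel_measurable borel" using v by (simp add: bsq_def)
  show b: "bsq (\<lambda>x. g x * v x)"
    by (rule bsq_bound[OF _ v, of _ A]) (auto simp: norm_mult intro: mult_right_mono gA)
  have sb: "square_integrable (\<lambda>x. g x * v x)" by (rule bsq_square_integrable[OF b])
  have eq: "AE x in lebesgue. h x * rep_L2 (abs_L2 v) x = g x * v x"
    using ae rep_abs_L2[OF bsq_square_integrable[OF v]] by eventually_elim simp
  have rm: "rep_L2 (abs_L2 v) \<in> borel_measurable lebesgue" using square_integrable_rep_L2[of "abs_L2 v"] by (simp add: square_integrable_def)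
  have m: "(\<lambda>x. h x * rep_L2 (abs_L2 v) x) \<in> borel_measurable lebesgue" using h rm by measurable
  have "integrable lebesgue (\<lambda>x. (cmod (h x * rep_L2 (abs_L2 v) x))\<^sup>2)"
  proof (rule integrable_cong_AE_imp)
    show "integrable lebesgue (\<lambda>x. (cmod (g x * v x))\<^sup>2)" using sb by (simp add: square_integrable_def)
    show "(\<lambda>x. (cmod (h x * rep_L2 (abs_L2 v) x))\<^sup>2) \<in> borel_measurable lebesgue" using m by measurable
    show "AE x in lebesgue. (cmod (g x * v x))\<^sup>2 = (cmod (h x * rep_L2 (abs_L2 v) x))\<^sup>2" using eq by eventually_elim simp
  qed
  then have "square_integrable (\<lambda>x. h x * rep_L2 (abs_L2 v) x)" using m by (simp add: square_integrable_def)
  then show "mult_L2 h (abs_L2 v) = abs_L2 (\<lambda>x. g x * v x)"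
    unfolding mult_L2_def using abs_L2_eq_iff[OF _ sb] eq by simp
qed

text \<open>In this form it is closed, and countably many of the open sets suffice to cover the complement.\<close>

lemma ess_support_eq:
  "ess_support h = - \<Union>{U. open U \<and> (AE y in lebesgue. y \<in> U \<longrightarrow> h y = 0)}"
proof -
  have "x \<in> ess_support h \<longleftrightarrow> \<not> (\<exists>U. open U \<and> (AE y in lebesgue. y \<in> U \<longrightarrow> h y = 0) \<and> x \<in> U)" for x
  proof -
    have "(\<exists>U. open U \<and> (AE y in lebesgue. y \<in> U \<longrightarrow> h y = 0) \<and> x \<in> U) \<longleftrightarrow> (\<exists>e>0. AE y in lebesgue. y \<in> ball x e \<longrightarrow> h y = 0)"
    proof
      assume "\<exists>U. open U \<and> (AE y in lebesgue. y \<in> U \<longrightarrow> h y = 0) \<and> x \<in> U"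
      then obtain U where U: "open U" "AE y in lebesgue. y \<in> U \<longrightarrow> h y = 0" "x \<in> U" by blast
      obtain e where e: "e > 0" "ball x e \<subseteq> U" using U(1,3) by (auto simp: open_contains_ball)
      have "AE y in lebesgue. y \<in> ball x e \<longrightarrow> h y = 0" using U(2) by eventually_elim (use e(2) in blast)
      then show "\<exists>e>0. AE y in lebesgue. y \<in> ball x e \<longrightarrow> h y = 0" using e(1) by blast
    next
      assume "\<exists>e>0. AE y in lebesgue. y \<in> ball x e \<longrightarrow> h y = 0"
      then show "\<exists>U. open U \<and> (AE y in lebesgue. y \<in> U \<longrightarrow> h y = 0) \<and> x \<in> U" using centre_in_ball open_ball by blast
    qed
    then show ?thesis by (simp only: ess_support_def mem_Collect_eq) blast
  qed
  then show ?thesis by blast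
qed

lemma AE_zero_off_ess_support: "AE y in lebesgue. y \<notin> ess_support h \<longrightarrow> h y = 0"
proof -
  let ?F = "{U. open U \<and> (AE y in lebesgue. y \<in> U \<longrightarrow> h y = 0)}"
  obtain F where F: "F \<subseteq> ?F" "countable F" "\<Union>F = \<Union>?F"
    by (rule Lindelof[of ?F]) auto
  have "AE y in lebesgue. \<forall>U\<in>F. y \<in> U \<longrightarrow> h y = 0"
    using F(1) by (subst AE_ball_countable[OF F(2)]) blast
  then show ?thesis
  proof eventually_elim
    case (elim y)
    show ?case
    proof
      assume "y \<notin> ess_support h"
      then have "y \<in> \<Union>F" unfolding F(3) by (simp only: ess_support_eq Compl_iff not_not)
      then show "h y = 0" using elim by blast
    qed
  qed
qed

text \<open>Cutting the Borel representative off turns the essential bound and the essential support into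
  statements about every point.\<close>

lemma Linf_borel_version:
  fixes h :: "'a::euclidean_space \<Rightarrow> complex"
  assumes h: "h \<in> Linf"
  shows "\<exists>g. g \<in> borel_measurable borel \<and> (AE x in lebesgue. h x = g x)
    \<and> (\<forall>x. cmod (g x) \<le> real_of_ereal (Linf_norm h)) \<and> (\<forall>x. g x \<noteq> 0 \<longrightarrow> x \<in> ess_support h)"
proof -
  have hm: "h \<in> borel_measurable lebesgue" and fin: "Linf_norm h < \<infinity>" using h by (auto simp: Linf_def)
  have ae: "AE x in lebesgue. ereal (cmod (h x)) \<le> Linf_norm h" unfolding Linf_norm_def by (rule esssup_AE)
  have "ae_filter (lebesgue :: 'a measure) \<noteq> bot" by (simp add: ae_filter_eq_bot_iff)
  from eventually_happens'[OF this ae] obtain x0 where "ereal (cmod (h x0)) \<le> Linf_norm h" by blast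
  then have "0 \<le> Linf_norm h" using order_trans[of 0 "ereal (cmod (h x0))"] by simp
  then obtain A where A: "Linf_norm h = ereal A" "0 \<le> A" using fin by (cases "Linf_norm h") auto
  obtain g0 where g0[measurable]: "g0 \<in> borel_measurable borel" and g0ae: "AE x in lebesgue. h x = g0 x"
    using lebesgue_borel_version[OF hm] by blast
  have "closed (ess_support h)" unfolding ess_support_eq closed_def by (auto intro!: open_Union)
  then have S[measurable]: "ess_support h \<in> sets borel" by (rule borel_closed)
  let ?g = "\<lambda>x. if cmod (g0 x) \<le> A \<and> x \<in> ess_support h then g0 x else 0"
  show ?thesis
  proof (intro exI[of _ ?g] conjI)
    show "?g \<in> borel_measurable borel" by measurable
    show "AE x in lebesgue. h x = ?g x"
      using g0ae ae AE_zero_off_ess_support[of h] by eventually_elim (auto simp: A)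
  qed (auto simp: A split: if_splits)
qed

section \<open>The Schatten estimate\<close>

theorem theorem3p2:
  fixes q l\<^sub>0 :: real and n m :: nat
  assumes "0 < q" "q \<le> 1"
    and "n = nat \<lfloor>real DIM('a::euclidean_space) / q\<rfloor> + 1"
    and "n \<le> m"
    and "0 < l\<^sub>0"
  shows "\<exists>C::real. \<forall>(\<alpha>::real) (l::real) (\<rho>::real) (R::real) (h\<^sub>1 :: 'a \<Rightarrow> complex) (h\<^sub>2 :: 'a \<Rightarrow> complex)
      (a :: 'a \<times> 'a \<Rightarrow> complex) (u :: 'a) (\<mu> :: 'a) (t::real).
    0 < \<alpha> \<and> 0 < l \<and> 0 < \<rho> \<and> l\<^sub>0 \<le> \<alpha> * l * \<rho> \<and> l \<le> R \<and>
    h\<^sub>1 \<in> Linf \<and> h\<^sub>2 \<in> Linf \<and>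
    (\<forall>x\<in>ess_support h\<^sub>1. \<forall>y\<in>ess_support h\<^sub>2. R \<le> dist x y) \<and>
    a \<in> symbol_class n m \<and>
    closure {z. a z \<noteq> 0} \<subseteq> ball u l \<times> ball \<mu> \<rho> \<and>
    t \<in> {0..1}
    \<longrightarrow>
    mult_L2 h\<^sub>1 \<circ> Op \<alpha> t a \<circ> mult_L2 h\<^sub>2 \<in> schatten_class q \<and>
    schatten_norm q (mult_L2 h\<^sub>1 \<circ> Op \<alpha> t a \<circ> mult_L2 h\<^sub>2)
      \<le> C * real_of_ereal (Linf_norm h\<^sub>1) * real_of_ereal (Linf_norm h\<^sub>2)
          * (\<alpha> * R * \<rho>) powr (real DIM('a) / q - real m) * enn2real (symbol_norm n m a l \<rho>)"
proof (rule exI[of _ "cutoff_pdo.schatten_const TYPE('a) l\<^sub>0 q n m"], intro allI impI, elim conjE)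
  fix \<alpha> l \<rho> R t :: real and h\<^sub>1 h\<^sub>2 :: "'a \<Rightarrow> complex" and a :: "'a \<times> 'a \<Rightarrow> complex" and u \<mu> :: 'a
  assume pos: "0 < \<alpha>" "0 < l" "0 < \<rho>" "l\<^sub>0 \<le> \<alpha> * l * \<rho>" "l \<le> R" and h: "h\<^sub>1 \<in> Linf" "h\<^sub>2 \<in> Linf"
    and dist: "\<forall>x\<in>ess_support h\<^sub>1. \<forall>y\<in>ess_support h\<^sub>2. R \<le> dist x y"
    and a: "a \<in> symbol_class n m" "closure {z. a z \<noteq> 0} \<subseteq> ball u l \<times> ball \<mu> \<rho>" and t: "t \<in> {0..1}"
  let ?A1 = "real_of_ereal (Linf_norm h\<^sub>1)" and ?A2 = "real_of_ereal (Linf_norm h\<^sub>2)"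
  let ?N = "enn2real (symbol_norm n m a l \<rho>)"
  obtain g1 where g1: "g1 \<in> borel_measurable borel" "AE x in lebesgue. h\<^sub>1 x = g1 x" "\<And>x. cmod (g1 x) \<le> ?A1" "\<And>x. g1 x \<noteq> 0 \<Longrightarrow> x \<in> ess_support h\<^sub>1"
    using Linf_borel_version[OF h(1)] by (elim exE conjE) simp
  obtain g2 where g2: "g2 \<in> borel_measurable borel" "AE x in lebesgue. h\<^sub>2 x = g2 x" "\<And>x. cmod (g2 x) \<le> ?A2" "\<And>x. g2 x \<noteq> 0 \<Longrightarrow> x \<in> ess_support h\<^sub>2"
    using Linf_borel_version[OF h(2)] by (elim exE conjE) simp
  note [measurable] = g1(1) g2(1)
  have hm: "h\<^sub>1 \<in> borel_measurable lebesgue" "h\<^sub>2 \<in> borel_measurable lebesgue" using h by (auto simp: Linf_def)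
  interpret pdo l \<rho> u \<alpha> t l\<^sub>0 by unfold_locales (use pos t assms(5) in auto)
  \<comment> \<open>The phases centre the symbol in frequency and do not change the moduli.\<close>
  let ?k1 = "\<lambda>x. g1 x * ephase x \<mu>" and ?k2 = "\<lambda>y. ephase (- y) \<mu> * g2 y"
  interpret cutoff_pdo l \<rho> u \<alpha> t l\<^sub>0 ?k1 ?k2 ?A1 ?A2 R
  proof unfold_locales
    show "?k1 \<in> borel_measurable borel" "?k2 \<in> borel_measurable borel" by measurable
    show "R \<le> dist x y" if "?k1 x \<noteq> 0" "?k2 y \<noteq> 0" for x y using dist g1(4)[of x] g2(4)[of y] that by auto
  qed (use g1(3) g2(3) pos in \<open>auto simp: norm_mult\<close>)
  let ?c = "\<lambda>w \<xi>. a (w, \<xi> + \<mu>)"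
  have W: "w_class n m ?N ?c" by (rule symbol_w_class[OF a])
  have ac: "adm ?N ?c" by (rule xi_class_adm[OF w_class_xi[OF W]])
  have eq: "mult_L2 h\<^sub>1 \<circ> Op \<alpha> t a \<circ> mult_L2 h\<^sub>2 = kernel_op (kern ?c)"
  proof
    fix f :: "'a L2"
    note hs = op_kernel_hs[OF ac, of \<mu>]
    have f: "f = abs_L2 (brep f)" "bsq (brep f)" by (rule brep(2), rule brep(1))
    note m2 = mult_L2_abs[OF hm(2) g2(1,2,3) f(2)]
    have "(mult_L2 h\<^sub>1 \<circ> Op \<alpha> t a \<circ> mult_L2 h\<^sub>2) f = mult_L2 h\<^sub>1 (kernel_op (op_kernel \<mu> ?c) (mult_L2 h\<^sub>2 (abs_L2 (brep f))))"
      using Op_eq_kernel_op[OF ac refl] f(1) by simp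
    also have "\<dots> = mult_L2 h\<^sub>1 (abs_L2 (\<lambda>x. LINT y|lborel. op_kernel \<mu> ?c x y * (g2 y * brep f y)))"
      unfolding m2(1) kernel_op_abs[OF hs m2(2)] ..
    also have "\<dots> = abs_L2 (\<lambda>x. g1 x * (LINT y|lborel. op_kernel \<mu> ?c x y * (g2 y * brep f y)))"
      by (rule mult_L2_abs(1)[OF hm(1) g1(1,2,3) kernel_int_L2(2)[OF hs m2(2)]])
    also have "\<dots> = abs_L2 (\<lambda>x. LINT y|lborel. kern ?c x y * brep f y)"
    proof (intro arg_cong[where f = abs_L2] ext)
      fix x
      have "ephase (x - y) \<mu> = ephase x \<mu> * ephase (- y) \<mu>" for y
        by (simp add: ephase_def inner_diff_left right_diff_distrib exp_add[symmetric] algebra_simps)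
      then have "g1 x * (op_kernel \<mu> ?c x y * (g2 y * brep f y)) = kern ?c x y * brep f y" for y
        unfolding op_kernel_def kern_def amp_def by (simp only: mult_ac)
      then show "g1 x * (LINT y|lborel. op_kernel \<mu> ?c x y * (g2 y * brep f y)) = (LINT y|lborel. kern ?c x y * brep f y)"
        by (simp only: integral_mult_right_zero[symmetric])
    qed
    also have "\<dots> = kernel_op (kern ?c) f"
      using kernel_op_abs[OF kern_hs[OF ac] f(2)] f(1) by simp
    finally show "(mult_L2 h\<^sub>1 \<circ> Op \<alpha> t a \<circ> mult_L2 h\<^sub>2) f = kernel_op (kern ?c) f" .
  qed
  have "real DIM('a) / q < real n" using assms(1,3) by (simp add: nat_less_real_le) linarith
  then have n: "real DIM('a) < q * real n" using assms(1) by (simp add: pos_divide_less_eq mult.commute)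
  note S = kernel_op_schatten[OF W enn2real_nonneg assms(1,2) n assms(4)]
  show "mult_L2 h\<^sub>1 \<circ> Op \<alpha> t a \<circ> mult_L2 h\<^sub>2 \<in> schatten_class q \<and>
    schatten_norm q (mult_L2 h\<^sub>1 \<circ> Op \<alpha> t a \<circ> mult_L2 h\<^sub>2)
      \<le> cutoff_pdo.schatten_const TYPE('a) l\<^sub>0 q n m * ?A1 * ?A2
          * (\<alpha> * R * \<rho>) powr (real DIM('a) / q - real m) * ?N"
    unfolding eq using S(1) S(2)[unfolded big_def] by (rule conjI)
qed

end
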